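(* For every strict partition $\lambda=(\lambda_1>\lambda_2>\dots>\lambda_r>0)$, define \[ \ket{\lambda}_P=\begin{cases} \Phi^{(\beta)}_{\lambda_1}e^{\Theta}\Phi^{(\beta)}_{\lambda_2}e^{\Theta}\cdots\Phi^{(\beta)}_{\lambda_r}e^{\Theta}\ket{0} & (r \text{ even}),\\ \Phi^{(\beta)}_{\lambda_1}e^{\Theta}\Phi^{(\beta)}_{\lambda_2}e^{\Theta}\cdots\Phi^{(\beta)}_{\lambda_r}e^{\Theta}\phi^{(\beta)}_0e^{\Theta}\ket{0} & (r \text{ odd}). \end{cases} \] Then $GP_\lambda(x)=\bra{0}e^{\mathcal{H}^{(\beta)}(x)}\ket{\lambda}_P$.
   Context: Let $\beta$ be an indeterminate and $x=(x_1,x_2,\dots)$ variables. Let $\mathcal{A}$ be the associative $\mathbb{Q}(\beta)$-algebra generated by $\phi_n$ ($n\in\mathbb{Z}$) with $\phi_m\phi_n+\phi_n\phi_m=2(-1)^m\delta_{m+n,0}$ (infinite linear combinations allowed in a suitable completion). The vacuum vectors satisfy $\phi_{-n}\ket{0}=0$, $\bra{0}\phi_n=0$ for $n>0$; the vacuum expectation value is the bilinear pairing $\bra{u}\otimes\ket{v}\mapsto\langle u|v\rangle$ between $\bra{0}\mathcal{A}$ and $\mathcal{A}\ket{0}$ with $\langle0|0\rangle=1$, $\bra{0}\phi_0\ket{0}=0$, $(\bra{u}\phi_n)\ket{v}=\bra{u}(\phi_n\ket{v})$. Let $X\mapsto X^\ast$ be the anti-algebra involution with $\phi_n^\ast=(-1)^n\phi_{-n}$.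 Deformed fermions: $\sum_{n\ge0}\phi^{(\beta)}_nz^n=\sum_{n\ge0}\phi_n(z+\tfrac{\beta}{2})^n$, $\sum_{n\ge1}\phi^{(\beta)}_{-n}z^{-n}=\sum_{n\ge1}\phi_{-n}\big(\tfrac{z^{-1}}{1+\frac{\beta}{2}z^{-1}}\big)^n$, and $\Phi^{(\beta)}_n=\sum_{k\ge0}\tfrac12(-\tfrac{\beta}{2})^k\phi^{(\beta)}_{n+k}$ (i.e. $\sum_n\Phi^{(\beta)}_nz^n=\frac{1}{2+\beta z^{-1}}\sum_n\phi^{(\beta)}_nz^n$). For odd $m\in\mathbb{Z}$ let $b_m=\frac14\sum_{i\in\mathbb{Z}}(-1)^i\phi_{-i-m}\phi_i$. For $m\ne0$ let $b^{(\beta)}_m$ be obtained from $\frac{(X-\frac{\beta}{2})^m-(-X-\frac{\beta}{2})^m}{2}$ (a polynomial in $X$ if $m>0$, a power series in $X^{-1}$ if $m<0$; only odd powers of $X$ occur) by substituting $X^k\mapsto b_k$. Let $p_n(x)=\sum_ix_i^n$ and $\mathcal{H}^{(\beta)}(x)=2\sum_{n=1,3,5,\dots}\frac{p_n(x)}{n}b^{(\beta)}_n$, and $\Theta=2\sum_{n=1,3,5,\dots}(\tfrac{\beta}{2})^n\frac{b_{-n}}{n}$. The vacuum expectation value $\bra{0}e^{\mathcal{H}^{(\beta)}(x)}\ket{\lambda}_P$ is a well-defined formal power series in $x$. Let $x\oplus y=x+y+\beta xy$ and $x\ominus y=\frac{x-y}{1+\beta y}$. The $K$-theoretic Schur $P$-function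 $GP_\lambda(x)$ (of Ikeda–Naruse, with parameter $\beta$) of a strict partition $\lambda$ of length $r$ is given by \[ GP_\lambda(x)=[u_1^{-\lambda_1}\cdots u_r^{-\lambda_r}]\prod_{i=1}^r\frac{1}{(2+\beta u_i)(1+\beta u_i)}\prod_{i=1}^r\prod_{j\ge1}\frac{u_i\oplus x_j}{u_i\ominus x_j}\prod_{1\le i<j\le r}\frac{u_j\ominus u_i}{u_j\oplus u_i}, \] where the rational functions are expanded in $\mathbb{Q}(\beta)((u_r))\cdots((u_2))((u_1))[[x_1,x_2,\dots]]$ (the Laurent expansion on $|x_j|<|u_1|<\dots<|u_r|<|\beta^{-1}|$) and $[\,\cdot\,]$ denotes the coefficient of a monomial.
   Formalization: The sum defining H^(β)(x) runs over all n ≥ 1 instead of n = 1,3,5,…; with odd n only the identity fails already for λ=(1) in one variable, where an extra term (β/2)x_1^2 appears while GP_(1)(x_1)=x_1. *)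

theory Defs
  imports
    "HOL-Library.Poly_Mapping"
    "HOL-Library.Groups_Big_Fun"
    "HOL-Computational_Algebra.Computational_Algebra"
begin

section \<open>Convolution products\<close>

text \<open>
  Product of two formal sums indexed by a monoid. Only pairs with non-zero contribution are summed,
  so that the same definition serves series whose supports (rather than the monoid itself)
  guarantee finiteness.
\<close>

definition conv :: "('g \<Rightarrow> 'g \<Rightarrow> 'g) \<Rightarrow> ('g \<Rightarrow> 'a::semiring_0) \<Rightarrow> ('g \<Rightarrow> 'a) \<Rightarrow> 'g \<Rightarrow> 'a" where
  "conv opr f g m = (\<Sum>(a, b) \<in> {(a, b). opr a b = m \<and> f a \<noteq> 0 \<and> g b \<noteq> 0}. f a * g b)"

definition conv_set :: "('g \<Rightarrow> 'g \<Rightarrow> 'g) \<Rightarrow> ('g \<Rightarrow> 'a::zero) \<Rightarrow> ('g \<Rightarrow> 'a) \<Rightarrow> 'g \<Rightarrow> ('g \<times> 'g) set" where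
  "conv_set opr f g m = {(a, b). opr a b = m \<and> f a \<noteq> 0 \<and> g b \<noteq> 0}"

lemma conv_superset:
  assumes "finite D" "conv_set opr f g m \<subseteq> D" "\<And>a b. (a, b) \<in> D \<Longrightarrow> opr a b = m"
  shows "conv opr f g m = (\<Sum>(a, b) \<in> D. f a * g b)"
  unfolding conv_def using assms
  by (intro sum.mono_neutral_left) (auto simp: conv_set_def)

lemma conv_nonzeroD:
  assumes "conv opr f g m \<noteq> 0"
  shows "\<exists>a b. opr a b = m \<and> f a \<noteq> 0 \<and> g b \<noteq> 0"
proof (rule ccontr)
  assume "\<not> ?thesis"
  hence "{(a, b). opr a b = m \<and> f a \<noteq> 0 \<and> g b \<noteq> 0} = {}" by blast
  with assms show False unfolding conv_def by simp
qed

lemma conv_assoc: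
  fixes f g h :: "'g \<Rightarrow> 'a::semiring_0"
  assumes assoc: "\<And>a b c. opr (opr a b) c = opr a (opr b c)"
    and fg: "\<And>m. finite (conv_set opr f g m)" and gh: "\<And>m. finite (conv_set opr g h m)"
    and L: "\<And>m. finite (conv_set opr (conv opr f g) h m)"
    and R: "\<And>m. finite (conv_set opr f (conv opr g h) m)"
    and L': "\<And>m. finite {(a, b, c). opr a (opr b c) = m \<and> f a \<noteq> 0 \<and> g b \<noteq> 0 \<and> h c \<noteq> 0}"
  shows "conv opr (conv opr f g) h = conv opr f (conv opr g h)"
proof
  fix m
  define T where "T = {(a, b, c). opr a (opr b c) = m \<and> f a \<noteq> 0 \<and> g b \<noteq> 0 \<and> h c \<noteq> 0}"
  have fT: "finite T" unfolding T_def by (rule L')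
  define D where "D = (\<lambda>(a, b, c). (opr a b, c)) ` T"
  define E where "E = (\<lambda>(a, b, c). (a, opr b c)) ` T"
  have "conv opr (conv opr f g) h m = (\<Sum>(d, c)\<in>D. conv opr f g d * h c)"
  proof (rule conv_superset)
    show "finite D" using fT by (simp add: D_def)
    show "conv_set opr (conv opr f g) h m \<subseteq> D"
    proof
      fix p assume "p \<in> conv_set opr (conv opr f g) h m"
      then obtain d c where p: "p = (d, c)" "opr d c = m" "conv opr f g d \<noteq> 0" "h c \<noteq> 0"
        by (auto simp: conv_set_def)
      then obtain a b where "opr a b = d" "f a \<noteq> 0" "g b \<noteq> 0" using conv_nonzeroD by metis
      with p have "(a, b, c) \<in> T" "p = (\<lambda>(a, b, c). (opr a b, c)) (a, b, c)"
        by (auto simp: T_def assoc)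
      thus "p \<in> D" unfolding D_def by blast
    qed
  qed (auto simp: D_def T_def assoc)
  also have "\<dots> = (\<Sum>y\<in>D. \<Sum>t | t \<in> T \<and> (\<lambda>(a, b, c). (opr a b, c)) t = y. (\<lambda>(a, b, c). f a * g b * h c) t)"
  proof (rule sum.cong[OF refl], goal_cases)
    case (1 y)
    obtain d c where y: "y = (d, c)" by (cases y)
    with 1 have dc: "(d, c) \<in> D" by simp
    hence c: "opr d c = m" "h c \<noteq> 0" by (auto simp: D_def T_def assoc)
    have eq: "{t. t \<in> T \<and> (\<lambda>(a, b, c). (opr a b, c)) t = (d, c)} = (\<lambda>(a, b). (a, b, c)) ` conv_set opr f g d"
      using c by (auto simp: T_def conv_set_def image_def assoc[symmetric])
    have "conv opr f g d * h c = (\<Sum>(a, b)\<in>conv_set opr f g d. f a * g b) * h c"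
      by (simp add: conv_def conv_set_def)
    also have "\<dots> = (\<Sum>(a, b)\<in>conv_set opr f g d. f a * g b * h c)"
      by (simp add: sum_distrib_right case_prod_unfold)
    also have "\<dots> = (\<Sum>t | t \<in> T \<and> (\<lambda>(a, b, c). (opr a b, c)) t = (d, c). (\<lambda>(a, b, c). f a * g b * h c) t)"
      unfolding eq by (subst sum.reindex) (auto simp: inj_on_def case_prod_unfold)
    finally show ?case by (simp add: y)
  qed
  also have "\<dots> = (\<Sum>(a, b, c)\<in>T. f a * g b * h c)"
    using sum.image_gen[OF fT, of "\<lambda>(a, b, c). f a * g b * h c" "\<lambda>(a, b, c). (opr a b, c)"]
    unfolding D_def by simp
  also have "\<dots> = (\<Sum>y\<in>E. \<Sum>t | t \<in> T \<and> (\<lambda>(a, b, c). (a, opr b c)) t = y. (\<lambda>(a, b, c). f a * g b * h c) t)"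
    using sum.image_gen[OF fT, of "\<lambda>(a, b, c). f a * g b * h c" "\<lambda>(a, b, c). (a, opr b c)"]
    unfolding E_def by simp
  also have "\<dots> = (\<Sum>(a, e)\<in>E. f a * conv opr g h e)"
  proof (rule sum.cong[OF refl], goal_cases)
    case (1 y)
    obtain a e where y: "y = (a, e)" by (cases y)
    with 1 have ae: "(a, e) \<in> E" by simp
    hence c: "opr a e = m" "f a \<noteq> 0" by (auto simp: E_def T_def)
    have eq: "{t. t \<in> T \<and> (\<lambda>(a, b, c). (a, opr b c)) t = (a, e)} = (\<lambda>(b, c). (a, b, c)) ` conv_set opr g h e"
      using c by (auto simp: T_def conv_set_def image_def)
    have "f a * conv opr g h e = f a * (\<Sum>(b, c)\<in>conv_set opr g h e. g b * h c)"
      by (simp add: conv_def conv_set_def)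
    also have "\<dots> = (\<Sum>(b, c)\<in>conv_set opr g h e. f a * g b * h c)"
      by (simp add: sum_distrib_left case_prod_unfold mult.assoc)
    also have "\<dots> = (\<Sum>t | t \<in> T \<and> (\<lambda>(a, b, c). (a, opr b c)) t = (a, e). (\<lambda>(a, b, c). f a * g b * h c) t)"
      unfolding eq by (subst sum.reindex) (auto simp: inj_on_def case_prod_unfold)
    finally show ?case by (simp add: y)
  qed
  also have "\<dots> = conv opr f (conv opr g h) m"
  proof (rule conv_superset[symmetric])
    show "finite E" using fT by (simp add: E_def)
    show "conv_set opr f (conv opr g h) m \<subseteq> E"
    proof
      fix p assume "p \<in> conv_set opr f (conv opr g h) m"
      then obtain a e where p: "p = (a, e)" "opr a e = m" "conv opr g h e \<noteq> 0" "f a \<noteq> 0"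
        by (auto simp: conv_set_def)
      then obtain b c where "opr b c = e" "g b \<noteq> 0" "h c \<noteq> 0" using conv_nonzeroD by metis
      with p have "(a, b, c) \<in> T" "p = (\<lambda>(a, b, c). (a, opr b c)) (a, b, c)"
        by (auto simp: T_def)
      thus "p \<in> E" unfolding E_def by blast
    qed
  qed (auto simp: E_def T_def)
  finally show "conv opr (conv opr f g) h m = conv opr f (conv opr g h) m" .
qed

lemma conv_add_left:
  fixes f g h :: "'g \<Rightarrow> 'a::semiring_0"
  assumes "finite (conv_set opr f h m)" "finite (conv_set opr g h m)"
  shows "conv opr (\<lambda>a. f a + g a) h m = conv opr f h m + conv opr g h m"
proof -
  let ?D = "conv_set opr f h m \<union> conv_set opr g h m"
  have "conv opr (\<lambda>a. f a + g a) h m = (\<Sum>(a, b)\<in>?D. (f a + g a) * h b)"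
    using assms by (intro conv_superset) (auto simp: conv_set_def)
  also have "\<dots> = (\<Sum>(a, b)\<in>?D. f a * h b) + (\<Sum>(a, b)\<in>?D. g a * h b)"
    by (simp add: sum.distrib distrib_right case_prod_unfold)
  also have "(\<Sum>(a, b)\<in>?D. f a * h b) = conv opr f h m"
    using assms by (intro conv_superset[symmetric]) (auto simp: conv_set_def)
  also have "(\<Sum>(a, b)\<in>?D. g a * h b) = conv opr g h m"
    using assms by (intro conv_superset[symmetric]) (auto simp: conv_set_def)
  finally show ?thesis .
qed

lemma conv_add_right:
  fixes f g h :: "'g \<Rightarrow> 'a::semiring_0"
  assumes "finite (conv_set opr h f m)" "finite (conv_set opr h g m)"
  shows "conv opr h (\<lambda>a. f a + g a) m = conv opr h f m + conv opr h g m"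
proof -
  let ?D = "conv_set opr h f m \<union> conv_set opr h g m"
  have "conv opr h (\<lambda>a. f a + g a) m = (\<Sum>(a, b)\<in>?D. h a * (f b + g b))"
    using assms by (intro conv_superset) (auto simp: conv_set_def)
  also have "\<dots> = (\<Sum>(a, b)\<in>?D. h a * f b) + (\<Sum>(a, b)\<in>?D. h a * g b)"
    by (simp add: sum.distrib distrib_left case_prod_unfold)
  also have "(\<Sum>(a, b)\<in>?D. h a * f b) = conv opr h f m"
    using assms by (intro conv_superset[symmetric]) (auto simp: conv_set_def)
  also have "(\<Sum>(a, b)\<in>?D. h a * g b) = conv opr h g m"
    using assms by (intro conv_superset[symmetric]) (auto simp: conv_set_def)
  finally show ?thesis .
qed

lemma conv_one_left:
  assumes "\<And>a. opr e a = a"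
  shows "conv opr (\<lambda>a. if a = e then (1::'a::semiring_1) else 0) f m = f m"
proof -
  have "conv opr (\<lambda>a. if a = e then 1 else 0) f m
      = (\<Sum>(a, b)\<in>{(e, m)}. (if a = e then 1 else 0) * f b)"
    using assms by (intro conv_superset) (auto simp: conv_set_def split: if_splits)
  thus ?thesis by simp
qed

lemma conv_one_right:
  assumes "\<And>a. opr a e = a"
  shows "conv opr f (\<lambda>a. if a = e then (1::'a::semiring_1) else 0) m = f m"
proof -
  have "conv opr f (\<lambda>a. if a = e then 1 else 0) m
      = (\<Sum>(a, b)\<in>{(m, e)}. f a * (if b = e then 1 else 0))"
    using assms by (intro conv_superset) (auto simp: conv_set_def split: if_splits)
  thus ?thesis by simp
qed

lemma conv_commute:
  fixes f g :: "'g \<Rightarrow> 'a::comm_semiring_0"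
  assumes "\<And>a b. opr a b = opr b a"
  shows "conv opr f g m = conv opr g f m"
  unfolding conv_def
  by (rule sum.reindex_bij_witness[of _ prod.swap prod.swap]) (use assms in \<open>auto simp: mult.commute\<close>)


section \<open>Formal power series in countably many commuting variables\<close>

text \<open>
  A monomial in \<open>x\<^sub>1, x\<^sub>2, \<dots>\<close> is a finitely supported exponent vector; the
  variable \<open>x\<^sub>j\<close> has index \<open>j - 1\<close>. A series is an arbitrary formal sum of monomials.
\<close>

typedef 'a mps = "UNIV :: ((nat \<Rightarrow>\<^sub>0 nat) \<Rightarrow> 'a) set"
  morphisms mps_coeff Abs_mps ..

setup_lifting type_definition_mps

lemma mps_eqI: "(\<And>m. mps_coeff f m = mps_coeff g m) \<Longrightarrow> f = g"
  by (simp add: mps_coeff_inject[symmetric] fun_eq_iff)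

lemma finite_le_monom:
  fixes m :: "nat \<Rightarrow>\<^sub>0 nat"
  shows "finite {a. \<forall>i. Poly_Mapping.lookup a i \<le> Poly_Mapping.lookup m i}"
proof -
  let ?S = "{a. \<forall>i. Poly_Mapping.lookup a i \<le> Poly_Mapping.lookup m i}"
  have 1: "Poly_Mapping.lookup a i \<le> Max (Poly_Mapping.lookup m ` Poly_Mapping.keys m)" if "a \<in> ?S" "i \<in> Poly_Mapping.keys m" for a i
  proof -
    have "Poly_Mapping.lookup a i \<le> Poly_Mapping.lookup m i" using that by blast
    also have "\<dots> \<le> Max (Poly_Mapping.lookup m ` Poly_Mapping.keys m)" using that by (intro Max_ge) auto
    finally show ?thesis .
  qed
  have 2: "Poly_Mapping.lookup a i = 0" if "a \<in> ?S" "i \<notin> Poly_Mapping.keys m" for a i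
    using that by (metis (mono_tags, lifting) Poly_Mapping.in_keys_iff le_zero_eq mem_Collect_eq)
  have "Poly_Mapping.lookup ` ?S \<subseteq> {f. \<forall>i. (i \<in> Poly_Mapping.keys m \<longrightarrow> f i \<in> {..Max (Poly_Mapping.lookup m ` Poly_Mapping.keys m)}) \<and> (i \<notin> Poly_Mapping.keys m \<longrightarrow> f i = 0)}"
  proof (intro image_subsetI CollectI allI conjI impI)
    fix a i assume a: "a \<in> ?S"
    show "Poly_Mapping.lookup a i \<in> {..Max (Poly_Mapping.lookup m ` Poly_Mapping.keys m)}"
      if "i \<in> Poly_Mapping.keys m" using 1[OF a that] by simp
    show "Poly_Mapping.lookup a i = 0" if "i \<notin> Poly_Mapping.keys m" using 2[OF a that] .
  qed
  moreover have "finite {f. \<forall>i. (i \<in> Poly_Mapping.keys m \<longrightarrow> f i \<in> {..Max (Poly_Mapping.lookup m ` Poly_Mapping.keys m)}) \<and> (i \<notin> Poly_Mapping.keys m \<longrightarrow> f i = 0)}"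
    by (rule finite_set_of_finite_funs) auto
  ultimately have "finite (Poly_Mapping.lookup ` ?S)" by (rule finite_subset)
  moreover have "inj_on Poly_Mapping.lookup ?S" by (meson inj_onI Poly_Mapping.lookup_inject)
  ultimately show ?thesis by (rule finite_imageD)
qed

lemma finite_le_monom2:
  fixes m :: "nat \<Rightarrow>\<^sub>0 nat"
  shows "finite {(a, b, c). a + (b + c) = m}"
proof (rule finite_subset)
  let ?S = "{a. \<forall>i. Poly_Mapping.lookup a i \<le> Poly_Mapping.lookup m i}"
  show "{(a, b, c). a + (b + c) = m} \<subseteq> ?S \<times> ?S \<times> ?S"
    by (auto simp: Poly_Mapping.lookup_add)
  show "finite (?S \<times> ?S \<times> ?S)" by (intro finite_cartesian_product finite_le_monom)
qed

lemma finite_conv_monom: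
  fixes m :: "nat \<Rightarrow>\<^sub>0 nat"
  shows "finite (conv_set (+) f g m)"
proof (rule finite_subset)
  let ?S = "{a. \<forall>i. Poly_Mapping.lookup a i \<le> Poly_Mapping.lookup m i}"
  show "conv_set (+) f g m \<subseteq> ?S \<times> ?S"
    by (auto simp: Poly_Mapping.lookup_add conv_set_def)
  show "finite (?S \<times> ?S)" by (intro finite_cartesian_product finite_le_monom)
qed

instantiation mps :: (comm_ring_1) comm_ring_1
begin

lift_definition zero_mps :: "'a mps" is "\<lambda>_. 0" .
lift_definition one_mps :: "'a mps" is "\<lambda>m. if m = 0 then 1 else 0" .
lift_definition plus_mps :: "'a mps \<Rightarrow> 'a mps \<Rightarrow> 'a mps" is "\<lambda>f g m. f m + g m" .
lift_definition minus_mps :: "'a mps \<Rightarrow> 'a mps \<Rightarrow> 'a mps" is "\<lambda>f g m. f m - g m" .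
lift_definition uminus_mps :: "'a mps \<Rightarrow> 'a mps" is "\<lambda>f m. - f m" .
lift_definition times_mps :: "'a mps \<Rightarrow> 'a mps \<Rightarrow> 'a mps" is "conv (+)" .

instance
proof
  fix a b c :: "'a mps"
  show "a * b * c = a * (b * c)"
  proof transfer
    fix a b c :: "(nat \<Rightarrow>\<^sub>0 nat) \<Rightarrow> 'a"
    show "conv (+) (conv (+) a b) c = conv (+) a (conv (+) b c)"
    proof (rule conv_assoc)
      fix m
      show "finite {(x, y, z). x + (y + z) = m \<and> a x \<noteq> 0 \<and> b y \<noteq> 0 \<and> c z \<noteq> 0}"
        by (rule finite_subset[OF _ finite_le_monom2[of m]]) auto
    qed (rule finite_conv_monom | simp add: add.assoc)+
  qed
  show "a * b = b * a" by transfer (auto simp: fun_eq_iff intro: conv_commute add.commute)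
  show "1 * a = a" by transfer (rule ext, simp add: conv_one_left)
  show "(a + b) * c = a * c + b * c"
    by transfer (simp add: fun_eq_iff conv_add_left finite_conv_monom)
  show "(0 :: 'a mps) \<noteq> 1" by transfer (simp add: fun_eq_iff)
qed (transfer; simp add: algebra_simps)+

end

text \<open>
  \<open>f / g\<close> is the unique solution of \<open>h * g = f\<close> in the series ring (used only for unique solutions).
\<close>

instantiation mps :: (comm_ring_1) inverse
begin
definition divide_mps :: "'a mps \<Rightarrow> 'a mps \<Rightarrow> 'a mps" where
  "(f :: 'a mps) div g = (THE h. h * g = f)"
definition inverse_mps :: "'a mps \<Rightarrow> 'a mps" where
  "inverse (f :: 'a mps) = 1 div f"
instance ..
end

lemma mps_divide_unit:
  fixes f g u :: "'a::comm_ring_1 mps"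
  assumes "u * g = 1"
  shows "f / g = f * u"
  unfolding divide_mps_def
proof (rule the_equality)
  show "f * u * g = f" using assms by (simp add: mult.assoc)
  fix h assume "h * g = f"
  hence "f * u = h * (u * g)" by (metis mult.assoc mult.commute)
  thus "h = f * u" using assms by simp
qed

lift_definition mps_const :: "'a::zero \<Rightarrow> 'a mps" is "\<lambda>c m. if m = 0 then c else 0" .

lift_definition xvar :: "nat \<Rightarrow> 'a::zero_neq_one mps" is
  "\<lambda>j m. if m = Poly_Mapping.single j 1 then 1 else 0" .

text \<open>
  Infinite sums are taken coefficientwise: each coefficient must be a finite sum. Infinite products
  are limits of the partial products, each coefficient being eventually constant.
\<close>

definition mps_sum :: "('i \<Rightarrow> 'a::comm_monoid_add mps) \<Rightarrow> 'a mps" where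
  "mps_sum f = Abs_mps (\<lambda>m. Sum_any (\<lambda>i. mps_coeff (f i) m))"

definition mps_prodinf :: "(nat \<Rightarrow> 'a::comm_ring_1 mps) \<Rightarrow> 'a mps" where
  "mps_prodinf f = Abs_mps (\<lambda>m. THE c. \<forall>\<^sub>F N in sequentially. mps_coeff (\<Prod>j<N. f j) m = c)"

definition power_sum :: "nat \<Rightarrow> 'a::comm_ring_1 mps" where
  "power_sum n = mps_sum (\<lambda>j. xvar j ^ n)"


section \<open>Iterated Laurent series\<close>

text \<open>
  Formal sums of monomials with exponents in an ordered abelian group and well-ordered support.
  For exponent vectors in \<open>\<int>\<^sup>r\<close> with the lexicographic order (first coordinate most
  significant), a support is well-ordered iff the exponents of \<open>u\<^sub>1\<close> are bounded below, for
  each of them those of \<open>u\<^sub>2\<close> are bounded below, and so on; hence these are exactly the elements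
  of \<open>K((u\<^sub>r))\<dots>((u\<^sub>2))((u\<^sub>1))\<close>. The type below with exponents \<open>nat \<Rightarrow>\<^sub>0 int\<close>, whose library
  order is this lexicographic order, contains all these fields simultaneously.
\<close>

typedef (overloaded) ('g, 'a) hahn =
    "{f :: 'g::linordered_ab_group_add \<Rightarrow> 'a::zero. wfp_on {e. f e \<noteq> 0} (<)}"
  morphisms hahn_coeff Abs_hahn
  by (rule exI[of _ "\<lambda>_. 0"]) (simp add: wfp_on_def)

setup_lifting type_definition_hahn

lemma wfp_on_less_ex_min:
  fixes A :: "'g::linorder set"
  assumes "wfp_on A (<)" "B \<subseteq> A" "B \<noteq> {}"
  shows "\<exists>z\<in>B. \<forall>y\<in>B. z \<le> y"
  using assms unfolding wfp_on_iff_ex_minimal by (meson linorder_not_less)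

lemma wfp_on_greater_ex_max:
  fixes A :: "'g::linorder set"
  assumes "wfp_on A (>)" "B \<subseteq> A" "B \<noteq> {}"
  shows "\<exists>z\<in>B. \<forall>y\<in>B. y \<le> z"
  using assms unfolding wfp_on_iff_ex_minimal by (meson linorder_not_less)

lemma wfp_on_Un_less:
  fixes A B :: "'g::linorder set"
  assumes "wfp_on A (<)" "wfp_on B (<)"
  shows "wfp_on (A \<union> B) (<)"
  unfolding wfp_on_iff_ex_minimal
proof (intro allI impI)
  fix S assume S: "S \<subseteq> A \<union> B" "S \<noteq> {}"
  show "\<exists>z\<in>S. \<forall>y. y < z \<longrightarrow> y \<notin> S"
  proof (cases "S \<inter> A = {} \<or> S \<inter> B = {}")
    case True
    hence "S \<subseteq> A \<or> S \<subseteq> B" using S by blast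
    thus ?thesis using S assms unfolding wfp_on_iff_ex_minimal by blast
  next
    case False
    obtain z where z: "z \<in> S \<inter> A" "\<forall>y\<in>S \<inter> A. z \<le> y"
      using wfp_on_less_ex_min[OF assms(1), of "S \<inter> A"] False by blast
    obtain w where w: "w \<in> S \<inter> B" "\<forall>y\<in>S \<inter> B. w \<le> y"
      using wfp_on_less_ex_min[OF assms(2), of "S \<inter> B"] False by blast
    have "min z w \<in> S" using z w by (auto simp: min_def)
    moreover have "min z w \<le> y" if "y \<in> S" for y
      using that z w S by (auto simp: min_le_iff_disj)
    ultimately show ?thesis by (meson linorder_not_less)
  qed
qed

lemma finite_if_wfp_on_both:
  fixes P :: "'g::linorder set"
  assumes "wfp_on P (<)" "wfp_on P (>)"
  shows "finite P"
proof (rule ccontr)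
  assume inf: "infinite P"
  define Q where "Q = {p \<in> P. infinite {q \<in> P. p \<le> q}}"
  have "P \<noteq> {}" using inf by auto
  then obtain p0 where p0: "p0 \<in> P" "\<forall>y\<in>P. p0 \<le> y"
    using wfp_on_less_ex_min[OF assms(1), of P] by blast
  hence "{q \<in> P. p0 \<le> q} = P" by auto
  hence "p0 \<in> Q" using inf p0 by (simp add: Q_def)
  then obtain p where p: "p \<in> Q" "\<forall>y\<in>Q. y \<le> p"
    using wfp_on_greater_ex_max[OF assms(2), of Q] by (auto simp: Q_def)
  have "{q \<in> P. p \<le> q} \<subseteq> insert p {q \<in> P. p < q}" by auto
  hence inf': "infinite {q \<in> P. p < q}"
    using p(1) unfolding Q_def by (metis (mono_tags, lifting) finite_insert finite_subset mem_Collect_eq)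
  hence "{q \<in> P. p < q} \<noteq> {}" by (metis finite.emptyI)
  then obtain p' where p': "p' \<in> {q \<in> P. p < q}" "\<forall>y\<in>{q \<in> P. p < q}. p' \<le> y"
    using wfp_on_less_ex_min[OF assms(1), of "{q \<in> P. p < q}"] by blast
  have "{q \<in> P. p < q} \<subseteq> {q \<in> P. p' \<le> q}" using p' by auto
  hence "p' \<in> Q" using inf' p' finite_subset unfolding Q_def by blast
  with p p' show False by auto
qed

lemma finite_sum_decomp:
  fixes A B :: "'g::linordered_ab_group_add set"
  assumes "wfp_on A (<)" "wfp_on B (<)"
  shows "finite {(a, b). a + b = m \<and> a \<in> A \<and> b \<in> B}"
proof -
  let ?P = "{a \<in> A. m - a \<in> B}"
  have "wfp_on ?P (<)" using assms(1) wfp_on_subset[of A "(<)" ?P] by blast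
  moreover have "wfp_on ?P (>)"
    by (rule wfp_on_mono_stronger[OF assms(2), of "\<lambda>a. m - a"]) auto
  ultimately have "finite ?P" by (rule finite_if_wfp_on_both)
  moreover have "{(a, b). a + b = m \<and> a \<in> A \<and> b \<in> B} \<subseteq> (\<lambda>a. (a, m - a)) ` ?P"
    by auto
  ultimately show ?thesis by (meson finite_imageI finite_subset)
qed

lemma wfp_on_sumset:
  fixes A B :: "'g::linordered_ab_group_add set"
  assumes A: "wfp_on A (<)" and B: "wfp_on B (<)"
  shows "wfp_on {a + b |a b. a \<in> A \<and> b \<in> B} (<)"
  unfolding wfp_on_iff_ex_minimal
proof (intro allI impI)
  fix S assume S: "S \<subseteq> {a + b |a b. a \<in> A \<and> b \<in> B}" "S \<noteq> {}"
  define A' where "A' = {a \<in> A. \<exists>b\<in>B. a + b \<in> S}"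
  define l where "l a = (SOME b. b \<in> B \<and> a + b \<in> S \<and> (\<forall>c\<in>B. a + c \<in> S \<longrightarrow> b \<le> c))" for a
  have l: "l a \<in> B \<and> a + l a \<in> S \<and> (\<forall>c\<in>B. a + c \<in> S \<longrightarrow> l a \<le> c)" if "a \<in> A'" for a
    unfolding l_def
  proof (rule someI_ex)
    have "{b \<in> B. a + b \<in> S} \<noteq> {}" using that by (auto simp: A'_def)
    thus "\<exists>b. b \<in> B \<and> a + b \<in> S \<and> (\<forall>c\<in>B. a + c \<in> S \<longrightarrow> b \<le> c)"
      using wfp_on_less_ex_min[OF B, of "{b \<in> B. a + b \<in> S}"] by auto
  qed
  define R where "R = {a \<in> A'. \<forall>a'\<in>A'. a' < a \<longrightarrow> l a < l a'}"
  have RA: "R \<subseteq> A" by (auto simp: R_def A'_def)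
  have "wfp_on R (<)" using wfp_on_subset[OF A RA] .
  moreover have "wfp_on R (>)"
    by (rule wfp_on_mono_stronger[OF B, of l]) (auto simp: R_def l)
  ultimately have finR: "finite R" by (rule finite_if_wfp_on_both)
  have dom: "\<exists>r\<in>R. r \<le> a \<and> l r \<le> l a" if "a \<in> A'" for a
  proof -
    have "a \<in> A" using that by (simp add: A'_def)
    from A this show ?thesis using that
    proof (induction a rule: wfp_on_induct[consumes 2, case_names less])
      case (less a)
      show ?case
      proof (cases "a \<in> R")
        case False
        then obtain a' where a': "a' \<in> A'" "a' < a" "l a' \<le> l a"
          using less.prems by (auto simp: R_def not_less)
        moreover have "a' \<in> A" using a' by (simp add: A'_def)
        ultimately obtain r where "r \<in> R" "r \<le> a'" "l r \<le> l a'" using less.IH by blast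
        with a' show ?thesis by (meson order.strict_implies_order order.trans)
      qed auto
    qed
  qed
  obtain s where "s \<in> S" using S by blast
  then obtain a b where ab: "a \<in> A" "b \<in> B" "s = a + b" using S by blast
  hence "a \<in> A'" using \<open>s \<in> S\<close> by (auto simp: A'_def)
  hence "R \<noteq> {}" using dom by blast
  define z where "z = Min ((\<lambda>r. r + l r) ` R)"
  have "z \<in> (\<lambda>r. r + l r) ` R" unfolding z_def using finR \<open>R \<noteq> {}\<close> by (intro Min_in) auto
  hence "z \<in> S" using l by (auto simp: R_def)
  moreover have "z \<le> y" if y: "y \<in> S" for y
  proof -
    have "y \<in> {a + b |a b. a \<in> A \<and> b \<in> B}" using S(1) y by (rule subsetD)
    then obtain a b where ab: "a \<in> A" "b \<in> B" "y = a + b" by blast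
    have abS: "a + b \<in> S" using y ab(3) by simp
    have a: "a \<in> A'" unfolding A'_def using ab(1,2) abS by blast
    obtain r where r: "r \<in> R" "r \<le> a" "l r \<le> l a" using dom[OF a] by blast
    have "z \<le> r + l r" unfolding z_def using finR r(1) by (intro Min_le) auto
    also have "\<dots> \<le> a + l a" using r(2,3) by (rule add_mono)
    also have "\<dots> \<le> a + b" using l[OF a] ab(2) abS by (intro add_left_mono) blast
    finally show ?thesis using ab(3) by simp
  qed
  ultimately show "\<exists>z\<in>S. \<forall>y. y < z \<longrightarrow> y \<notin> S" by (meson linorder_not_less)
qed

lemma finite_conv_hahn:
  fixes f g :: "'g::linordered_ab_group_add \<Rightarrow> 'a::zero"
  assumes "wfp_on {e. f e \<noteq> 0} (<)" "wfp_on {e. g e \<noteq> 0} (<)"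
  shows "finite (conv_set (+) f g m)"
  using finite_sum_decomp[OF assms, of m] by (simp add: conv_set_def)

lemma wfp_on_conv:
  fixes f g :: "'g::linordered_ab_group_add \<Rightarrow> 'a::semiring_0"
  assumes "wfp_on {e. f e \<noteq> 0} (<)" "wfp_on {e. g e \<noteq> 0} (<)"
  shows "wfp_on {e. conv (+) f g e \<noteq> 0} (<)"
proof (rule wfp_on_subset[OF wfp_on_sumset[OF assms]])
  show "{e. conv (+) f g e \<noteq> 0} \<subseteq> {a + b |a b. a \<in> {e. f e \<noteq> 0} \<and> b \<in> {e. g e \<noteq> 0}}"
    using conv_nonzeroD[of "(+)" f g] by blast
qed

lemma finite_conv_hahn3:
  fixes f g h :: "'g::linordered_ab_group_add \<Rightarrow> 'a::zero"
  assumes f: "wfp_on {e. f e \<noteq> 0} (<)" and g: "wfp_on {e. g e \<noteq> 0} (<)"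
    and h: "wfp_on {e. h e \<noteq> 0} (<)"
  shows "finite {(a, b, c). a + (b + c) = m \<and> f a \<noteq> 0 \<and> g b \<noteq> 0 \<and> h c \<noteq> 0}"
proof -
  define G where "G = {a + b |a b. a \<in> {e. g e \<noteq> 0} \<and> b \<in> {e. h e \<noteq> 0}}"
  let ?P = "{(a, d). a + d = m \<and> a \<in> {e. f e \<noteq> 0} \<and> d \<in> G}"
  have "finite ?P" unfolding G_def by (intro finite_sum_decomp f wfp_on_sumset g h)
  hence "finite (\<Union>(a, d)\<in>?P. (\<lambda>(b, c). (a, b, c)) ` {(b, c). b + c = d \<and> b \<in> {e. g e \<noteq> 0} \<and> c \<in> {e. h e \<noteq> 0}})"
    by (rule finite_UN_I) (clarify, intro finite_imageI finite_sum_decomp g h)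
  moreover have "{(a, b, c). a + (b + c) = m \<and> f a \<noteq> 0 \<and> g b \<noteq> 0 \<and> h c \<noteq> 0} \<subseteq> \<dots>"
  proof clarify
    fix a b c assume *: "f a \<noteq> 0" "g b \<noteq> 0" "h c \<noteq> 0" "m = a + (b + c)"
    hence "(a, b + c) \<in> {(x, d). x + d = a + (b + c) \<and> x \<in> {e. f e \<noteq> 0} \<and> d \<in> G}"
      by (auto simp: G_def)
    moreover have "(a, b, c) \<in> (\<lambda>(y, z). (a, y, z)) `
        {(y, z). y + z = b + c \<and> y \<in> {e. g e \<noteq> 0} \<and> z \<in> {e. h e \<noteq> 0}}"
      using * by (intro image_eqI[of _ _ "(b, c)"]) auto
    ultimately show "(a, b, c) \<in> (\<Union>(x, d)\<in>{(x, d). x + d = a + (b + c) \<and> x \<in> {e. f e \<noteq> 0} \<and> d \<in> G}.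
        (\<lambda>(y, z). (x, y, z)) ` {(y, z). y + z = d \<and> y \<in> {e. g e \<noteq> 0} \<and> z \<in> {e. h e \<noteq> 0}})"
      by (intro UN_I[of "(a, b + c)"]) simp_all
  qed
  ultimately show ?thesis by (rule finite_subset[rotated])
qed

instantiation hahn :: (linordered_ab_group_add, comm_ring_1) comm_ring_1
begin

lift_definition zero_hahn :: "('a, 'b) hahn" is "\<lambda>_. 0" by (simp add: wfp_on_def)
lift_definition one_hahn :: "('a, 'b) hahn" is "\<lambda>m. if m = 0 then 1 else 0"
  by (simp add: wfp_on_def)
lift_definition plus_hahn :: "('a, 'b) hahn \<Rightarrow> ('a, 'b) hahn \<Rightarrow> ('a, 'b) hahn"
  is "\<lambda>f g m. f m + g m"
  subgoal for f g
    by (rule wfp_on_subset[OF wfp_on_Un_less[of "{e. f e \<noteq> 0}" "{e. g e \<noteq> 0}"]]) auto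
  done
lift_definition minus_hahn :: "('a, 'b) hahn \<Rightarrow> ('a, 'b) hahn \<Rightarrow> ('a, 'b) hahn"
  is "\<lambda>f g m. f m - g m"
  subgoal for f g
    by (rule wfp_on_subset[OF wfp_on_Un_less[of "{e. f e \<noteq> 0}" "{e. g e \<noteq> 0}"]]) auto
  done
lift_definition uminus_hahn :: "('a, 'b) hahn \<Rightarrow> ('a, 'b) hahn" is "\<lambda>f m. - f m" by simp
lift_definition times_hahn :: "('a, 'b) hahn \<Rightarrow> ('a, 'b) hahn \<Rightarrow> ('a, 'b) hahn" is "conv (+)"
  by (rule wfp_on_conv)

instance
proof
  fix a b c :: "('a, 'b) hahn"
  show "a * b * c = a * (b * c)"
    by transfer (rule conv_assoc; (simp only: add.assoc)?;
        (intro finite_conv_hahn finite_conv_hahn3 wfp_on_conv; assumption))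
  show "a * b = b * a" by transfer (auto simp: fun_eq_iff intro: conv_commute add.commute)
  show "1 * a = a" by transfer (rule ext, simp add: conv_one_left)
  show "(a + b) * c = a * c + b * c"
    by transfer (simp add: fun_eq_iff conv_add_left finite_conv_hahn)
  show "(0 :: ('a, 'b) hahn) \<noteq> 1" by transfer (simp add: fun_eq_iff)
qed (transfer; simp add: algebra_simps)+

end

lift_definition hahn_monom :: "'g::linordered_ab_group_add \<Rightarrow> 'a::zero \<Rightarrow> ('g, 'a) hahn" is
  "\<lambda>e c m. if m = e then c else 0"
  by (simp add: wfp_on_def)


section \<open>The \<open>K\<close>-theoretic Schur \<open>P\<close>-functions\<close>

type_synonym qb = "rat poly fract"

definition bet :: qb where
  "bet = Fract [:0, 1:] 1"

text \<open>
  \<open>\<rat>(\<beta>)((u\<^sub>r))\<dots>((u\<^sub>1))[[x\<^sub>1, x\<^sub>2, \<dots>]]\<close> for all \<open>r\<close> at once; here too \<open>u\<^sub>i\<close> has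
  index \<open>i - 1\<close>.
\<close>

type_synonym ux_series = "(nat \<Rightarrow>\<^sub>0 int, qb) hahn mps"

definition ux_const :: "qb \<Rightarrow> ux_series" where
  "ux_const c = mps_const (hahn_monom 0 c)"

definition uvar :: "nat \<Rightarrow> ux_series" where
  "uvar i = mps_const (hahn_monom (Poly_Mapping.single i 1) 1)"

definition oplus :: "ux_series \<Rightarrow> ux_series \<Rightarrow> ux_series" (infixl "\<oplus>\<^sub>\<beta>" 65) where
  "a \<oplus>\<^sub>\<beta> b = a + b + ux_const bet * a * b"

definition ominus :: "ux_series \<Rightarrow> ux_series \<Rightarrow> ux_series" (infixl "\<ominus>\<^sub>\<beta>" 65) where
  "a \<ominus>\<^sub>\<beta> b = (a - b) / (1 + ux_const bet * b)"

definition strict_partition :: "nat list \<Rightarrow> bool" where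
  "strict_partition lam \<longleftrightarrow> sorted_wrt (>) lam \<and> (\<forall>l \<in> set lam. l > 0)"

definition GP_generating :: "nat \<Rightarrow> ux_series" where
  "GP_generating r =
     (\<Prod>i<r. 1 / ((2 + ux_const bet * uvar i) * (1 + ux_const bet * uvar i)))
   * (\<Prod>i<r. mps_prodinf (\<lambda>j. (uvar i \<oplus>\<^sub>\<beta> xvar j) / (uvar i \<ominus>\<^sub>\<beta> xvar j)))
   * (\<Prod>j<r. \<Prod>i<j. (uvar j \<ominus>\<^sub>\<beta> uvar i) / (uvar j \<oplus>\<^sub>\<beta> uvar i))"

definition GP :: "nat list \<Rightarrow> qb mps" where
  "GP lam = Abs_mps (\<lambda>m. hahn_coeff (mps_coeff (GP_generating (length lam)) m)
      (\<Sum>i<length lam. Poly_Mapping.single i (- int (lam ! i))))"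


section \<open>Formal series in noncommuting letters\<close>

text \<open>
  Arbitrary (infinite) linear combinations of words in the letters \<open>\<phi>\<^sub>n\<close>, \<open>n \<in> \<int>\<close>. The word
  \<open>\<phi>\<^bsub>n\<^sub>1\<^esub> \<dots> \<phi>\<^bsub>n\<^sub>k\<^esub>\<close> is the list \<open>[n\<^sub>1, \<dots>, n\<^sub>k]\<close>.
\<close>

typedef 'a wser = "UNIV :: (int list \<Rightarrow> 'a) set"
  morphisms word_coeff Abs_wser ..

setup_lifting type_definition_wser

lemma finite_splits: "finite {(u, v). u @ v = (w :: 'b list)}"
proof (rule finite_subset)
  show "{(u, v). u @ v = w} \<subseteq> (\<lambda>k. (take k w, drop k w)) ` {..length w}"
  proof clarify
    fix u v assume "w = u @ v"
    thus "(u, v) \<in> (\<lambda>k. (take k (u @ v), drop k (u @ v))) ` {..length (u @ v)}"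
      by (intro image_eqI[of _ _ "length u"]) auto
  qed
qed simp

lemma finite_conv_words: "finite (conv_set (@) f g w)"
  by (rule finite_subset[OF _ finite_splits[of w]]) (auto simp: conv_set_def)

lemma finite_splits3: "finite {(u, v, s). u @ (v @ s) = (w :: 'b list)}"
proof (rule finite_subset)
  show "{(u, v, s). u @ (v @ s) = w} \<subseteq>
      (\<Union>(u, t)\<in>{(u, t). u @ t = w}. (\<lambda>(v, s). (u, v, s)) ` {(v, s). v @ s = t})" by auto
  show "finite (\<Union>(u, t)\<in>{(u, t). u @ t = w}. (\<lambda>(v, s). (u, v, s)) ` {(v, s). v @ s = t})"
    by (rule finite_UN_I) (auto intro: finite_splits)
qed

instantiation wser :: (ring_1) ring_1
begin

lift_definition zero_wser :: "'a wser" is "\<lambda>_. 0" .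
lift_definition one_wser :: "'a wser" is "\<lambda>w. if w = [] then 1 else 0" .
lift_definition plus_wser :: "'a wser \<Rightarrow> 'a wser \<Rightarrow> 'a wser" is "\<lambda>f g w. f w + g w" .
lift_definition minus_wser :: "'a wser \<Rightarrow> 'a wser \<Rightarrow> 'a wser" is "\<lambda>f g w. f w - g w" .
lift_definition uminus_wser :: "'a wser \<Rightarrow> 'a wser" is "\<lambda>f w. - f w" .
lift_definition times_wser :: "'a wser \<Rightarrow> 'a wser \<Rightarrow> 'a wser" is "conv (@)" .

instance
proof
  fix a b c :: "'a wser"
  show "a * b * c = a * (b * c)"
  proof transfer
    fix a b c :: "int list \<Rightarrow> 'a"
    show "conv (@) (conv (@) a b) c = conv (@) a (conv (@) b c)"
    proof (rule conv_assoc)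
      fix w
      show "finite {(x, y, z). x @ (y @ z) = w \<and> a x \<noteq> 0 \<and> b y \<noteq> 0 \<and> c z \<noteq> 0}"
        by (rule finite_subset[OF _ finite_splits3[of w]]) auto
    qed (rule finite_conv_words | simp)+
  qed
  show "1 * a = a" by transfer (rule ext, simp add: conv_one_left)
  show "a * 1 = a" by transfer (rule ext, simp add: conv_one_right)
  show "(a + b) * c = a * c + b * c"
    by transfer (simp add: fun_eq_iff conv_add_left finite_conv_words)
  show "a * (b + c) = a * b + a * c"
    by transfer (simp add: fun_eq_iff conv_add_right finite_conv_words)
  show "(0 :: 'a wser) \<noteq> 1" by transfer (simp add: fun_eq_iff)
qed (transfer; simp add: algebra_simps)+

end


section \<open>Neutral fermions\<close>

text \<open>
  Elements of the completed algebra with coefficients extended to \<open>\<rat>(\<beta>)[[x]]\<close> are represented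
  by series of words; the relations of the algebra are imposed on the vacuum pairing below.
  Infinite sums are again coefficientwise, in the word as well as in the monomial in \<open>x\<close>.
\<close>

type_synonym fseries = "qb mps wser"

definition fscale :: "qb mps \<Rightarrow> fseries \<Rightarrow> fseries" where
  "fscale c F = Abs_wser (\<lambda>w. c * word_coeff F w)"

abbreviation fscale_const :: "qb \<Rightarrow> fseries \<Rightarrow> fseries" (infixr "\<bullet>" 72) where
  "c \<bullet> F \<equiv> fscale (mps_const c) F"

definition fsum :: "('i \<Rightarrow> fseries) \<Rightarrow> fseries" where
  "fsum F = Abs_wser (\<lambda>w. mps_sum (\<lambda>i. word_coeff (F i) w))"

definition fexp :: "fseries \<Rightarrow> fseries" where
  "fexp F = fsum (\<lambda>k::nat. (1 / of_nat (fact k)) \<bullet> F ^ k)"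

definition phi :: "int \<Rightarrow> fseries" where
  "phi n = Abs_wser (\<lambda>w. if w = [n] then 1 else 0)"

text \<open>
  Only the non-negative modes of the deformed fermions are needed: \<open>\<phi>\<^sup>(\<^sup>\<beta>\<^sup>)\<^sub>n\<close> is the coefficient
  of \<open>z\<^sup>n\<close> in \<open>\<Sum>\<^sub>m \<phi>\<^sub>m (z + \<beta>/2)\<^sup>m\<close>.
\<close>

definition phi_beta :: "nat \<Rightarrow> fseries" where
  "phi_beta n = fsum (\<lambda>m::nat. coeff ([:bet / 2, 1:] ^ m) n \<bullet> phi (int m))"

definition Phi_beta :: "nat \<Rightarrow> fseries" where
  "Phi_beta n = fsum (\<lambda>k::nat. (1 / 2 * (- bet / 2) ^ k) \<bullet> phi_beta (n + k))"

definition current :: "int \<Rightarrow> fseries" where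
  "current m = fsum (\<lambda>i::int. ((-1) powi i / 4) \<bullet> (phi (- i - m) * phi i))"

text \<open>\<open>b\<^sup>(\<^sup>\<beta>\<^sup>)\<^sub>m\<close> for \<open>m > 0\<close>; the coefficients of even powers of \<open>X\<close> vanish.\<close>

definition current_beta :: "nat \<Rightarrow> fseries" where
  "current_beta m = fsum (\<lambda>k::nat.
     coeff (smult (1 / 2) ([:- bet / 2, 1:] ^ m - [:- bet / 2, -1:] ^ m)) k \<bullet> current (int k))"

text \<open>
  The sum runs over all \<open>n \<ge> 1\<close>, not only over odd \<open>n\<close>. The commutator with
  \<open>2 b\<^sup>(\<^sup>\<beta>\<^sup>)\<^sub>n\<close> multiplies the generating series \<open>\<Sum>\<^sub>m \<phi>\<^sub>m (z + \<beta>/2)\<^sup>m\<close> over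
  \<open>m \<in> \<int>\<close> by \<open>z\<^sup>n - (- z - \<beta>)\<^sup>n\<close>, so that summing over all \<open>n\<close> and exponentiating yields
  \<open>\<Prod>\<^sub>j (1 + (z + \<beta>) x\<^sub>j) / (1 - z x\<^sub>j)\<close>. Summing over odd \<open>n\<close> only would add, already for
  \<open>\<lambda> = (1)\<close>, a term \<open>\<beta>/2 x\<^sub>1\<^sup>2\<close> to the expectation value, whereas \<open>GP\<close> of \<open>(1)\<close> in the
  single variable \<open>x\<^sub>1\<close> is \<open>x\<^sub>1\<close>.
\<close>

definition hamiltonian :: fseries where
  "hamiltonian = fsum (\<lambda>n::nat. if n \<ge> 1
     then fscale (mps_const (2 / of_nat n) * power_sum n) (current_beta n) else 0)"

definition Theta :: fseries where
  "Theta = fsum (\<lambda>n::nat. if odd n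
     then (2 * (bet / 2) ^ n / of_nat n) \<bullet> current (- int n) else 0)"

text \<open>
  The bilinear pairing between \<open>\<langle>0|A\<close> and \<open>A|0\<rangle>\<close>, given by its values
  \<open>\<langle>0|\<phi>\<^sub>u \<cdot> \<phi>\<^sub>v|0\<rangle>\<close> on words \<open>u\<close>, \<open>v\<close>. The last four conditions say that the bilinear form
  so defined on the free algebra descends to \<open>\<langle>0|A\<close> and \<open>A|0\<rangle>\<close>, i.e. respects the defining
  relations of \<open>A\<close> and the vacuum annihilation conditions.
\<close>

definition is_vacuum_pairing :: "(int list \<Rightarrow> int list \<Rightarrow> qb) \<Rightarrow> bool" where
  "is_vacuum_pairing P \<longleftrightarrow>
     P [] [] = 1 \<and>
     P [] [0] = 0 \<and>
     (\<forall>u n v. P (u @ [n]) v = P u (n # v)) \<and>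
     (\<forall>n>0. \<forall>u v. P (n # u) v = 0) \<and>
     (\<forall>n>0. \<forall>u v. P u (v @ [-n]) = 0) \<and>
     (\<forall>u v w m n. P (u @ [m, n] @ w) v + P (u @ [n, m] @ w) v
        = (if m + n = 0 then 2 * (-1) powi m * P (u @ w) v else 0)) \<and>
     (\<forall>u v w m n. P u (v @ [m, n] @ w) + P u (v @ [n, m] @ w)
        = (if m + n = 0 then 2 * (-1) powi m * P u (v @ w) else 0))"

definition vacuum_pairing :: "int list \<Rightarrow> int list \<Rightarrow> qb" where
  "vacuum_pairing = (THE P. is_vacuum_pairing P)"

text \<open>
  \<open>\<langle>0|U \<cdot> V|0\<rangle>\<close> for completed elements, extended bilinearly; for each monomial in \<open>x\<close> the sum
  over pairs of words must be finite.
\<close>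

definition vev :: "fseries \<Rightarrow> fseries \<Rightarrow> qb mps" where
  "vev U V = Abs_mps (\<lambda>m. Sum_any (\<lambda>(u, v).
     mps_coeff (word_coeff U u * word_coeff V v) m * vacuum_pairing u v))"

text \<open>The operator \<open>X\<close> such that \<open>|\<lambda>\<rangle>\<^sub>P = X|0\<rangle>\<close>.\<close>

definition ket_P :: "nat list \<Rightarrow> fseries" where
  "ket_P lam = prod_list (map (\<lambda>l. Phi_beta l * fexp Theta) lam)
     * (if even (length lam) then 1 else phi_beta 0 * fexp Theta)"

end

theory Submission
  imports Defs
begin

text \<open>
  Both sides are Pfaffians.

  Series of words act from the right on functionals on words. The functional \<open>\<langle>0|e\<^sup>H\<close> is an
  eigenvector of all \<open>b\<^sub>-\<^sub>n\<close> with \<open>n > 0\<close> odd, hence of \<open>e\<^sup>\<Theta>\<close>, with eigenvalue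
  \<open>\<kappa> = \<Prod>\<^sub>j (1 + \<beta> x\<^sub>j)\<close>. Moving \<open>e\<^sup>\<Theta>\<close> to the left past \<open>\<Sum>\<^sub>m f\<^sub>m \<phi>\<^sub>m\<close>, which is encoded by
  \<open>f(X) = \<Sum>\<^sub>m f\<^sub>m X\<^sup>m\<close>, multiplies \<open>f(X)\<close> by \<open>(1 - \<beta>X/2) / (1 + \<beta>X/2)\<close>. After all exponentials
  have been absorbed in this way, Wick's theorem evaluates the vacuum expectation value as a Pfaffian.

  In terms of \<open>\<zeta>\<^sub>i = 1/u\<^sub>i + \<beta>/2\<close>, the product over pairs in the generating function of \<open>GP\<close> is
  \<open>\<Prod> (\<zeta>\<^sub>i - \<zeta>\<^sub>j) / (\<zeta>\<^sub>i + \<zeta>\<^sub>j)\<close> up to powers of \<open>1 + \<beta> u\<^sub>i\<close>, which is a Pfaffian by Schur's identity;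
  for odd \<open>r\<close> one adds \<open>\<zeta> = -\<beta>/2\<close>. The variables of disjoint pairs being separate, taking
  coefficients commutes with the Pfaffian. Expanding \<open>(\<zeta>\<^sub>i - \<zeta>\<^sub>j) / (\<zeta>\<^sub>i + \<zeta>\<^sub>j)\<close> in powers of
  \<open>\<zeta>\<^sub>j / \<zeta>\<^sub>i\<close> then identifies the entries of the two Pfaffians.
\<close>


section \<open>Pfaffians\<close>

text \<open>The letters are free, and the Clifford relations hold only after pairing with the
  vacuum; hence operators appear only through their action on functionals respecting these
  relations. The obstacle is convergence: \<open>GH\<close> has no energy bound, so e^\<Theta>
  cannot act on it by finite sums. But H lowers the energy by k only with coefficients of x-degree
  at least k, so the coefficient of each x-monomial is a functional of bounded energy, and
  everything acts coefficientwise in x.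

  Two counts make the Pfaffians agree. Letter i has N - i exponentials to its right and so acquires
  (1 - \<beta>X/2) / (1 + \<beta>X/2) to that power; for X = 1/\<zeta>_i this quotient is 1 / (1 +
  \<beta>u_i), which has the same exponent in the generating function. The scalar \<kappa> comes
  from N exponentials on one side and from r infinite products on the other; for odd r the missing
  one belongs to the added letter, since \<kappa> times the series \<open>qq\<close> at X =
  -\<beta>/2 is 1.

  Infinite products are compared with exponentials through their logarithmic derivatives for the
  Euler operator. All divisions are by units, as the coefficient rings are treated as mere
  commutative rings.\<close>

function pf :: "('i \<Rightarrow> 'i \<Rightarrow> 'a::comm_ring_1) \<Rightarrow> 'i list \<Rightarrow> 'a" where
  "pf g [] = 1"
| "pf g (a # w) = (\<Sum>j<length w. (-1) ^ j * g a (w ! j) * pf g (take j w @ drop (Suc j) w))"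
  by pat_completeness auto
termination
  by (relation "measure (\<lambda>(g, w). length w)") auto

declare pf.simps(2) [simp del]

text \<open>Contraction with a linear form, as a signed derivation on words. Unlike the sum over
  positions, this recursion fits induction on words.\<close>

fun del :: "('i \<Rightarrow> 'a::comm_ring_1) \<Rightarrow> ('i list \<Rightarrow> 'a) \<Rightarrow> 'i list \<Rightarrow> 'a" where
  "del h f [] = 0"
| "del h f (b # w) = h b * f w - del h (\<lambda>v. f (b # v)) w"

lemma del_eq_sum: "del h f w = (\<Sum>j<length w. (-1) ^ j * h (w ! j) * f (take j w @ drop (Suc j) w))"
proof (induction w arbitrary: f)
  case (Cons b w)
  show ?case by (simp add: Cons sum.lessThan_Suc_shift sum_negf[symmetric] del: sum.lessThan_Suc)
qed simp

lemma pf_Cons: "pf g (a # w) = del (g a) (pf g) w"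
  by (simp add: pf.simps(2) del_eq_sum)

lemma del_cong:
  assumes "\<And>v. Suc (length v) = length w \<Longrightarrow> f v = f' v" "\<And>b. b \<in> set w \<Longrightarrow> h b = h' b"
  shows "del h f w = del h' f' w"
  using assms
proof (induction w arbitrary: f f')
  case (Cons b w)
  have "del h (\<lambda>v. f (b # v)) w = del h' (\<lambda>v. f' (b # v)) w"
    using Cons.prems by (intro Cons.IH) auto
  thus ?case using Cons.prems by simp
qed simp

lemma del_zero [simp]: "del h (\<lambda>_. 0) w = 0"
  by (induction w) auto

lemma del_add: "del h (\<lambda>v. f v + f' v) w = del h f w + del h f' w"
  by (induction w arbitrary: f f') (auto simp: algebra_simps)

lemma del_diff: "del h (\<lambda>v. f v - f' v) w = del h f w - del h f' w"
  by (induction w arbitrary: f f') (auto simp: algebra_simps)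

lemma del_scale: "del h (\<lambda>v. c * f v) w = c * del h f w"
  by (induction w arbitrary: f) (auto simp: algebra_simps)

lemma del_sum: "del h (\<lambda>v. \<Sum>i\<in>I. f i v) w = (\<Sum>i\<in>I. del h (f i) w)"
  by (induction I rule: infinite_finite_induct) (auto simp: del_add)

lemma del_sum_left: "del (\<lambda>b. \<Sum>i\<in>I. h i b) f w = (\<Sum>i\<in>I. del (h i) f w)"
  by (induction w arbitrary: f) (auto simp: sum_distrib_right sum_subtractf)

lemma del_scale_left: "del (\<lambda>b. c * h b) f w = c * del h f w"
  by (induction w arbitrary: f) (auto simp: algebra_simps)

lemma del_zero_left [simp]: "del (\<lambda>b. 0) f w = 0"
  by (induction w arbitrary: f) auto

text \<open>Removing two letters in the other order shifts the position of one of them by one, hence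
  the sign. In \<open>vac_clifford\<close> this cancels everything except the anticommutator of the
  first two letters.\<close>

lemma del_antisym: "del h (del k f) w = - del k (del h f) w"
  by (induction w arbitrary: f) (auto simp: del_diff del_scale)

lemma pf_cong:
  assumes "\<And>a b. a \<in> set w \<Longrightarrow> b \<in> set w \<Longrightarrow> g a b = g' a b"
  shows "pf g w = pf g' w"
  using assms
proof (induction "length w" arbitrary: w rule: less_induct)
  case less
  show ?case
  proof (cases w)
    case (Cons a v)
    have "pf g (take j v @ drop (Suc j) v) = pf g' (take j v @ drop (Suc j) v)" if "j < length v" for j
      using that Cons
      by (intro less(1)) (auto intro!: less(2) dest: in_set_takeD in_set_dropD)
    moreover have "g a (v ! j) = g' a (v ! j)" if "j < length v" for j
      using that Cons by (intro less(2)) auto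
    ultimately show ?thesis by (simp add: Cons pf.simps(2))
  qed simp
qed

lemma pf_map: "pf g (map f w) = pf (\<lambda>a b. g (f a) (f b)) w"
proof (induction "length w" arbitrary: w rule: less_induct)
  case less
  show ?case
  proof (cases w)
    case (Cons a v)
    have *: "pf g (take j (map f v) @ drop (Suc j) (map f v)) =
        pf (\<lambda>a b. g (f a) (f b)) (take j v @ drop (Suc j) v)" if "j < length v" for j
      unfolding take_map drop_map map_append[symmetric] using that Cons by (intro less) auto
    show ?thesis by (simp add: Cons pf.simps(2) *)
  qed simp
qed

lemma pf_scale: "pf (\<lambda>a b. c a * c b * g a b) w = prod_list (map c w) * pf g w"
proof (induction "length w" arbitrary: w rule: less_induct)
  case less
  show ?case
  proof (cases w)
    case (Cons a v)
    have *: "pf (\<lambda>a b. c a * c b * g a b) (take j v @ drop (Suc j) v) =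
        prod_list (map c (take j v @ drop (Suc j) v)) * pf g (take j v @ drop (Suc j) v)" if "j < length v" for j
      using that Cons by (intro less) auto
    have **: "prod_list (map c v) = c (v ! j) * prod_list (map c (take j v @ drop (Suc j) v))"
      if "j < length v" for j
    proof -
      have "map c v = map c (take j v @ v ! j # drop (Suc j) v)"
        using id_take_nth_drop[OF that] by simp
      thus ?thesis by (simp add: algebra_simps)
    qed
    have "pf (\<lambda>a b. c a * c b * g a b) w = (\<Sum>j<length v. c a * prod_list (map c v) * ((-1) ^ j * g a (v ! j) * pf g (take j v @ drop (Suc j) v)))"
      unfolding Cons pf.simps(2)
    proof (intro sum.cong refl, goal_cases)
      case (1 j)
      hence "j < length v" by simp
      show ?case unfolding *[OF \<open>j < length v\<close>] **[OF \<open>j < length v\<close>] by (simp add: algebra_simps)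
    qed
    also have "\<dots> = prod_list (map c w) * pf g w"
      by (simp add: Cons pf.simps(2) sum_distrib_left)
    finally show ?thesis .
  qed simp
qed

section \<open>Multilinear extension of functionals on words\<close>

fun lin :: "'i set \<Rightarrow> ('i \<Rightarrow> 'a::comm_ring_1) list \<Rightarrow> ('i list \<Rightarrow> 'a) \<Rightarrow> 'a" where
  "lin I [] f = f []"
| "lin I (a # as) f = (\<Sum>M\<in>I. a M * lin I as (\<lambda>w. f (M # w)))"

lemma lin_diff: "lin I as (\<lambda>w. f w - f' w) = lin I as f - lin I as f'"
  by (induction as arbitrary: f f') (simp_all add: right_diff_distrib sum_subtractf)

lemma lin_scale: "lin I as (\<lambda>w. c * f w) = c * lin I as f"
  by (induction as arbitrary: f) (auto simp: algebra_simps sum_distrib_left)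

lemma lin_del:
  "lin I as (del h f) = del (\<lambda>a. \<Sum>M\<in>I. a M * h M) (\<lambda>bs. lin I bs f) as"
proof (induction as arbitrary: f)
  case (Cons a as)
  have "lin I (a # as) (del h f) = (\<Sum>M\<in>I. a M * (h M * lin I as f - lin I as (del h (\<lambda>v. f (M # v)))))"
    by (simp add: lin_diff lin_scale)
  also have "\<dots> = (\<Sum>M\<in>I. a M * h M) * lin I as f - (\<Sum>M\<in>I. a M * lin I as (del h (\<lambda>v. f (M # v))))"
    by (simp add: algebra_simps sum_subtractf sum_distrib_left)
  also have "\<dots> = del (\<lambda>a. \<Sum>M\<in>I. a M * h M) (\<lambda>bs. lin I bs f) (a # as)"
    by (simp add: Cons.IH del_sum del_scale)
  finally show ?case .
qed simp

text \<open>Wick's theorem for linear combinations of letters: contraction commutes with multilinear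
  extension (\<open>lin_del\<close>), so only the two-point function changes.\<close>

lemma lin_pf: "lin I as (pf g) = pf (\<lambda>a b. \<Sum>M\<in>I. \<Sum>N\<in>I. a M * b N * g M N) as"
proof (induction "length as" arbitrary: as rule: less_induct)
  case less
  show ?case
  proof (cases as)
    case (Cons a bs)
    let ?g = "\<lambda>a b. \<Sum>M\<in>I. \<Sum>N\<in>I. a M * b N * g M N"
    have "lin I as (pf g) = (\<Sum>M\<in>I. a M * del (\<lambda>b. \<Sum>N\<in>I. b N * g M N) (\<lambda>bs. lin I bs (pf g)) bs)"
      by (simp add: Cons pf_Cons lin_del)
    also have "\<dots> = del (\<lambda>b. \<Sum>M\<in>I. a M * (\<Sum>N\<in>I. b N * g M N)) (\<lambda>bs. lin I bs (pf g)) bs"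
      by (subst del_sum_left) (simp add: del_scale_left)
    also have "\<dots> = del (?g a) (pf ?g) bs"
      using Cons by (intro del_cong less) (auto simp: sum_distrib_left mult.assoc)
    finally show ?thesis by (simp add: Cons pf_Cons)
  qed simp
qed


section \<open>Functionals on words\<close>

definition sg :: "int \<Rightarrow> 'a::comm_ring_1" where
  "sg n = (if even n then 1 else -1)"

lemma sg_add: "sg (a + b) = sg a * sg b"
  and sg_minus [simp]: "sg (- a) = sg a"
  and sg_diff: "sg (a - b) = sg a * sg b"
  and sg_square [simp]: "sg a * sg a = 1" "sg a * (sg a * x) = x"
  and sg_0 [simp]: "sg 0 = 1"
  by (auto simp: sg_def)

lemma sg_eq_powi: "(-1) powi n = (sg n :: 'a::field)"
  by (simp add: sg_def)

lemma sg_eq_power: "sg (int n) = (-1) ^ n"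
  by (auto simp: sg_def)

definition acomm :: "int \<Rightarrow> int \<Rightarrow> 'a::comm_ring_1" where
  "acomm m n = (if m + n = 0 then 2 * sg m else 0)"

definition clifford :: "(int list \<Rightarrow> 'a::comm_ring_1) \<Rightarrow> bool" where
  "clifford G \<longleftrightarrow> (\<forall>u v m n. G (u @ m # n # v) + G (u @ n # m # v) = acomm m n * G (u @ v))"

definition right_vac :: "(int list \<Rightarrow> 'a::comm_ring_1) \<Rightarrow> bool" where
  "right_vac G \<longleftrightarrow> (\<forall>u n. n > 0 \<longrightarrow> G (u @ [- n]) = 0)"

text \<open>Models the functionals sending a word w to <G| phi_w |0>. Nothing is required at the
  left end, so <G| may be any bra.\<close>

definition bra :: "(int list \<Rightarrow> 'a::comm_ring_1) \<Rightarrow> bool" where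
  "bra G \<longleftrightarrow> clifford G \<and> right_vac G"

lemma bra_swap: "bra G \<Longrightarrow> G (u @ m # n # v) = acomm m n * G (u @ v) - G (u @ n # m # v)"
  by (simp add: bra_def clifford_def eq_diff_eq)

lemma bra_prefix: "bra G \<Longrightarrow> bra (\<lambda>w. G (u @ w))"
  unfolding bra_def clifford_def right_vac_def append_assoc[symmetric] by blast

lemma bra_Cons: "bra G \<Longrightarrow> bra (\<lambda>w. G (n # w))"
  using bra_prefix[of G "[n]"] by simp

lemma bra_swap2: "bra G \<Longrightarrow> G (m # n # v) = acomm m n * G v - G (n # m # v)"
  using bra_swap[of G "[]" m n v] by simp

text \<open>A word of negative sum has a negative letter. Moved to the right end it annihilates the
  vacuum, and each contraction on the way removes two letters of sum zero, leaving a shorter word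
  with the same sum.\<close>

lemma bra_negative:
  assumes "bra G" "sum_list w < 0"
  shows "G (u @ w) = 0"
  using assms
proof (induction "length w" arbitrary: u w rule: less_induct)
  case less
  have "\<exists>a \<in> set w. a < 0"
  proof (rule ccontr)
    assume "\<not> ?thesis"
    hence "sum_list w \<ge> 0" by (intro sum_list_nonneg) auto
    with less.prems show False by simp
  qed
  then obtain a w1 w2 where w: "w = w1 @ a # w2" and a: "a < 0" by (meson split_list)
  have "G (u @ w1 @ a # w2) = 0"
    if "length (w1 @ a # w2) = length w" "sum_list (w1 @ a # w2) = sum_list w" for w1 w2
    using that
  proof (induction w2 arbitrary: w1)
    case Nil
    have "G ((u @ w1) @ [- (- a)]) = 0"
      using less.prems(1) a unfolding bra_def right_vac_def
      by (metis neg_0_less_iff_less)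
    thus ?case by simp
  next
    case (Cons b w2)
    have "G (u @ w1 @ a # b # w2) = acomm a b * G (u @ w1 @ w2) - G (u @ w1 @ b # a # w2)"
      using bra_swap[OF less.prems(1), of "u @ w1" a b w2] by simp
    moreover have "G (u @ w1 @ b # a # w2) = 0"
      using Cons.IH[of "w1 @ [b]"] Cons.prems by simp
    moreover have "acomm a b * G (u @ w1 @ w2) = 0"
    proof (cases "a + b = 0")
      case True
      have "G (u @ w1 @ w2) = 0"
        using Cons.prems True less.prems by (intro less.hyps) auto
      thus ?thesis by simp
    qed (simp add: acomm_def)
    ultimately show ?case by simp
  qed
  from this[of w1 w2] show ?case by (simp add: w)
qed

lemma bra_negative': "bra G \<Longrightarrow> sum_list w < 0 \<Longrightarrow> G w = 0"
  using bra_negative[of G w "[]"] by simp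

text \<open>With -n on the right the tail has negative energy; for \<open>m \<noteq> n\<close> the
  two letters anticommute, which carries the vanishing over to the other order.\<close>

lemma bra_swap_vanish:
  assumes "bra G" "sum_list w < n" "m \<noteq> n"
  shows "G ([m, - n] @ w) = 0"  "G ([- n, m] @ w) = 0"
proof -
  show *: "G ([m, - n] @ w) = 0" using bra_negative[OF assms(1), of "- n # w" "[m]"] assms(2) by simp
  show "G ([- n, m] @ w) = 0" 
    using bra_swap2[OF assms(1), of "-n" m w] * assms(3) by (auto simp: acomm_def)
qed

text \<open>A positive letter can be moved to the left end, where it raises the energy beyond the bound.\<close>

lemma bra_positive_letter:
  assumes "bra G" "\<And>w. sum_list w > D \<Longrightarrow> G w = 0" "G (u @ p # v) \<noteq> 0" "p > D"
  shows "- p \<in> set u"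
  using assms(3)
proof (induction u arbitrary: v rule: rev_induct)
  case Nil
  have "sum_list v \<ge> 0"
    using bra_negative[OF assms(1), of v "[p]"] Nil by (cases "sum_list v < 0") auto
  hence "sum_list (p # v) > D" using assms(4) by simp
  with assms(2) Nil show ?case by simp
next
  case (snoc b u)
  show ?case
  proof (cases "b = - p")
    case False
    have "G ((u @ [b]) @ p # v) = acomm b p * G (u @ v) - G (u @ p # b # v)"
      using bra_swap[OF assms(1), of u b p v] by simp
    also have "acomm b p = 0" using False by (auto simp: acomm_def)
    finally have "G (u @ p # b # v) \<noteq> 0" using snoc.prems by auto
    from snoc.IH[OF this] show ?thesis by simp
  qed simp
qed


section \<open>The vacuum functional\<close>

text \<open>The two-point function <0| phi_a phi_b |0>: positive a is annihilated by <0|, and phi_0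
  squares to 1.\<close>

definition ct :: "int \<Rightarrow> int \<Rightarrow> 'a::comm_ring_1" where
  "ct a b = (if a + b = 0 then if a < 0 then 2 * sg a else if a = 0 then 1 else 0 else 0)"

abbreviation vac :: "int list \<Rightarrow> 'a::comm_ring_1" where
  "vac \<equiv> pf ct"

lemma ct_add_commuted: "ct m n + ct n m = acomm m n"
proof (cases "m + n = 0")
  case True
  hence "n = - m" by simp
  thus ?thesis by (auto simp: ct_def acomm_def)
qed (simp add: ct_def acomm_def add.commute)

text \<open>The terms that contract one of the two exchanged letters cancel between the two words;
  in all others the relation is inherited from \<open>f\<close>. The bound \<open>L\<close> is there
  because the induction in \<open>vac_clifford\<close> knows the relation for short words
  only.\<close>

lemma del_clifford:
  assumes "\<And>u m n v. length u + length v < L \<Longrightarrow> f (u @ m # n # v) + f (u @ n # m # v) = acomm m n * f (u @ v)"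
    and "length u + length v < Suc L"
  shows "del h f (u @ m # n # v) + del h f (u @ n # m # v) = acomm m n * del h f (u @ v)"
  using assms
proof (induction u arbitrary: f L)
  case Nil
  have "del h f (m # n # v) + del h f (n # m # v) = del h (\<lambda>v. f (m # n # v) + f (n # m # v)) v"
    by (simp add: del_add)
  also have "\<dots> = del h (\<lambda>v. acomm m n * f v) v"
    using Nil.prems(1)[of "[]"] Nil.prems(2) by (intro del_cong) auto
  finally show ?case by (simp add: del_scale)
next
  case (Cons b u)
  have 1: "f (u @ m # n # v) + f (u @ n # m # v) = acomm m n * f (u @ v)"
    using Cons.prems by auto
  have 2: "del h (\<lambda>v. f (b # v)) (u @ m # n # v) + del h (\<lambda>v. f (b # v)) (u @ n # m # v)
      = acomm m n * del h (\<lambda>v. f (b # v)) (u @ v)"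
  proof (rule Cons.IH)
    fix u' v' :: "int list" and m n assume "length u' + length v' < L - 1"
    thus "f (b # u' @ m # n # v') + f (b # u' @ n # m # v') = acomm m n * f (b # u' @ v')"
      using Cons.prems(1)[of "b # u'" v' m n] by simp
  qed (use Cons.prems in auto)
  have "del h f ((b # u) @ m # n # v) + del h f ((b # u) @ n # m # v) =
      h b * (f (u @ m # n # v) + f (u @ n # m # v)) -
      (del h (\<lambda>v. f (b # v)) (u @ m # n # v) + del h (\<lambda>v. f (b # v)) (u @ n # m # v))"
    by (simp add: algebra_simps)
  also have "\<dots> = acomm m n * del h f ((b # u) @ v)"
    unfolding 1 2 by (simp add: algebra_simps)
  finally show ?case .
qed

lemma vac_clifford:
  "(vac (u @ m # n # v) :: 'a::comm_ring_1) + vac (u @ n # m # v) = acomm m n * vac (u @ v)"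
proof (induction "length u + length v" arbitrary: u m n v rule: less_induct)
  case less
  show ?case
  proof (cases u)
    case Nil
    have "(pf ct (m # n # v) :: 'a) = ct m n * pf ct v - del (ct m) (del (ct n) (pf ct)) v" for m n
      by (simp add: pf_Cons)
    from this[of m n] this[of n m] del_antisym[of "ct m" "ct n" "pf ct :: _ \<Rightarrow> 'a" v] show ?thesis
      by (simp add: Nil ct_add_commuted[symmetric] algebra_simps)
  next
    case (Cons a u')
    show ?thesis unfolding Cons append_Cons pf_Cons
      by (rule del_clifford[where L = "length u' + length v"]) (use less Cons in auto)
  qed
qed

lemma del_snoc_zero:
  assumes "h z = 0" "\<And>v. f (v @ [z]) = 0"
  shows "del h f (w @ [z]) = 0"
  using assms
proof (induction w arbitrary: f)
  case (Cons a w)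
  have "del h (\<lambda>v. f (a # v)) (w @ [z]) = 0"
    using Cons.prems(2)[of "a # _"] by (intro Cons.IH Cons.prems) simp
  thus ?case by (simp add: Cons.prems)
qed simp

lemma vac_right: "n > 0 \<Longrightarrow> (vac (u @ [- n]) :: 'a::comm_ring_1) = 0"
proof (induction "length u" arbitrary: u rule: less_induct)
  case less
  show ?case
  proof (cases u)
    case (Cons a u')
    \<comment> \<open>\<open>del_snoc_zero\<close> asks for vanishing on words of every length, the
      induction hypothesis gives it for short ones; cutting \<open>vac\<close> off at the length
      that occurs reconciles the two.\<close>
    have "del (ct a) (vac :: _ \<Rightarrow> 'a) (u' @ [- n]) = del (ct a) (\<lambda>v. if length v \<le> length u' then vac v else 0) (u' @ [- n])"
      by (intro del_cong) auto
    also have "\<dots> = 0"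
      by (intro del_snoc_zero) (use less Cons in \<open>auto simp: ct_def\<close>)
    finally show ?thesis by (simp add: Cons pf_Cons)
  qed (simp add: pf_Cons)
qed

lemma vac_left: "n > 0 \<Longrightarrow> (vac (n # w) :: 'a::comm_ring_1) = 0"
proof -
  assume "n > 0"
  hence "del (ct n) (vac :: _ \<Rightarrow> 'a) w = del (\<lambda>_. 0) vac w" by (intro del_cong) (auto simp: ct_def)
  thus ?thesis by (simp add: pf_Cons)
qed

lemma bra_vac: "bra vac"
  by (simp add: bra_def clifford_def right_vac_def vac_clifford vac_right)

lemma del_nonzeroD:
  assumes "del h f w \<noteq> 0"
  shows "\<exists>u b v. w = u @ b # v \<and> h b \<noteq> 0 \<and> f (u @ v) \<noteq> 0"
  using assms
proof (induction w arbitrary: f)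
  case (Cons a w)
  show ?case
  proof (cases "h a * f w = 0")
    case True
    with Cons.prems have "del h (\<lambda>v. f (a # v)) w \<noteq> 0" by auto
    from Cons.IH[OF this] obtain u b v where "w = u @ b # v" "h b \<noteq> 0" "f (a # u @ v) \<noteq> 0" by blast
    thus ?thesis by (intro exI[of _ "a # u"] exI[of _ b] exI[of _ v]) auto
  next
    case False
    thus ?thesis by (intro exI[of _ "[]"] exI[of _ a] exI[of _ w]) auto
  qed
qed simp

lemma vac_energy: "(vac w :: 'a::comm_ring_1) \<noteq> 0 \<Longrightarrow> sum_list w = 0"
proof (induction "length w" arbitrary: w rule: less_induct)
  case less
  show ?case
  proof (cases w)
    case (Cons a w')
    with less.prems have "del (ct a) (vac :: _ \<Rightarrow> 'a) w' \<noteq> 0" by (simp add: pf_Cons)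
    then obtain u b v where *: "w' = u @ b # v" "(ct a b :: 'a) \<noteq> 0" "(vac (u @ v) :: 'a) \<noteq> 0"
      using del_nonzeroD by blast
    have "a + b = 0" using *(2) by (auto simp: ct_def split: if_splits)
    thus ?thesis using less.hyps[of "u @ v"] * Cons by simp
  qed simp
qed

section \<open>Uniqueness of the vacuum functional\<close>

lemma clifford_move_left:
  assumes "\<And>u v m n. f (u @ m # n # v) + f (u @ n # m # v) = acomm m n * f (u @ v)"
    and "\<And>v. length v < length u + length w \<Longrightarrow> f v = 0"
    and "f (n # u @ w) = (0 :: 'a::comm_ring_1)"
  shows "f (u @ n # w) = 0"
  using assms(2-)
proof (induction u arbitrary: w rule: rev_induct)
  case (snoc b u)
  have "f (u @ n # b # w) = 0" using snoc.prems by (intro snoc.IH) auto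
  moreover have "f (u @ b # n # w) + f (u @ n # b # w) = 0"
    using snoc.prems(1)[of "u @ w"] by (simp add: assms(1))
  ultimately show ?case by simp
qed simp

lemma clifford_move_right:
  assumes "\<And>u v m n. f (u @ m # n # v) + f (u @ n # m # v) = acomm m n * f (u @ v)"
    and "\<And>v. length v < length u + length w \<Longrightarrow> f v = 0"
    and "f (u @ w @ [n]) = (0 :: 'a::comm_ring_1)"
  shows "f (u @ n # w) = 0"
  using assms(2-)
proof (induction w arbitrary: u)
  case (Cons b w)
  have "f ((u @ [b]) @ n # w) = 0" using Cons.prems by (intro Cons.IH) auto
  moreover have "f (u @ b # n # w) + f (u @ n # b # w) = 0"
    using Cons.prems(1)[of "u @ w"] by (simp add: assms(1))
  ultimately show ?case by simp
qed simp

text \<open>A nonzero letter can be moved to the end where it annihilates the vacuum, and the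
  contractions it leaves behind are shorter words. Words of zeros shrink because 2 phi_0^2 = 2,
  where characteristic 0 permits division by 2.\<close>

lemma vacuum_functional_unique:
  fixes f :: "int list \<Rightarrow> 'a::field_char_0"
  assumes cl: "\<And>u v m n. f (u @ m # n # v) + f (u @ n # m # v) = acomm m n * f (u @ v)"
    and lv: "\<And>n w. n > 0 \<Longrightarrow> f (n # w) = 0"
    and rv: "\<And>n w. n > 0 \<Longrightarrow> f (w @ [- n]) = 0"
    and 0: "f [] = 0" "f [0] = 0"
  shows "f w = 0"
proof (induction "length w" arbitrary: w rule: less_induct)
  case less
  show ?case
  proof (cases "\<exists>n\<in>set w. n \<noteq> 0")
    case True
    then obtain u n v where w: "w = u @ n # v" and n: "n \<noteq> 0" by (metis split_list)
    show ?thesis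
    proof (cases "n > 0")
      case True
      show ?thesis unfolding w
        by (rule clifford_move_left[OF cl]) (use less w lv[OF True] in auto)
    next
      case False
      show ?thesis unfolding w
        by (rule clifford_move_right[OF cl])
          (use less w rv[of "-n" "u @ v"] n False in auto)
    qed
  next
    case False
    then consider "w = []" | "w = [0]" | v where "w = 0 # 0 # v"
      by (metis list.set_intros(1) list.set_intros(2) remdups_adj.cases)
    thus ?thesis
    proof cases
      case 3
      have "f v = 0" using 3 by (intro less) auto
      moreover have "2 * f w = acomm 0 0 * f v" using cl[of "[]" 0 0 v] 3 by simp
      ultimately show ?thesis by simp
    qed (use 0 in auto)
  qed
qed

lemma is_vacuum_pairing_vac: "is_vacuum_pairing (\<lambda>u v. vac (u @ v))"
proof -
  have *: "(if m + n = 0 then 2 * (-1) powi m * x else 0) = acomm m n * (x :: qb)" for m n x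
    by (simp add: acomm_def sg_eq_powi)
  have 1: "vac (u @ [m, n] @ w) + vac (u @ [n, m] @ w) = acomm m n * (vac (u @ w) :: qb)" for u m n w
    using vac_clifford[of u m n w] by simp
  show ?thesis
    unfolding is_vacuum_pairing_def *
  proof (intro conjI allI impI)
    fix u v :: "int list" and n :: int assume "n > 0"
    show "vac ((n # u) @ v) = (0 :: qb)" using \<open>n > 0\<close> by (simp add: vac_left)
    show "vac (u @ (v @ [- n])) = (0 :: qb)" using vac_right[OF \<open>n > 0\<close>, of "u @ v"] by simp
  next
    fix u v w :: "int list" and m n :: int
    show "vac ((u @ [m, n] @ w) @ v) + vac ((u @ [n, m] @ w) @ v) = acomm m n * (vac ((u @ w) @ v) :: qb)"
      using 1[of u m n "w @ v"] by simp
    show "vac (u @ (v @ [m, n] @ w)) + vac (u @ (v @ [n, m] @ w)) = acomm m n * (vac (u @ (v @ w)) :: qb)"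
      using 1[of "u @ v" m n w] by simp
  qed (auto simp: pf_Cons)
qed

lemma vacuum_pairing_eq: "vacuum_pairing u v = vac (u @ v)"
proof -
  have "P = (\<lambda>u v. vac (u @ v))" if P: "is_vacuum_pairing P" for P
  proof -
    have *: "(if m + n = 0 then 2 * (-1) powi m * x else 0) = acomm m n * (x :: qb)" for m n x
      by (simp add: acomm_def sg_eq_powi)
    note P' = P[unfolded is_vacuum_pairing_def *]
    have app: "P u v = P [] (u @ v)" for u v
    proof (induction u arbitrary: v rule: rev_induct)
      case (snoc n u)
      have "P (u @ [n]) v = P u (n # v)" using P' by blast
      thus ?case by (simp add: snoc)
    qed simp
    have "P [] w - vac w = 0" for w
    proof (rule vacuum_functional_unique[of "\<lambda>w. P [] w - vac w"])
      fix u v :: "int list" and m n :: int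
      have "P [] (u @ [m, n] @ v) + P [] (u @ [n, m] @ v) = acomm m n * P [] (u @ v)" using P' by blast
      moreover have "vac (u @ m # n # v) + vac (u @ n # m # v) = acomm m n * (vac (u @ v) :: qb)"
        by (rule vac_clifford)
      ultimately show "P [] (u @ m # n # v) - vac (u @ m # n # v) + (P [] (u @ n # m # v) - vac (u @ n # m # v)) =
          acomm m n * (P [] (u @ v) - vac (u @ v))"
        by (simp add: algebra_simps)
    next
      fix n :: int and w :: "int list" assume n: "n > 0"
      have "P (n # []) w = 0" using P' n by blast
      thus "P [] (n # w) - vac (n # w) = 0" using app[of "[n]" w] vac_left[OF n, of w] by simp
      have "P [] (w @ [- n]) = 0" using P' n by blast
      thus "P [] (w @ [- n]) - vac (w @ [- n]) = 0" using vac_right[OF n, of w] by simp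
    next
      have "P [] [] = 1" "P [] [0] = 0" using P' by blast+
      thus "P [] [] - vac [] = 0" "P [] [0] - vac [0] = 0" by (simp_all add: pf_Cons)
    qed
    hence "P u v = vac (u @ v)" for u v by (subst app) simp
    thus ?thesis by (intro ext)
  qed
  hence "vacuum_pairing = (\<lambda>u v. vac (u @ v))"
    unfolding vacuum_pairing_def by (rule the_equality[where P = is_vacuum_pairing, OF is_vacuum_pairing_vac])
  from fun_cong[OF fun_cong[OF this]] show ?thesis .
qed


section \<open>The right action of series of words on functionals\<close>

definition act :: "(int list \<Rightarrow> 'a::comm_ring_1) \<Rightarrow> 'a wser \<Rightarrow> int list \<Rightarrow> 'a" where
  "act G A w = Sum_any (\<lambda>a. word_coeff A a * G (a @ w))"

lemma act_superset:
  assumes "finite S" "\<And>a. word_coeff A a \<noteq> 0 \<Longrightarrow> G (a @ w) \<noteq> 0 \<Longrightarrow> a \<in> S"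
  shows "act G A w = (\<Sum>a\<in>S. word_coeff A a * G (a @ w))"
  unfolding act_def
proof (rule Sum_any.expand_superset[OF assms(1)])
  show "{a. word_coeff A a * G (a @ w) \<noteq> 0} \<subseteq> S"
    using assms(2) by (metis (mono_tags, lifting) mem_Collect_eq mult_not_zero subsetI)
qed

lemma word_coeff_mult:
  "word_coeff (A * B) c = (\<Sum>(a, b)\<in>conv_set (@) (word_coeff A) (word_coeff B) c. word_coeff A a * word_coeff B b)"
  by (simp add: times_wser.rep_eq conv_def conv_set_def)

text \<open>An exchange of two infinite sums, legitimate because only finitely many pairs of words
  contribute. For the operators at hand this finiteness comes from
  \<open>finite_blocks\<close>.\<close>

lemma act_mult:
  assumes fin: "finite {(a, b). word_coeff A a \<noteq> 0 \<and> word_coeff B b \<noteq> 0 \<and> G (a @ b @ w) \<noteq> 0}"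
  shows "act G (A * B) w = act (act G A) B w"
proof -
  define P where "P = {(a, b). word_coeff A a \<noteq> 0 \<and> word_coeff B b \<noteq> 0 \<and> G (a @ b @ w) \<noteq> 0}"
  have fP: "finite P" unfolding P_def by (rule fin)
  define C where "C = (\<lambda>(a, b). a @ b) ` P"
  let ?t = "\<lambda>(a, b). word_coeff A a * word_coeff B b * G (a @ b @ w)"
  have C: "c \<in> C \<longleftrightarrow> (\<exists>a b. c = a @ b \<and> (a, b) \<in> P)" for c
    by (auto simp: C_def)
  have "act G (A * B) w = (\<Sum>c\<in>C. word_coeff (A * B) c * G (c @ w))"
  proof (rule act_superset)
    show "finite C" using fP by (simp add: C_def)
    fix c assume *: "word_coeff (A * B) c \<noteq> 0" "G (c @ w) \<noteq> 0"
    from *(1) obtain a b where "a @ b = c" "word_coeff A a \<noteq> 0" "word_coeff B b \<noteq> 0"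
      unfolding times_wser.rep_eq using conv_nonzeroD by metis
    thus "c \<in> C" unfolding C using *(2) by (intro exI[of _ a] exI[of _ b]) (auto simp: P_def)
  qed
  also have "\<dots> = (\<Sum>c\<in>C. \<Sum>p | p \<in> P \<and> (\<lambda>(a, b). a @ b) p = c. ?t p)"
  proof (intro sum.cong refl)
    fix c assume "c \<in> C"
    then obtain a b where ab: "c = a @ b" "(a, b) \<in> P" unfolding C by blast
    hence "G (c @ w) \<noteq> 0" by (simp add: P_def)
    hence "{p. p \<in> P \<and> (\<lambda>(a, b). a @ b) p = c} = conv_set (@) (word_coeff A) (word_coeff B) c"
      by (auto simp: P_def conv_set_def)
    moreover have "(\<Sum>(a, b)\<in>conv_set (@) (word_coeff A) (word_coeff B) c. word_coeff A a * word_coeff B b) * G (c @ w)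
        = (\<Sum>p\<in>conv_set (@) (word_coeff A) (word_coeff B) c. ?t p)"
      unfolding sum_distrib_right by (intro sum.cong) (auto simp: conv_set_def)
    ultimately show "word_coeff (A * B) c * G (c @ w) = (\<Sum>p | p \<in> P \<and> (\<lambda>(a, b). a @ b) p = c. ?t p)"
      by (simp add: word_coeff_mult)
  qed
  also have "\<dots> = (\<Sum>p\<in>P. ?t p)"
    unfolding C_def by (rule sum.image_gen[symmetric, OF fP])
  also have "\<dots> = (\<Sum>p\<in>fst ` P \<times> snd ` P. ?t p)"
    using fP by (intro sum.mono_neutral_left) (force simp: P_def)+
  also have "\<dots> = (\<Sum>a\<in>fst ` P. \<Sum>b\<in>snd ` P. ?t (a, b))"
    by (rule sum.cartesian_product')
  also have "\<dots> = (\<Sum>b\<in>snd ` P. word_coeff B b * (\<Sum>a\<in>fst ` P. word_coeff A a * G (a @ b @ w)))"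
    by (subst sum.swap) (simp add: sum_distrib_left mult_ac)
  also have "\<dots> = (\<Sum>b\<in>snd ` P. word_coeff B b * act G A (b @ w))"
  proof (intro sum.cong refl arg_cong2[where f = times])
    fix b assume "b \<in> snd ` P"
    hence "word_coeff B b \<noteq> 0" by (auto simp: P_def)
    thus "(\<Sum>a\<in>fst ` P. word_coeff A a * G (a @ b @ w)) = act G A (b @ w)"
      using fP by (intro act_superset[symmetric]) (force simp: P_def)+
  qed
  also have "\<dots> = act (act G A) B w"
  proof (rule act_superset[symmetric])
    show "finite (snd ` P)" using fP by simp
    fix b assume *: "word_coeff B b \<noteq> 0" "act G A (b @ w) \<noteq> 0"
    from *(2) obtain a where "word_coeff A a * G (a @ b @ w) \<noteq> 0"
      unfolding act_def by (rule Sum_any.not_neutral_obtains_not_neutral)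
    hence "word_coeff A a \<noteq> 0" "G (a @ b @ w) \<noteq> 0" by auto
    with *(1) have "(a, b) \<in> P" by (simp add: P_def)
    thus "b \<in> snd ` P" by force
  qed
  finally show ?thesis .
qed

text \<open>\<open>d\<close> and \<open>e\<close> are the total amounts by which the energy is lowered and raised.\<close>

inductive blocks :: "nat \<Rightarrow> nat \<Rightarrow> nat \<Rightarrow> int list \<Rightarrow> bool" where
  Nil: "blocks 0 0 0 []"
| lower: "blocks l d e a \<Longrightarrow> k > 0 \<Longrightarrow> blocks l (d + k) e (a @ [- int k - i, i])"
| raise: "blocks l d e a \<Longrightarrow> k > 0 \<Longrightarrow> blocks l d (e + k) (a @ [int k - i, i])"
| letter: "blocks l d e a \<Longrightarrow> blocks (Suc l) d (e + k) (a @ [int k])"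

lemma blocks_append: "blocks l' d' e' b \<Longrightarrow> blocks l d e a \<Longrightarrow> blocks (l + l') (d + d') (e + e') (a @ b)"
  by (induction rule: blocks.induct) (auto simp flip: append_assoc add.assoc intro: blocks.intros)

lemma blocks_sum: "blocks l d e a \<Longrightarrow> sum_list a = int e - int d"
  by (induction rule: blocks.induct) auto

lemma blocks_length: "blocks l d e a \<Longrightarrow> length a \<le> l + 2 * (d + e)"
  by (induction rule: blocks.induct) auto

text \<open>The last hypothesis is what \<open>bra_positive_letter\<close> provides. A letter of a
  new block that exceeds \<open>D\<close> has its negative among the earlier letters, its partner
  being excluded by \<open>k > 0\<close>, and is bounded by induction; the two letters of a block
  determine each other up to its energy.\<close>

lemma blocks_letters:
  assumes "blocks l d e a" "D \<ge> 0" "\<And>u p v. a = u @ p # v \<Longrightarrow> p > D \<Longrightarrow> - p \<in> set u"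
  shows "\<forall>x\<in>set a. \<bar>x\<bar> \<le> D + int d + int e"
  using assms(1,3)
proof (induction rule: blocks.induct)
  case (lower l d e a k i)
  have IH: "\<forall>x\<in>set a. \<bar>x\<bar> \<le> D + int d + int e"
    by (rule lower.IH) (use lower.prems[of _ _ "_ @ [- int k - i, i]"] in auto)
  have "- i \<in> set a" if "i > D" using lower.prems[of "a @ [- int k - i]" i "[]"] that lower.hyps by auto
  moreover have "i + int k \<in> set a" if "- int k - i > D"
    using lower.prems[of a "- int k - i" "[i]"] that by auto
  ultimately show ?case using IH assms(2) lower.hyps by fastforce
next
  case (raise l d e a k i)
  have IH: "\<forall>x\<in>set a. \<bar>x\<bar> \<le> D + int d + int e"
    by (rule raise.IH) (use raise.prems[of _ _ "_ @ [int k - i, i]"] in auto)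
  have "- i \<in> set a" if "i > D" using raise.prems[of "a @ [int k - i]" i "[]"] that raise.hyps by auto
  moreover have "i - int k \<in> set a" if "int k - i > D"
    using raise.prems[of a "int k - i" "[i]"] that by auto
  ultimately show ?case using IH assms(2) raise.hyps by fastforce
next
  case (letter l d e a k)
  have IH: "\<forall>x\<in>set a. \<bar>x\<bar> \<le> D + int d + int e"
    by (rule letter.IH) (use letter.prems[of _ _ "_ @ [int k]"] in auto)
  thus ?case using assms(2) by fastforce
qed simp

text \<open>Every pair carries energy at least 1, so bounds on the energies bound the length;
  \<open>bra_positive_letter\<close> bounds the letters.\<close>

lemma finite_blocks:
  assumes "bra G" "\<And>w. sum_list w > D \<Longrightarrow> G w = 0"
  shows "finite {a. G (a @ w) \<noteq> 0 \<and> (\<exists>l\<le>L. \<exists>d\<le>X. \<exists>e\<le>Y. blocks l d e a)}"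
proof (rule finite_subset[OF _ finite_lists_length_le])
  define B where "B = \<bar>D\<bar> + int X + int Y"
  show "{a. G (a @ w) \<noteq> 0 \<and> (\<exists>l\<le>L. \<exists>d\<le>X. \<exists>e\<le>Y. blocks l d e a)}
      \<subseteq> {a. set a \<subseteq> {-B..B} \<and> length a \<le> L + 2 * (X + Y)}"
  proof clarify
    fix a l d e assume *: "G (a @ w) \<noteq> 0" "l \<le> L" "d \<le> X" "e \<le> Y" "blocks l d e a"
    have "\<forall>x\<in>set a. \<bar>x\<bar> \<le> \<bar>D\<bar> + int d + int e"
      using bra_positive_letter[OF assms(1), of D] assms(2) *(1) 
      by (intro blocks_letters[OF *(5)]) auto
    hence "set a \<subseteq> {-B..B}" using * by (force simp: B_def)
    moreover have "l + 2 * (d + e) \<le> L + 2 * (X + Y)"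
      using *(2-4) by (intro add_mono mult_le_mono2)
    hence "length a \<le> L + 2 * (X + Y)" using blocks_length[OF *(5)] by linarith
    ultimately show "set a \<subseteq> {-B..B} \<and> length a \<le> L + 2 * (X + Y)" by blast
  qed
  show "finite {-B..B}" by simp
qed


section \<open>Current operators\<close>

text \<open>The right action of 4 b_{-k}; the factor 4 avoids a division in the arbitrary
  coefficient ring.\<close>

definition bop :: "int \<Rightarrow> (int list \<Rightarrow> 'a::comm_ring_1) \<Rightarrow> int list \<Rightarrow> 'a" where
  "bop k G w = Sum_any (\<lambda>i. sg i * G ([k - i, i] @ w))"

text \<open>Below the interval phi_i leaves negative energy on the right. Above it phi_{k-i} does so
  after an exchange of the two letters, which anticommute because
  \<open>k \<noteq> 0\<close>.\<close>

lemma bop_support: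
  assumes "bra G" "k \<noteq> 0" "G ([k - i, i] @ w) \<noteq> 0"
  shows "i \<in> {- sum_list w..k + sum_list w}"
proof -
  have "\<not> i < - sum_list w"
    using bra_negative[OF assms(1), of "i # w" "[k - i]"] assms(3) by auto
  moreover have "\<not> i > k + sum_list w"
    using bra_swap_vanish(2)[OF assms(1), of w "i - k" i] assms(2,3) by auto
  ultimately show ?thesis by simp
qed

lemma bop_superset:
  assumes "bra G" "k \<noteq> 0" "finite S" "{- sum_list w..k + sum_list w} \<subseteq> S"
  shows "bop k G w = (\<Sum>i\<in>S. sg i * G ([k - i, i] @ w))"
  unfolding bop_def using assms(3)
proof (rule Sum_any.expand_superset)
  show "{i. sg i * G ([k - i, i] @ w) \<noteq> 0} \<subseteq> S"
    using bop_support[OF assms(1,2)] assms(4) by (metis (mono_tags, lifting) mem_Collect_eq mult_zero_right subset_eq)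
qed

lemma bop_interval:
  assumes "bra G" "k \<noteq> 0" "M \<ge> \<bar>sum_list w\<bar> + \<bar>k\<bar>"
  shows "bop k G w = (\<Sum>i\<in>{-M..M}. sg i * G ([k - i, i] @ w))"
  using assms by (intro bop_superset) auto

lemma braI:
  assumes "\<And>u m n v. G (u @ m # n # v) + G (u @ n # m # v) = acomm m n * G (u @ v)"
    and "\<And>u n. n > 0 \<Longrightarrow> G (u @ [- n]) = 0"
  shows "bra G"
  using assms by (auto simp: bra_def clifford_def right_vac_def)

lemma braD:
  assumes "bra G"
  shows "G (u @ m # n # v) + G (u @ n # m # v) = acomm m n * G (u @ v)"
    and "n > 0 \<Longrightarrow> G (u @ [- n]) = 0"
  using assms by (auto simp: bra_def clifford_def right_vac_def)

lemma bra_zero [simp]: "bra (\<lambda>_. 0)"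
  by (rule braI) auto

lemma bra_add: "bra G \<Longrightarrow> bra H \<Longrightarrow> bra (\<lambda>w. G w + H w)"
  by (rule braI) (auto simp: braD algebra_simps simp flip: braD(1))

lemma bra_scale: "bra G \<Longrightarrow> bra (\<lambda>w. c * G w)"
  by (rule braI) (auto simp: braD algebra_simps simp flip: braD(1))

lemma bra_sum: "(\<And>i. i \<in> I \<Longrightarrow> bra (G i)) \<Longrightarrow> bra (\<lambda>w. \<Sum>i\<in>I. G i w)"
  by (induction I rule: infinite_finite_induct) (auto intro: bra_add)

text \<open>Both Clifford relation and vacuum condition involve finitely many words only.\<close>

lemma bra_local:
  assumes "\<And>W. finite W \<Longrightarrow> \<exists>H. bra H \<and> (\<forall>w\<in>W. G w = H w)"
  shows "bra G"
proof (rule braI)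
  fix u m n v
  obtain H where "bra H" "\<forall>w\<in>{u @ m # n # v, u @ n # m # v, u @ v}. G w = H w"
    using assms[of "{u @ m # n # v, u @ n # m # v, u @ v}"] by auto
  thus "G (u @ m # n # v) + G (u @ n # m # v) = acomm m n * G (u @ v)"
    using braD(1)[of H u m n v] by simp
next
  fix u :: "int list" and n :: int assume n: "n > 0"
  obtain H where "bra H" "\<forall>w\<in>{u @ [- n]}. G w = H w"
    using assms[of "{u @ [- n]}"] by auto
  thus "G (u @ [- n]) = 0" using braD(2)[of H n u] n by simp
qed

lemma bra_bop: 
  assumes "bra G" "k \<noteq> 0"
  shows "bra (bop k G)"
proof (rule bra_local)
  fix W :: "int list set" assume W: "finite W"
  define M where "M = (\<Sum>w\<in>W. \<bar>sum_list w\<bar>) + \<bar>k\<bar>"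
  have M: "M \<ge> \<bar>sum_list w\<bar> + \<bar>k\<bar>" if "w \<in> W" for w
    using member_le_sum[of w W "\<lambda>w. \<bar>sum_list w\<bar>"] that W by (simp add: M_def)
  have "bra (\<lambda>w. \<Sum>i\<in>{-M..M}. sg i * G ([k - i, i] @ w))"
    by (intro bra_sum bra_scale bra_prefix assms)
  moreover have "\<forall>w\<in>W. bop k G w = (\<Sum>i\<in>{-M..M}. sg i * G ([k - i, i] @ w))"
    using M by (intro ballI bop_interval assms)
  ultimately show "\<exists>H. bra H \<and> (\<forall>w\<in>W. bop k G w = H w)" by blast
qed

lemma bop_sum:
  assumes "\<And>j. j \<in> J \<Longrightarrow> bra (G j)" "k \<noteq> 0"
  shows "bop k (\<lambda>w. \<Sum>j\<in>J. c j * G j w) w = (\<Sum>j\<in>J. c j * bop k (G j) w)"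
proof -
  let ?M = "\<bar>sum_list w\<bar> + \<bar>k\<bar>"
  have "bop k (\<lambda>w. \<Sum>j\<in>J. c j * G j w) w = (\<Sum>i\<in>{-?M..?M}. \<Sum>j\<in>J. sg i * (c j * G j ([k - i, i] @ w)))"
    using assms by (subst bop_interval[where M = ?M]) (auto intro!: bra_sum bra_scale simp: sum_distrib_left)
  also have "\<dots> = (\<Sum>j\<in>J. c j * bop k (G j) w)"
    by (subst sum.swap, intro sum.cong refl, subst bop_interval[where M = ?M])
      (use assms in \<open>auto simp: sum_distrib_left mult_ac\<close>)
  finally show ?thesis .
qed

text \<open>Moving phi_a through the pair meets two contractions, at i = -a and at i = k + a. For
  odd k both contribute with the same sign and weight 2, so the commutator of 4 b_{-k} with phi_a is
  4 phi_{a+k}.\<close>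

lemma bop_Cons:
  assumes "bra G" "odd k"
  shows "bop k G (a # w) = bop k (\<lambda>v. G (a # v)) w + 4 * G ((a + k) # w)"
proof -
  have k: "k \<noteq> 0" using assms(2) by auto
  define M where "M = \<bar>sum_list w\<bar> + \<bar>k\<bar> + \<bar>a\<bar>"
  have t: "sg i * G ([k - i, i] @ a # w) = sg i * G (a # [k - i, i] @ w)
      + (if i = - a then 2 * G ((k + a) # w) else 0) + (if i = k + a then 2 * G ((k + a) # w) else 0)" for i
  proof -
    have "G ([k - i, i] @ a # w) = G (a # [k - i, i] @ w)
        + acomm i a * G ((k - i) # w) - acomm (k - i) a * G (i # w)"
      using bra_swap[OF assms(1), of "[k - i]" i a w] bra_swap2[OF assms(1), of "k - i" a "i # w"] by simp
    moreover have "acomm i a = (if i = - a then 2 * sg i else (0 :: 'a))"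
      by (auto simp: acomm_def)
    moreover have "sg (k - i) = - (sg i :: 'a)" using assms(2) by (auto simp: sg_def)
    hence "acomm (k - i) a = (if i = k + a then - 2 * sg i else (0 :: 'a))"
      by (auto simp: acomm_def)
    moreover have "sg i * (2 * sg i * x) = 2 * x" for x :: 'a
      by (metis mult.left_commute sg_square(2) mult.assoc)
    moreover have "k + 2 * a \<noteq> 0" using assms(2) by presburger
    ultimately show ?thesis by (auto simp: distrib_left right_diff_distrib)
  qed
  have "bop k G (a # w) = (\<Sum>i\<in>{-M..M}. sg i * G ([k - i, i] @ a # w))"
    by (rule bop_interval) (use assms k in \<open>auto simp: M_def\<close>)
  also have "\<dots> = (\<Sum>i\<in>{-M..M}. sg i * G (a # [k - i, i] @ w)
      + (if i = - a then 2 * G ((k + a) # w) else 0) + (if i = k + a then 2 * G ((k + a) # w) else 0))"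
    unfolding t ..
  also have "\<dots> = (\<Sum>i\<in>{-M..M}. sg i * G (a # [k - i, i] @ w)) + 4 * G ((a + k) # w)"
  proof -
    have "- a \<in> {-M..M}" "k + a \<in> {-M..M}" by (auto simp: M_def)
    thus ?thesis by (simp add: sum.distrib add.commute)
  qed
  also have "(\<Sum>i\<in>{-M..M}. sg i * G (a # [k - i, i] @ w)) = bop k (\<lambda>v. G (a # v)) w"
    using bra_Cons[OF assms(1), of a] k
    by (subst bop_interval[where M = M]) (auto simp: M_def)
  finally show ?thesis .
qed

lemma sum_diff_shift_one:
  fixes X :: "int \<Rightarrow> 'a::ab_group_add"
  assumes "a \<le> b + 1"
  shows "(\<Sum>j\<in>{a..b}. X j - X (j - 1)) = X b - X (a - 1)"
proof -
  have "(\<Sum>j\<in>{a..<a + int n}. X j - X (j - 1)) = X (a + int n - 1) - X (a - 1)" for n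
  proof (induction n)
    case (Suc n)
    have "{a..<a + int (Suc n)} = insert (a + int n) {a..<a + int n}" by auto
    thus ?case using Suc by (simp add: add.commute)
  qed simp
  moreover have "{a..<a + int (nat (b + 1 - a))} = {a..b}" "a + int (nat (b + 1 - a)) - 1 = b"
    using assms by auto
  ultimately show ?thesis by metis
qed

lemma sum_diff_shift:
  fixes X :: "int \<Rightarrow> 'a::ab_group_add"
  assumes "a \<le> b + 1"
  shows "(\<Sum>j\<in>{a..b}. X j - X (j - int m)) = (\<Sum>i<m. X (b - int i) - X (a - 1 - int i))"
proof (induction m)
  case (Suc m)
  have "(\<Sum>j\<in>{a..b}. X j - X (j - int (Suc m))) =
      (\<Sum>j\<in>{a..b}. X j - X (j - int m)) + (\<Sum>j\<in>{a..b}. X (j - int m) - X (j - 1 - int m))"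
    by (simp add: sum.distrib[symmetric] algebra_simps)
  also have "(\<Sum>j\<in>{a..b}. X (j - int m) - X (j - 1 - int m)) = X (b - int m) - X (a - 1 - int m)"
    using sum_diff_shift_one[OF assms, of "\<lambda>j. X (j - int m)"] by simp
  finally show ?case by (simp add: Suc)
qed simp

text \<open>
  The commutator comes from a telescoping sum: the two ends of the support contribute differently
  because \<open>\<phi>\<^sub>-\<^sub>j \<phi>\<^sub>j\<close> tends to \<open>2 (-1)\<^sup>j\<close> for large \<open>j\<close> and to \<open>0\<close> for very negative \<open>j\<close>.
\<close>

lemma heisenberg:
  assumes "bra G" "odd m" "odd n"
  shows "bop (int n) (bop (- int m) G) w =
    bop (- int m) (bop (int n) G) w + (if m = n then 8 * of_nat m * G w else 0)"
proof -
  have nz: "int n \<noteq> 0" "- int m \<noteq> 0" and odd: "odd (- int m)" using assms by (auto simp: odd_pos)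
  \<comment> \<open>Contains the supports of the inner and outer sums, and leaves enough room that
    both ends of the telescoping sum, shifted by up to m places, are decided by negative
    energy.\<close>
  define M where "M = 2 * (\<bar>sum_list w\<bar> + int m + int n + 1)"
  define X where "X = (\<lambda>j. sg j * G ((int n - int m - j) # j # w))"
  have step: "bop (- int m) G ([int n - j, j] @ w) =
      bop (- int m) (\<lambda>v. G ([int n - j, j] @ v)) w + 4 * G ((int n - j) # (j - int m) # w)
      + 4 * G ((int n - int m - j) # j # w)" for j
    using bop_Cons[OF assms(1) odd, of "int n - j" "j # w"]
      bop_Cons[OF bra_Cons[OF assms(1), of "int n - j"] odd, of j w] by (simp add: algebra_simps)
  have "bop (int n) (bop (- int m) G) w =
      (\<Sum>j\<in>{-M..M}. sg j * bop (- int m) G ([int n - j, j] @ w))"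
    by (rule bop_interval) (use assms nz in \<open>auto simp: M_def intro: bra_bop\<close>)
  also have "\<dots> = (\<Sum>j\<in>{-M..M}. sg j * bop (- int m) (\<lambda>v. G ([int n - j, j] @ v)) w)
      + 4 * (\<Sum>j\<in>{-M..M}. X j - X (j - int m))"
    unfolding step using odd
    by (simp add: sum_distrib_left sum.distrib[symmetric] X_def sg_diff algebra_simps)
      (auto simp: sg_def intro!: sum.cong)
  also have "(\<Sum>j\<in>{-M..M}. sg j * bop (- int m) (\<lambda>v. G ([int n - j, j] @ v)) w) =
      (\<Sum>i\<in>{-M..M}. sg i * bop (int n) G ([- int m - i, i] @ w))"
  proof -
    have "(\<Sum>j\<in>{-M..M}. sg j * bop (- int m) (\<lambda>v. G ([int n - j, j] @ v)) w) =
        (\<Sum>j\<in>{-M..M}. \<Sum>i\<in>{-M..M}. sg j * (sg i * G ([int n - j, j] @ [- int m - i, i] @ w)))"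
      by (intro sum.cong refl, subst bop_interval[where M = M])
        (use nz in \<open>auto simp: M_def sum_distrib_left intro!: bra_Cons assms\<close>)
    also have "\<dots> = (\<Sum>i\<in>{-M..M}. \<Sum>j\<in>{-M..M}. sg i * (sg j * G ([int n - j, j] @ [- int m - i, i] @ w)))"
      by (subst sum.swap) (simp add: mult_ac)
    also have "\<dots> = (\<Sum>i\<in>{-M..M}. sg i * bop (int n) G ([- int m - i, i] @ w))"
      by (intro sum.cong refl, subst bop_interval[where M = M])
        (use nz assms(1) in \<open>auto simp: M_def sum_distrib_left\<close>)
    finally show ?thesis .
  qed
  also have "\<dots> = bop (- int m) (bop (int n) G) w"
    by (rule bop_interval[symmetric]) (use assms nz in \<open>auto simp: M_def intro: bra_bop\<close>)
  also have "(\<Sum>j\<in>{-M..M}. X j - X (j - int m)) = (\<Sum>i<m. X (M - int i) - X (- M - 1 - int i))"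
    by (rule sum_diff_shift) (simp add: M_def)
  also have "\<dots> = (\<Sum>i<m. if m = n then 2 * G w else 0)"
  proof (intro sum.cong refl)
    fix i assume i: "i \<in> {..<m}"
    have "G ([int n - int m - (- M - 1 - int i)] @ (- M - 1 - int i) # w) = 0"
      by (rule bra_negative[OF assms(1)]) (use i in \<open>auto simp: M_def\<close>)
    hence low: "X (- M - 1 - int i) = 0" by (simp add: X_def)
    let ?j = "M - int i"
    have "X ?j = (if m = n then 2 * G w else 0)"
    proof (cases "m = n")
      case True
      have "G ([?j] @ (- ?j) # w) = 0"
        by (rule bra_negative[OF assms(1)]) (use i in \<open>auto simp: M_def\<close>)
      moreover have "sg ?j * (2 * sg ?j * x) = 2 * x" for x :: 'a
        by (metis mult.left_commute sg_square(2) mult.assoc)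
      moreover have "sg (- ?j) = (sg ?j :: 'a)" by (rule sg_minus)
      ultimately show ?thesis using bra_swap2[OF assms(1), of "- ?j" ?j w] True
        by (simp add: X_def acomm_def)
    next
      case False
      have "G ([- (?j + int m - int n), ?j] @ w) = 0"
        by (rule bra_swap_vanish(2)[OF assms(1)]) (use False i in \<open>auto simp: M_def\<close>)
      thus ?thesis using False by (simp add: X_def algebra_simps)
    qed
    with low show "X ?j - X (- M - 1 - int i) = (if m = n then 2 * G w else 0)" by simp
  qed
  finally show ?thesis by (simp add: mult_ac)
qed

text \<open>As n > 0, one of the letters n - i and i is positive; the two anticommute, so it can be
  put next to <0|.\<close>

lemma bop_vac:
  assumes "odd n"
  shows "bop (int n) (vac :: _ \<Rightarrow> 'a::comm_ring_1) w = 0"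
proof -
  have "(vac ([int n - i, i] @ w) :: 'a) = 0" for i
  proof (cases "int n - i > 0")
    case False
    have n: "n > 0" using assms by (rule odd_pos)
    have "(vac ((int n - i) # i # w) :: 'a) = acomm (int n - i) i * vac w - vac (i # (int n - i) # w)"
      by (rule bra_swap2[OF bra_vac])
    also have "acomm (int n - i) i = (0 :: 'a)" using n by (auto simp: acomm_def)
    also have "(vac (i # (int n - i) # w) :: 'a) = 0" using False n by (intro vac_left) auto
    finally show ?thesis by simp
  qed (simp add: vac_left)
  thus ?thesis by (simp add: bop_def)
qed


section \<open>Exponentials of quadratic operators\<close>

text \<open>Since \<open>h\<close> vanishes beyond N, the square of index pairs may be cut to the
  triangle n + k <= N and summed along diagonals.\<close>

lemma sum_fps_mult:
  fixes f g :: "'a::comm_ring_1 fps"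
  assumes "\<And>M. M > N \<Longrightarrow> h M = 0"
  shows "(\<Sum>n\<le>N. \<Sum>k\<le>N. f $ n * g $ k * h (n + k)) = (\<Sum>M\<le>N. (f * g) $ M * h M)"
proof -
  have "(\<Sum>n\<le>N. \<Sum>k\<le>N. f $ n * g $ k * h (n + k)) = (\<Sum>(n, k)\<in>{..N} \<times> {..N}. f $ n * g $ k * h (n + k))"
    by (simp add: sum.cartesian_product)
  also have "\<dots> = (\<Sum>(n, k)\<in>{(n, k). n + k \<le> N}. f $ n * g $ k * h (n + k))"
    by (intro sum.mono_neutral_right) (auto, metis assms mult_zero_right not_le)
  also have "\<dots> = (\<Sum>M\<le>N. \<Sum>n\<le>M. f $ n * g $ (M - n) * h M)"
    by (subst sum.triangle_reindex_eq) (auto intro!: sum.cong)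
  also have "\<dots> = (\<Sum>M\<le>N. (f * g) $ M * h M)"
    by (simp add: fps_mult_nth sum_distrib_right atLeast0AtMost)
  finally show ?thesis .
qed

lemma sum_pascal:
  fixes t :: "nat \<Rightarrow> 'a::comm_ring_1"
  shows "(\<Sum>j\<le>Suc N. of_nat (Suc N choose j) * t j) = (\<Sum>j\<le>N. of_nat (N choose j) * (t j + t (Suc j)))"
proof -
  have "(\<Sum>j\<le>Suc N. of_nat (Suc N choose j) * t j) =
      t 0 + (\<Sum>j\<le>N. of_nat (N choose Suc j) * t (Suc j)) + (\<Sum>j\<le>N. of_nat (N choose j) * t (Suc j))"
    by (simp add: sum.atMost_Suc_shift sum.distrib[symmetric] algebra_simps del: sum.atMost_Suc)
  also have "t 0 + (\<Sum>j\<le>N. of_nat (N choose Suc j) * t (Suc j)) = (\<Sum>j\<le>Suc N. of_nat (N choose j) * t j)"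
    by (simp add: sum.atMost_Suc_shift del: sum.atMost_Suc)
  also have "\<dots> = (\<Sum>j\<le>N. of_nat (N choose j) * t j)"
    by (simp add: binomial_eq_0)
  finally show ?thesis by (simp add: sum.distrib[symmetric] distrib_left)
qed

text \<open>
  \<open>eps = 1\<close> for \<open>\<Theta>\<close> and \<open>eps = -1\<close> for the Hamiltonian; \<open>iv k\<close> is \<open>1 / k!\<close>.
\<close>

locale quadratic =
  fixes eps :: int and s :: "'a::comm_ring_1 fps" and iv :: "nat \<Rightarrow> 'a"
  assumes eps: "eps = 1 \<or> eps = -1"
    and s_even: "even n \<Longrightarrow> s $ n = 0"
    and iv_binomial: "j \<le> n \<Longrightarrow> iv n * of_nat (n choose j) = iv j * iv (n - j)"
begin

lemma eps_square [simp]: "eps * eps = 1" "eps * (eps * x) = x"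
  using eps by auto

lemma s_0 [simp]: "s $ 0 = 0" by (simp add: s_even)

text \<open>The bound makes \<open>qop\<close> and its exponential finite sums on each word, as the
  blocks they prefix have positive energy in the direction \<open>eps\<close>.\<close>

definition bb :: "int \<Rightarrow> (int list \<Rightarrow> 'a) \<Rightarrow> bool" where
  "bb D G \<longleftrightarrow> bra G \<and> (\<forall>w. eps * sum_list w > D \<longrightarrow> G w = 0)"

lemma bbD: "bb D G \<Longrightarrow> bra G" "bb D G \<Longrightarrow> eps * sum_list w > D \<Longrightarrow> G w = 0"
  by (auto simp: bb_def)

lemma bb_mono: "bb D G \<Longrightarrow> D \<le> D' \<Longrightarrow> bb D' G"
  by (auto simp: bb_def)

lemma bb_sum: "(\<And>j. j \<in> J \<Longrightarrow> bb D (G j)) \<Longrightarrow> bb D (\<lambda>w. \<Sum>j\<in>J. c j * G j w)"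
  by (auto simp: bb_def intro!: bra_sum bra_scale sum.neutral)

lemma bb_Cons: "bb D G \<Longrightarrow> bb (D - eps * a) (\<lambda>w. G (a # w))"
  by (auto simp: bb_def bra_Cons algebra_simps)

lemma bop_bound:
  assumes "bb D G" "int n + eps * sum_list w > D"
  shows "bop (eps * int n) G w = 0"
proof -
  have "G ([eps * int n - i, i] @ w) = 0" for i
    using assms(2) by (intro bbD[OF assms(1)]) (auto simp: distrib_left)
  thus ?thesis by (simp add: bop_def)
qed

definition qop :: "(int list \<Rightarrow> 'a) \<Rightarrow> int list \<Rightarrow> 'a" where
  "qop G w = Sum_any (\<lambda>n. s $ n * bop (eps * int n) G w)"

lemma qop_eq:
  assumes "bb D G" "int N \<ge> D - eps * sum_list w"
  shows "qop G w = (\<Sum>n\<le>N. s $ n * bop (eps * int n) G w)"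
  unfolding qop_def
proof (rule Sum_any.expand_superset)
  show "{n. s $ n * bop (eps * int n) G w \<noteq> 0} \<subseteq> {..N}"
  proof clarify
    fix n assume "s $ n * bop (eps * int n) G w \<noteq> 0"
    hence "bop (eps * int n) G w \<noteq> 0" by auto
    hence "\<not> int n + eps * sum_list w > D" using bop_bound[OF assms(1)] by blast
    thus "n \<le> N" using assms(2) by simp
  qed
qed simp

lemma qop_cong:
  assumes "\<And>v. eps * sum_list v \<ge> eps * sum_list w \<Longrightarrow> G v = G' v"
  shows "qop G w = qop G' w"
proof -
  have "bop (eps * int n) G w = bop (eps * int n) G' w" for n
    unfolding bop_def by (intro Sum_any.cong arg_cong2[where f = times] assms) (auto simp: distrib_left)
  thus ?thesis by (simp add: qop_def)
qed

lemma odd_eps: "odd n \<Longrightarrow> odd (eps * int n)" "odd n \<Longrightarrow> eps * int n \<noteq> 0"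
proof -
  show "odd n \<Longrightarrow> odd (eps * int n)" using eps by auto
  thus "odd n \<Longrightarrow> eps * int n \<noteq> 0" by fastforce
qed

text \<open>Because s has no constant term, each prefixed block adds at least 1 to the energy in the
  direction \<open>eps\<close>; hence the powers of \<open>qop\<close> eventually vanish on any
  given word.\<close>

lemma bb_qop:
  assumes "bb D G"
  shows "bb (D - 1) (qop G)"
  unfolding bb_def
proof (intro conjI allI impI)
  show "bra (qop G)"
  proof (rule bra_local)
    fix W :: "int list set" assume W: "finite W"
    define N where "N = nat (\<Sum>w\<in>W. \<bar>D - eps * sum_list w\<bar>)"
    have N: "int N \<ge> D - eps * sum_list w" if "w \<in> W" for w
      using member_le_sum[of w W "\<lambda>w. \<bar>D - eps * sum_list w\<bar>"] that W by (simp add: N_def)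
    have "bra (\<lambda>w. s $ n * bop (eps * int n) G w)" for n
    proof (cases "odd n")
      case True
      show ?thesis by (intro bra_scale bra_bop bbD[OF assms] odd_eps(2)[OF True])
    qed (simp add: s_even)
    hence "bra (\<lambda>w. \<Sum>n\<le>N. s $ n * bop (eps * int n) G w)" by (intro bra_sum)
    thus "\<exists>H. bra H \<and> (\<forall>w\<in>W. qop G w = H w)"
      using qop_eq[OF assms N] by blast
  qed
next
  fix w assume *: "D - 1 < eps * sum_list w"
  have "s $ n * bop (eps * int n) G w = 0" for n
    using * bop_bound[OF assms, of n w] by (cases "n = 0") auto
  thus "qop G w = 0" by (simp add: qop_def)
qed

lemma bb_qop_pow: "bb D G \<Longrightarrow> bb (D - int k) ((qop ^^ k) G)"
proof (induction k)
  case (Suc k)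
  from bb_qop[OF Suc.IH[OF Suc.prems]] show ?case by (simp add: algebra_simps)
qed simp

lemma qop_sum:
  assumes "\<And>j. j \<in> J \<Longrightarrow> bb D (G j)"
  shows "qop (\<lambda>w. \<Sum>j\<in>J. c j * G j w) w = (\<Sum>j\<in>J. c j * qop (G j) w)"
proof -
  define N where "N = nat (D - eps * sum_list w)"
  have "qop (\<lambda>w. \<Sum>j\<in>J. c j * G j w) w =
      (\<Sum>n\<le>N. s $ n * bop (eps * int n) (\<lambda>w. \<Sum>j\<in>J. c j * G j w) w)"
    by (rule qop_eq[of D]) (auto intro!: bb_sum assms simp: N_def)
  also have "\<dots> = (\<Sum>n\<le>N. s $ n * (\<Sum>j\<in>J. c j * bop (eps * int n) (G j) w))"
  proof (intro sum.cong refl)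
    fix n
    show "s $ n * bop (eps * int n) (\<lambda>w. \<Sum>j\<in>J. c j * G j w) w = s $ n * (\<Sum>j\<in>J. c j * bop (eps * int n) (G j) w)"
    proof (cases "odd n")
      case True
      show ?thesis by (simp only: bop_sum[OF bbD(1)[OF assms] odd_eps(2)[OF True]])
    qed (simp add: s_even)
  qed
  also have "\<dots> = (\<Sum>j\<in>J. c j * (\<Sum>n\<le>N. s $ n * bop (eps * int n) (G j) w))"
    unfolding sum_distrib_left by (subst sum.swap) (simp add: mult_ac)
  also have "\<dots> = (\<Sum>j\<in>J. c j * qop (G j) w)"
    by (intro sum.cong refl, subst qop_eq[OF assms]) (auto simp: N_def)
  finally show ?thesis .
qed

lemma qop_pow_sum:
  assumes "\<And>j. j \<in> J \<Longrightarrow> bb D (G j)"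
  shows "(qop ^^ k) (\<lambda>w. \<Sum>j\<in>J. c j * G j w) = (\<lambda>w. \<Sum>j\<in>J. c j * (qop ^^ k) (G j) w)"
proof (induction k)
  case (Suc k)
  show ?case using qop_sum[where D = "D - int k" and J = J and G = "\<lambda>j. (qop ^^ k) (G j)"] bb_qop_pow[OF assms]
    by (simp add: Suc fun_eq_iff)
qed simp

lemma qop_pow_add:
  assumes "bb D G" "bb D H"
  shows "(qop ^^ k) (\<lambda>w. G w + H w) = (\<lambda>w. (qop ^^ k) G w + (qop ^^ k) H w)"
  using qop_pow_sum[of "{True, False}" D "\<lambda>b. if b then G else H" k "\<lambda>_. 1"] assms by simp

lemma qop_pow_cong:
  assumes "\<And>v. eps * sum_list v \<ge> eps * sum_list w \<Longrightarrow> G v = G' v"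
  shows "(qop ^^ k) G w = (qop ^^ k) G' w"
  using assms
proof (induction k arbitrary: w)
  case (Suc k)
  show ?case using Suc by (auto intro!: qop_cong)
qed auto

section \<open>Commuting a letter with the exponential\<close>

definition sh :: "int \<Rightarrow> 'a fps \<Rightarrow> (int list \<Rightarrow> 'a) \<Rightarrow> int list \<Rightarrow> 'a" where
  "sh a f G w = Sum_any (\<lambda>n. f $ n * G ((a + eps * int n) # w))"

lemma letter_bound:
  assumes "bb D G" "int n > D - eps * a - eps * sum_list w"
  shows "G ((a + eps * int n) # w) = 0"
  using assms(2) by (intro bbD[OF assms(1)]) (auto simp: distrib_left)

lemma sh_eq:
  assumes "bb D G" "int N \<ge> D - eps * a - eps * sum_list w"
  shows "sh a f G w = (\<Sum>n\<le>N. f $ n * G ((a + eps * int n) # w))"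
  unfolding sh_def
proof (rule Sum_any.expand_superset)
  show "{n. f $ n * G ((a + eps * int n) # w) \<noteq> 0} \<subseteq> {..N}"
  proof clarify
    fix n assume "f $ n * G ((a + eps * int n) # w) \<noteq> 0"
    hence "G ((a + eps * int n) # w) \<noteq> 0" by auto
    hence "\<not> int n > D - eps * a - eps * sum_list w" using letter_bound[OF assms(1)] by blast
    thus "n \<le> N" using assms(2) by simp
  qed
qed simp

lemma bb_letter:
  assumes "bb D G"
  shows "bb (D - eps * a) (\<lambda>v. G ((a + eps * int n) # v))"
  by (rule bb_mono[OF bb_Cons[OF assms]]) (simp add: distrib_left)

lemma bb_sh:
  assumes "bb D G"
  shows "bb (D - eps * a) (sh a f G)"
  unfolding bb_def
proof (intro conjI allI impI)
  show "bra (sh a f G)"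
  proof (rule bra_local)
    fix W :: "int list set" assume W: "finite W"
    define N where "N = nat (\<Sum>w\<in>W. \<bar>D - eps * a - eps * sum_list w\<bar>)"
    have N: "int N \<ge> D - eps * a - eps * sum_list w" if "w \<in> W" for w
      using member_le_sum[of w W "\<lambda>w. \<bar>D - eps * a - eps * sum_list w\<bar>"] that W by (simp add: N_def)
    have "bra (\<lambda>w. \<Sum>n\<le>N. f $ n * G ((a + eps * int n) # w))"
      by (intro bra_sum bra_scale bra_Cons bbD[OF assms])
    thus "\<exists>H. bra H \<and> (\<forall>w\<in>W. sh a f G w = H w)"
      using sh_eq[OF assms N] by blast
  qed
next
  fix w assume *: "D - eps * a < eps * sum_list w"
  have "f $ n * G ((a + eps * int n) # w) = 0" for n
    using * by (subst letter_bound[OF assms]) auto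
  thus "sh a f G w = 0" by (simp add: sh_def)
qed

lemma sh_1: "sh a 1 G w = G (a # w)"
proof -
  have "(1 :: 'a fps) $ n * G ((a + eps * int n) # w) = (if n = 0 then G (a # w) else 0)" for n
    by simp
  thus ?thesis by (simp add: sh_def)
qed

lemma qop_Cons:
  assumes "bb D G" "int N \<ge> D - eps * a - eps * sum_list w"
  shows "qop G (a # w) = qop (\<lambda>v. G (a # v)) w + (\<Sum>n\<le>N. (4 * s) $ n * G ((a + eps * int n) # w))"
proof -
  have "qop G (a # w) = (\<Sum>n\<le>N. s $ n * bop (eps * int n) G (a # w))"
    using assms by (intro qop_eq) (auto simp: distrib_left)
  also have "\<dots> = (\<Sum>n\<le>N. s $ n * bop (eps * int n) (\<lambda>v. G (a # v)) w + (4 * s) $ n * G ((a + eps * int n) # w))"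
  proof (intro sum.cong refl)
    fix n
    show "s $ n * bop (eps * int n) G (a # w) =
        s $ n * bop (eps * int n) (\<lambda>v. G (a # v)) w + (4 * s) $ n * G ((a + eps * int n) # w)"
    proof (cases "odd n")
      case True
      show ?thesis
        by (simp add: bop_Cons[OF bbD(1)[OF assms(1)] odd_eps(1)[OF True]] fps_numeral_fps_const algebra_simps)
    qed (simp add: s_even fps_numeral_fps_const)
  qed
  also have "\<dots> = qop (\<lambda>v. G (a # v)) w + (\<Sum>n\<le>N. (4 * s) $ n * G ((a + eps * int n) # w))"
    using assms by (simp add: sum.distrib qop_eq[OF bb_Cons[OF assms(1)], of a w N])
  finally show ?thesis .
qed

text \<open>If X^n stands for the letter phi_{a + eps n}, then by \<open>qop_Cons\<close> the
  commutator with the quadratic operator is multiplication by 4 s.\<close>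

lemma sh_qop:
  assumes "bb D G"
  shows "sh a f (qop G) = (\<lambda>w. qop (sh a f G) w + sh a (f * (4 * s)) G w)"
proof
  fix w
  define N where "N = nat (D - eps * a - eps * sum_list w)"
  have N: "int N \<ge> D - eps * a - eps * sum_list w" by (simp add: N_def)
  let ?h = "\<lambda>M. G ((a + eps * int M) # w)"
  have "sh a f (qop G) w = (\<Sum>n\<le>N. f $ n * qop G ((a + eps * int n) # w))"
    by (rule sh_eq[OF bb_mono[OF bb_qop[OF assms]]]) (use N in auto)
  also have "\<dots> = (\<Sum>n\<le>N. f $ n * (qop (\<lambda>v. G ((a + eps * int n) # v)) w + (\<Sum>k\<le>N. (4 * s) $ k * ?h (n + k))))"
    by (intro sum.cong refl, subst qop_Cons[OF assms, where N = N])
      (use N in \<open>auto simp: distrib_left add.assoc\<close>)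
  also have "\<dots> = (\<Sum>n\<le>N. f $ n * qop (\<lambda>v. G ((a + eps * int n) # v)) w) +
      (\<Sum>n\<le>N. \<Sum>k\<le>N. f $ n * (4 * s) $ k * ?h (n + k))"
    by (simp add: distrib_left sum.distrib sum_distrib_left mult.assoc)
  also have "(\<Sum>n\<le>N. \<Sum>k\<le>N. f $ n * (4 * s) $ k * ?h (n + k)) = (\<Sum>M\<le>N. (f * (4 * s)) $ M * ?h M)"
    by (rule sum_fps_mult, rule letter_bound[OF assms]) (use N in auto)
  also have "\<dots> = sh a (f * (4 * s)) G w"
    by (rule sh_eq[OF assms N, symmetric])
  also have "(\<Sum>n\<le>N. f $ n * qop (\<lambda>v. G ((a + eps * int n) # v)) w) =
      qop (\<lambda>v. \<Sum>n\<le>N. f $ n * G ((a + eps * int n) # v)) w"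
    by (rule qop_sum[symmetric, OF bb_letter[OF assms]])
  also have "\<dots> = qop (sh a f G) w"
    by (rule qop_cong, rule sh_eq[OF assms, symmetric]) (use N in auto)
  finally show "sh a f (qop G) w = qop (sh a f G) w + sh a (f * (4 * s)) G w" .
qed

text \<open>The binomial theorem for two commuting operations: applying \<open>qop\<close>, and
  multiplying the letter by 4 s.\<close>

lemma sh_qop_pow:
  assumes "bb D G"
  shows "sh a f ((qop ^^ N) G) w = (\<Sum>j\<le>N. of_nat (N choose j) * (qop ^^ (N - j)) (sh a (f * (4 * s) ^ j) G) w)"
  using assms
proof (induction N arbitrary: D G)
  case (Suc N)
  have "sh a f ((qop ^^ Suc N) G) w =
      (\<Sum>j\<le>N. of_nat (N choose j) * (qop ^^ (N - j)) (sh a (f * (4 * s) ^ j) (qop G)) w)"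
    unfolding funpow_Suc_right comp_def by (rule Suc.IH[OF bb_qop[OF Suc.prems]])
  also have "\<dots> = (\<Sum>j\<le>N. of_nat (N choose j) * ((qop ^^ (Suc N - j)) (sh a (f * (4 * s) ^ j) G) w
      + (qop ^^ (Suc N - Suc j)) (sh a (f * (4 * s) ^ Suc j) G) w))"
  proof (intro sum.cong refl)
    fix j assume j: "j \<in> {..N}"
    have "(qop ^^ (N - j)) (sh a (f * (4 * s) ^ j) (qop G)) =
        (\<lambda>w. (qop ^^ (N - j)) (qop (sh a (f * (4 * s) ^ j) G)) w + (qop ^^ (N - j)) (sh a (f * (4 * s) ^ j * (4 * s)) G) w)"
      unfolding sh_qop[OF Suc.prems]
      by (rule qop_pow_add[of "D - eps * a"])
        (auto intro!: bb_sh Suc.prems bb_mono[OF bb_qop[OF bb_sh[OF Suc.prems]]])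
    moreover have "(qop ^^ (N - j)) (qop H) = (qop ^^ (Suc N - j)) H" for H
      using j by (simp add: Suc_diff_le funpow_swap1)
    ultimately show "of_nat (N choose j) * (qop ^^ (N - j)) (sh a (f * (4 * s) ^ j) (qop G)) w =
        of_nat (N choose j) * ((qop ^^ (Suc N - j)) (sh a (f * (4 * s) ^ j) G) w
          + (qop ^^ (Suc N - Suc j)) (sh a (f * (4 * s) ^ Suc j) G) w)"
      by (simp add: mult_ac)
  qed
  also have "\<dots> = (\<Sum>j\<le>Suc N. of_nat (Suc N choose j) * (qop ^^ (Suc N - j)) (sh a (f * (4 * s) ^ j) G) w)"
    by (rule sum_pascal[symmetric])
  finally show ?case .
qed simp

definition eop :: "(int list \<Rightarrow> 'a) \<Rightarrow> int list \<Rightarrow> 'a" where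
  "eop G w = Sum_any (\<lambda>N. iv N * (qop ^^ N) G w)"

lemma eop_eq:
  assumes "bb D G" "int N \<ge> D - eps * sum_list w"
  shows "eop G w = (\<Sum>n\<le>N. iv n * (qop ^^ n) G w)"
  unfolding eop_def
proof (rule Sum_any.expand_superset)
  show "{n. iv n * (qop ^^ n) G w \<noteq> 0} \<subseteq> {..N}"
  proof clarify
    fix n assume "iv n * (qop ^^ n) G w \<noteq> 0"
    hence "(qop ^^ n) G w \<noteq> 0" by auto
    hence "\<not> eps * sum_list w > D - int n" using bbD(2)[OF bb_qop_pow[OF assms(1)]] by blast
    thus "n \<le> N" using assms(2) by simp
  qed
qed simp

text \<open>This is exp (4 s); as s has no constant term, powers beyond n do not reach X^n.\<close>

definition es :: "'a fps" where
  "es = Abs_fps (\<lambda>n. \<Sum>j\<le>n. iv j * ((4 * s) ^ j) $ n)"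

lemma s_power_nth: "n < j \<Longrightarrow> ((4 * s) ^ j) $ n = 0"
  using startsby_zero_power_prefix[of "4 * s" j] by simp

text \<open>Exponentiating the commutator of \<open>sh_qop\<close>: passing the letter to the left
  of the exponential multiplies it by exp (4 s).\<close>

lemma eop_Cons:
  assumes "bb D G" "int N \<ge> D - eps * a - eps * sum_list w"
  shows "eop G (a # w) = (\<Sum>n\<le>N. es $ n * eop (\<lambda>v. G ((a + eps * int n) # v)) w)"
proof -
  define h where "h = (\<lambda>n i. (qop ^^ i) (\<lambda>v. G ((a + eps * int n) # v)) w)"
  have h0: "h n i = 0" if "n + i > N" for n i
  proof -
    have "bb (D - eps * (a + eps * int n)) (\<lambda>v. G ((a + eps * int n) # v))" by (rule bb_Cons[OF assms(1)])
    from bbD(2)[OF bb_qop_pow[OF this, of i], of w] that assms(2) show ?thesis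
      by (simp add: h_def distrib_left)
  qed
  have sh: "(qop ^^ i) (sh a g G) w = (\<Sum>n\<le>N. g $ n * h n i)" for i g
  proof -
    have "(qop ^^ i) (sh a g G) w = (qop ^^ i) (\<lambda>v. \<Sum>n\<le>N. g $ n * G ((a + eps * int n) # v)) w"
      by (rule qop_pow_cong, rule sh_eq[OF assms(1)]) (use assms(2) in auto)
    also have "\<dots> = (\<Sum>n\<le>N. g $ n * h n i)"
      by (subst qop_pow_sum[OF bb_letter[OF assms(1)]]) (simp add: h_def)
    finally show ?thesis .
  qed
  have "eop G (a # w) = (\<Sum>K\<le>N. iv K * (qop ^^ K) G (a # w))"
    by (rule eop_eq[OF assms(1)]) (use assms(2) in \<open>auto simp: distrib_left\<close>)
  also have "\<dots> = (\<Sum>K\<le>N. iv K * (\<Sum>j\<le>K. of_nat (K choose j) * (\<Sum>n\<le>N. ((4 * s) ^ j) $ n * h n (K - j))))"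
    unfolding sh_1[symmetric] by (simp add: sh_qop_pow[OF assms(1)] sh)
  also have "\<dots> = (\<Sum>K\<le>N. \<Sum>j\<le>K. \<Sum>n\<le>N. iv j * iv (K - j) * ((4 * s) ^ j) $ n * h n (K - j))"
    by (simp add: sum_distrib_left mult.assoc[symmetric] iv_binomial)
  also have "\<dots> = (\<Sum>(j, i)\<in>{(j, i). j + i \<le> N}. \<Sum>n\<le>N. iv j * iv i * ((4 * s) ^ j) $ n * h n i)"
    by (subst sum.triangle_reindex_eq) simp
  \<comment> \<open>Outside the triangle either n < j, and the power of 4 s has no coefficient at
    X^n, or n + i > N, and the energy bound applies.\<close>
  also have "\<dots> = (\<Sum>(j, i)\<in>{..N} \<times> {..N}. \<Sum>n\<le>N. iv j * iv i * ((4 * s) ^ j) $ n * h n i)"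
  proof (intro sum.mono_neutral_left)
    show "\<forall>p\<in>{..N} \<times> {..N} - {(j, i). j + i \<le> N}.
        (case p of (j, i) \<Rightarrow> \<Sum>n\<le>N. iv j * iv i * ((4 * s) ^ j) $ n * h n i) = 0"
    proof
      fix p assume p: "p \<in> {..N} \<times> {..N} - {(j, i). j + i \<le> N}"
      have "iv (fst p) * iv (snd p) * ((4 * s) ^ fst p) $ n * h n (snd p) = 0" for n
      proof -
        have "n < fst p \<or> n + snd p > N" using p by auto
        thus ?thesis using s_power_nth h0 by auto
      qed
      thus "(case p of (j, i) \<Rightarrow> \<Sum>n\<le>N. iv j * iv i * ((4 * s) ^ j) $ n * h n i) = 0"
        by (simp add: case_prod_unfold)
    qed
  qed auto
  also have "\<dots> = (\<Sum>j\<le>N. \<Sum>i\<le>N. \<Sum>n\<le>N. iv j * iv i * ((4 * s) ^ j) $ n * h n i)"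
    by (rule sum.cartesian_product[symmetric])
  also have "\<dots> = (\<Sum>j\<le>N. \<Sum>n\<le>N. \<Sum>i\<le>N. iv j * iv i * ((4 * s) ^ j) $ n * h n i)"
    by (intro sum.cong refl sum.swap)
  also have "\<dots> = (\<Sum>n\<le>N. \<Sum>j\<le>N. \<Sum>i\<le>N. iv j * iv i * ((4 * s) ^ j) $ n * h n i)"
    by (rule sum.swap)
  also have "\<dots> = (\<Sum>n\<le>N. (\<Sum>j\<le>N. iv j * ((4 * s) ^ j) $ n) * (\<Sum>i\<le>N. iv i * h n i))"
    by (simp add: sum_distrib_left sum_distrib_right mult_ac)
  also have "\<dots> = (\<Sum>n\<le>N. es $ n * eop (\<lambda>v. G ((a + eps * int n) # v)) w)"
  proof (intro sum.cong refl arg_cong2[where f = times])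
    fix n assume n: "n \<in> {..N}"
    have "(\<Sum>j\<le>N. iv j * ((4 * s) ^ j) $ n) = (\<Sum>j\<le>n. iv j * ((4 * s) ^ j) $ n)"
      using n s_power_nth by (intro sum.mono_neutral_right) auto
    thus "(\<Sum>j\<le>N. iv j * ((4 * s) ^ j) $ n) = es $ n" by (simp add: es_def)
    show "(\<Sum>i\<le>N. iv i * h n i) = eop (\<lambda>v. G ((a + eps * int n) # v)) w"
      unfolding h_def by (rule eop_eq[OF bb_letter[OF assms(1)], symmetric]) (use assms(2) in auto)
  qed
  finally show ?thesis .
qed

end


section \<open>Quadratic operators as series of words\<close>

context quadratic
begin

definition quad :: "'a wser" where
  "quad = Abs_wser (\<lambda>w. case w of [a, b] \<Rightarrow> if eps * (a + b) > 0 then s $ nat (eps * (a + b)) * sg b else 0 | _ \<Rightarrow> 0)"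

lemma word_coeff_quad:
  "word_coeff quad w = (case w of [a, b] \<Rightarrow> if eps * (a + b) > 0 then s $ nat (eps * (a + b)) * sg b else 0 | _ \<Rightarrow> 0)"
  by (simp add: quad_def Abs_wser_inverse)

lemma quad_block: "word_coeff quad [eps * int n - i, i] = s $ n * sg i"
  by (auto simp: word_coeff_quad)

lemma quad_nonzeroD:
  assumes "word_coeff quad a \<noteq> 0"
  obtains n i where "n > 0" "a = [eps * int n - i, i]"
proof -
  obtain x y where a: "a = [x, y]" "eps * (x + y) > 0"
    using assms by (auto simp: word_coeff_quad split: list.splits if_splits)
  define n where "n = nat (eps * (x + y))"
  have "int n = eps * (x + y)" "n > 0" using a(2) by (auto simp: n_def)
  hence "eps * int n = x + y" by simp
  with a \<open>n > 0\<close> show ?thesis by (intro that[of n y]) auto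
qed

lemma act_quad:
  assumes "bb D G"
  shows "act G quad w = qop G w"
proof -
  define N where "N = nat (D - eps * sum_list w)"
  define M where "M = \<bar>sum_list w\<bar> + int N"
  let ?f = "\<lambda>(n, i). [eps * int n - i, i]"
  let ?I = "{..N} \<times> {-M..M}"
  have "act G quad w = (\<Sum>a\<in>?f ` ?I. word_coeff quad a * G (a @ w))"
  proof (rule act_superset)
    fix a assume *: "word_coeff quad a \<noteq> 0" "G (a @ w) \<noteq> 0"
    then obtain n i where a: "n > 0" "a = [eps * int n - i, i]" using quad_nonzeroD by blast
    have "\<not> eps * sum_list (a @ w) > D" using * bbD(2)[OF assms] by blast
    hence "n \<le> N" using a by (auto simp: N_def distrib_left)
    moreover have "i \<in> {- sum_list w..eps * int n + sum_list w}"
      using *(2) a eps by (intro bop_support[OF bbD(1)[OF assms]]) auto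
    hence "i \<in> {-M..M}" using \<open>n \<le> N\<close> eps by (auto simp: M_def)
    ultimately show "a \<in> ?f ` ?I" using a by force
  qed simp
  also have "\<dots> = (\<Sum>p\<in>?I. word_coeff quad (?f p) * G (?f p @ w))"
  proof (rule sum.reindex_cong[OF _ refl])
    show "inj_on ?f ?I" using eps by (auto simp: inj_on_def)
  qed simp
  also have "\<dots> = (\<Sum>n\<le>N. \<Sum>i\<in>{-M..M}. s $ n * sg i * G ([eps * int n - i, i] @ w))"
    by (simp add: sum.cartesian_product case_prod_unfold quad_block)
  also have "\<dots> = (\<Sum>n\<le>N. s $ n * bop (eps * int n) G w)"
  proof (intro sum.cong refl)
    fix n assume n: "n \<in> {..N}"
    show "(\<Sum>i\<in>{-M..M}. s $ n * sg i * G ([eps * int n - i, i] @ w)) = s $ n * bop (eps * int n) G w"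
    proof (cases "odd n")
      case True
      have "bop (eps * int n) G w = (\<Sum>i\<in>{-M..M}. sg i * G ([eps * int n - i, i] @ w))"
        by (rule bop_interval[OF bbD(1)[OF assms] odd_eps(2)[OF True]]) (use n eps in \<open>auto simp: M_def\<close>)
      thus ?thesis by (simp add: sum_distrib_left mult.assoc)
    qed (simp add: s_even)
  qed
  also have "\<dots> = qop G w"
    by (rule qop_eq[OF assms, symmetric]) (simp add: N_def)
  finally show ?thesis .
qed

definition qblocks :: "nat \<Rightarrow> int list \<Rightarrow> bool" where
  "qblocks n a \<longleftrightarrow> (if eps = 1 then blocks 0 0 n a else blocks 0 n 0 a)"

lemma qblocks_append: "qblocks n a \<Longrightarrow> qblocks m b \<Longrightarrow> qblocks (n + m) (a @ b)"
  using blocks_append[of 0 0 m b 0 0 n a] blocks_append[of 0 m 0 b 0 n 0 a]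
  by (auto simp: qblocks_def split: if_splits)

lemma qblocks_sum: "qblocks n a \<Longrightarrow> sum_list a = eps * int n"
  using eps by (auto simp: qblocks_def blocks_sum split: if_splits)

lemma qblocks_block:
  assumes "n > 0"
  shows "qblocks n [eps * int n - i, i]"
  using eps blocks.raise[OF blocks.Nil assms] blocks.lower[OF blocks.Nil assms]
  by (auto simp: qblocks_def)

lemma quad_pow_nonzeroD:
  assumes "word_coeff (quad ^ k) a \<noteq> 0"
  shows "length a = 2 * k \<and> (\<exists>n\<ge>k. qblocks n a)"
  using assms
proof (induction k arbitrary: a)
  case 0
  thus ?case using blocks.Nil by (auto simp: one_wser.rep_eq qblocks_def split: if_splits)
next
  case (Suc k)
  from Suc.prems obtain b c where bc: "b @ c = a" "word_coeff (quad ^ k) b \<noteq> 0" "word_coeff quad c \<noteq> 0"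
    unfolding power_Suc2 times_wser.rep_eq using conv_nonzeroD by metis
  from Suc.IH[OF bc(2)] obtain n where n: "length b = 2 * k" "n \<ge> k" "qblocks n b" by blast
  from bc(3) obtain m i where m: "m > 0" "c = [eps * int m - i, i]" by (rule quad_nonzeroD)
  have "qblocks (n + m) (b @ c)"
    unfolding m(2) by (rule qblocks_append[OF n(3) qblocks_block[OF m(1)]])
  hence "qblocks (n + m) a" by (simp only: bc(1))
  thus ?case using n m bc by (intro conjI exI[of _ "n + m"]) auto
qed

lemma finite_qblocks:
  assumes "bb D G" "\<And>w. sum_list w > U \<Longrightarrow> G w = 0"
  shows "finite {a. G (a @ w) \<noteq> 0 \<and> (\<exists>n. qblocks n a)}"
proof (rule finite_subset)
  define X where "X = nat (\<bar>U\<bar> + \<bar>sum_list w\<bar>)"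
  show "finite {a. G (a @ w) \<noteq> 0 \<and> (\<exists>l\<le>0. \<exists>d\<le>X. \<exists>e\<le>X. blocks l d e a)}"
    by (rule finite_blocks[OF bbD(1)[OF assms(1)] assms(2)])
  show "{a. G (a @ w) \<noteq> 0 \<and> (\<exists>n. qblocks n a)} \<subseteq> {a. G (a @ w) \<noteq> 0 \<and> (\<exists>l\<le>0. \<exists>d\<le>X. \<exists>e\<le>X. blocks l d e a)}"
  proof clarify
    fix a n assume *: "G (a @ w) \<noteq> 0" "qblocks n a"
    have "\<not> sum_list (a @ w) < 0" "\<not> sum_list (a @ w) > U"
      using * bra_negative'[OF bbD(1)[OF assms(1)], of "a @ w"] assms(2)[of "a @ w"] by auto
    hence "n \<le> X" using qblocks_sum[OF *(2)] eps by (auto simp: X_def)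
    thus "\<exists>l\<le>0. \<exists>d\<le>X. \<exists>e\<le>X. blocks l d e a" using *(2) by (auto simp: qblocks_def split: if_splits)
  qed
qed

lemma act_quad_pow:
  assumes "bb D G" "\<And>w. sum_list w > U \<Longrightarrow> G w = 0"
  shows "act G (quad ^ k) = (qop ^^ k) G"
proof (induction k)
  case 0
  show ?case
  proof
    fix w
    have "act G 1 w = (\<Sum>a\<in>{[]}. word_coeff 1 a * G (a @ w))"
      by (rule act_superset) (auto simp: one_wser.rep_eq split: if_splits)
    thus "act G (quad ^ 0) w = (qop ^^ 0) G w" by (simp add: one_wser.rep_eq)
  qed
next
  case (Suc k)
  show ?case
  proof
    fix w
    let ?P = "{(a, b). word_coeff (quad ^ k) a \<noteq> 0 \<and> word_coeff quad b \<noteq> 0 \<and> G (a @ b @ w) \<noteq> 0}"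
    have "act G (quad ^ Suc k) w = act (act G (quad ^ k)) quad w"
      unfolding power_Suc2
    proof (rule act_mult, rule finite_subset)
      let ?C = "{c. G (c @ w) \<noteq> 0 \<and> (\<exists>n. qblocks n c)}"
      show "finite (\<Union>c\<in>?C. {(a, b). a @ b = c})"
        by (intro finite_UN_I finite_qblocks[OF assms] finite_splits)
      show "?P \<subseteq> (\<Union>c\<in>?C. {(a, b). a @ b = c})"
      proof clarify
        fix a b assume *: "word_coeff (quad ^ k) a \<noteq> 0" "word_coeff quad b \<noteq> 0" "G (a @ b @ w) \<noteq> 0"
        have "\<exists>n. qblocks n a" using quad_pow_nonzeroD[OF *(1)] by blast
        moreover have "\<exists>n. qblocks n b" using quad_pow_nonzeroD[of 1 b] *(2) by auto
        ultimately have "\<exists>n. qblocks n (a @ b)" using qblocks_append by blast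
        with *(3) show "(a, b) \<in> (\<Union>c\<in>?C. {(a, b). a @ b = c})" by auto
      qed
    qed
    thus "act G (quad ^ Suc k) w = (qop ^^ Suc k) G w"
      by (simp add: Suc.IH act_quad[OF bb_qop_pow[OF assms(1)]])
  qed
qed

text \<open>The words of \<open>quad ^ k\<close> have length 2k, so each coefficient of the
  exponential is a single term rather than an infinite sum.\<close>

definition wexp :: "'a wser" where
  "wexp = Abs_wser (\<lambda>a. iv (length a div 2) * word_coeff (quad ^ (length a div 2)) a)"

lemma word_coeff_wexp: "word_coeff wexp a = iv (length a div 2) * word_coeff (quad ^ (length a div 2)) a"
  by (simp add: wexp_def Abs_wser_inverse)

lemma wexp_nonzeroD: "word_coeff wexp a \<noteq> 0 \<Longrightarrow> \<exists>n. qblocks n a"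
  using quad_pow_nonzeroD[of "length a div 2" a] by (force simp: word_coeff_wexp)

lemma act_wexp:
  assumes "bb D G" "\<And>w. sum_list w > U \<Longrightarrow> G w = 0"
  shows "act G wexp w = eop G w"
proof -
  define S where "S = {a. G (a @ w) \<noteq> 0 \<and> (\<exists>n. qblocks n a)}"
  have S: "finite S" unfolding S_def by (rule finite_qblocks[OF assms])
  \<comment> \<open>Large enough both for the exponential series to terminate on w and for the
    number of pairs in every contributing word.\<close>
  define K where "K = nat (D - eps * sum_list w) + sum length S"
  have "eop G w = (\<Sum>N\<le>K. iv N * (qop ^^ N) G w)"
  proof (rule eop_eq[OF assms(1)])
    show "int K \<ge> D - eps * sum_list w" unfolding K_def of_nat_add by linarith
  qed
  also have "\<dots> = (\<Sum>N\<le>K. iv N * (\<Sum>a\<in>S. word_coeff (quad ^ N) a * G (a @ w)))"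
  proof (intro sum.cong refl arg_cong2[where f = times])
    fix N
    have "act G (quad ^ N) w = (\<Sum>a\<in>S. word_coeff (quad ^ N) a * G (a @ w))"
      by (rule act_superset[OF S]) (use quad_pow_nonzeroD in \<open>auto simp: S_def\<close>)
    thus "(qop ^^ N) G w = (\<Sum>a\<in>S. word_coeff (quad ^ N) a * G (a @ w))"
      by (simp add: act_quad_pow[OF assms])
  qed
  also have "\<dots> = (\<Sum>a\<in>S. (\<Sum>N\<le>K. iv N * word_coeff (quad ^ N) a) * G (a @ w))"
    by (simp add: sum_distrib_left sum_distrib_right mult.assoc) (rule sum.swap)
  also have "\<dots> = (\<Sum>a\<in>S. word_coeff wexp a * G (a @ w))"
  proof (intro sum.cong refl arg_cong2[where f = times])
    fix a assume "a \<in> S"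
    hence "length a \<le> K" using member_le_sum[of a S length] S by (simp add: K_def)
    hence "length a div 2 \<le> K" by linarith
    have "(\<Sum>N\<le>K. iv N * word_coeff (quad ^ N) a) = (\<Sum>N\<in>{length a div 2}. iv N * word_coeff (quad ^ N) a)"
    proof (rule sum.mono_neutral_right)
      have "word_coeff (quad ^ N) a = 0" if "N \<noteq> length a div 2" for N
        using quad_pow_nonzeroD[of N a] that by fastforce
      thus "\<forall>N\<in>{..K} - {length a div 2}. iv N * word_coeff (quad ^ N) a = 0" by simp
    qed (use \<open>length a div 2 \<le> K\<close> in auto)
    thus "(\<Sum>N\<le>K. iv N * word_coeff (quad ^ N) a) = word_coeff wexp a" by (simp add: word_coeff_wexp)
  qed
  also have "\<dots> = act G wexp w"
    by (rule act_superset[OF S, symmetric]) (use wexp_nonzeroD in \<open>auto simp: S_def\<close>)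
  finally show ?thesis by simp
qed

end


section \<open>Coefficients of series in the variables \<open>x\<close>\<close>

definition mdeg :: "(nat \<Rightarrow>\<^sub>0 nat) \<Rightarrow> nat" where
  "mdeg m = (\<Sum>i\<in>Poly_Mapping.keys m. Poly_Mapping.lookup m i)"

lemma mdeg_superset:
  assumes "finite I" "Poly_Mapping.keys m \<subseteq> I"
  shows "mdeg m = (\<Sum>i\<in>I. Poly_Mapping.lookup m i)"
  unfolding mdeg_def using assms by (intro sum.mono_neutral_left) (auto simp: in_keys_iff)

lemma mdeg_add: "mdeg (a + b) = mdeg a + mdeg b"
proof -
  let ?I = "Poly_Mapping.keys a \<union> Poly_Mapping.keys b"
  have "mdeg (a + b) = (\<Sum>i\<in>?I. Poly_Mapping.lookup (a + b) i)"
    using keys_add[of a b] by (intro mdeg_superset) auto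
  also have "\<dots> = mdeg a + mdeg b"
    by (simp add: lookup_add sum.distrib mdeg_superset[of ?I a] mdeg_superset[of ?I b])
  finally show ?thesis .
qed

lemma mdeg_0 [simp]: "mdeg 0 = 0"
  by (simp add: mdeg_def)

lemma mdeg_eq_0_iff: "mdeg m = 0 \<longleftrightarrow> m = 0"
  by (auto simp: mdeg_def in_keys_iff intro!: poly_mapping_eqI)

lemma mdeg_single [simp]: "mdeg (Poly_Mapping.single j n) = n"
  by (simp add: mdeg_def)

definition splits :: "(nat \<Rightarrow>\<^sub>0 nat) \<Rightarrow> ((nat \<Rightarrow>\<^sub>0 nat) \<times> (nat \<Rightarrow>\<^sub>0 nat)) set" where
  "splits m = {(a, b). a + b = m}"

lemma finite_splits_monom [simp]: "finite (splits m)"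
  using finite_conv_monom[of "\<lambda>_. 1 :: nat" "\<lambda>_. 1 :: nat" m] by (simp add: conv_set_def splits_def)

lemma mps_coeff_mult: "mps_coeff (f * g) m = (\<Sum>(a, b)\<in>splits m. mps_coeff f a * mps_coeff g b)"
  unfolding times_mps.rep_eq
  by (rule conv_superset) (auto simp: conv_set_def splits_def finite_splits_monom[unfolded splits_def])

lemma mps_coeff_simps [simp]:
  "mps_coeff (f + g) m = mps_coeff f m + mps_coeff g m"
  "mps_coeff (f - g) m = mps_coeff f m - mps_coeff g m"
  "mps_coeff (- f) m = - mps_coeff f m"
  "mps_coeff 0 m = 0"
  by (simp_all add: plus_mps.rep_eq minus_mps.rep_eq uminus_mps.rep_eq zero_mps.rep_eq)

lemma mps_coeff_sum [simp]: "mps_coeff (\<Sum>i\<in>I. f i) m = (\<Sum>i\<in>I. mps_coeff (f i) m)"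
  by (induction I rule: infinite_finite_induct) auto

lemma mps_coeff_1: "mps_coeff 1 m = (if m = 0 then 1 else 0)"
  by (simp add: one_mps.rep_eq)

lemma mps_coeff_Abs [simp]: "mps_coeff (Abs_mps f) = f"
  by (simp add: Abs_mps_inverse)

lemma mps_coeff_sum_any: "mps_coeff (mps_sum f) m = Sum_any (\<lambda>i. mps_coeff (f i) m)"
  by (simp add: mps_sum_def)

lemma mps_const_coeff: "mps_coeff (mps_const c) m = (if m = 0 then c else 0)"
  by (simp add: mps_const.rep_eq)

lemma mps_coeff_const_mult [simp]: "mps_coeff (mps_const c * f) m = c * mps_coeff f m"
proof -
  have "mps_coeff (mps_const c * f) m = (\<Sum>(a, b)\<in>{(0, m)}. mps_coeff (mps_const c) a * mps_coeff f b)"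
    unfolding mps_coeff_mult
    by (rule sum.mono_neutral_right)
      (auto simp: splits_def mps_const_coeff finite_splits_monom[unfolded splits_def] split: if_splits)
  thus ?thesis by (simp add: mps_const_coeff)
qed

lemma mps_const_hom:
  "mps_const (0 :: 'a::comm_ring_1) = 0"
  "mps_const (1 :: 'a::comm_ring_1) = 1"
  "mps_const (x + y :: 'a) = mps_const x + mps_const y"
  "mps_const (x - y :: 'a) = mps_const x - mps_const y"
  "mps_const (x * y :: 'a) = mps_const x * mps_const y"
  "mps_const (- x :: 'a) = - mps_const x"
proof -
  show "mps_const (x * y) = mps_const x * mps_const y"
    by (rule mps_eqI) (simp add: mps_const_coeff)
qed (rule mps_eqI; simp add: mps_const_coeff mps_coeff_1)+

lemma mps_const_eq_0_iff [simp]: "mps_const (c :: 'a::comm_ring_1) = 0 \<longleftrightarrow> c = 0"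
  by (metis (full_types) mps_coeff_simps(4) mps_const_coeff mps_const_hom(1))

lemma mps_const_sum: "mps_const (\<Sum>i\<in>I. f i :: 'a::comm_ring_1) = (\<Sum>i\<in>I. mps_const (f i))"
  by (induction I rule: infinite_finite_induct) (auto simp: mps_const_hom)

lemma mps_const_power: "mps_const (x ^ n :: 'a::comm_ring_1) = mps_const x ^ n"
  by (induction n) (auto simp: mps_const_hom)

lemma mps_const_of_nat: "mps_const (of_nat n :: 'a::comm_ring_1) = of_nat n"
  by (induction n) (auto simp: mps_const_hom)

lemma mps_const_numeral: "mps_const (numeral n :: 'a::comm_ring_1) = numeral n"
  using mps_const_of_nat[of "numeral n", where 'a = 'a] by simp

lemma mps_sum_const: "mps_sum (\<lambda>i. mps_const (c i :: 'a::comm_ring_1)) = mps_const (Sum_any c)"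
  by (rule mps_eqI) (simp add: mps_coeff_sum_any mps_const_coeff)

lemma mps_sum_single:
  assumes "\<And>i. i \<noteq> j \<Longrightarrow> f i = (0 :: 'a::comm_ring_1 mps)"
  shows "mps_sum f = f j"
proof (rule mps_eqI)
  fix m
  have "Sum_any (\<lambda>i. mps_coeff (f i) m) = (\<Sum>i\<in>{j}. mps_coeff (f i) m)"
    using assms by (intro Sum_any.expand_superset) (auto, metis mps_coeff_simps(4))
  thus "mps_coeff (mps_sum f) m = mps_coeff (f j) m" by (simp add: mps_coeff_sum_any)
qed

lemma xvar_power_coeff: "mps_coeff (xvar j ^ n :: 'a::comm_ring_1 mps) m = (if m = Poly_Mapping.single j n then 1 else 0)"
proof (induction n arbitrary: m)
  case (Suc n)
  have "mps_coeff (xvar j ^ Suc n :: 'a mps) m =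
      (\<Sum>p\<in>splits m. if p = (Poly_Mapping.single j 1, Poly_Mapping.single j n) then 1 else 0)"
    unfolding power_Suc mps_coeff_mult
    by (intro sum.cong refl) (auto simp: xvar.rep_eq Suc split: if_splits)
  also have "\<dots> = (if (Poly_Mapping.single j 1, Poly_Mapping.single j n) \<in> splits m then 1 else 0)"
    by simp
  finally show ?case by (simp add: splits_def flip: single_add)
qed (simp add: mps_coeff_1)

text \<open>\<open>psum a\<close> is \<open>\<Sum>\<^sub>n a\<^sub>n p\<^sub>n(x)\<close>, summed over \<open>n \<ge> 1\<close>.\<close>

definition psum :: "(nat \<Rightarrow> 'a::comm_ring_1) \<Rightarrow> 'a mps" where
  "psum a = Abs_mps (\<lambda>m. if card (Poly_Mapping.keys m) = 1 then a (mdeg m) else 0)"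

lemma psum_coeff: "mps_coeff (psum a) m = (if card (Poly_Mapping.keys m) = 1 then a (mdeg m) else 0)"
  by (simp add: psum_def)

lemma power_sum_coeff:
  assumes "n > 0"
  shows "mps_coeff (power_sum n :: 'a::comm_ring_1 mps) m = (if card (Poly_Mapping.keys m) = 1 \<and> mdeg m = n then 1 else 0)"
proof -
  have 1: "mps_coeff (power_sum n :: 'a mps) m = Sum_any (\<lambda>j. if m = Poly_Mapping.single j n then 1 else 0)"
    by (simp add: power_sum_def mps_coeff_sum_any xvar_power_coeff)
  show ?thesis
  proof (cases "\<exists>j. m = Poly_Mapping.single j n")
    case True
    then obtain j where m: "m = Poly_Mapping.single j n" by blast
    have "(m = Poly_Mapping.single i n) = (i = j)" for i
      using assms unfolding m
      by (metis keys_single neq0_conv singleton_insert_inj_eq)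
    thus ?thesis using assms by (simp add: 1) (simp add: m)
  next
    case False
    have "\<not> (card (Poly_Mapping.keys m) = 1 \<and> mdeg m = n)"
    proof
      assume *: "card (Poly_Mapping.keys m) = 1 \<and> mdeg m = n"
      then obtain j where j: "Poly_Mapping.keys m = {j}" by (meson card_1_singletonE)
      hence "Poly_Mapping.lookup m j = n" using * by (simp add: mdeg_def)
      hence "m = Poly_Mapping.single j n"
        using j by (intro poly_mapping_eqI) (auto simp: lookup_single when_def in_keys_iff)
      with False show False by blast
    qed
    thus ?thesis using False by (simp add: 1)
  qed
qed

lemma card_keys_mdeg: "card (Poly_Mapping.keys m) = 1 \<Longrightarrow> mdeg m > 0"
  using mdeg_eq_0_iff[of m] by (cases "m = 0") auto

lemma psum_eq_mps_sum:
  "mps_sum (\<lambda>n. if n \<ge> 1 then mps_const (a n) * power_sum n else 0) = psum a"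
proof (rule mps_eqI)
  fix m
  have "mps_coeff (if n \<ge> 1 then mps_const (a n) * power_sum n else 0) m =
      (if n = mdeg m then mps_coeff (psum a) m else 0)" for n
    using card_keys_mdeg[of m] by (auto simp: power_sum_coeff psum_coeff)
  thus "mps_coeff (mps_sum (\<lambda>n. if n \<ge> 1 then mps_const (a n) * power_sum n else 0)) m = mps_coeff (psum a) m"
    by (simp add: mps_coeff_sum_any)
qed


section \<open>The operators as series of words\<close>

lemma word_coeff_Abs [simp]: "word_coeff (Abs_wser f) = f"
  by (simp add: Abs_wser_inverse)

lemma wser_eqI: "(\<And>w. word_coeff A w = word_coeff B w) \<Longrightarrow> A = B"
  by (simp add: word_coeff_inject[symmetric] fun_eq_iff)

lemma word_coeff_fsum: "word_coeff (fsum F) w = mps_sum (\<lambda>i. word_coeff (F i) w)"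
  by (simp add: fsum_def)

lemma word_coeff_fscale: "word_coeff (fscale c F) w = c * word_coeff F w"
  by (simp add: fscale_def)

lemma word_coeff_phi: "word_coeff (phi n) w = (if w = [n] then 1 else 0)"
  by (simp add: phi_def)

lemma word_coeff_phi2: "word_coeff (phi a * phi b) w = (if w = [a, b] then 1 else 0)"
proof -
  have "conv (@) (word_coeff (phi a)) (word_coeff (phi b)) w =
      (\<Sum>(u, v)\<in>(if w = [a, b] then {([a], [b])} else {}). word_coeff (phi a) u * word_coeff (phi b) v)"
    by (rule conv_superset) (auto simp: conv_set_def word_coeff_phi split: if_splits)
  thus ?thesis by (simp add: times_wser.rep_eq word_coeff_phi)
qed

lemma word_coeff_current:
  "word_coeff (current z) w = (case w of [a, b] \<Rightarrow> if a + b = - z then mps_const (sg b / 4) else 0 | _ \<Rightarrow> 0)"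
proof -
  let ?F = "\<lambda>i. word_coeff (((-1) powi i / 4) \<bullet> (phi (- i - z) * phi i)) w"
  have F: "?F i = (if w = [- i - z, i] then mps_const (sg i / 4) else 0)" for i
    by (simp add: word_coeff_fscale word_coeff_phi2 sg_eq_powi)
  show ?thesis
  proof (cases "\<exists>a b. w = [a, b]")
    case True
    then obtain a b where w: "w = [a, b]" by blast
    have "mps_sum ?F = ?F b" unfolding F by (rule mps_sum_single) (auto simp: w)
    thus ?thesis unfolding current_def word_coeff_fsum F by (auto simp: w)
  next
    case False
    hence "?F i = 0" for i by (auto simp: F)
    moreover have "mps_sum (\<lambda>i. 0) = (0 :: qb mps)" by (rule mps_eqI) (simp add: mps_coeff_sum_any)
    ultimately show ?thesis using False unfolding current_def word_coeff_fsum
      by (auto split: list.splits)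
  qed
qed

definition cb :: "nat \<Rightarrow> qb poly" where
  "cb m = smult (1 / 2) ([:- bet / 2, 1:] ^ m - [:- bet / 2, -1:] ^ m)"

lemma pcompose_power: "pcompose (p ^ n) q = pcompose p q ^ n"
  by (induction n) (simp_all add: pcompose_1 pcompose_mult)

text \<open>Replacing X by -X exchanges the two powers in \<open>cb\<close>, so this polynomial is
  odd.\<close>

lemma cb_even: "even k \<Longrightarrow> coeff (cb m) k = 0"
proof -
  assume k: "even k"
  have "pcompose (cb m) [:0, -1:] = - cb m"
    by (simp add: cb_def pcompose_smult pcompose_diff pcompose_pCons pcompose_power smult_diff_right)
  hence "coeff (pcompose (cb m) [:0, -1:]) k = - coeff (cb m) k" by simp
  thus ?thesis using k by (simp add: coeff_pcompose_linear)
qed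

lemma degree_cb: "degree (cb m) \<le> m"
proof -
  have "degree ([:- bet / 2, x:] ^ m) \<le> m" for x :: qb
    using degree_power_le[of "[:- bet / 2, x:]" m] by (cases "x = 0") auto
  thus ?thesis unfolding cb_def by (intro order.trans[OF degree_smult_le] degree_diff_le)
qed

lemma word_coeff_current_beta:
  "word_coeff (current_beta m) w = (case w of [a, b] \<Rightarrow> 
     if a + b < 0 then mps_const (coeff (cb m) (nat (- (a + b))) * (sg b / 4)) else 0 | _ \<Rightarrow> 0)"
proof -
  let ?F = "\<lambda>k. word_coeff (coeff (cb m) k \<bullet> current (int k)) w"
  have 0: "mps_sum (\<lambda>i. 0) = (0 :: qb mps)" by (rule mps_eqI) (simp add: mps_coeff_sum_any)
  have eq: "word_coeff (current_beta m) w = mps_sum ?F"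
    unfolding current_beta_def word_coeff_fsum cb_def ..
  show ?thesis
  proof (cases "\<exists>a b. w = [a, b] \<and> a + b < 0")
    case True
    then obtain a b where w: "w = [a, b]" "a + b < 0" by blast
    have "mps_sum ?F = ?F (nat (- (a + b)))"
      by (rule mps_sum_single) (use w in \<open>auto simp: word_coeff_fscale word_coeff_current\<close>)
    also have "\<dots> = mps_const (coeff (cb m) (nat (- (a + b))) * (sg b / 4))"
      using w by (simp add: word_coeff_fscale word_coeff_current flip: mps_const_hom(5))
    finally have *: "mps_sum ?F = mps_const (coeff (cb m) (nat (- (a + b))) * (sg b / 4))" .
    show ?thesis unfolding eq * using w by simp
  next
    case False
    have "?F k = 0" for k
      using False by (cases "k = 0") (auto simp: word_coeff_fscale word_coeff_current cb_even mps_const_hom split: list.splits)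
    thus ?thesis using False by (auto simp: eq 0 split: list.splits)
  qed
qed

text \<open>The coefficient of b_k when the Hamiltonian is collected by currents. Its x-degree is at
  least k because \<open>cb n\<close> has degree at most n.\<close>

definition hh :: "nat \<Rightarrow> qb mps" where
  "hh k = psum (\<lambda>n. 2 / of_nat n * coeff (cb n) k)"

lemma hh_even: "even k \<Longrightarrow> hh k = 0"
  by (rule mps_eqI) (simp add: hh_def psum_coeff cb_even)

lemma hh_degree: "mps_coeff (hh k) m \<noteq> 0 \<Longrightarrow> k \<le> mdeg m"
  using degree_cb[of "mdeg m"] le_degree[of "cb (mdeg m)" k] by (auto simp: hh_def psum_coeff split: if_splits)

lemma word_coeff_hamiltonian:
  "word_coeff hamiltonian w = (case w of [a, b] \<Rightarrow>
     if a + b < 0 then mps_const (sg b / 4) * hh (nat (- (a + b))) else 0 | _ \<Rightarrow> 0)"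
proof -
  have 0: "mps_sum (\<lambda>i. 0) = (0 :: qb mps)" by (rule mps_eqI) (simp add: mps_coeff_sum_any)
  let ?F = "\<lambda>n::nat. word_coeff (if n \<ge> 1 then fscale (mps_const (2 / of_nat n) * power_sum n) (current_beta n) else 0) w"
  have eq: "word_coeff hamiltonian w = mps_sum ?F"
    unfolding hamiltonian_def word_coeff_fsum ..
  show ?thesis
  proof (cases "\<exists>a b. w = [a, b] \<and> a + b < 0")
    case True
    then obtain a b where w: "w = [a, b]" "a + b < 0" by blast
    define k where "k = nat (- (a + b))"
    have "?F n = (if n \<ge> 1 then mps_const (sg b / 4 * (2 / of_nat n * coeff (cb n) k)) * power_sum n else 0)" for n
    proof -
      have "sg b / 4 * (2 / of_nat n * coeff (cb n) k) = 2 / of_nat n * (coeff (cb n) k * (sg b / 4))"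
        by simp
      hence "mps_const (sg b / 4 * (2 / of_nat n * coeff (cb n) k)) =
          mps_const (2 / of_nat n) * mps_const (coeff (cb n) k * (sg b / 4))"
        by (simp only: mps_const_hom(5))
      thus ?thesis using w by (simp add: word_coeff_fscale word_coeff_current_beta zero_wser.rep_eq k_def mult_ac)
    qed
    hence "mps_sum ?F = psum (\<lambda>n. sg b / 4 * (2 / of_nat n * coeff (cb n) k))"
      by (simp only: psum_eq_mps_sum)
    also have "\<dots> = mps_const (sg b / 4) * hh k"
      by (rule mps_eqI) (simp add: psum_coeff hh_def)
    finally have *: "mps_sum ?F = mps_const (sg b / 4) * hh k" .
    show ?thesis unfolding eq * using w by (simp add: k_def)
  next
    case False
    hence "?F n = 0" for n
      by (auto simp: word_coeff_fscale word_coeff_current_beta zero_wser.rep_eq split: list.splits)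
    thus ?thesis using False by (auto simp: eq 0 split: list.splits)
  qed
qed

lemma inverse_fact_binomial:
  "j \<le> n \<Longrightarrow> (1 / fact n) * of_nat (n choose j) = (1 / fact j) * (1 / fact (n - j) :: 'a::field_char_0)"
  by (simp add: binomial_fact)

text \<open>The weights of H and \<Theta> are divided by 4, here and in \<open>sT\<close>, since
  \<open>bop\<close> is four times a current.\<close>

definition sH :: "qb mps fps" where
  "sH = Abs_fps (\<lambda>k. mps_const (1 / 4) * hh k)"

definition sT :: "qb fps" where
  "sT = Abs_fps (\<lambda>n. if odd n then (bet / 2) ^ n / (2 * of_nat n) else 0)"

lemma sH_nth: "sH $ k = mps_const (1 / 4) * hh k"
  by (simp add: sH_def)

lemma sT_nth: "sT $ n = (if odd n then (bet / 2) ^ n / (2 * of_nat n) else 0)"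
  by (simp add: sT_def)

interpretation H: quadratic "-1" sH "\<lambda>k. mps_const (1 / fact k :: qb)"
proof
  fix j n :: nat assume "j \<le> n"
  thus "mps_const (1 / fact n :: qb) * of_nat (n choose j) = mps_const (1 / fact j) * mps_const (1 / fact (n - j))"
    by (simp only: mps_const_of_nat[symmetric] mps_const_hom[symmetric] inverse_fact_binomial)
qed (auto simp: sH_def hh_even)

interpretation T: quadratic 1 sT "\<lambda>k. 1 / fact k :: qb"
  by standard (auto simp: sT_def binomial_fact)

lemma sg_const: "mps_const (sg b :: qb) = sg b"
  by (simp add: sg_def mps_const_hom)

lemma hamiltonian_eq: "hamiltonian = H.quad"
proof (rule wser_eqI)
  fix w
  have "mps_const (sg b / 4 :: qb) = mps_const (1 / 4) * sg b" for b
    by (simp flip: sg_const mps_const_hom)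
  thus "word_coeff hamiltonian w = word_coeff H.quad w"
    by (auto simp: word_coeff_hamiltonian H.word_coeff_quad sH_nth split: list.splits)
qed

lemma word_coeff_fexp_single:
  assumes "\<And>k. word_coeff (F ^ k) w \<noteq> 0 \<Longrightarrow> length w = 2 * k"
  shows "word_coeff (fexp F) w = mps_const (1 / fact (length w div 2)) * word_coeff (F ^ (length w div 2)) w"
proof -
  have "word_coeff (fexp F) w = mps_sum (\<lambda>k. mps_const (1 / fact k) * word_coeff (F ^ k) w)"
    by (simp add: fexp_def word_coeff_fsum word_coeff_fscale)
  also have "\<dots> = mps_const (1 / fact (length w div 2)) * word_coeff (F ^ (length w div 2)) w"
  proof (rule mps_sum_single)
    fix k assume "k \<noteq> length w div 2"
    hence "word_coeff (F ^ k) w = 0" using assms[of k] by fastforce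
    thus "mps_const (1 / fact k) * word_coeff (F ^ k) w = 0" by simp
  qed
  finally show ?thesis .
qed

lemma fexp_hamiltonian: "fexp hamiltonian = H.wexp"
  by (rule wser_eqI, subst word_coeff_fexp_single)
    (use H.quad_pow_nonzeroD in \<open>auto simp: hamiltonian_eq H.word_coeff_wexp\<close>)

text \<open>\<Theta> and the fermions have coefficients free of x; keeping them over the ground
  field lets them act on each x-coefficient of a functional separately.\<close>

definition wconst :: "qb wser \<Rightarrow> fseries" where
  "wconst A = Abs_wser (\<lambda>w. mps_const (word_coeff A w))"

lemma word_coeff_wconst: "word_coeff (wconst A) w = mps_const (word_coeff A w)"
  by (simp add: wconst_def)

lemma wconst_mult: "wconst (A * B) = wconst A * wconst B"
proof (rule wser_eqI)
  fix w
  have "conv_set (@) (word_coeff (wconst A)) (word_coeff (wconst B)) w = conv_set (@) (word_coeff A) (word_coeff B) w"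
    by (simp add: conv_set_def word_coeff_wconst)
  thus "word_coeff (wconst (A * B)) w = word_coeff (wconst A * wconst B) w"
    unfolding word_coeff_wconst word_coeff_mult
    by (simp add: mps_const_sum mps_const_hom case_prod_unfold)
qed

lemma wconst_1: "wconst 1 = 1"
  by (rule wser_eqI) (simp add: word_coeff_wconst one_wser.rep_eq mps_const_hom)

lemma wconst_power: "wconst (A ^ k) = wconst A ^ k"
  by (induction k) (simp_all add: wconst_1 wconst_mult)

lemma wconst_prod_list: "wconst (prod_list As) = prod_list (map wconst As)"
  by (induction As) (simp_all add: wconst_1 wconst_mult)

lemma Theta_eq: "Theta = wconst T.quad"
proof (rule wser_eqI)
  fix w
  have 0: "mps_sum (\<lambda>i. 0) = (0 :: qb mps)" by (rule mps_eqI) (simp add: mps_coeff_sum_any)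
  let ?F = "\<lambda>n::nat. word_coeff (if odd n then (2 * (bet / 2) ^ n / of_nat n) \<bullet> current (- int n) else 0) w"
  have eq: "word_coeff Theta w = mps_sum ?F"
    unfolding Theta_def word_coeff_fsum ..
  show "word_coeff Theta w = word_coeff (wconst T.quad) w"
  proof (cases "\<exists>a b. w = [a, b] \<and> a + b > 0")
    case True
    then obtain a b where w: "w = [a, b]" "a + b > 0" by blast
    have "mps_sum ?F = ?F (nat (a + b))"
      by (rule mps_sum_single) (use w in \<open>auto simp: word_coeff_fscale word_coeff_current zero_wser.rep_eq\<close>)
    also have "\<dots> = word_coeff (wconst T.quad) w"
      using w by (simp add: word_coeff_wconst T.word_coeff_quad word_coeff_fscale word_coeff_current
        zero_wser.rep_eq sT_nth mps_const_hom(1) mult_ac flip: mps_const_hom(5))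
    finally show ?thesis by (simp add: eq)
  next
    case False
    hence "?F n = 0" for n
      by (cases "n = 0") (auto simp: word_coeff_fscale word_coeff_current zero_wser.rep_eq split: list.splits)
    thus ?thesis using False by (auto simp: eq 0 word_coeff_wconst T.word_coeff_quad mps_const_hom split: list.splits)
  qed
qed

lemma fexp_Theta: "fexp Theta = wconst T.wexp"
proof (rule wser_eqI)
  fix w
  show "word_coeff (fexp Theta) w = word_coeff (wconst T.wexp) w"
    by (subst word_coeff_fexp_single)
      (use T.quad_pow_nonzeroD in \<open>auto simp: Theta_eq T.word_coeff_wexp word_coeff_wconst simp flip: wconst_power mps_const_hom(5)\<close>)
qed

definition Psi :: "'a fps \<Rightarrow> 'a::comm_ring_1 wser" where
  "Psi f = Abs_wser (\<lambda>w. case w of [a] \<Rightarrow> if a \<ge> 0 then f $ nat a else 0 | _ \<Rightarrow> 0)"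

lemma word_coeff_Psi: "word_coeff (Psi f) w = (case w of [a] \<Rightarrow> if a \<ge> 0 then f $ nat a else 0 | _ \<Rightarrow> 0)"
  by (simp add: Psi_def)

definition phi_fps :: "nat \<Rightarrow> qb fps" where
  "phi_fps n = Abs_fps (\<lambda>m. coeff ([:bet / 2, 1:] ^ m) n)"

definition Phi_fps :: "nat \<Rightarrow> qb fps" where
  "Phi_fps l = Abs_fps (\<lambda>m. \<Sum>k\<le>m. 1 / 2 * (- bet / 2) ^ k * coeff ([:bet / 2, 1:] ^ m) (l + k))"

lemma phi_beta_eq: "phi_beta n = wconst (Psi (phi_fps n))"
proof (rule wser_eqI)
  fix w
  have 0: "mps_sum (\<lambda>i. 0) = (0 :: qb mps)" by (rule mps_eqI) (simp add: mps_coeff_sum_any)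
  let ?F = "\<lambda>m. word_coeff (coeff ([:bet / 2, 1:] ^ m) n \<bullet> phi (int m)) w"
  have eq: "word_coeff (phi_beta n) w = mps_sum ?F"
    unfolding phi_beta_def word_coeff_fsum ..
  have F: "?F m = (if w = [int m] then mps_const (coeff ([:bet / 2, 1:] ^ m) n) else 0)" for m
    by (simp add: word_coeff_fscale word_coeff_phi)
  show "word_coeff (phi_beta n) w = word_coeff (wconst (Psi (phi_fps n))) w"
  proof (cases "\<exists>m. w = [int m]")
    case True
    then obtain m where w: "w = [int m]" by blast
    have "mps_sum ?F = ?F m" unfolding F by (rule mps_sum_single) (simp add: w)
    thus ?thesis unfolding eq F by (simp add: w word_coeff_wconst word_coeff_Psi phi_fps_def)
  next
    case False
    have "word_coeff (Psi (phi_fps n)) w = 0"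
      using False nonneg_int_cases by (auto simp: word_coeff_Psi split: list.splits)
    thus ?thesis unfolding eq F using False by (simp add: 0 word_coeff_wconst mps_const_hom)
  qed
qed

lemma degree_linear_power: "coeff ([:c, 1 :: 'a::comm_ring_1:] ^ m) k = 0" if "k > m"
  using that degree_power_le[of "[:c, 1:]" m] degree_pCons_le[of c "[:1:]"]
  by (intro coeff_eq_0) (auto simp: order.strict_trans1)

lemma Phi_beta_eq: "Phi_beta l = wconst (Psi (Phi_fps l))"
proof (rule wser_eqI)
  fix w
  let ?c = "\<lambda>k. 1 / 2 * (- bet / 2) ^ k * word_coeff (Psi (phi_fps (l + k))) w"
  have "word_coeff (Phi_beta l) w = mps_sum (\<lambda>k. mps_const (?c k))"
    unfolding Phi_beta_def word_coeff_fsum word_coeff_fscale phi_beta_eq word_coeff_wconst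
    by (simp only: mps_const_hom)
  also have "\<dots> = mps_const (Sum_any ?c)" by (rule mps_sum_const)
  also have "Sum_any ?c = word_coeff (Psi (Phi_fps l)) w"
  proof (cases "\<exists>m. w = [int m]")
    case True
    then obtain m where w: "w = [int m]" by blast
    have "Sum_any ?c = (\<Sum>k\<le>m. ?c k)"
    proof (rule Sum_any.expand_superset)
      show "{k. ?c k \<noteq> 0} \<subseteq> {..m}"
        using degree_linear_power[of m _ "bet / 2"]
        by (auto simp: w word_coeff_Psi phi_fps_def) (meson not_le_imp_less trans_less_add2)
    qed simp
    thus ?thesis by (simp add: w word_coeff_Psi phi_fps_def Phi_fps_def)
  next
    case False
    have "word_coeff (Psi f) w = 0" for f :: "qb fps"
      using False nonneg_int_cases by (auto simp: word_coeff_Psi split: list.splits)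
    thus ?thesis by simp
  qed
  finally show "word_coeff (Phi_beta l) w = word_coeff (wconst (Psi (Phi_fps l))) w"
    by (simp add: word_coeff_wconst)
qed

definition ket_fps :: "nat list \<Rightarrow> qb fps list" where
  "ket_fps lam = map Phi_fps lam @ (if even (length lam) then [] else [phi_fps 0])"

lemma even_length_ket_fps: "even (length (ket_fps lam))"
  by (simp add: ket_fps_def)

lemma ket_P_eq: "ket_P lam = wconst (prod_list (map (\<lambda>f. Psi f * T.wexp) (ket_fps lam)))"
  unfolding ket_P_def ket_fps_def wconst_prod_list
  by (simp add: Phi_beta_eq phi_beta_eq fexp_Theta wconst_mult comp_def)


section \<open>The functional \<open>\<langle>0|e\<^sup>H\<close>\<close>

text \<open>A lower bound for the x-degree. The bound is an integer so that the energy
  \<open>sum_list w\<close> can be used directly; negative bounds are vacuous.\<close>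

definition ord :: "int \<Rightarrow> 'a::comm_ring_1 mps \<Rightarrow> bool" where
  "ord d f \<longleftrightarrow> (\<forall>m. mps_coeff f m \<noteq> 0 \<longrightarrow> d \<le> int (mdeg m))"

lemma ord_zero [simp]: "ord d 0"
  by (simp add: ord_def)

lemma ord_sum: "(\<And>i. i \<in> I \<Longrightarrow> ord d (f i)) \<Longrightarrow> ord d (\<Sum>i\<in>I. f i)"
  unfolding ord_def mps_coeff_sum by (meson sum.not_neutral_contains_not_neutral)

lemma splits_mdeg: "(a, b) \<in> splits m \<Longrightarrow> mdeg m = mdeg a + mdeg b"
  by (auto simp: splits_def mdeg_add)

lemma ord_mult:
  assumes "ord d f" "ord e g"
  shows "ord (d + e) (f * g)"
  unfolding ord_def
proof (intro allI impI)
  fix m assume "mps_coeff (f * g) m \<noteq> 0"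
  then obtain a b where ab: "(a, b) \<in> splits m" "mps_coeff f a * mps_coeff g b \<noteq> 0"
    unfolding mps_coeff_mult by (elim sum.not_neutral_contains_not_neutral) auto
  hence "mps_coeff f a \<noteq> 0" "mps_coeff g b \<noteq> 0" by auto
  with assms have "d \<le> int (mdeg a)" "e \<le> int (mdeg b)" by (auto simp: ord_def)
  thus "d + e \<le> int (mdeg m)" using splits_mdeg[OF ab(1)] by simp
qed

lemma ord_nonpos: "d \<le> 0 \<Longrightarrow> ord d f"
  by (auto simp: ord_def)

lemma ord_scale: "ord d f \<Longrightarrow> ord d (c * f)"
  using ord_mult[OF ord_nonpos[of 0 c], of d f] by simp

lemma ord_hh: "ord (int k) (hh k)"
  using hh_degree by (auto simp: ord_def)

lemma ord_power: "ord d f \<Longrightarrow> ord (int k * d) (f ^ k)"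
proof (induction k)
  case (Suc k)
  show ?case using ord_mult[OF Suc.prems Suc.IH[OF Suc.prems]] by (simp add: algebra_simps)
qed (simp add: ord_nonpos)

lemma ord_bop:
  assumes "bra G" "k \<noteq> 0" "\<And>w. ord (sum_list w) (G w)"
  shows "ord (k + sum_list w) (bop k G w)"
proof -
  have "ord (k + sum_list w) (sg i * G ([k - i, i] @ w))" for i
    using assms(3)[of "[k - i, i] @ w"] by (intro ord_scale) simp
  thus ?thesis by (subst bop_interval[OF assms(1,2) order.refl]) (intro ord_sum)
qed

lemma bop_cong: "(\<And>i. G ([k - i, i] @ w) = G' ([k - i, i] @ w)) \<Longrightarrow> bop k G w = bop k G' w"
  by (simp add: bop_def)

context quadratic
begin

lemma bra_eop:
  assumes "bb D G"
  shows "bra (eop G)"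
proof (rule bra_local)
  fix W :: "int list set" assume W: "finite W"
  define N where "N = nat (\<Sum>w\<in>W. \<bar>D - eps * sum_list w\<bar>)"
  have N: "int N \<ge> D - eps * sum_list w" if "w \<in> W" for w
    using member_le_sum[of w W "\<lambda>w. \<bar>D - eps * sum_list w\<bar>"] that W by (simp add: N_def)
  have "bra (\<lambda>w. \<Sum>n\<le>N. iv n * (qop ^^ n) G w)"
    by (intro bra_sum bra_scale bbD(1)[OF bb_qop_pow[OF assms]])
  thus "\<exists>H. bra H \<and> (\<forall>w\<in>W. eop G w = H w)"
    using eop_eq[OF assms N] by blast
qed

lemma eop_bound:
  assumes "bb D G" "eps * sum_list w > D"
  shows "eop G w = 0"
proof -
  have "(qop ^^ n) G w = 0" for n
    using bbD(2)[OF bb_qop_pow[OF assms(1)], of n w] assms(2) by simp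
  thus ?thesis by (simp add: eop_def)
qed

text \<open>The coefficient of phi_M in e^q phi_a e^{-q}, where q is the quadratic operator.\<close>

definition itm :: "int \<Rightarrow> int \<Rightarrow> 'a" where
  "itm a M = (if eps * a \<le> eps * M then es $ nat (eps * (M - a)) else 0)"

text \<open>After passing all letters by \<open>eop_Cons\<close>, the exponential stands next to
  |0>. For \<open>eps = -1\<close> it consists of lowering operators, which annihilate |0>, so it
  acts there as 1.\<close>

lemma eop_lin:
  assumes "eps = -1" "bb D G" "K \<ge> D + (\<Sum>a\<leftarrow>w. \<bar>a\<bar>)" "\<And>a. a \<in> set w \<Longrightarrow> \<bar>a\<bar> \<le> K" "iv 0 = 1"
  shows "eop G w = lin {-K..K} (map itm w) G"
  using assms(2-4)
proof (induction w arbitrary: D G)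
  case Nil
  have "eop G [] = (\<Sum>n\<le>nat D. iv n * (qop ^^ n) G [])"
    by (rule eop_eq[OF Nil.prems(1)]) simp
  also have "\<dots> = (\<Sum>n\<in>{0}. iv n * (qop ^^ n) G [])"
  proof (rule sum.mono_neutral_right)
    have "(qop ^^ n) G [] = 0" if pos: "n > 0" for n
    proof -
      obtain n' where n: "n = Suc n'" using pos gr0_implies_Suc by blast
      have bra: "bra ((qop ^^ n') G)" by (rule bbD(1)[OF bb_qop_pow[OF Nil.prems(1)]])
      have "bop (eps * int k) ((qop ^^ n') G) [] = 0" if "k > 0" for k
        using bra_negative'[OF bra, of "[eps * int k - i, i]" for i] that assms(1) by (simp add: bop_def)
      hence "s $ k * bop (eps * int k) ((qop ^^ n') G) [] = 0" for k
        by (cases "k = 0") auto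
      thus ?thesis by (simp add: n qop_def)
    qed
    thus "\<forall>n\<in>{..nat D} - {0}. iv n * (qop ^^ n) G [] = 0" by simp
  qed auto
  finally show ?case by (simp add: assms(5))
next
  case (Cons a w)
  define N where "N = nat (D + a + sum_list w)"
  let ?h = "\<lambda>M. eop (\<lambda>v. G (M # v)) w"
  have h0: "?h M = 0" if "M < - D - sum_list w" for M
    using that assms(1) by (intro eop_bound[OF bb_Cons[OF Cons.prems(1)]]) simp
  have le: "eps * a \<le> eps * M \<longleftrightarrow> M \<le> a" for M using assms(1) by simp
  have sl: "\<bar>sum_list w\<bar> \<le> (\<Sum>a\<leftarrow>w. \<bar>a\<bar>)"
    by (induction w) auto
  have "eop G (a # w) = (\<Sum>n\<le>N. es $ n * ?h (a + eps * int n))"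
    by (rule eop_Cons[OF Cons.prems(1)]) (simp add: assms(1) N_def)
  also have "\<dots> = (\<Sum>M\<in>(\<lambda>n. a + eps * int n) ` {..N}. itm a M * ?h M)"
  proof -
    have "itm a (a + eps * int n) = es $ n" for n by (simp add: itm_def distrib_left)
    moreover have "inj_on (\<lambda>n. a + eps * int n) {..N}" using eps by (auto simp: inj_on_def)
    ultimately show ?thesis by (simp add: sum.reindex)
  qed
  \<comment> \<open>The index set is replaced by an interval common to all letters: above
    \<open>a\<close> the coefficient \<open>itm\<close> is zero, and far below it \<open>h0\<close>
    applies.\<close>
  also have "\<dots> = (\<Sum>M\<in>(\<lambda>n. a + eps * int n) ` {..N} \<union> {-K..K}. itm a M * ?h M)"
  proof (rule sum.mono_neutral_left)
    show "\<forall>M\<in>(\<lambda>n. a + eps * int n) ` {..N} \<union> {-K..K} - (\<lambda>n. a + eps * int n) ` {..N}. itm a M * ?h M = 0"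
    proof
      fix M assume M: "M \<in> (\<lambda>n. a + eps * int n) ` {..N} \<union> {-K..K} - (\<lambda>n. a + eps * int n) ` {..N}"
      show "itm a M * ?h M = 0"
      proof (cases "M \<le> a \<and> M \<ge> - D - sum_list w")
        case True
        hence "M = a + eps * int (nat (a - M))" "nat (a - M) \<le> N" by (auto simp: assms(1) N_def)
        with M show ?thesis by blast
      qed (use h0[of M] in \<open>auto simp: itm_def le\<close>)
    qed
  qed auto
  also have "\<dots> = (\<Sum>M\<in>{-K..K}. itm a M * ?h M)"
  proof (rule sum.mono_neutral_right)
    show "\<forall>M\<in>(\<lambda>n. a + eps * int n) ` {..N} \<union> {-K..K} - {-K..K}. itm a M * ?h M = 0"
    proof
      fix M assume M: "M \<in> (\<lambda>n. a + eps * int n) ` {..N} \<union> {-K..K} - {-K..K}"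
      hence "M \<le> a" by (auto simp: assms(1))
      moreover have "a \<le> K" using Cons.prems(3)[of a] by simp
      ultimately have "M < - K" using M by auto
      hence "M < - D - sum_list w" using Cons.prems(2) sl by simp
      thus "itm a M * ?h M = 0" by (simp add: h0)
    qed
  qed auto
  also have "\<dots> = (\<Sum>M\<in>{-K..K}. itm a M * lin {-K..K} (map itm w) (\<lambda>v. G (M # v)))"
  proof (intro sum.cong refl)
    fix M assume "M \<in> {-K..K}"
    show "itm a M * ?h M = itm a M * lin {-K..K} (map itm w) (\<lambda>v. G (M # v))"
    proof (cases "M \<le> a")
      case True
      have "?h M = lin {-K..K} (map itm w) (\<lambda>v. G (M # v))"
        by (rule Cons.IH[OF bb_Cons[OF Cons.prems(1)]]) (use True Cons.prems assms(1) in auto)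
      thus ?thesis by simp
    qed (simp add: itm_def le)
  qed
  finally show ?case by simp
qed

end

lemma mps_vac: "(vac w :: qb mps) = mps_const (vac w)"
proof (induction "length w" arbitrary: w rule: less_induct)
  case less
  have ct: "(ct a b :: qb mps) = mps_const (ct a b)" for a b
    by (simp add: ct_def mps_const_hom mps_const_numeral sg_def)
  show ?case
  proof (cases w)
    case (Cons a v)
    have "(vac (take j v @ drop (Suc j) v) :: qb mps) = mps_const (vac (take j v @ drop (Suc j) v))"
      if "j < length v" for j using that Cons by (intro less) auto
    thus ?thesis
      by (simp add: Cons pf.simps(2) ct mps_const_sum mps_const_hom mps_const_power)
  qed (simp add: mps_const_hom)
qed

lemma bb_vac: "H.bb 0 vac"
  using vac_energy by (force simp: H.bb_def bra_vac)

lemma vac_upper: "sum_list w > 0 \<Longrightarrow> vac w = (0 :: 'a::comm_ring_1)"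
  using vac_energy[of w, where 'a = 'a] by force

definition GH :: "int list \<Rightarrow> qb mps" where
  "GH = H.eop vac"

lemma act_vac_fexp_hamiltonian: "act vac (fexp hamiltonian) w = GH w"
  unfolding GH_def fexp_hamiltonian by (rule H.act_wexp[OF bb_vac vac_upper])

lemma bra_GH: "bra GH"
  unfolding GH_def by (rule H.bra_eop[OF bb_vac])

lemma bb_qop_pow_vac: "H.bb (- int k) ((H.qop ^^ k) vac)"
  using H.bb_qop_pow[OF bb_vac, of k] by simp

text \<open>Each b_n in H has a coefficient of x-degree at least n, so every unit of energy carried
  by the word is paid for by a degree in x.\<close>

lemma ord_qop_pow: "ord (sum_list w) ((H.qop ^^ k) vac w)"
proof (induction k arbitrary: w)
  case 0
  show ?case using vac_energy[of w, where 'a = "qb mps"] by (cases "vac w = (0 :: qb mps)") (auto intro: ord_nonpos)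
next
  case (Suc k)
  have "ord (sum_list w) (sH $ n * bop (-1 * int n) ((H.qop ^^ k) vac) w)" for n
  proof (cases "n = 0")
    case False
    have "ord (int n) (sH $ n)" unfolding sH_nth by (intro ord_scale ord_hh)
    moreover have "ord (-1 * int n + sum_list w) (bop (-1 * int n) ((H.qop ^^ k) vac) w)"
      by (rule ord_bop) (use False Suc H.bbD(1)[OF bb_qop_pow_vac] in auto)
    ultimately have "ord (int n + (-1 * int n + sum_list w)) (sH $ n * bop (-1 * int n) ((H.qop ^^ k) vac) w)"
      by (rule ord_mult)
    thus ?thesis by simp
  qed simp
  moreover have "(H.qop ^^ Suc k) vac w = (\<Sum>n\<le>nat (- int k + sum_list w). sH $ n * bop (-1 * int n) ((H.qop ^^ k) vac) w)"
    unfolding funpow.simps comp_def by (rule H.qop_eq[OF bb_qop_pow_vac]) simp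
  ultimately show ?case by (simp add: ord_sum)
qed

lemma GH_eq: "int N \<ge> sum_list w \<Longrightarrow> GH w = (\<Sum>k\<le>N. mps_const (1 / fact k) * (H.qop ^^ k) vac w)"
  unfolding GH_def by (rule H.eop_eq[OF bb_vac]) simp

lemma ord_GH: "ord (sum_list w) (GH w)"
proof -
  have "sum_list w \<le> int (nat (sum_list w))" by simp
  from GH_eq[OF this] show ?thesis by (simp add: ord_sum ord_scale ord_qop_pow)
qed

text \<open>By \<open>heisenberg\<close> only the summand k = n of the Hamiltonian fails to commute,
  and its commutator is a scalar.\<close>

lemma bop_qop:
  assumes "H.bb D G" "odd n"
  shows "bop (int n) (H.qop G) w = H.qop (bop (int n) G) w + 8 * of_nat n * sH $ n * G w"
proof -
  have bra: "bra G" by (rule H.bbD(1)[OF assms(1)])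
  have n: "int n \<noteq> 0" using assms(2) by (auto dest: odd_pos)
  define N where "N = nat (D + int n + sum_list w) + n"
  let ?J = "{k. k \<le> N \<and> odd k}"
  have qop: "H.qop G' v = (\<Sum>k\<in>?J. sH $ k * bop (- int k) G' v)" if "H.bb D' G'" "int N \<ge> D' + sum_list v" for G' v D'
  proof -
    have "H.qop G' v = (\<Sum>k\<le>N. sH $ k * bop (-1 * int k) G' v)"
      by (rule H.qop_eq[OF that(1)]) (use that(2) in simp)
    also have "\<dots> = (\<Sum>k\<in>?J. sH $ k * bop (- int k) G' v)"
      by (rule sum.mono_neutral_cong_right) (auto simp: sH_nth hh_even)
    finally show ?thesis .
  qed
  have "bop (int n) (H.qop G) w = bop (int n) (\<lambda>v. \<Sum>k\<in>?J. sH $ k * bop (- int k) G v) w"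
    by (rule bop_cong, rule qop[OF assms(1)]) (simp add: N_def)
  also have "\<dots> = (\<Sum>k\<in>?J. sH $ k * bop (int n) (bop (- int k) G) w)"
    by (rule bop_sum[OF _ n]) (use bra in \<open>auto intro!: bra_bop dest: odd_pos\<close>)
  also have "\<dots> = (\<Sum>k\<in>?J. sH $ k * bop (- int k) (bop (int n) G) w
      + (if k = n then sH $ n * (8 * of_nat n * G w) else 0))"
    by (intro sum.cong refl) (auto simp: heisenberg[OF bra _ assms(2)] distrib_left)
  also have "\<dots> = (\<Sum>k\<in>?J. sH $ k * bop (- int k) (bop (int n) G) w) + sH $ n * (8 * of_nat n * G w)"
    using assms(2) by (simp add: sum.distrib N_def)
  also have "(\<Sum>k\<in>?J. sH $ k * bop (- int k) (bop (int n) G) w) = H.qop (bop (int n) G) w"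
  proof (rule qop[symmetric])
    show "H.bb (D + int n) (bop (int n) G)"
      unfolding H.bb_def
    proof (intro conjI allI impI bra_bop[OF bra n])
      fix v assume "D + int n < -1 * sum_list v"
      hence "G ([int n - i, i] @ v) = 0" for i
        by (intro H.bbD(2)[OF assms(1)]) simp
      thus "bop (int n) G v = 0" by (simp add: bop_def)
    qed
  qed (simp add: N_def)
  finally show ?thesis by (simp add: mult_ac)
qed

text \<open>The power rule for a derivation: the commutator with \<open>qop\<close> is the scalar 8
  n s_n, and the starting functional is annihilated by \<open>bop_vac\<close>.\<close>

lemma bop_qop_pow:
  assumes "odd n"
  shows "bop (int n) ((H.qop ^^ k) vac) w = of_nat k * (8 * of_nat n * sH $ n) * (H.qop ^^ (k - 1)) vac w"
proof (induction k arbitrary: w)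
  case 0
  show ?case by (simp add: bop_vac[OF assms])
next
  case (Suc k)
  let ?c = "8 * of_nat n * sH $ n"
  have "bop (int n) ((H.qop ^^ Suc k) vac) w = H.qop (bop (int n) ((H.qop ^^ k) vac)) w + ?c * (H.qop ^^ k) vac w"
    unfolding funpow.simps comp_def by (rule bop_qop[OF bb_qop_pow_vac assms])
  also have "bop (int n) ((H.qop ^^ k) vac) = (\<lambda>w. of_nat k * ?c * (H.qop ^^ (k - 1)) vac w)"
    by (rule ext, rule Suc)
  also have "H.qop \<dots> w = of_nat k * ?c * H.qop ((H.qop ^^ (k - 1)) vac) w"
    using H.qop_sum[of "{()}" _ "\<lambda>_. (H.qop ^^ (k - 1)) vac" "\<lambda>_. of_nat k * ?c" w, OF bb_qop_pow_vac] by simp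
  also have "\<dots> = of_nat k * ?c * (H.qop ^^ k) vac w"
    by (cases k) auto
  finally show ?case by (simp add: algebra_simps)
qed

lemma bop_GH:
  assumes "odd n"
  shows "bop (int n) GH w = 2 * of_nat n * hh n * GH w"
proof -
  have n: "int n \<noteq> 0" using assms by (auto dest: odd_pos)
  define N where "N = nat (int n + sum_list w)"
  let ?c = "8 * of_nat n * sH $ n"
  have N: "sum_list w \<le> int N" using assms by (simp add: N_def)
  \<comment> \<open>With the upper limit \<open>Suc N\<close>, lowering the power by one leaves the
    exponential series up to \<open>N\<close>.\<close>
  have "bop (int n) GH w = bop (int n) (\<lambda>v. \<Sum>k\<le>Suc N. mps_const (1 / fact k) * (H.qop ^^ k) vac v) w"
    by (rule bop_cong, rule GH_eq) (simp add: N_def)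
  also have "\<dots> = (\<Sum>k\<le>Suc N. mps_const (1 / fact k) * bop (int n) ((H.qop ^^ k) vac) w)"
    by (rule bop_sum[OF _ n]) (rule H.bbD(1)[OF bb_qop_pow_vac])
  also have "\<dots> = (\<Sum>k\<le>N. ?c * (mps_const (1 / fact k) * (H.qop ^^ k) vac w))"
  proof -
    have iv: "mps_const (1 / fact (Suc k)) * of_nat (Suc k) = mps_const (1 / fact k :: qb)" for k
      by (simp del: of_nat_Suc flip: mps_const_of_nat mps_const_hom(5))
    hence "mps_const (1 / fact (Suc k)) * (of_nat (Suc k) * ?c * x) = ?c * (mps_const (1 / fact k :: qb) * x)" for k and x :: "qb mps"
    proof -
      fix k x
      have "mps_const (1 / fact (Suc k)) * (of_nat (Suc k) * ?c * x) =
          ?c * ((mps_const (1 / fact (Suc k)) * of_nat (Suc k)) * x)" by (simp only: mult_ac)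
      thus "mps_const (1 / fact (Suc k)) * (of_nat (Suc k) * ?c * x) = ?c * (mps_const (1 / fact k :: qb) * x)"
        by (simp only: iv)
    qed
    thus ?thesis
      unfolding bop_qop_pow[OF assms] sum.atMost_Suc_shift diff_Suc_1 by (simp del: of_nat_Suc fact_Suc)
  qed
  also have "\<dots> = ?c * GH w"
    unfolding GH_eq[OF N] by (simp add: sum_distrib_left)
  also have "?c = 2 * of_nat n * hh n"
  proof -
    have "(8 :: qb mps) * mps_const (1 / 4) = 2"
      by (simp flip: mps_const_numeral mps_const_hom(5))
    thus ?thesis by (simp add: sH_nth mult_ac)
  qed
  finally show ?thesis .
qed

section \<open>Wick's theorem for <0|e^H\<close>

definition ep :: "nat \<Rightarrow> 'a::comm_ring_1" where
  "ep p = (if p = 0 then 1 else 2 * (-1) ^ p)"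

definition qq :: "qb mps fps" where
  "qq = H.es"

text \<open>The two-point function <0| e^H phi_a phi_b |0>: conjugation by e^H spreads each letter
  with the coefficients \<open>qq\<close>, and \<open>ct\<close> pairs phi_{-p} with phi_p. The
  values \<open>ep\<close> of \<open>ct\<close> are also the coefficients of (1 - t) / (1 + t),
  through which the factors (\<zeta>_i - \<zeta>_j) / (\<zeta>_i + \<zeta>_j) enter later.\<close>

definition ghat :: "nat \<Rightarrow> nat \<Rightarrow> qb mps" where
  "ghat a b = (\<Sum>p\<le>b. ep p * (qq $ (a + p) * qq $ (b - p)))"

lemma GH_pf: "GH (map int ns) = pf ghat ns"
proof -
  define K where "K = int (sum_list ns)"
  have "sum_list (map (\<lambda>a. \<bar>a\<bar>) (map int ns)) = K" unfolding K_def by (induction ns) auto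
  moreover have le: "int n \<le> K" if "n \<in> set ns" for n
    using member_le_sum_list[OF that] by (simp add: K_def)
  ultimately have "GH (map int ns) = lin {-K..K} (map H.itm (map int ns)) vac"
    unfolding GH_def by (intro H.eop_lin[OF _ bb_vac]) (auto simp: mps_const_hom)
  also have "\<dots> = pf (\<lambda>a b. \<Sum>M\<in>{-K..K}. \<Sum>N\<in>{-K..K}. H.itm (int a) M * H.itm (int b) N * ct M N) ns"
    by (simp add: lin_pf pf_map)
  also have "\<dots> = pf ghat ns"
  proof (rule pf_cong)
    fix a b assume "a \<in> set ns" "b \<in> set ns"
    have "(\<Sum>M\<in>{-K..K}. \<Sum>N\<in>{-K..K}. H.itm (int a) M * H.itm (int b) N * ct M N) =
        (\<Sum>(M, N)\<in>{-K..K} \<times> {-K..K}. H.itm (int a) M * H.itm (int b) N * ct M N)"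
      by (simp add: sum.cartesian_product)
    also have "\<dots> = (\<Sum>(M, N)\<in>(\<lambda>p. (- int p, int p)) ` {..b}. H.itm (int a) M * H.itm (int b) N * ct M N)"
    proof (rule sum.mono_neutral_right)
      show "(\<lambda>p. (- int p, int p)) ` {..b} \<subseteq> {-K..K} \<times> {-K..K}"
        using le[OF \<open>b \<in> set ns\<close>] by auto
      show "\<forall>x\<in>{-K..K} \<times> {-K..K} - (\<lambda>p. (- int p, int p)) ` {..b}.
          (case x of (M, N) \<Rightarrow> H.itm (int a) M * H.itm (int b) N * ct M N) = 0"
      proof clarify
        fix M N assume *: "(M, N) \<notin> (\<lambda>p. (- int p, int p)) ` {..b}"
        show "H.itm (int a) M * H.itm (int b) N * ct M N = 0"
        proof (rule ccontr)
          assume nz: "H.itm (int a) M * H.itm (int b) N * ct M N \<noteq> 0"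
          have "ct M N \<noteq> (0 :: qb mps)" using nz by auto
          hence "M = - N" "N \<ge> 0" by (auto simp: ct_def split: if_splits)
          moreover have "H.itm (int b) N \<noteq> 0" using nz by auto
          hence "N \<le> int b" by (auto simp: H.itm_def split: if_splits)
          ultimately have "(M, N) = (- int (nat N), int (nat N))" "nat N \<le> b" by auto
          with * show False by blast
        qed
      qed
    qed auto
    also have "\<dots> = (\<Sum>p\<le>b. H.itm (int a) (- int p) * H.itm (int b) (int p) * ct (- int p) (int p))"
      by (subst sum.reindex) (auto simp: inj_on_def)
    also have "\<dots> = ghat a b"
      unfolding ghat_def
    proof (intro sum.cong refl)
      fix p assume "p \<in> {..b}"
      hence "H.itm (int b) (int p) = qq $ (b - p)" by (simp add: H.itm_def qq_def nat_diff_distrib)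
      moreover have "H.itm (int a) (- int p) = qq $ (a + p)"
        by (simp add: H.itm_def qq_def flip: of_nat_add)
      moreover have "ct (- int p) (int p) = (ep p :: qb mps)"
        by (auto simp: ct_def ep_def sg_eq_power)
      ultimately show "H.itm (int a) (- int p) * H.itm (int b) (int p) * ct (- int p) (int p) =
          ep p * (qq $ (a + p) * qq $ (b - p))" by (simp add: mult_ac)
    qed
    finally show "(\<Sum>M\<in>{-K..K}. \<Sum>N\<in>{-K..K}. H.itm (int a) M * H.itm (int b) N * ct M N) = ghat a b" .
  qed
  finally show ?thesis .
qed


section \<open>Moving the exponentials of \<open>\<Theta>\<close> to the left\<close>

definition gr :: "(int list \<Rightarrow> qb mps) \<Rightarrow> bool" where
  "gr F \<longleftrightarrow> bra F \<and> (\<forall>w. ord (sum_list w) (F w))"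

lemma grD: "gr F \<Longrightarrow> bra F" "gr F \<Longrightarrow> ord (sum_list w) (F w)"
  by (simp_all add: gr_def)

lemma gr_GH: "gr GH"
  by (simp add: gr_def bra_GH ord_GH)

lemma gr_scale: "gr F \<Longrightarrow> gr (\<lambda>w. x * F w)"
  by (auto simp: gr_def intro: bra_scale ord_scale)

text \<open>For graded \<open>F\<close> this coefficient functional vanishes on energies above
  \<open>mdeg m\<close>, unlike \<open>F\<close> itself, so the raising operator \<Theta> and its
  exponential can act on it.\<close>

definition cf :: "(nat \<Rightarrow>\<^sub>0 nat) \<Rightarrow> (int list \<Rightarrow> qb mps) \<Rightarrow> int list \<Rightarrow> qb" where
  "cf m F w = mps_coeff (F w) m"

lemma acomm_const: "(acomm m n :: qb mps) = mps_const (acomm m n)"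
  by (simp add: acomm_def sg_def mps_const_hom mps_const_numeral)

lemma bb_cf:
  assumes "gr F" "mdeg m \<le> D"
  shows "T.bb (int D) (cf m F)"
  unfolding T.bb_def
proof (intro conjI allI impI)
  have "bra F" using assms(1) by (simp add: gr_def)
  show "bra (cf m F)"
  proof (rule braI)
    fix u v k n
    show "cf m F (u @ k # n # v) + cf m F (u @ n # k # v) = acomm k n * cf m F (u @ v)"
      using arg_cong[OF braD(1)[OF \<open>bra F\<close>, of u k n v], of "\<lambda>f. mps_coeff f m"]
      by (simp add: cf_def acomm_const)
  next
    fix u :: "int list" and n :: int assume "n > 0"
    from braD(2)[OF \<open>bra F\<close> this, of u] show "cf m F (u @ [- n]) = 0" by (simp add: cf_def)
  qed
  fix w assume "int D < 1 * sum_list w"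
  moreover have "ord (sum_list w) (F w)" using assms(1) by (simp add: gr_def)
  ultimately show "cf m F w = 0" using assms(2) by (force simp: ord_def cf_def)
qed

text \<open>Words without lowering blocks have non-negative energy, so for a functional bounded
  above only finitely many of them contribute.\<close>

definition tame :: "nat \<Rightarrow> qb wser \<Rightarrow> bool" where
  "tame L A \<longleftrightarrow> (\<forall>a. word_coeff A a \<noteq> 0 \<longrightarrow> (\<exists>l\<le>L. \<exists>e. blocks l 0 e a))"

lemma tameD: "tame L A \<Longrightarrow> word_coeff A a \<noteq> 0 \<Longrightarrow> \<exists>l\<le>L. \<exists>e. blocks l 0 e a"
  by (auto simp: tame_def)

lemma blocks_append': "\<exists>l\<le>L. \<exists>e. blocks l 0 e a \<Longrightarrow> \<exists>l\<le>L'. \<exists>e. blocks l 0 e b \<Longrightarrow>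
    \<exists>l\<le>L + L'. \<exists>e. blocks l 0 e (a @ b)"
  using blocks_append[of _ 0 _ b _ 0 _ a] by simp (meson add_mono)

lemma tame_mult:
  assumes "tame L A" "tame L' B"
  shows "tame (L + L') (A * B)"
  unfolding tame_def
proof (intro allI impI)
  fix c assume "word_coeff (A * B) c \<noteq> 0"
  then obtain a b where ab: "a @ b = c" "word_coeff A a \<noteq> 0" "word_coeff B b \<noteq> 0"
    unfolding times_wser.rep_eq using conv_nonzeroD by metis
  show "\<exists>l\<le>L + L'. \<exists>e. blocks l 0 e c"
    using blocks_append'[OF tameD[OF assms(1) ab(2)] tameD[OF assms(2) ab(3)]] by (simp only: ab(1))
qed

lemma tame_Psi: "tame 1 (Psi f)"
  unfolding tame_def
proof (intro allI impI)
  fix a assume "word_coeff (Psi f) a \<noteq> 0"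
  then obtain x where "a = [x]" "x \<ge> 0" by (auto simp: word_coeff_Psi split: list.splits if_splits)
  hence "blocks (Suc 0) 0 (nat x) a" using blocks.letter[OF blocks.Nil, of "nat x"] by simp
  thus "\<exists>l\<le>1. \<exists>e. blocks l 0 e a" by (intro exI[of _ "Suc 0"]) auto
qed

lemma tame_wexp: "tame 0 T.wexp"
  unfolding tame_def using T.wexp_nonzeroD by (auto simp: T.qblocks_def)

lemma tame_1: "tame 0 1"
  using blocks.Nil by (auto simp: tame_def one_wser.rep_eq)

lemma tame_prod_list: "tame (length fs) (prod_list (map (\<lambda>f. Psi f * T.wexp) fs))"
proof (induction fs)
  case (Cons f fs)
  show ?case using tame_mult[OF tame_mult[OF tame_Psi[of f] tame_wexp] Cons.IH] by simp
qed (simp add: tame_1)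

lemma finite_tame:
  assumes "T.bb D G"
  shows "finite {a. G (a @ w) \<noteq> 0 \<and> (\<exists>l\<le>L. \<exists>e. blocks l 0 e a)}"
proof (rule finite_subset)
  have up: "G v = 0" if "sum_list v > D" for v
    using T.bbD(2)[OF assms, of v] that by simp
  show "finite {a. G (a @ w) \<noteq> 0 \<and> (\<exists>l\<le>L. \<exists>d\<le>0. \<exists>e\<le>nat (D - sum_list w). blocks l d e a)}"
    by (rule finite_blocks[OF T.bbD(1)[OF assms] up])
  show "{a. G (a @ w) \<noteq> 0 \<and> (\<exists>l\<le>L. \<exists>e. blocks l 0 e a)} \<subseteq>
    {a. G (a @ w) \<noteq> 0 \<and> (\<exists>l\<le>L. \<exists>d\<le>0. \<exists>e\<le>nat (D - sum_list w). blocks l d e a)}"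
  proof clarify
    fix a l e assume *: "G (a @ w) \<noteq> 0" "l \<le> L" "blocks l 0 e a"
    have "\<not> sum_list (a @ w) > D" using up *(1) by blast
    hence "e \<le> nat (D - sum_list w)" using blocks_sum[OF *(3)] by simp
    thus "\<exists>l\<le>L. \<exists>d\<le>0. \<exists>e\<le>nat (D - sum_list w). blocks l d e a" using * by blast
  qed
qed

lemma act_tame_mult:
  assumes "T.bb D G" "tame L A" "tame L' B"
  shows "act G (A * B) w = act (act G A) B w"
proof (rule act_mult, rule finite_subset)
  let ?C = "{c. G (c @ w) \<noteq> 0 \<and> (\<exists>l\<le>L + L'. \<exists>e. blocks l 0 e c)}"
  show "finite (\<Union>c\<in>?C. {(a, b). a @ b = c})"
    by (intro finite_UN_I finite_tame[OF assms(1)] finite_splits)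
  show "{(a, b). word_coeff A a \<noteq> 0 \<and> word_coeff B b \<noteq> 0 \<and> G (a @ b @ w) \<noteq> 0} \<subseteq> (\<Union>c\<in>?C. {(a, b). a @ b = c})"
  proof clarify
    fix a b assume *: "word_coeff A a \<noteq> 0" "word_coeff B b \<noteq> 0" "G (a @ b @ w) \<noteq> 0"
    have "\<exists>l\<le>L + L'. \<exists>e. blocks l 0 e (a @ b)"
      using tameD[OF assms(2) *(1)] tameD[OF assms(3) *(2)] by (rule blocks_append')
    with *(3) show "(a, b) \<in> (\<Union>c\<in>?C. {(a, b). a @ b = c})" by auto
  qed
qed

lemma act_tame:
  assumes "T.bb D G" "tame L A" "finite W"
  obtains S where "finite S" "\<And>w. w \<in> W \<Longrightarrow> act G A w = (\<Sum>a\<in>S. word_coeff A a * G (a @ w))"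
    "\<And>a. a \<in> S \<Longrightarrow> \<exists>e. sum_list a = int e"
proof
  let ?S = "\<Union>w\<in>W. {a. G (a @ w) \<noteq> 0 \<and> (\<exists>l\<le>L. \<exists>e. blocks l 0 e a)}"
  show fin: "finite ?S" using assms(3) finite_tame[OF assms(1)] by blast
  show "act G A w = (\<Sum>a\<in>?S. word_coeff A a * G (a @ w))" if "w \<in> W" for w
    by (rule act_superset[OF fin]) (use tameD[OF assms(2)] that in auto)
  show "\<exists>e. sum_list a = int e" if "a \<in> ?S" for a
    using that blocks_sum by fastforce
qed

text \<open>The sum over words is finite only for each x-monomial separately, hence the definition
  by coefficients.\<close>

definition ract :: "(int list \<Rightarrow> qb mps) \<Rightarrow> qb wser \<Rightarrow> int list \<Rightarrow> qb mps" where
  "ract F A w = Abs_mps (\<lambda>m. act (cf m F) A w)"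

lemma cf_ract: "cf m (ract F A) = act (cf m F) A"
  by (simp add: ract_def cf_def fun_eq_iff)

lemma eq_cfI: "(\<And>m w. cf m F w = cf m F' w) \<Longrightarrow> F = F'"
  by (intro ext mps_eqI) (simp add: cf_def)

lemma gr_ract:
  assumes "gr F" "tame L A"
  shows "gr (ract F A)"
  unfolding gr_def
proof (intro conjI allI)
  have bra: "bra (cf m (ract F A))" for m
  proof (rule bra_local)
    fix W :: "int list set" assume "finite W"
    then obtain S where S: "\<And>w. w \<in> W \<Longrightarrow> act (cf m F) A w = (\<Sum>a\<in>S. word_coeff A a * cf m F (a @ w))"
      using act_tame[OF bb_cf[OF assms(1) order.refl] assms(2)] by metis
    have "bra (\<lambda>w. \<Sum>a\<in>S. word_coeff A a * cf m F (a @ w))"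
      by (intro bra_sum bra_scale bra_prefix T.bbD(1)[OF bb_cf[OF assms(1) order.refl]])
    thus "\<exists>H. bra H \<and> (\<forall>w\<in>W. cf m (ract F A) w = H w)" unfolding cf_ract using S by blast
  qed
  show "bra (ract F A)"
  proof (rule braI)
    fix u k n v
    show "ract F A (u @ k # n # v) + ract F A (u @ n # k # v) = acomm k n * ract F A (u @ v)"
      using braD(1)[OF bra, of _ u k n v] by (intro mps_eqI) (simp add: cf_def acomm_const)
  next
    fix u :: "int list" and n :: int assume "n > 0"
    from braD(2)[OF bra this, of _ u] show "ract F A (u @ [- n]) = 0" 
      by (intro mps_eqI) (simp add: cf_def)
  qed
  fix w
  show "ord (sum_list w) (ract F A w)"
    unfolding ord_def
  proof (intro allI impI)
    fix m assume nz: "mps_coeff (ract F A w) m \<noteq> 0"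
    have "finite {w}" by simp
    then obtain S where S0: "\<And>v. v \<in> {w} \<Longrightarrow> act (cf m F) A v = (\<Sum>a\<in>S. word_coeff A a * cf m F (a @ v))"
      and S: "\<And>a. a \<in> S \<Longrightarrow> \<exists>e. sum_list a = int e"
      by (rule act_tame[OF bb_cf[OF assms(1) order.refl] assms(2)]) blast
    from nz have "act (cf m F) A w \<noteq> 0" by (simp flip: cf_ract add: cf_def)
    then obtain a where a: "a \<in> S" "word_coeff A a * cf m F (a @ w) \<noteq> 0"
      unfolding S0[OF singletonI] by (elim sum.not_neutral_contains_not_neutral)
    have "ord (sum_list (a @ w)) (F (a @ w))" by (rule grD(2)[OF assms(1)])
    moreover have "mps_coeff (F (a @ w)) m \<noteq> 0" using a(2) by (simp add: cf_def)
    ultimately have "sum_list a + sum_list w \<le> int (mdeg m)" by (auto simp: ord_def)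
    thus "sum_list w \<le> int (mdeg m)" using S[OF a(1)] by auto
  qed
qed

lemma ract_mult:
  assumes "gr F" "tame L A" "tame L' B"
  shows "ract F (A * B) = ract (ract F A) B"
  by (rule eq_cfI) (simp add: cf_ract act_tame_mult[OF bb_cf[OF assms(1) order.refl] assms(2,3)])

lemma ract_1: "ract F 1 = F"
proof (rule eq_cfI)
  fix m w
  have "act (cf m F) 1 w = (\<Sum>a\<in>{[]}. word_coeff 1 a * cf m F (a @ w))"
    by (rule act_superset) (auto simp: one_wser.rep_eq split: if_splits)
  thus "cf m (ract F 1) w = cf m F w" by (simp add: cf_ract one_wser.rep_eq)
qed

lemma cf_mult: "cf m (\<lambda>w. x * F w) w = (\<Sum>(a, b)\<in>splits m. mps_coeff x a * cf b F w)"
  by (simp add: cf_def mps_coeff_mult)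

text \<open>The scalar \<open>x\<close> mixes monomials, so one finite set of words has to serve all
  factorisations of m at once.\<close>

lemma ract_scale:
  assumes "gr F" "tame L A"
  shows "ract (\<lambda>w. x * F w) A = (\<lambda>w. x * ract F A w)"
proof (rule eq_cfI)
  fix m w
  let ?C = "\<lambda>b. {a. cf b F (a @ w) \<noteq> 0 \<and> (\<exists>l\<le>L. \<exists>e. blocks l 0 e a)}"
  define S where "S = (\<Union>p\<in>splits m. ?C (snd p))"
  have fin: "finite S"
    unfolding S_def by (intro finite_UN_I finite_splits_monom finite_tame[OF bb_cf[OF assms(1) order.refl]])
  have "cf m (ract (\<lambda>w. x * F w) A) w = (\<Sum>a\<in>S. word_coeff A a * cf m (\<lambda>w. x * F w) (a @ w))"
    unfolding cf_ract
  proof (rule act_superset[OF fin])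
    fix a assume *: "word_coeff A a \<noteq> 0" "cf m (\<lambda>w. x * F w) (a @ w) \<noteq> 0"
    from *(2) obtain p where "p \<in> splits m" "mps_coeff x (fst p) * cf (snd p) F (a @ w) \<noteq> 0"
      unfolding cf_mult by (elim sum.not_neutral_contains_not_neutral) (auto simp: case_prod_unfold)
    thus "a \<in> S" using tameD[OF assms(2) *(1)] unfolding S_def by auto
  qed
  also have "\<dots> = (\<Sum>p\<in>splits m. mps_coeff x (fst p) * (\<Sum>a\<in>S. word_coeff A a * cf (snd p) F (a @ w)))"
    unfolding cf_mult sum_distrib_left by (subst sum.swap) (simp add: case_prod_unfold mult_ac)
  also have "\<dots> = (\<Sum>p\<in>splits m. mps_coeff x (fst p) * act (cf (snd p) F) A w)"
  proof (intro sum.cong refl arg_cong2[where f = times])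
    fix p assume "p \<in> splits m"
    thus "(\<Sum>a\<in>S. word_coeff A a * cf (snd p) F (a @ w)) = act (cf (snd p) F) A w"
      using tameD[OF assms(2)] by (intro act_superset[OF fin, symmetric]) (auto simp: S_def)
  qed
  also have "\<dots> = cf m (\<lambda>w. x * ract F A w) w"
    by (simp add: cf_mult case_prod_unfold cf_ract)
  finally show "cf m (ract (\<lambda>w. x * F w) A) w = cf m (\<lambda>w. x * ract F A w) w" .
qed

lemma act_Psi:
  assumes "T.bb D G" "int N \<ge> D - sum_list w"
  shows "act G (Psi f) w = (\<Sum>n\<le>N. f $ n * G (int n # w))"
proof -
  have "act G (Psi f) w = (\<Sum>a\<in>(\<lambda>n. [int n]) ` {..N}. word_coeff (Psi f) a * G (a @ w))"
  proof (rule act_superset)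
    fix a assume *: "word_coeff (Psi f) a \<noteq> 0" "G (a @ w) \<noteq> 0"
    from *(1) obtain x where x: "a = [x]" "x \<ge> 0" by (auto simp: word_coeff_Psi split: list.splits if_splits)
    have "\<not> sum_list (a @ w) > D" using T.bbD(2)[OF assms(1), of "a @ w"] *(2) by auto
    hence "nat x \<le> N" using x assms(2) by simp
    thus "a \<in> (\<lambda>n. [int n]) ` {..N}" using x by (intro image_eqI[of _ _ "nat x"]) auto
  qed simp
  also have "\<dots> = (\<Sum>n\<le>N. f $ n * G (int n # w))"
    by (subst sum.reindex) (auto simp: inj_on_def word_coeff_Psi)
  finally show ?thesis .
qed

definition Tq :: "qb fps" where
  "Tq = (1 - fps_const (bet / 2) * fps_X) * inverse (1 + fps_const (bet / 2) * fps_X)"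

lemma Tq_mult: "Tq * (1 + fps_const (bet / 2) * fps_X) = 1 - fps_const (bet / 2) * fps_X"
  unfolding Tq_def mult.assoc by (subst inverse_mult_eq_1) auto

lemma es_compose: "T.es = fps_exp 1 oo (4 * sT)"
  by (rule fps_ext) (simp add: T.es_def fps_compose_nth atLeast0AtMost)

text \<open>4 sT is 2 artanh (bX) with b = \<beta>/2, whose exponential is (1 + bX) / (1 - bX). The
  proof uses only its derivative 2b / (1 - b^2 X^2): the product has derivative zero and constant
  term 1.\<close>

lemma es_Tq: "T.es * Tq = 1"
proof -
  define b where "b = bet / 2"
  let ?d = "1 + fps_const b * fps_X" and ?e = "1 - fps_const b * fps_X"
  have s0: "(4 * sT) $ 0 = 0" by (simp add: sT_nth)
  have ds: "fps_deriv (4 * sT) * (?e * ?d) = fps_const (2 * b)"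
  proof -
    define dd where "dd = fps_deriv (4 * sT)"
    have nth: "dd $ n = (if even n then 2 * b ^ Suc n else 0)" for n
      by (simp add: dd_def sT_nth b_def fps_numeral_fps_const del: of_nat_Suc)
    have "?e * ?d = 1 - fps_const (b\<^sup>2) * fps_X\<^sup>2"
      by (simp add: algebra_simps power2_eq_square flip: fps_const_mult)
    hence "dd * (?e * ?d) = dd - fps_const (b\<^sup>2) * (fps_X\<^sup>2 * dd)"
      by (simp add: algebra_simps)
    also have "\<dots> = fps_const (2 * b)"
    proof (rule fps_ext)
      fix n
      show "(dd - fps_const (b\<^sup>2) * (fps_X\<^sup>2 * dd)) $ n = fps_const (2 * b) $ n"
      proof (cases "n < 2")
        case True
        hence "n = 0 \<or> n = 1" by auto
        thus ?thesis by (auto simp: nth fps_X_power_mult_nth)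
      next
        case False
        then obtain k where n: "n = Suc (Suc k)" by (metis add_2_eq_Suc le_Suc_ex not_less)
        show ?thesis by (simp add: nth n fps_X_power_mult_nth) (simp add: power2_eq_square)
      qed
    qed
    finally show ?thesis by (simp only: dd_def)
  qed
  have des: "fps_deriv T.es = T.es * fps_deriv (4 * sT)"
    unfolding es_compose by (subst fps_compose_deriv[OF s0]) simp
  have eq: "Tq * ?d = ?e" using Tq_mult by (simp add: b_def)
  have dTq: "fps_deriv Tq * ?d + fps_const b * Tq = - fps_const b"
    using arg_cong[OF eq, of fps_deriv] by (simp add: algebra_simps)
  have "(fps_deriv Tq + fps_deriv (4 * sT) * Tq) * ?d\<^sup>2 = 
      (fps_deriv Tq * ?d + fps_const b * Tq) * ?d - fps_const b * (Tq * ?d) + fps_deriv (4 * sT) * ((Tq * ?d) * ?d)"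
    by (simp add: algebra_simps power2_eq_square)
  also have "\<dots> = - fps_const b * ?d - fps_const b * ?e + fps_const (2 * b)"
    unfolding dTq eq ds ..
  also have "\<dots> = fps_const (2 * b) - (fps_const b + fps_const b)"
    by (simp add: algebra_simps)
  also have "\<dots> = 0" by (simp only: fps_const_add) simp
  finally have "(fps_deriv Tq + fps_deriv (4 * sT) * Tq) * ?d\<^sup>2 = 0" .
  moreover have "?d \<noteq> 0"
  proof
    assume "?d = 0"
    hence "?d $ 0 = 0" by (simp only: fps_zero_nth)
    thus False by simp
  qed
  ultimately have z: "fps_deriv Tq + fps_deriv (4 * sT) * Tq = 0" by simp
  have "fps_deriv (T.es * Tq) = T.es * (fps_deriv Tq + fps_deriv (4 * sT) * Tq)"
    by (simp only: fps_deriv_mult des) (simp add: algebra_simps)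
  hence "fps_deriv (T.es * Tq) = 0" unfolding z by simp
  hence "T.es * Tq = fps_const ((T.es * Tq) $ 0)" by (simp only: fps_deriv_eq_0_iff)
  also have "(T.es * Tq) $ 0 = 1" by (simp add: T.es_def Tq_def)
  finally show ?thesis by simp
qed

context quadratic
begin

lemma eop_cong:
  assumes "\<And>v. eps * sum_list v \<ge> eps * sum_list w \<Longrightarrow> G v = G' v"
  shows "eop G w = eop G' w"
  unfolding eop_def using qop_pow_cong[of w G G', OF assms] by simp

lemma eop_sum:
  assumes "\<And>j. j \<in> J \<Longrightarrow> bb D (G j)"
  shows "eop (\<lambda>w. \<Sum>j\<in>J. c j * G j w) w = (\<Sum>j\<in>J. c j * eop (G j) w)"
proof -
  define N where "N = nat (D - eps * sum_list w)"
  have N: "int N \<ge> D - eps * sum_list w" by (simp add: N_def)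
  have "eop (\<lambda>w. \<Sum>j\<in>J. c j * G j w) w = (\<Sum>n\<le>N. iv n * (\<Sum>j\<in>J. c j * (qop ^^ n) (G j) w))"
    by (subst eop_eq[OF bb_sum[OF assms] N]) (auto simp: qop_pow_sum[OF assms])
  also have "\<dots> = (\<Sum>j\<in>J. c j * (\<Sum>n\<le>N. iv n * (qop ^^ n) (G j) w))"
    unfolding sum_distrib_left by (subst sum.swap) (simp add: mult_ac)
  also have "\<dots> = (\<Sum>j\<in>J. c j * eop (G j) w)"
    by (intro sum.cong refl) (simp add: eop_eq[OF assms N])
  finally show ?thesis .
qed

end

lemma upper_bb: "T.bb D G \<Longrightarrow> sum_list w > D \<Longrightarrow> G w = 0"
  using T.bbD(2)[of D G w] by simp

text \<open>By \<open>eop_Cons\<close>, e^\<Theta> times the letter g is the letter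
  \<open>g * T.es\<close> times e^\<Theta>. Taking \<open>g = f * Tq\<close> inverts this, because
  \<open>Tq\<close> is the inverse of \<open>T.es\<close>.\<close>

lemma act_Psi_wexp:
  assumes "T.bb D G" "T.bb D (act G (Psi f))" "T.bb D (act G T.wexp)"
  shows "act (act G (Psi f)) T.wexp w = act (act G T.wexp) (Psi (f * Tq)) w"
proof -
  define N where "N = nat (D - sum_list w)"
  have N: "int N \<ge> D - sum_list w" by (simp add: N_def)
  let ?h = "\<lambda>M. T.eop (\<lambda>v. G (int M # v)) w"
  have bb: "T.bb D (\<lambda>v. G (int M # v))" for M
    by (rule T.bb_mono[OF T.bb_Cons[OF assms(1)]]) simp
  have h0: "?h M = 0" if "M > N" for M
    using that N by (intro T.eop_bound[OF T.bb_Cons[OF assms(1)]]) simp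
  have "act (act G (Psi f)) T.wexp w = T.eop (act G (Psi f)) w"
    by (rule T.act_wexp[OF assms(2) upper_bb[OF assms(2)]])
  also have "\<dots> = T.eop (\<lambda>v. \<Sum>n\<le>N. f $ n * G (int n # v)) w"
    by (rule T.eop_cong, rule act_Psi[OF assms(1)]) (use N in simp)
  also have "\<dots> = (\<Sum>M\<le>N. f $ M * ?h M)"
    by (rule T.eop_sum[OF bb])
  also have "\<dots> = (\<Sum>M\<le>N. (f * Tq * T.es) $ M * ?h M)"
    by (simp add: mult.assoc es_Tq[unfolded mult.commute[of T.es]])
  also have "\<dots> = (\<Sum>n\<le>N. \<Sum>k\<le>N. (f * Tq) $ n * T.es $ k * ?h (n + k))"
    by (rule sum_fps_mult[symmetric, OF h0])
  also have "\<dots> = (\<Sum>n\<le>N. (f * Tq) $ n * T.eop G (int n # w))"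
    by (intro sum.cong refl, subst T.eop_Cons[OF assms(1), where N = N])
      (use N in \<open>auto simp: sum_distrib_left mult.assoc\<close>)
  also have "\<dots> = (\<Sum>n\<le>N. (f * Tq) $ n * act G T.wexp (int n # w))"
    by (simp add: T.act_wexp[OF assms(1) upper_bb[OF assms(1)]])
  also have "\<dots> = act (act G T.wexp) (Psi (f * Tq)) w"
    by (rule act_Psi[OF assms(3) N, symmetric])
  finally show ?thesis .
qed

lemma bb_act: "gr F \<Longrightarrow> tame L A \<Longrightarrow> mdeg m \<le> D \<Longrightarrow> T.bb (int D) (act (cf m F) A)"
  using bb_cf[OF gr_ract] by (simp add: cf_ract)

lemma ract_Psi_wexp:
  assumes "gr F"
  shows "ract (ract F (Psi f)) T.wexp = ract (ract F T.wexp) (Psi (f * Tq))"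
  by (rule eq_cfI, unfold cf_ract, rule act_Psi_wexp)
    (rule bb_cf bb_act assms order.refl tame_Psi tame_wexp)+


section \<open>Comparison up to a given degree in x\<close>

definition eq_upto :: "nat \<Rightarrow> 'a::comm_ring_1 mps \<Rightarrow> 'a mps \<Rightarrow> bool" where
  "eq_upto D f g \<longleftrightarrow> (\<forall>m. mdeg m \<le> D \<longrightarrow> mps_coeff f m = mps_coeff g m)"

lemma eq_upto_refl [simp]: "eq_upto D f f"
  by (simp add: eq_upto_def)

lemma eq_upto_trans [trans]: "eq_upto D f g \<Longrightarrow> eq_upto D g h \<Longrightarrow> eq_upto D f h"
  by (simp add: eq_upto_def)

lemma eq_upto_sym: "eq_upto D f g \<Longrightarrow> eq_upto D g f"
  by (simp add: eq_upto_def)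

lemma eq_uptoD: "eq_upto D f g \<Longrightarrow> mdeg m \<le> D \<Longrightarrow> mps_coeff f m = mps_coeff g m"
  by (simp add: eq_upto_def)

lemma eq_upto_sum: "(\<And>i. i \<in> I \<Longrightarrow> eq_upto D (f i) (g i)) \<Longrightarrow> eq_upto D (\<Sum>i\<in>I. f i) (\<Sum>i\<in>I. g i)"
  by (simp add: eq_upto_def)

lemma eq_upto_mult:
  assumes "eq_upto D f f'" "eq_upto D g g'"
  shows "eq_upto D (f * g) (f' * g')"
  unfolding eq_upto_def mps_coeff_mult
proof (intro allI impI sum.cong refl)
  fix m p assume "mdeg m \<le> D" "p \<in> splits m"
  hence "mdeg (fst p) \<le> D" "mdeg (snd p) \<le> D" using splits_mdeg[of "fst p" "snd p" m] by auto
  thus "(case p of (a, b) \<Rightarrow> mps_coeff f a * mps_coeff g b) = (case p of (a, b) \<Rightarrow> mps_coeff f' a * mps_coeff g' b)"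
    using assms by (simp add: eq_upto_def case_prod_unfold)
qed

lemma mps_eq_if_eq_upto: "(\<And>D. eq_upto D f g) \<Longrightarrow> f = g"
  by (rule mps_eqI) (auto simp: eq_upto_def)

lemma pf_eq_upto:
  assumes "\<And>a b. eq_upto D (g a b) (g' a b)"
  shows "eq_upto D (pf g w) (pf g' w)"
proof (induction "length w" arbitrary: w rule: less_induct)
  case less
  show ?case
  proof (cases w)
    case (Cons a v)
    show ?thesis unfolding Cons pf.simps(2)
      by (intro eq_upto_sum eq_upto_mult eq_upto_refl assms less) (auto simp: Cons)
  qed simp
qed

lemma lin_eq_upto:
  assumes "\<And>w. eq_upto D (f w) (f' w)"
  shows "eq_upto D (lin I as f) (lin I as f')"
  using assms
proof (induction as arbitrary: f f')
  case (Cons a as)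
  show ?case by (simp, intro eq_upto_sum eq_upto_mult eq_upto_refl Cons.IH Cons.prems)
qed simp

lemma ord_eq_0: "ord d f \<Longrightarrow> int (mdeg m) < d \<Longrightarrow> mps_coeff f m = 0"
  by (force simp: ord_def)

lemma ord_eq_upto_0: "ord d f \<Longrightarrow> int D < d \<Longrightarrow> eq_upto D f 0"
  by (auto simp: eq_upto_def intro: ord_eq_0)

text \<open>The eigenvalue of \<Theta> on <0|e^H: the eigenvalues 2 n hh_n of \<open>bop_GH\<close>
  with the weights \<open>sT\<close> add up to the sum of (\<beta>/2)^n hh_n, that is, to
  \<open>cb\<close> evaluated at \<beta>/2. It is the logarithm of \<kappa>.\<close>

definition cc :: "qb mps" where
  "cc = psum (\<lambda>n. 2 / of_nat n * poly (cb n) (bet / 2))"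

definition mexp :: "qb mps \<Rightarrow> qb mps" where
  "mexp x = Abs_mps (\<lambda>m. \<Sum>k\<le>mdeg m. 1 / fact k * mps_coeff (x ^ k) m)"

lemma ord_psum: "ord 1 (psum a)"
  using card_keys_mdeg by (force simp: ord_def psum_coeff)

lemma mexp_eq_upto:
  assumes "ord 1 x" "D \<le> N"
  shows "eq_upto D (\<Sum>k\<le>N. mps_const (1 / fact k) * x ^ k) (mexp x)"
  unfolding eq_upto_def
proof (intro allI impI)
  fix m assume m: "mdeg m \<le> D"
  have "(\<Sum>k\<le>N. 1 / fact k * mps_coeff (x ^ k) m) = (\<Sum>k\<le>mdeg m. 1 / fact k * mps_coeff (x ^ k) m)"
    using m assms(2) ord_eq_0[OF ord_power[OF assms(1)]] by (intro sum.mono_neutral_right) auto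
  thus "mps_coeff (\<Sum>k\<le>N. mps_const (1 / fact k) * x ^ k) m = mps_coeff (mexp x) m"
    by (simp add: mexp_def)
qed

lemma sum_coeff_poly:
  assumes "degree p \<le> N"
  shows "(\<Sum>n\<le>N. coeff p n * x ^ n) = poly p (x :: 'a::comm_ring_1)"
proof -
  have "poly p x = (\<Sum>n\<le>degree p. coeff p n * x ^ n)" by (rule poly_altdef)
  also have "\<dots> = (\<Sum>n\<le>N. coeff p n * x ^ n)"
    using assms by (intro sum.mono_neutral_left) (auto simp: coeff_eq_0)
  finally show ?thesis by simp
qed

lemma cc_eq_upto:
  assumes "D \<le> N"
  shows "eq_upto D (\<Sum>n\<le>N. mps_const ((bet / 2) ^ n) * hh n) cc"
  unfolding eq_upto_def
proof (intro allI impI)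
  fix m assume m: "mdeg m \<le> D"
  have "(\<Sum>n\<le>N. coeff (cb (mdeg m)) n * (bet / 2) ^ n) = poly (cb (mdeg m)) (bet / 2)"
    using m assms degree_cb[of "mdeg m"] by (intro sum_coeff_poly) simp
  hence "poly (cb (mdeg m)) (bet / 2) = (\<Sum>n\<le>N. coeff (cb (mdeg m)) n * (bet / 2) ^ n)" ..
  thus "mps_coeff (\<Sum>n\<le>N. mps_const ((bet / 2) ^ n) * hh n) m = mps_coeff cc m"
    by (simp add: hh_def cc_def psum_coeff sum_distrib_left sum_divide_distrib mult_ac)
qed

lemma bop_cf:
  assumes "gr F" "k \<noteq> 0"
  shows "bop k (cf m (\<lambda>w. x * F w)) w = cf m (\<lambda>w. x * bop k F w) w"
proof -
  have sg: "sg i * mps_coeff f m = mps_coeff (sg i * f) m" for i and f :: "qb mps"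
    by (auto simp: sg_def)
  have "bop k (cf m (\<lambda>w. x * F w)) w = (\<Sum>i\<in>{-(\<bar>sum_list w\<bar> + \<bar>k\<bar>)..\<bar>sum_list w\<bar> + \<bar>k\<bar>}. sg i * cf m (\<lambda>w. x * F w) ([k - i, i] @ w))"
    by (rule bop_interval[OF T.bbD(1)[OF bb_cf[OF gr_scale[OF assms(1)] order.refl]] assms(2) order.refl])
  also have "\<dots> = cf m (\<lambda>w. x * bop k F w) w"
    unfolding bop_interval[OF grD(1)[OF assms(1)] assms(2) order.refl]
    by (simp only: cf_def sg mps_coeff_sum[symmetric] sum_distrib_left mult.left_commute)
  finally show ?thesis .
qed

text \<open>An eigenvector over the power series in x is not one coefficient by coefficient, as the
  eigenvalue mixes monomials. The arbitrary factor \<open>x\<close> is what allows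
  iteration.\<close>

lemma qop_cf_GH: "T.qop (cf m (\<lambda>w. x * GH w)) = cf m (\<lambda>w. cc * x * GH w)"
proof
  fix w
  define N where "N = mdeg m + nat \<bar>sum_list w\<bar>"
  have "T.qop (cf m (\<lambda>w. x * GH w)) w = (\<Sum>n\<le>N. sT $ n * bop (1 * int n) (cf m (\<lambda>w. x * GH w)) w)"
    by (rule T.qop_eq[OF bb_cf[OF gr_scale[OF gr_GH] order.refl]]) (simp add: N_def)
  also have "\<dots> = (\<Sum>n\<le>N. mps_coeff (mps_const ((bet / 2) ^ n) * hh n * (x * GH w)) m)"
  proof (intro sum.cong refl)
    fix n
    show "sT $ n * bop (1 * int n) (cf m (\<lambda>w. x * GH w)) w = mps_coeff (mps_const ((bet / 2) ^ n) * hh n * (x * GH w)) m"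
    proof (cases "odd n")
      case True
      hence n: "n > 0" by (rule odd_pos)
      have "bop (int n) (cf m (\<lambda>w. x * GH w)) w = mps_coeff (x * bop (int n) GH w) m"
        using n by (subst bop_cf[OF gr_GH]) (auto simp: cf_def)
      also have "x * bop (int n) GH w = mps_const (2 * of_nat n) * (hh n * (x * GH w))"
        by (simp add: bop_GH[OF True] mps_const_hom mps_const_of_nat mps_const_numeral mult_ac)
      also have "sT $ n * mps_coeff \<dots> m = mps_coeff (mps_const ((bet / 2) ^ n) * (hh n * (x * GH w))) m"
        using n True by (simp add: sT_nth)
      finally show ?thesis by (simp add: mult.assoc)
    qed (simp add: sT_nth hh_even)
  qed
  also have "\<dots> = mps_coeff ((\<Sum>n\<le>N. mps_const ((bet / 2) ^ n) * hh n) * (x * GH w)) m"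
    by (simp only: sum_distrib_right mps_coeff_sum)
  also have "\<dots> = mps_coeff (cc * (x * GH w)) m"
    by (rule eq_uptoD[OF eq_upto_mult[OF cc_eq_upto eq_upto_refl], of "mdeg m"]) (auto simp: N_def)
  finally show "T.qop (cf m (\<lambda>w. x * GH w)) w = cf m (\<lambda>w. cc * x * GH w) w"
    by (simp add: cf_def mult.assoc)
qed

lemma qop_pow_cf_GH: "(T.qop ^^ k) (cf m GH) = cf m (\<lambda>w. cc ^ k * GH w)"
proof (induction k)
  case (Suc k)
  thus ?case by (simp add: qop_cf_GH)
qed simp

definition kap :: "qb mps" where
  "kap = mexp cc"

lemma ract_GH_wexp: "ract GH T.wexp = (\<lambda>w. kap * GH w)"
proof (rule eq_cfI, unfold cf_ract)
  fix m w
  define N where "N = mdeg m + nat \<bar>sum_list w\<bar>"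
  note bb = bb_cf[OF gr_GH, of m "mdeg m", OF order.refl]
  have "act (cf m GH) T.wexp w = T.eop (cf m GH) w"
    by (rule T.act_wexp[OF bb upper_bb[OF bb]])
  also have "\<dots> = (\<Sum>k\<le>N. 1 / fact k * (T.qop ^^ k) (cf m GH) w)"
    by (rule T.eop_eq[OF bb]) (simp add: N_def)
  also have "\<dots> = mps_coeff ((\<Sum>k\<le>N. mps_const (1 / fact k) * cc ^ k) * GH w) m"
    by (simp add: qop_pow_cf_GH cf_def sum_distrib_right mult.assoc)
  also have "\<dots> = mps_coeff (kap * GH w) m"
    unfolding kap_def cc_def
    by (rule eq_uptoD[OF eq_upto_mult[OF mexp_eq_upto[OF ord_psum] eq_upto_refl], of "mdeg m"]) (auto simp: N_def)
  finally show "act (cf m GH) T.wexp w = cf m (\<lambda>w. kap * GH w) w" by (simp add: cf_def)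
qed

section \<open>Collecting the exponentials\<close>

definition letters :: "qb fps list \<Rightarrow> (int list \<Rightarrow> qb mps) \<Rightarrow> int list \<Rightarrow> qb mps" where
  "letters fs F = foldl (\<lambda>F f. ract F (Psi f)) F fs"

lemma letters_simps:
  "letters [] F = F" "letters (f # fs) F = letters fs (ract F (Psi f))"
  "letters (fs @ [f]) F = ract (letters fs F) (Psi f)"
  by (simp_all add: letters_def)

lemma gr_letters: "gr F \<Longrightarrow> gr (letters fs F)"
  by (induction fs arbitrary: F) (auto simp: letters_simps gr_ract[OF _ tame_Psi])

lemma ract_letters_wexp:
  "ract (letters fs GH) T.wexp = (\<lambda>w. kap * letters (map (\<lambda>f. f * Tq) fs) GH w)"
proof (induction fs rule: rev_induct)
  case (snoc f fs)
  have "ract (letters (fs @ [f]) GH) T.wexp = ract (ract (letters fs GH) T.wexp) (Psi (f * Tq))"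
    unfolding letters_simps by (rule ract_Psi_wexp[OF gr_letters[OF gr_GH]])
  also have "\<dots> = (\<lambda>w. kap * letters (map (\<lambda>f. f * Tq) (fs @ [f])) GH w)"
    by (simp add: snoc ract_scale[OF gr_letters[OF gr_GH] tame_Psi] letters_simps)
  finally show ?case .
qed (simp add: letters_simps ract_GH_wexp)

text \<open>The exponent counts the exponentials to the right of the letter, including the one
  attached to it; each of them passes the letter once.\<close>

fun twist :: "qb fps list \<Rightarrow> qb fps list" where
  "twist [] = []"
| "twist (f # fs) = f * Tq ^ Suc (length fs) # twist fs"

lemma length_twist [simp]: "length (twist fs) = length fs"
  by (induction fs) auto

lemma foldl_letters_wexp:
  "foldl (\<lambda>F f. ract (ract F (Psi f)) T.wexp) (\<lambda>w. x * letters gs GH w) fs =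
    (\<lambda>w. kap ^ length fs * x * letters (map (\<lambda>g. g * Tq ^ length fs) gs @ twist fs) GH w)"
proof (induction fs arbitrary: x gs)
  case (Cons f fs)
  have gr: "gr (letters gs GH)" for gs by (rule gr_letters[OF gr_GH])
  have "ract (ract (\<lambda>w. x * letters gs GH w) (Psi f)) T.wexp =
      (\<lambda>w. (kap * x) * letters (map (\<lambda>g. g * Tq) (gs @ [f])) GH w)"
    by (simp add: ract_scale[OF gr tame_Psi] ract_scale[OF gr tame_wexp] ract_letters_wexp
      mult_ac flip: letters_simps(3))
  hence "foldl (\<lambda>F f. ract (ract F (Psi f)) T.wexp) (\<lambda>w. x * letters gs GH w) (f # fs) =
      foldl (\<lambda>F f. ract (ract F (Psi f)) T.wexp) (\<lambda>w. (kap * x) * letters (map (\<lambda>g. g * Tq) (gs @ [f])) GH w) fs"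
    by simp
  also note Cons.IH
  also have "map (\<lambda>g. g * Tq ^ length fs) (map (\<lambda>g. g * Tq) (gs @ [f])) @ twist fs =
      map (\<lambda>g. g * Tq ^ length (f # fs)) gs @ twist (f # fs)"
    by (simp add: comp_def mult.assoc)
  finally show ?case by (simp add: mult_ac)
qed (simp add: comp_def)

lemma ract_prod_list:
  "gr F \<Longrightarrow> ract F (prod_list (map (\<lambda>f. Psi f * T.wexp) fs)) = foldl (\<lambda>F f. ract (ract F (Psi f)) T.wexp) F fs"
proof (induction fs arbitrary: F)
  case (Cons f fs)
  have "ract F (prod_list (map (\<lambda>f. Psi f * T.wexp) (f # fs))) =
      ract (ract F (Psi f * T.wexp)) (prod_list (map (\<lambda>f. Psi f * T.wexp) fs))"
    by (simp, rule ract_mult[OF Cons.prems tame_mult[OF tame_Psi tame_wexp] tame_prod_list])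
  also have "ract F (Psi f * T.wexp) = ract (ract F (Psi f)) T.wexp"
    by (rule ract_mult[OF Cons.prems tame_Psi tame_wexp])
  finally show ?case
    by (simp add: Cons.IH gr_ract[OF gr_ract[OF Cons.prems tame_Psi] tame_wexp])
qed (simp add: ract_1)

section \<open>The expectation value as an action on <0|e^H\<close>

lemma ord_wexp_H: "ord (- sum_list u) (word_coeff (fexp hamiltonian) u)"
proof -
  have "ord (- sum_list u) (word_coeff (H.quad ^ k) u)" for k
  proof (induction k arbitrary: u)
    case 0
    show ?case by (auto simp: one_wser.rep_eq ord_nonpos)
  next
    case (Suc k)
    have quad: "ord (- sum_list u) (word_coeff H.quad u)" for u
    proof (cases "\<exists>a b. u = [a, b] \<and> a + b < 0")
      case True
      then obtain a b where u: "u = [a, b]" "a + b < 0" by blast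
      have "ord (int (nat (- (a + b)))) (sH $ nat (- (a + b)) * sg b)"
        unfolding sH_nth mult.assoc by (subst mult.commute[of "hh _"]) (intro ord_scale ord_hh)
      thus ?thesis using u by (simp add: H.word_coeff_quad)
    qed (auto simp: H.word_coeff_quad split: list.splits)
    show ?case unfolding power_Suc word_coeff_mult
    proof (rule ord_sum, clarify)
      fix a b assume "(a, b) \<in> conv_set (@) (word_coeff H.quad) (word_coeff (H.quad ^ k)) u"
      hence "u = a @ b" by (auto simp: conv_set_def)
      thus "ord (- sum_list u) (word_coeff H.quad a * word_coeff (H.quad ^ k) b)"
        using ord_mult[OF quad[of a] Suc.IH[of b]] by simp
    qed
  qed
  thus ?thesis by (simp add: fexp_hamiltonian H.word_coeff_wexp ord_scale)
qed

text \<open>For a fixed monomial m the word u lowers the energy by at most \<open>mdeg m\<close>,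
  and the vacuum forces v to raise it by the same amount. So finitely many pairs contribute, and the
  double sum may be carried out over u first.\<close>

lemma vev_eq_ract:
  assumes "tame L V"
  shows "vev (fexp hamiltonian) (wconst V) = ract GH V []"
proof (rule mps_eqI)
  fix m
  let ?U = "\<lambda>u. mps_coeff (word_coeff (fexp hamiltonian) u) m"
  let ?g = "\<lambda>u v. ?U u * word_coeff V v * vac (u @ v)"
  define P where "P = {(u, v). ?g u v \<noteq> 0}"
  have U: "\<exists>n. blocks 0 n 0 u" if "word_coeff (fexp hamiltonian) u \<noteq> 0" for u
    using H.wexp_nonzeroD[of u] that by (auto simp: fexp_hamiltonian H.qblocks_def)
  have finP: "finite P"
  proof (rule finite_subset)
    let ?C = "{c. (vac (c @ []) :: qb) \<noteq> 0 \<and> (\<exists>l\<le>L. \<exists>d\<le>mdeg m. \<exists>e\<le>mdeg m. blocks l d e c)}"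
    show "finite (\<Union>c\<in>?C. {(a, b). a @ b = c})"
      by (intro finite_UN_I finite_splits finite_blocks[OF bra_vac vac_upper])
    show "P \<subseteq> (\<Union>c\<in>?C. {(a, b). a @ b = c})"
    proof clarify
      fix u v assume "(u, v) \<in> P"
      hence nz: "?U u \<noteq> 0" "word_coeff V v \<noteq> 0" "(vac (u @ v) :: qb) \<noteq> 0" by (auto simp: P_def)
      from nz(1) have "word_coeff (fexp hamiltonian) u \<noteq> 0" by auto
      then obtain n where n: "blocks 0 n 0 u" using U by blast
      from tameD[OF assms nz(2)] obtain l e where le: "l \<le> L" "blocks l 0 e v" by blast
      have b: "blocks l n e (u @ v)" using blocks_append[OF le(2) n] by simp
      have "e = n" using blocks_sum[OF b] vac_energy[OF nz(3)] by simp
      moreover have "n \<le> mdeg m"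
      proof -
        have "ord (int n) (word_coeff (fexp hamiltonian) u)"
          using ord_wexp_H[of u] blocks_sum[OF n] by simp
        thus ?thesis using nz(1) by (auto simp: ord_def)
      qed
      ultimately show "(u, v) \<in> (\<Union>c\<in>?C. {(a, b). a @ b = c})"
        using b le(1) nz(3) by auto
    qed
  qed
  define A where "A = fst ` P"
  define B where "B = snd ` P"
  have fin: "finite A" "finite B" using finP by (auto simp: A_def B_def)
  have inner: "(\<Sum>u\<in>A. ?U u * vac (u @ v)) = cf m GH v" if "word_coeff V v \<noteq> 0" for v
  proof -
    obtain S where S: "finite S" "A \<subseteq> S"
      "\<And>u. word_coeff (fexp hamiltonian) u \<noteq> 0 \<Longrightarrow> (vac (u @ v) :: qb mps) \<noteq> 0 \<Longrightarrow> u \<in> S"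
    proof
      let ?S = "A \<union> {u. (vac (u @ v) :: qb mps) \<noteq> 0 \<and> (\<exists>n. H.qblocks n u)}"
      show "finite ?S" using fin(1) H.finite_qblocks[OF bb_vac vac_upper] by blast
      show "u \<in> ?S" if "word_coeff (fexp hamiltonian) u \<noteq> 0" "(vac (u @ v) :: qb mps) \<noteq> 0" for u
        using H.wexp_nonzeroD[of u] that by (auto simp: fexp_hamiltonian)
    qed auto
    have "cf m GH v = mps_coeff (\<Sum>u\<in>S. word_coeff (fexp hamiltonian) u * vac (u @ v)) m"
      unfolding cf_def act_vac_fexp_hamiltonian[symmetric] by (subst act_superset[OF S(1)]) (use S(3) in auto)
    also have "\<dots> = (\<Sum>u\<in>S. ?U u * vac (u @ v))"
      by (simp add: mps_vac mult.commute[of _ "mps_const _"]) (simp add: mult.commute)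
    also have "\<dots> = (\<Sum>u\<in>A. ?U u * vac (u @ v))"
    proof (rule sum.mono_neutral_right[OF S(1,2)], intro ballI)
      fix u assume "u \<in> S - A"
      hence "(u, v) \<notin> P" by (force simp: A_def)
      thus "?U u * vac (u @ v) = 0" using that by (auto simp: P_def)
    qed
    finally show ?thesis ..
  qed
  have "mps_coeff (vev (fexp hamiltonian) (wconst V)) m = Sum_any (\<lambda>p. case p of (u, v) \<Rightarrow> ?g u v)"
    by (simp add: vev_def word_coeff_wconst vacuum_pairing_eq mult.commute[of _ "mps_const _"] case_prod_unfold)
      (simp add: mult_ac)
  also have "\<dots> = (\<Sum>p\<in>A \<times> B. case p of (u, v) \<Rightarrow> ?g u v)"
    by (rule Sum_any.expand_superset) (use fin in \<open>force simp: A_def B_def P_def\<close>)+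
  also have "\<dots> = (\<Sum>v\<in>B. word_coeff V v * (\<Sum>u\<in>A. ?U u * vac (u @ v)))"
    unfolding sum.cartesian_product' by (subst sum.swap) (simp add: sum_distrib_left mult_ac)
  also have "\<dots> = (\<Sum>v\<in>B. word_coeff V v * cf m GH (v @ []))"
  proof (intro sum.cong refl)
    fix v show "word_coeff V v * (\<Sum>u\<in>A. ?U u * vac (u @ v)) = word_coeff V v * cf m GH (v @ [])"
      using inner[of v] by (cases "word_coeff V v = 0") auto
  qed
  also have "\<dots> = act (cf m GH) V []"
  proof (rule act_superset[OF fin(2), symmetric])
    fix v assume *: "word_coeff V v \<noteq> 0" "cf m GH (v @ []) \<noteq> 0"
    hence "(\<Sum>u\<in>A. ?U u * vac (u @ v)) \<noteq> 0" using inner[of v] by simp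
    then obtain u where "?U u * vac (u @ v) \<noteq> 0" by (elim sum.not_neutral_contains_not_neutral)
    hence "(u, v) \<in> P" using *(1) by (auto simp: P_def)
    thus "v \<in> B" by (force simp: B_def)
  qed
  finally show "mps_coeff (vev (fexp hamiltonian) (wconst V)) m = mps_coeff (ract GH V []) m"
    by (simp add: ract_def)
qed

section \<open>Infinite combinations of letters\<close>

lemma ord_qq: "ord (int n) (qq $ n)"
proof -
  have mult: "ord (int n) ((f * g) $ n)" if "\<And>n. ord (int n) (f $ n)" "\<And>n. ord (int n) (g $ n)" for f g :: "qb mps fps" and n
    unfolding fps_mult_nth
  proof (intro ord_sum)
    fix i assume "i \<in> {0..n}"
    thus "ord (int n) (f $ i * g $ (n - i))" using ord_mult[OF that(1)[of i] that(2)[of "n - i"]] by (simp flip: of_nat_add)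
  qed
  have 4: "ord (int n) ((4 * sH) $ n)" for n
    using ord_scale[OF ord_scale[OF ord_hh]] by (simp add: sH_nth fps_numeral_fps_const)
  have "ord (int n) (((4 * sH) ^ j) $ n)" for j n
  proof (induction j arbitrary: n)
    case (Suc j)
    show ?case unfolding power_Suc by (intro mult 4 Suc)
  qed (simp add: ord_nonpos)
  thus ?thesis by (simp add: qq_def H.es_def ord_sum ord_scale)
qed

lemma ord_ghat: "ord (int a + int b) (ghat a b)"
  unfolding ghat_def
proof (rule ord_sum, rule ord_scale)
  fix p assume "p \<in> {..b}"
  hence "int a + int b = int (a + p) + int (b - p)" by simp
  thus "ord (int a + int b) (qq $ (a + p) * qq $ (b - p))"
    using ord_mult[OF ord_qq[of "a + p"] ord_qq[of "b - p"]] by (simp only:)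
qed

definition gpart :: "nat \<Rightarrow> qb fps \<Rightarrow> qb fps \<Rightarrow> qb mps" where
  "gpart D f f' = (\<Sum>n\<le>D. \<Sum>k\<le>D. mps_const (f $ n) * mps_const (f' $ k) * ghat n k)"

text \<open>The bilinear extension of \<open>ghat\<close> to infinite combinations of letters. By
  \<open>ord_ghat\<close>, indices up to \<open>mdeg m\<close> suffice for the monomial m.\<close>

definition gfull :: "qb fps \<Rightarrow> qb fps \<Rightarrow> qb mps" where
  "gfull f f' = Abs_mps (\<lambda>m. mps_coeff (gpart (mdeg m) f f') m)"

lemma gpart_mono:
  assumes "D \<le> D'"
  shows "eq_upto D (gpart D' f f') (gpart D f f')"
proof -
  let ?t = "\<lambda>(n, k). mps_const (f $ n) * mps_const (f' $ k) * ghat n k"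
  have "gpart D' f f' = (\<Sum>p\<in>{..D'} \<times> {..D'}. ?t p)"
    by (simp add: gpart_def sum.cartesian_product)
  also have "eq_upto D \<dots> (\<Sum>p\<in>{..D'} \<times> {..D'}. if p \<in> {..D} \<times> {..D} then ?t p else 0)"
  proof (rule eq_upto_sum)
    fix p assume "p \<in> {..D'} \<times> {..D'}"
    obtain n k where p: "p = (n, k)" by (cases p)
    show "eq_upto D (?t p) (if p \<in> {..D} \<times> {..D} then ?t p else 0)"
    proof (cases "n \<le> D \<and> k \<le> D")
      case False
      have "ord (int n + int k) (?t p)" unfolding p by (simp add: ord_scale ord_ghat mult.assoc)
      hence "eq_upto D (?t p) 0" by (rule ord_eq_upto_0) (use False in auto)
      thus ?thesis using False p by auto
    qed (simp add: p)
  qed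
  also have "(\<Sum>p\<in>{..D'} \<times> {..D'}. if p \<in> {..D} \<times> {..D} then ?t p else 0) = (\<Sum>p\<in>{..D} \<times> {..D}. ?t p)"
    using assms by (intro sum.mono_neutral_cong_right) auto
  also have "\<dots> = gpart D f f'"
    by (simp add: gpart_def sum.cartesian_product)
  finally show ?thesis .
qed

lemma gpart_gfull: "eq_upto D (gpart D f f') (gfull f f')"
  unfolding eq_upto_def using gpart_mono[of _ D f f'] by (auto simp: gfull_def eq_upto_def)

lemma lin_sum: "lin I as (\<lambda>w. \<Sum>j\<in>J. f j w) = (\<Sum>j\<in>J. lin I as (f j))"
proof (induction as arbitrary: f)
  case (Cons a as)
  show ?case by (simp add: Cons sum_distrib_left) (rule sum.swap)
qed simp

text \<open>Up to degree D in x, letters of index above D contribute nothing as long as the word to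
  their right has non-negative energy; the infinite combinations become finite and
  \<open>lin_pf\<close> applies.\<close>

lemma letters_lin:
  assumes "gr F" "sum_list w \<ge> 0"
  shows "eq_upto D (letters fs F w) (lin {..D} (map (\<lambda>f n. mps_const (f $ n)) fs) (\<lambda>ns. F (map int ns @ w)))"
  using assms(1)
proof (induction fs arbitrary: F)
  case (Cons f fs)
  have "eq_upto D (letters (f # fs) F w) (lin {..D} (map (\<lambda>f n. mps_const (f $ n)) fs) (\<lambda>ns. ract F (Psi f) (map int ns @ w)))"
    unfolding letters_simps by (rule Cons.IH[OF gr_ract[OF Cons.prems tame_Psi]])
  also have "eq_upto D \<dots> (lin {..D} (map (\<lambda>f n. mps_const (f $ n)) fs)
      (\<lambda>ns. \<Sum>n\<le>D. mps_const (f $ n) * F (int n # map int ns @ w)))"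
  proof (rule lin_eq_upto)
    fix ns
    have "sum_list (map int ns) \<ge> 0" by (induction ns) auto
    hence nn: "sum_list (map int ns @ w) \<ge> 0" using assms(2) by simp
    show "eq_upto D (ract F (Psi f) (map int ns @ w)) (\<Sum>n\<le>D. mps_const (f $ n) * F (int n # map int ns @ w))"
      unfolding eq_upto_def
    proof (intro allI impI)
      fix m assume m: "mdeg m \<le> D"
      have "act (cf m F) (Psi f) (map int ns @ w) = (\<Sum>n\<le>D. f $ n * cf m F (int n # map int ns @ w))"
        by (rule act_Psi[OF bb_cf[OF Cons.prems m]]) (use nn in simp)
      thus "mps_coeff (ract F (Psi f) (map int ns @ w)) m = mps_coeff (\<Sum>n\<le>D. mps_const (f $ n) * F (int n # map int ns @ w)) m"
        by (simp add: ract_def) (simp add: cf_def)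
    qed
  qed
  also have "lin {..D} (map (\<lambda>f n. mps_const (f $ n)) fs) (\<lambda>ns. \<Sum>n\<le>D. mps_const (f $ n) * F (int n # map int ns @ w)) =
      lin {..D} (map (\<lambda>f n. mps_const (f $ n)) (f # fs)) (\<lambda>ns. F (map int ns @ w))"
    by (simp add: lin_sum lin_scale)
  finally show ?case .
qed (simp add: letters_simps)

lemma letters_pf: "letters fs GH [] = pf gfull fs"
proof (rule mps_eq_if_eq_upto)
  fix D
  have "eq_upto D (letters fs GH []) (lin {..D} (map (\<lambda>f n. mps_const (f $ n)) fs) (\<lambda>ns. GH (map int ns @ [])))"
    by (rule letters_lin[OF gr_GH]) simp
  also have "lin {..D} (map (\<lambda>f n. mps_const (f $ n)) fs) (\<lambda>ns. GH (map int ns @ [])) = pf (gpart D) fs"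
    by (simp add: GH_pf lin_pf pf_map gpart_def[abs_def])
  also have "eq_upto D (pf (gpart D) fs) (pf gfull fs)"
    by (rule pf_eq_upto[OF gpart_gfull])
  finally show "eq_upto D (letters fs GH []) (pf gfull fs)" .
qed

theorem vev_ket_P: "vev (fexp hamiltonian) (ket_P lam) = kap ^ length (ket_fps lam) * pf gfull (twist (ket_fps lam))"
proof -
  have "vev (fexp hamiltonian) (ket_P lam) = ract GH (prod_list (map (\<lambda>f. Psi f * T.wexp) (ket_fps lam))) []"
    unfolding ket_P_eq by (rule vev_eq_ract[OF tame_prod_list])
  also have "\<dots> = kap ^ length (ket_fps lam) * letters (twist (ket_fps lam)) GH []"
    using foldl_letters_wexp[of 1 "[]"] by (simp add: ract_prod_list[OF gr_GH] letters_simps)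
  finally show ?thesis by (simp add: letters_pf)
qed


section \<open>Hahn series with exponents in \<open>\<int>\<^sup>\<infinity>\<close>\<close>

type_synonym hs = "(nat \<Rightarrow>\<^sub>0 int, qb) hahn"

lemma hahn_eqI: "(\<And>e. hahn_coeff f e = hahn_coeff g e) \<Longrightarrow> f = g"
  by (simp add: hahn_coeff_inject[symmetric] fun_eq_iff)

lemma hahn_coeff_simps [simp]:
  "hahn_coeff (f + g :: hs) e = hahn_coeff f e + hahn_coeff g e"
  "hahn_coeff (f - g :: hs) e = hahn_coeff f e - hahn_coeff g e"
  "hahn_coeff (- f :: hs) e = - hahn_coeff f e"
  "hahn_coeff (0 :: hs) e = 0"
  by (simp_all add: plus_hahn.rep_eq minus_hahn.rep_eq uminus_hahn.rep_eq zero_hahn.rep_eq)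

lemma hahn_coeff_1: "hahn_coeff (1 :: hs) e = (if e = 0 then 1 else 0)"
  by (simp add: one_hahn.rep_eq)

lemma hahn_coeff_sum [simp]: "hahn_coeff (\<Sum>i\<in>I. f i :: hs) e = (\<Sum>i\<in>I. hahn_coeff (f i) e)"
  by (induction I rule: infinite_finite_induct) auto

lemma hahn_wf: "wfp_on {e. hahn_coeff f e \<noteq> 0} (<)"
  using hahn_coeff[of f] by simp

lemma finite_conv_set_hahn: "finite (conv_set (+) (hahn_coeff (f :: hs)) (hahn_coeff (g :: hs)) e)"
  by (rule finite_conv_hahn[OF hahn_wf hahn_wf])

lemma hahn_coeff_mult_superset:
  assumes "finite S" "conv_set (+) (hahn_coeff (f :: hs)) (hahn_coeff g) e \<subseteq> S" "\<And>a b. (a, b) \<in> S \<Longrightarrow> a + b = e"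
  shows "hahn_coeff (f * g) e = (\<Sum>(a, b)\<in>S. hahn_coeff f a * hahn_coeff g b)"
  unfolding times_hahn.rep_eq by (rule conv_superset[OF assms])

lemma hahn_mult_nonzeroD:
  assumes "hahn_coeff (f * g :: hs) e \<noteq> 0"
  obtains a b where "a + b = e" "hahn_coeff f a \<noteq> 0" "hahn_coeff g b \<noteq> 0"
  using assms unfolding times_hahn.rep_eq using conv_nonzeroD by metis

lemma hahn_monom_coeff: "hahn_coeff (hahn_monom e c) e' = (if e' = e then c else 0)"
  by (simp add: hahn_monom.rep_eq)

lemma hahn_monom_mult_coeff: "hahn_coeff (hahn_monom e c * f :: hs) e' = c * hahn_coeff f (e' - e)"
proof -
  have "hahn_coeff (hahn_monom e c * f) e' = (\<Sum>(a, b)\<in>{(e, e' - e)}. hahn_coeff (hahn_monom e c) a * hahn_coeff f b)"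
    by (rule hahn_coeff_mult_superset) (auto simp: conv_set_def hahn_monom_coeff split: if_splits)
  thus ?thesis by (simp add: hahn_monom_coeff)
qed

lemma hahn_monom_mult: "hahn_monom e c * hahn_monom e' c' = (hahn_monom (e + e') (c * c') :: hs)"
  by (rule hahn_eqI) (auto simp: hahn_monom_mult_coeff hahn_monom_coeff)

lemma hahn_monom_0_1 [simp]: "hahn_monom 0 1 = (1 :: hs)"
  by (rule hahn_eqI) (simp add: hahn_monom_coeff hahn_coeff_1)

definition hc :: "qb \<Rightarrow> hs" where
  "hc c = hahn_monom 0 c"

lemma hc_coeff: "hahn_coeff (hc c) e = (if e = 0 then c else 0)"
  by (simp add: hc_def hahn_monom_coeff)

lemma hc_mult_coeff [simp]: "hahn_coeff (hc c * f) e = c * hahn_coeff f e"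
  by (simp add: hc_def hahn_monom_mult_coeff)

lemma hc_hom:
  "hc 0 = 0" "hc 1 = 1" "hc (a + b) = hc a + hc b" "hc (a - b) = hc a - hc b"
  "hc (a * b) = hc a * hc b" "hc (- a) = - hc a"
  by (rule hahn_eqI; simp add: hc_coeff hahn_coeff_1)+

lemma hc_of_nat: "hc (of_nat n) = of_nat n"
  by (induction n) (auto simp: hc_hom)

lemma hc_power: "hc (a ^ n) = hc a ^ n"
  by (induction n) (auto simp: hc_hom)

lemma hc_numeral: "hc (numeral n) = numeral n"
  using hc_of_nat[of "numeral n"] by simp

text \<open>Serves to divide by the degree when an Euler equation is solved over this ring.\<close>

lemma hahn_torsion_free: "n > 0 \<Longrightarrow> of_nat n * (f :: hs) = 0 \<Longrightarrow> f = 0"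
proof -
  assume n: "n > 0" "of_nat n * f = 0"
  have "of_nat n * hahn_coeff f e = 0" for e
    using arg_cong[OF n(2), of "\<lambda>f. hahn_coeff f e"] by (simp flip: hc_of_nat)
  thus "f = 0" using n(1) by (intro hahn_eqI) simp
qed

definition hvars :: "nat set \<Rightarrow> hs \<Rightarrow> bool" where
  "hvars I f \<longleftrightarrow> (\<forall>e. hahn_coeff f e \<noteq> 0 \<longrightarrow> Poly_Mapping.keys e \<subseteq> I)"

lemma hvarsD: "hvars I f \<Longrightarrow> hahn_coeff f e \<noteq> 0 \<Longrightarrow> Poly_Mapping.keys e \<subseteq> I"
  by (simp add: hvars_def)

lemma hvarsI: "(\<And>e. \<not> Poly_Mapping.keys e \<subseteq> I \<Longrightarrow> hahn_coeff f e = 0) \<Longrightarrow> hvars I f"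
  by (auto simp: hvars_def)

lemma hvars_zero: "hvars I f \<Longrightarrow> \<not> Poly_Mapping.keys e \<subseteq> I \<Longrightarrow> hahn_coeff f e = 0"
  by (auto simp: hvars_def)

lemma hvars_mono: "hvars I f \<Longrightarrow> I \<subseteq> J \<Longrightarrow> hvars J f"
  by (auto simp: hvars_def)

lemma hvars_mult [intro]:
  assumes "hvars I f" "hvars I g"
  shows "hvars I (f * g)"
  unfolding hvars_def
proof (intro allI impI)
  fix e assume "hahn_coeff (f * g) e \<noteq> 0"
  then obtain a b where "a + b = e" "hahn_coeff f a \<noteq> 0" "hahn_coeff g b \<noteq> 0" by (rule hahn_mult_nonzeroD)
  moreover from this have "Poly_Mapping.keys a \<subseteq> I" "Poly_Mapping.keys b \<subseteq> I"
    using assms by (auto simp: hvars_def)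
  ultimately show "Poly_Mapping.keys e \<subseteq> I" using keys_add[of a b] by auto
qed

lemma hvars_add [intro]: "hvars I f \<Longrightarrow> hvars I g \<Longrightarrow> hvars I (f + g)"
  and hvars_diff [intro]: "hvars I f \<Longrightarrow> hvars I g \<Longrightarrow> hvars I (f - g)"
  and hvars_uminus [intro]: "hvars I f \<Longrightarrow> hvars I (- f)"
  by (rule hvarsI, simp add: hvars_zero)+

lemma hvars_0 [intro]: "hvars I 0"
  by (simp add: hvars_def)

lemma hvars_hc [intro]: "hvars I (hc c)"
  by (auto simp: hvars_def hc_coeff)

lemma hvars_1 [intro]: "hvars I 1"
  using hvars_hc[of I 1] by (simp add: hc_hom)

lemma hvars_power [intro]: "hvars I f \<Longrightarrow> hvars I (f ^ n)"
  by (induction n) auto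

definition hlow :: "nat \<Rightarrow> int \<Rightarrow> hs \<Rightarrow> bool" where
  "hlow i k f \<longleftrightarrow> (\<forall>e. hahn_coeff f e \<noteq> 0 \<longrightarrow> k \<le> Poly_Mapping.lookup e i)"

lemma hlowD: "hlow i k f \<Longrightarrow> Poly_Mapping.lookup e i < k \<Longrightarrow> hahn_coeff f e = 0"
  by (force simp: hlow_def)

lemma hlow_mono: "hlow i k f \<Longrightarrow> l \<le> k \<Longrightarrow> hlow i l f"
  by (force simp: hlow_def)

lemma hlow_mult: "hlow i k f \<Longrightarrow> hlow i l g \<Longrightarrow> hlow i (k + l) (f * g)"
  unfolding hlow_def
proof (intro allI impI)
  fix e assume *: "\<forall>e. hahn_coeff f e \<noteq> 0 \<longrightarrow> k \<le> Poly_Mapping.lookup e i"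
    "\<forall>e. hahn_coeff g e \<noteq> 0 \<longrightarrow> l \<le> Poly_Mapping.lookup e i" "hahn_coeff (f * g) e \<noteq> 0"
  from *(3) obtain a b where "a + b = e" "hahn_coeff f a \<noteq> 0" "hahn_coeff g b \<noteq> 0" by (rule hahn_mult_nonzeroD)
  moreover from this have "k \<le> Poly_Mapping.lookup a i" "l \<le> Poly_Mapping.lookup b i" using * by blast+
  ultimately show "k + l \<le> Poly_Mapping.lookup e i" by (auto simp: lookup_add)
qed

lemma hlow_add: "hlow i k f \<Longrightarrow> hlow i k g \<Longrightarrow> hlow i k (f + g)"
  by (auto simp: hlow_def) (metis add.right_neutral)

lemma hlow_uminus: "hlow i k f \<Longrightarrow> hlow i k (- f)"
  by (auto simp: hlow_def)

lemma hlow_hc: "k \<le> 0 \<Longrightarrow> hlow i k (hc c)"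
  by (auto simp: hlow_def hc_coeff)

lemma hlow_1: "k \<le> 0 \<Longrightarrow> hlow i k 1"
  using hlow_hc[of k i 1] by (simp add: hc_hom)

lemma hlow_power: "hlow i k f \<Longrightarrow> hlow i (int n * k) (f ^ n)"
proof (induction n)
  case (Suc n)
  show ?case using hlow_mult[OF Suc.prems Suc.IH[OF Suc.prems]] by (simp add: algebra_simps)
qed (simp add: hlow_1)

lemma hvars_lookup: "hvars I f \<Longrightarrow> hahn_coeff f e \<noteq> 0 \<Longrightarrow> i \<notin> I \<Longrightarrow> Poly_Mapping.lookup e i = 0"
  using hvarsD[of I f e] by (auto simp: in_keys_iff)

lemma hlow_not_var: "hvars I f \<Longrightarrow> i \<notin> I \<Longrightarrow> k \<le> 0 \<Longrightarrow> hlow i k f"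
  using hvars_lookup by (auto simp: hlow_def)

text \<open>Exponents of the variables before \<open>u\<^sub>i\<close> must vanish: these dominate the order of the exponents.\<close>

definition hfirst :: "nat \<Rightarrow> hs \<Rightarrow> bool" where
  "hfirst i f \<longleftrightarrow> (\<forall>e j. hahn_coeff f e \<noteq> 0 \<longrightarrow> j < i \<longrightarrow> Poly_Mapping.lookup e j = 0)"

lemma hfirst_mult:
  assumes "hfirst i f" "hfirst i g"
  shows "hfirst i (f * g)"
  unfolding hfirst_def
proof (intro allI impI)
  fix e j assume "hahn_coeff (f * g) e \<noteq> 0" and j: "j < i"
  from this(1) obtain a b where "a + b = e" "hahn_coeff f a \<noteq> 0" "hahn_coeff g b \<noteq> 0" by (rule hahn_mult_nonzeroD)
  with assms j show "Poly_Mapping.lookup e j = 0" by (auto simp: hfirst_def lookup_add)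
qed

lemma hfirst_power: "hfirst i f \<Longrightarrow> hfirst i (f ^ n)"
  by (induction n) (auto simp: hfirst_mult, auto simp: hfirst_def hahn_coeff_1 split: if_splits)

lemma hfirst_hvars: "hvars I f \<Longrightarrow> (\<And>j. j < i \<Longrightarrow> j \<notin> I) \<Longrightarrow> hfirst i f"
  using hvars_lookup by (auto simp: hfirst_def)

lemma less_poly_mapping_first:
  fixes e e' :: "nat \<Rightarrow>\<^sub>0 int"
  assumes "\<And>j. j < i \<Longrightarrow> Poly_Mapping.lookup e j = 0" "\<And>j. j < i \<Longrightarrow> Poly_Mapping.lookup e' j = 0"
    and "Poly_Mapping.lookup e i < Poly_Mapping.lookup e' i"
  shows "e < e'"
  unfolding less_poly_mapping.rep_eq less_fun_def using assms by (intro exI[of _ i]) auto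

section \<open>Geometric series of Hahn series\<close>

lemma wfp_on_UN_less:
  assumes "finite I" "\<And>i. i \<in> I \<Longrightarrow> wfp_on (A i :: 'g::linorder set) (<)"
  shows "wfp_on (\<Union>i\<in>I. A i) (<)"
  using assms
proof (induction I rule: finite_induct)
  case (insert i I)
  thus ?case using wfp_on_Un_less[of "A i" "\<Union>i\<in>I. A i"] by simp
qed (simp add: wfp_on_def)

text \<open>The coefficient of the sum of all powers of a. If every exponent in a has u_i-degree at
  least 1, powers beyond the u_i-degree of e cannot reach e.\<close>

definition hgeo_fun :: "nat \<Rightarrow> hs \<Rightarrow> (nat \<Rightarrow>\<^sub>0 int) \<Rightarrow> qb" where
  "hgeo_fun i a e = (\<Sum>k\<le>nat (Poly_Mapping.lookup e i). hahn_coeff (a ^ k) e)"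

lemma hgeo_fun_nonzeroD: "hgeo_fun i a e \<noteq> 0 \<Longrightarrow> \<exists>k\<le>nat (Poly_Mapping.lookup e i). hahn_coeff (a ^ k) e \<noteq> 0"
  unfolding hgeo_fun_def by (metis atMost_iff sum.not_neutral_contains_not_neutral)

text \<open>With the earlier exponents zero, the order compares the u_i-degrees first. At the least
  one occurring in B only finitely many powers contribute, and a finite union of well-ordered
  supports is well-ordered.\<close>

lemma hgeo_wf:
  assumes "hfirst i a" "hlow i 1 a"
  shows "wfp_on {e. hgeo_fun i a e \<noteq> 0} (<)"
  unfolding wfp_on_iff_ex_minimal
proof (intro allI impI)
  fix B assume B: "B \<subseteq> {e. hgeo_fun i a e \<noteq> 0}" "B \<noteq> {}"
  have nn: "0 \<le> Poly_Mapping.lookup e i" and first: "j < i \<Longrightarrow> Poly_Mapping.lookup e j = 0" if eB: "e \<in> B" for e j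
  proof -
    have "hgeo_fun i a e \<noteq> 0" using B(1) eB by blast
    then obtain k where k: "hahn_coeff (a ^ k) e \<noteq> 0" using hgeo_fun_nonzeroD by blast
    thus "0 \<le> Poly_Mapping.lookup e i" using hlow_power[OF assms(2), of k] by (force simp: hlow_def)
    show "j < i \<Longrightarrow> Poly_Mapping.lookup e j = 0"
      using hfirst_power[OF assms(1), of k] k by (auto simp: hfirst_def)
  qed
  obtain e0 where e0: "e0 \<in> B" "\<And>e. e \<in> B \<Longrightarrow> nat (Poly_Mapping.lookup e0 i) \<le> nat (Poly_Mapping.lookup e i)"
    using B(2) ex_has_least_nat[of "\<lambda>e. e \<in> B" _ "\<lambda>e. nat (Poly_Mapping.lookup e i)"] by blast
  define v where "v = nat (Poly_Mapping.lookup e0 i)"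
  let ?Bv = "{e \<in> B. nat (Poly_Mapping.lookup e i) = v}"
  have "?Bv \<subseteq> (\<Union>k\<in>{..v}. {e. hahn_coeff (a ^ k) e \<noteq> 0})"
    using B(1) hgeo_fun_nonzeroD by fastforce
  moreover have "wfp_on (\<Union>k\<in>{..v}. {e. hahn_coeff (a ^ k) e \<noteq> 0}) (<)"
    by (rule wfp_on_UN_less) (auto intro: hahn_wf)
  ultimately have "\<exists>z\<in>?Bv. \<forall>y\<in>?Bv. z \<le> y"
    using e0(1) by (intro wfp_on_less_ex_min) (auto simp: v_def)
  then obtain z where z: "z \<in> ?Bv" "\<forall>y\<in>?Bv. z \<le> y" by blast
  have "z \<le> y" if y: "y \<in> B" for y
  proof (cases "nat (Poly_Mapping.lookup y i) = v")
    case False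
    hence "v < nat (Poly_Mapping.lookup y i)" using e0(2)[OF y] unfolding v_def by linarith
    hence "Poly_Mapping.lookup z i < Poly_Mapping.lookup y i" using z(1) by auto
    thus ?thesis using z(1) first y less_poly_mapping_first[of i z y] by (simp add: less_imp_le)
  qed (use z(2) y in blast)
  thus "\<exists>z\<in>B. \<forall>y. y < z \<longrightarrow> y \<notin> B" using z(1) by (metis (no_types, lifting) mem_Collect_eq not_le)
qed

definition hgeo :: "nat \<Rightarrow> hs \<Rightarrow> hs" where
  "hgeo i a = Abs_hahn (hgeo_fun i a)"

context
  fixes i :: nat and a :: hs
  assumes first: "hfirst i a" and low: "hlow i 1 a"
begin

lemma hgeo_coeff: "hahn_coeff (hgeo i a) e = hgeo_fun i a e"
  unfolding hgeo_def by (subst Abs_hahn_inverse) (auto intro: hgeo_wf[OF first low])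

lemma hgeo_coeff_sum:
  assumes "int N \<ge> Poly_Mapping.lookup e i"
  shows "hahn_coeff (hgeo i a) e = hahn_coeff (\<Sum>k\<le>N. a ^ k) e"
proof -
  have "hahn_coeff (a ^ k) e = 0" if "k > nat (Poly_Mapping.lookup e i)" for k
    using that by (intro hlowD[OF hlow_power[OF low]]) simp
  hence "(\<Sum>k\<le>N. hahn_coeff (a ^ k) e) = hgeo_fun i a e"
    unfolding hgeo_fun_def using assms by (intro sum.mono_neutral_right) auto
  thus ?thesis by (simp add: hgeo_coeff)
qed

lemma hgeo_inverse: "(1 - a) * hgeo i a = 1"
proof (rule hahn_eqI)
  fix e
  define N where "N = nat (Poly_Mapping.lookup e i)"
  let ?b = "\<Sum>k\<le>N. a ^ k"
  let ?S = "conv_set (+) (hahn_coeff a) (hahn_coeff (hgeo i a)) e \<union> conv_set (+) (hahn_coeff a) (hahn_coeff ?b) e"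
  have fin: "finite ?S" using finite_conv_set_hahn by blast
  have "hahn_coeff (a * hgeo i a) e = (\<Sum>(x, y)\<in>?S. hahn_coeff a x * hahn_coeff (hgeo i a) y)"
    by (rule hahn_coeff_mult_superset[OF fin]) (auto simp: conv_set_def)
  also have "\<dots> = (\<Sum>(x, y)\<in>?S. hahn_coeff a x * hahn_coeff ?b y)"
  proof (intro sum.cong refl, clarify)
    fix x y assume "(x, y) \<in> ?S"
    hence xy: "x + y = e" "hahn_coeff a x \<noteq> 0" by (auto simp: conv_set_def)
    hence "Poly_Mapping.lookup x i \<ge> 1" using low by (auto simp: hlow_def)
    hence "Poly_Mapping.lookup y i \<le> int N" using xy(1) by (auto simp: N_def lookup_add)
    thus "hahn_coeff a x * hahn_coeff (hgeo i a) y = hahn_coeff a x * hahn_coeff ?b y"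
      by (simp only: hgeo_coeff_sum)
  qed
  also have "\<dots> = hahn_coeff (a * ?b) e"
    by (rule hahn_coeff_mult_superset[OF fin, symmetric]) (auto simp: conv_set_def)
  finally have "hahn_coeff ((1 - a) * hgeo i a) e = hahn_coeff ((1 - a) * ?b) e"
    using hgeo_coeff_sum[of e N] by (simp add: left_diff_distrib N_def)
  also have "(1 - a) * ?b = 1 - a ^ Suc N"
    by (rule sum_gp_basic)
  also have "hahn_coeff (1 - a ^ Suc N) e = hahn_coeff 1 e"
    using hlowD[OF hlow_power[OF low, of "Suc N"], of e] by (simp add: N_def del: power_Suc)
  finally show "hahn_coeff ((1 - a) * hgeo i a) e = hahn_coeff 1 e" .
qed

lemma hvars_hgeo: "hvars I a \<Longrightarrow> hvars I (hgeo i a)"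
  unfolding hvars_def hgeo_coeff using hgeo_fun_nonzeroD hvars_power[of I a] by (metis hvars_def)

lemma hlow_hgeo: "hlow i 0 (hgeo i a)"
  unfolding hlow_def hgeo_coeff
proof (intro allI impI)
  fix e assume "hgeo_fun i a e \<noteq> 0"
  then obtain k where "hahn_coeff (a ^ k) e \<noteq> 0" using hgeo_fun_nonzeroD by blast
  thus "0 \<le> Poly_Mapping.lookup e i" using hlow_power[OF low, of k] by (force simp: hlow_def)
qed

end


section \<open>The Euler operator and infinite products\<close>

definition mgeo :: "'a::comm_ring_1 mps \<Rightarrow> 'a mps" where
  "mgeo f = Abs_mps (\<lambda>m. \<Sum>k\<le>mdeg m. mps_coeff (f ^ k) m)"

lemma mgeo_eq_upto:
  assumes "ord 1 f" "D \<le> N"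
  shows "eq_upto D (mgeo f) (\<Sum>k\<le>N. f ^ k)"
  unfolding eq_upto_def
proof (intro allI impI)
  fix m assume m: "mdeg m \<le> D"
  have "mps_coeff (f ^ k) m = 0" if "k > mdeg m" for k
    using that by (intro ord_eq_0[OF ord_power[OF assms(1)]]) simp
  hence "(\<Sum>k\<le>mdeg m. mps_coeff (f ^ k) m) = (\<Sum>k\<le>N. mps_coeff (f ^ k) m)"
    using m assms(2) by (intro sum.mono_neutral_left) simp_all
  thus "mps_coeff (mgeo f) m = mps_coeff (\<Sum>k\<le>N. f ^ k) m" by (simp add: mgeo_def)
qed

lemma mgeo_inverse:
  assumes "ord 1 f"
  shows "(1 - f) * mgeo f = 1"
proof (rule mps_eq_if_eq_upto)
  fix D
  have "eq_upto D ((1 - f) * mgeo f) ((1 - f) * (\<Sum>k\<le>D. f ^ k))"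
    by (intro eq_upto_mult mgeo_eq_upto assms) auto
  also have "(1 - f) * (\<Sum>k\<le>D. f ^ k) = 1 - f ^ Suc D" by (rule sum_gp_basic)
  also have "eq_upto D (1 - f ^ Suc D) 1"
    using ord_eq_0[OF ord_power[OF assms, of "Suc D"]] by (auto simp: eq_upto_def simp del: power_Suc)
  finally show "eq_upto D ((1 - f) * mgeo f) 1" .
qed

text \<open>The sum of x_j d/dx_j. Its logarithmic derivatives turn exponentials and infinite
  products into power sums, and its kernel consists of the constants when the degrees can be
  cancelled.\<close>

definition EE :: "'a::comm_ring_1 mps \<Rightarrow> 'a mps" where
  "EE f = Abs_mps (\<lambda>m. of_nat (mdeg m) * mps_coeff f m)"

lemma EE_coeff: "mps_coeff (EE f) m = of_nat (mdeg m) * mps_coeff f m"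
  by (simp add: EE_def)

lemma EE_simps:
  "EE (f + g) = EE f + EE g" "EE (f - g) = EE f - EE g" "EE (- f) = - EE f" "EE 0 = 0"
  "EE 1 = 0" "EE (mps_const c) = 0"
  by (rule mps_eqI; simp add: EE_coeff algebra_simps mps_coeff_1 mps_const_coeff)+

lemma EE_const_mult: "EE (mps_const c * f) = mps_const c * EE f"
  by (rule mps_eqI) (simp add: EE_coeff mult.left_commute)

lemma EE_sum: "EE (\<Sum>i\<in>I. f i) = (\<Sum>i\<in>I. EE (f i))"
  by (induction I rule: infinite_finite_induct) (auto simp: EE_simps)

lemma EE_mult: "EE (f * g) = EE f * g + f * EE g"
proof (rule mps_eqI)
  fix m
  have "mps_coeff (EE (f * g)) m = (\<Sum>(a, b)\<in>splits m. of_nat (mdeg m) * (mps_coeff f a * mps_coeff g b))"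
    by (simp add: EE_coeff mps_coeff_mult sum_distrib_left case_prod_unfold)
  also have "\<dots> = (\<Sum>(a, b)\<in>splits m. mps_coeff (EE f) a * mps_coeff g b + mps_coeff f a * mps_coeff (EE g) b)"
    by (intro sum.cong refl) (auto simp: EE_coeff algebra_simps dest!: splits_mdeg)
  also have "\<dots> = mps_coeff (EE f * g + f * EE g) m"
    by (simp add: mps_coeff_mult sum.distrib case_prod_unfold)
  finally show "mps_coeff (EE (f * g)) m = mps_coeff (EE f * g + f * EE g) m" .
qed

lemma EE_power: "EE (f ^ Suc n) = of_nat (Suc n) * f ^ n * EE f"
proof (induction n)
  case (Suc n)
  have "EE (f ^ Suc (Suc n)) = EE f * f ^ Suc n + f * EE (f ^ Suc n)" by (simp add: EE_mult)
  thus ?case unfolding Suc by (simp add: algebra_simps)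
qed simp

lemma EE_psum: "EE (psum a) = psum (\<lambda>n. of_nat n * a n)"
  by (rule mps_eqI) (simp add: EE_coeff psum_coeff)

lemma EE_eq_upto: "eq_upto D f g \<Longrightarrow> eq_upto D (EE f) (EE g)"
  by (simp add: eq_upto_def EE_coeff)

definition psum1 :: "nat \<Rightarrow> (nat \<Rightarrow> 'a::comm_ring_1) \<Rightarrow> 'a mps" where
  "psum1 j a = Abs_mps (\<lambda>m. if Poly_Mapping.keys m = {j} then a (mdeg m) else 0)"

lemma psum1_coeff: "mps_coeff (psum1 j a) m = (if Poly_Mapping.keys m = {j} then a (mdeg m) else 0)"
  by (simp add: psum1_def)

lemma ord_const_xvar: "ord 1 (mps_const y * xvar j)"
  by (auto simp: ord_def xvar.rep_eq)

lemma keys_singleton_iff: "Poly_Mapping.keys m = {j} \<longleftrightarrow> m \<noteq> 0 \<and> m = Poly_Mapping.single j (mdeg m)"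
proof
  assume *: "Poly_Mapping.keys m = {j}"
  hence "mdeg m = Poly_Mapping.lookup m j" by (simp add: mdeg_def)
  moreover have "Poly_Mapping.lookup m i = 0" if "i \<noteq> j" for i
    using * that by (metis in_keys_iff singletonD)
  ultimately have "m = Poly_Mapping.single j (mdeg m)"
    by (intro poly_mapping_eqI) (auto simp: lookup_single when_def)
  thus "m \<noteq> 0 \<and> m = Poly_Mapping.single j (mdeg m)" using * by auto
next
  assume *: "m \<noteq> 0 \<and> m = Poly_Mapping.single j (mdeg m)"
  hence "mdeg m \<noteq> 0" by (simp add: mdeg_eq_0_iff)
  thus "Poly_Mapping.keys m = {j}" using * by (metis keys_single)
qed

lemma mgeo_xvar: "mgeo (mps_const y * xvar j) = 1 + psum1 j (\<lambda>n. y ^ n)"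
proof (rule mps_eqI)
  fix m
  have eq: "mps_coeff ((mps_const y * xvar j) ^ k) m = (if m = Poly_Mapping.single j k then y ^ k else 0)" for k
    by (simp add: power_mult_distrib xvar_power_coeff flip: mps_const_power)
  have "mps_coeff (mgeo (mps_const y * xvar j)) m = (\<Sum>k\<le>mdeg m. if m = Poly_Mapping.single j k then y ^ k else 0)"
    by (simp add: mgeo_def eq)
  also have "\<dots> = (\<Sum>k\<le>mdeg m. if k = mdeg m then if m = Poly_Mapping.single j (mdeg m) then y ^ mdeg m else 0 else 0)"
    by (intro sum.cong refl) (auto dest: arg_cong[of _ _ mdeg])
  also have "\<dots> = (if m = Poly_Mapping.single j (mdeg m) then y ^ mdeg m else 0)"
    by simp
  also have "\<dots> = mps_coeff (1 + psum1 j (\<lambda>n. y ^ n)) m"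
    by (cases "m = 0") (auto simp: psum1_coeff mps_coeff_1 keys_singleton_iff)
  finally show "mps_coeff (mgeo (mps_const y * xvar j)) m = mps_coeff (1 + psum1 j (\<lambda>n. y ^ n)) m" .
qed

lemma psum1_diff: "psum1 j (\<lambda>n. a n - b n) = psum1 j a - psum1 j b"
  by (rule mps_eqI) (simp add: psum1_coeff)

text \<open>The logarithmic derivative of (1 - y' x_j) (1 - y'' x_j) / (1 - y x_j), read off from
  that of 1 - y x_j, which is minus the sum of y^n x_j^n over n >= 1. The factors of the generating
  function have this shape.\<close>

lemma EE_factor:
  assumes "fac * (1 - mps_const y * xvar j) = (1 - mps_const y' * xvar j) * (1 - mps_const y'' * xvar j)"
  shows "EE fac = psum1 j (\<lambda>n. y ^ n - y' ^ n - y'' ^ n) * fac"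
proof -
  define A where "A = (\<lambda>y. 1 - mps_const y * xvar j :: 'a mps)"
  define s where "s = (\<lambda>y. psum1 j (\<lambda>n. y ^ n) :: 'a mps)"
  have inv: "A y * (1 + s y) = 1" for y
    unfolding A_def s_def mgeo_xvar[symmetric] by (rule mgeo_inverse[OF ord_const_xvar])
  have EA: "EE (A y) = - s y * A y" for y
  proof -
    have "EE (xvar j :: 'a mps) = xvar j"
      by (rule mps_eqI) (simp add: EE_coeff xvar.rep_eq)
    hence "EE (A y) = A y - 1" by (simp add: A_def EE_simps EE_const_mult)
    also have "1 = A y + s y * A y" using inv[of y] by (simp add: algebra_simps)
    finally show ?thesis by simp
  qed
  have fac: "fac * A y = A y' * A y''" using assms by (simp add: A_def)
  have "EE fac * A y = EE (fac * A y) - fac * EE (A y)" by (simp add: EE_mult)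
  also have "EE (fac * A y) = - (s y' + s y'') * (A y' * A y'')"
    unfolding fac EE_mult EA by (simp add: algebra_simps)
  also have "\<dots> - fac * EE (A y) = (s y - s y' - s y'') * fac * A y"
    unfolding fac[symmetric] EA by (simp add: algebra_simps)
  finally have "EE fac * (A y * (1 + s y)) = (s y - s y' - s y'') * fac * (A y * (1 + s y))"
    by (metis mult.assoc)
  hence "EE fac = (s y - s y' - s y'') * fac" by (simp add: inv)
  thus ?thesis by (simp add: s_def psum1_diff)
qed

lemma mps_coeff_mult_0: "mps_coeff (f * g) 0 = mps_coeff f 0 * mps_coeff g 0"
proof -
  have "splits 0 = {(0, 0)}" by (auto simp: splits_def dest: splits_mdeg[unfolded splits_def] arg_cong[of _ _ mdeg] simp: mdeg_add mdeg_eq_0_iff)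
  thus ?thesis by (simp add: mps_coeff_mult)
qed

lemma mps_coeff_prod_0: "mps_coeff (\<Prod>i\<in>I. f i) 0 = (\<Prod>i\<in>I. mps_coeff (f i) 0)"
  by (induction I rule: infinite_finite_induct) (auto simp: mps_coeff_mult_0 mps_coeff_1)

lemma EE_prod:
  assumes "\<And>j. EE (fac j) = l j * fac j"
  shows "EE (\<Prod>j<N::nat. fac j) = (\<Sum>j<N. l j) * (\<Prod>j<N. fac j)"
  by (induction N) (auto simp: EE_simps EE_mult assms algebra_simps)

text \<open>
  Both sides of the claim solve the same first order equation for the Euler operator. For a given
  monomial, only finitely many variables matter.
\<close>

lemma mps_prodinf_eqI:
  fixes Y :: "'a::comm_ring_1 mps"
  assumes tf: "\<And>n (x :: 'a). n > 0 \<Longrightarrow> of_nat n * x = 0 \<Longrightarrow> x = 0"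
    and fac: "\<And>j. EE (fac j) = psum1 j a * fac j" "\<And>j. mps_coeff (fac j) 0 = 1"
    and Y: "EE Y = psum a * Y" "mps_coeff Y 0 = 1"
  shows "mps_prodinf fac = Y"
proof (rule mps_eqI)
  have eq: "mps_coeff (\<Prod>j<N. fac j) m = mps_coeff Y m" if "Poly_Mapping.keys m \<subseteq> {..<N}" for m N
    using that
  proof (induction "mdeg m" arbitrary: m rule: less_induct)
    case less
    show ?case
    proof (cases "m = 0")
      case False
      have "mps_coeff (EE (\<Prod>j<N. fac j)) m = mps_coeff (EE Y) m"
        unfolding EE_prod[OF fac(1)] Y(1) mps_coeff_mult
      proof (intro sum.cong refl, clarify)
        fix b c assume bc: "(b, c) \<in> splits m"
        have keys: "Poly_Mapping.keys b \<subseteq> {..<N}" "Poly_Mapping.keys c \<subseteq> {..<N}"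
        proof -
          have "Poly_Mapping.lookup m i = Poly_Mapping.lookup b i + Poly_Mapping.lookup c i" for i
            using bc by (auto simp: splits_def lookup_add)
          hence "Poly_Mapping.keys b \<subseteq> Poly_Mapping.keys m" "Poly_Mapping.keys c \<subseteq> Poly_Mapping.keys m"
            by (auto simp: in_keys_iff)
          thus "Poly_Mapping.keys b \<subseteq> {..<N}" "Poly_Mapping.keys c \<subseteq> {..<N}" using less.prems by blast+
        qed
        have l: "mps_coeff (\<Sum>j<N. psum1 j a) b = mps_coeff (psum a) b"
        proof (cases "card (Poly_Mapping.keys b) = 1")
          case True
          then obtain j where j: "Poly_Mapping.keys b = {j}" by (meson card_1_singletonE)
          hence "(\<Sum>i<N. if Poly_Mapping.keys b = {i} then a (mdeg b) else 0) = (\<Sum>i<N. if i = j then a (mdeg b) else 0)"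
            by (intro sum.cong) auto
          thus ?thesis using j keys(1) by (simp add: psum1_coeff psum_coeff)
        next
          case False
          hence "Poly_Mapping.keys b \<noteq> {j}" for j by auto
          thus ?thesis using False by (simp add: psum1_coeff psum_coeff)
        qed
        \<comment> \<open>The logarithmic derivative has no constant term, so only coefficients of
          lower degree enter the recursion.\<close>
        show "mps_coeff (\<Sum>j<N. psum1 j a) b * mps_coeff (\<Prod>j<N. fac j) c = mps_coeff (psum a) b * mps_coeff Y c"
        proof (cases "b = 0")
          case True
          thus ?thesis using l by (simp add: psum_coeff)
        next
          case False
          hence "mdeg c < mdeg m" using splits_mdeg[OF bc] mdeg_eq_0_iff[of b] by linarith
          thus ?thesis using less.hyps keys(2) l by simp
        qed
      qed
      hence "of_nat (mdeg m) * (mps_coeff (\<Prod>j<N. fac j) m - mps_coeff Y m) = 0"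
        by (simp add: EE_coeff algebra_simps)
      moreover have "mdeg m > 0" using False mdeg_eq_0_iff[of m] by linarith
      ultimately have "mps_coeff (\<Prod>j<N. fac j) m - mps_coeff Y m = 0" by (rule tf[rotated])
      thus ?thesis by simp
    qed (simp add: mps_coeff_prod_0 fac Y)
  qed
  fix m :: "nat \<Rightarrow>\<^sub>0 nat"
  have "finite (Poly_Mapping.keys m)" by simp
  then obtain N0 where N0: "Poly_Mapping.keys m \<subseteq> {..<N0}" by (meson finite_nat_iff_bounded)
  have ev: "\<forall>\<^sub>F N in sequentially. mps_coeff (\<Prod>j<N. fac j) m = mps_coeff Y m"
    using eventually_ge_at_top[of N0] by eventually_elim (use N0 in \<open>auto intro!: eq\<close>)
  have "(THE c. \<forall>\<^sub>F N in sequentially. mps_coeff (\<Prod>j<N. fac j) m = c) = mps_coeff Y m"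
  proof (rule the_equality)
    show "\<forall>\<^sub>F N in sequentially. mps_coeff (\<Prod>j<N. fac j) m = mps_coeff Y m" by (rule ev)
    fix c assume "\<forall>\<^sub>F N in sequentially. mps_coeff (\<Prod>j<N. fac j) m = c"
    hence "\<forall>\<^sub>F N in sequentially. c = mps_coeff Y m" using ev by eventually_elim simp
    thus "c = mps_coeff Y m" by simp
  qed
  thus "mps_coeff (mps_prodinf fac) m = mps_coeff Y m" by (simp add: mps_prodinf_def)
qed


section \<open>Evaluating the exponential of the Hamiltonian\<close>

definition EF :: "'a::comm_ring_1 mps fps \<Rightarrow> 'a mps fps" where
  "EF F = Abs_fps (\<lambda>n. EE (F $ n))"

lemma EF_nth: "EF F $ n = EE (F $ n)"
  by (simp add: EF_def)

lemma EF_mult: "EF (F * G) = EF F * G + F * EF G"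
  by (rule fps_ext) (simp add: EF_nth fps_mult_nth EE_sum EE_mult sum.distrib)

lemma EF_power: "EF (F ^ Suc n) = of_nat (Suc n) * (EF F * F ^ n)"
proof (induction n)
  case (Suc n)
  have "EF (F ^ Suc (Suc n)) = EF F * F ^ Suc n + F * EF (F ^ Suc n)" by (simp add: EF_mult)
  thus ?case unfolding Suc by (simp add: algebra_simps)
qed simp

text \<open>The derivation rule for exp (4 sH). The exponential series at X^n may be extended by the
  power n + 1, which does not reach X^n; this makes room for the shift by one.\<close>

lemma EF_qq: "EF qq = EF (4 * sH) * qq"
proof (rule fps_ext)
  fix n
  let ?S = "4 * sH"
  have iv: "mps_const (1 / fact (Suc j)) * (of_nat (Suc j) * x) = mps_const (1 / fact j :: qb) * x" for j and x :: "qb mps"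
  proof -
    have "mps_const (1 / fact (Suc j)) * of_nat (Suc j) = mps_const (1 / fact j :: qb)"
      by (simp del: of_nat_Suc flip: mps_const_of_nat mps_const_hom(5))
    thus ?thesis by (simp only: mult.assoc[symmetric])
  qed
  have "EF qq $ n = (\<Sum>j\<le>n. mps_const (1 / fact j) * EF (?S ^ j) $ n)"
    by (simp add: EF_nth qq_def H.es_def EE_sum EE_simps EE_const_mult)
  also have "\<dots> = (\<Sum>j\<le>n. mps_const (1 / fact j) * (EF ?S * ?S ^ j) $ n)"
  proof -
    have "(\<Sum>j\<le>Suc n. mps_const (1 / fact j) * EF (?S ^ j) $ n) = 
        (\<Sum>j\<le>n. mps_const (1 / fact j) * (EF ?S * ?S ^ j) $ n)"
    proof -
      have "EF (?S ^ Suc j) $ n = of_nat (Suc j) * (EF ?S * ?S ^ j) $ n" for j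
        unfolding EF_power by (simp del: of_nat_Suc power_Suc flip: fps_of_nat)
      hence "mps_const (1 / fact (Suc j)) * EF (?S ^ Suc j) $ n = mps_const (1 / fact j :: qb) * (EF ?S * ?S ^ j) $ n" for j
        by (simp only: iv)
      moreover have "EF (?S ^ 0) $ n = 0" by (cases "n = 0") (simp_all add: EF_nth EE_simps)
      ultimately show ?thesis unfolding sum.atMost_Suc_shift by (simp del: power_Suc fact_Suc)
    qed
    moreover have "EF (?S ^ Suc n) $ n = 0"
      unfolding EF_nth H.s_power_nth[OF lessI] by (simp add: EE_simps)
    ultimately show ?thesis by (simp only: sum.atMost_Suc mult_zero_right add_0_right)
  qed
  also have "\<dots> = (\<Sum>j\<le>n. \<Sum>l\<le>n. mps_const (1 / fact j) * (EF ?S $ l * (?S ^ j) $ (n - l)))"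
    by (simp add: fps_mult_nth sum_distrib_left atLeast0AtMost)
  also have "\<dots> = (\<Sum>l\<le>n. EF ?S $ l * (\<Sum>j\<le>n. mps_const (1 / fact j) * (?S ^ j) $ (n - l)))"
    by (subst sum.swap) (simp add: sum_distrib_left mult_ac)
  also have "\<dots> = (\<Sum>l\<le>n. EF ?S $ l * qq $ (n - l))"
  proof (intro sum.cong refl arg_cong2[where f = times])
    fix l
    have "(\<Sum>j\<le>n. mps_const (1 / fact j) * (?S ^ j) $ (n - l)) = (\<Sum>j\<le>n - l. mps_const (1 / fact j) * (?S ^ j) $ (n - l))"
      using H.s_power_nth by (intro sum.mono_neutral_right) auto
    thus "(\<Sum>j\<le>n. mps_const (1 / fact j) * (?S ^ j) $ (n - l)) = qq $ (n - l)" by (simp add: qq_def H.es_def)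
  qed
  also have "\<dots> = (EF ?S * qq) $ n" by (simp add: fps_mult_nth atLeast0AtMost)
  finally show "EF qq $ n = (EF ?S * qq) $ n" .
qed

text \<open>Used at y = \<zeta>_i with the embedding \<open>hc\<close> of constants, and at y =
  -\<beta>/2 with the identity.\<close>

locale evaluation =
  fixes h :: "qb \<Rightarrow> 'a::comm_ring_1" and y :: 'a
  assumes h: "h 0 = 0" "h 1 = 1" "h (a + b) = h a + h b" "h (a - b) = h a - h b" "h (a * b) = h a * h b"
begin

lemma h_sum: "h (\<Sum>i\<in>I. f i) = (\<Sum>i\<in>I. h (f i))"
  by (induction I rule: infinite_finite_induct) (auto simp: h)

lemma h_of_nat: "h (of_nat n) = of_nat n"
  by (induction n) (auto simp: h)

definition mmap :: "qb mps \<Rightarrow> 'a mps" where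
  "mmap f = Abs_mps (\<lambda>m. h (mps_coeff f m))"

lemma mmap_coeff [simp]: "mps_coeff (mmap f) m = h (mps_coeff f m)"
  by (simp add: mmap_def)

lemma mmap_mult: "mmap (f * g) = mmap f * mmap g"
  by (rule mps_eqI) (simp add: mps_coeff_mult h_sum h case_prod_unfold)

lemma mmap_sum: "mmap (\<Sum>i\<in>I. f i) = (\<Sum>i\<in>I. mmap (f i))"
  by (rule mps_eqI) (simp add: h_sum)

lemma mmap_EE: "mmap (EE f) = EE (mmap f)"
  by (rule mps_eqI) (simp add: EE_coeff h h_of_nat)

lemma mmap_psum: "mmap (psum a) = psum (\<lambda>n. h (a n))"
  by (rule mps_eqI) (simp add: psum_coeff h)

lemma ord_mmap: "ord d f \<Longrightarrow> ord d (mmap f)"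
  unfolding ord_def mmap_coeff using h(1) by metis

text \<open>The value at X = y. It converges in the x-degree alone: in a \<open>regular\<close>
  series the coefficient of X^k has x-degree at least k, so the truncation loses nothing and y may
  be any ring element.\<close>

definition EV :: "qb mps fps \<Rightarrow> 'a mps" where
  "EV F = Abs_mps (\<lambda>m. \<Sum>k\<le>mdeg m. h (mps_coeff (F $ k) m) * y ^ k)"

definition regular :: "qb mps fps \<Rightarrow> bool" where
  "regular F \<longleftrightarrow> (\<forall>k. ord (int k) (F $ k))"

lemma EV_eq_upto:
  assumes "regular F" "D \<le> N"
  shows "eq_upto D (EV F) (\<Sum>k\<le>N. mps_const (y ^ k) * mmap (F $ k))"
  unfolding eq_upto_def
proof (intro allI impI)
  fix m assume m: "mdeg m \<le> D"
  have "mps_coeff (F $ k) m = 0" if "k > mdeg m" for k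
    using that assms(1) by (intro ord_eq_0[of "int k"]) (auto simp: regular_def)
  hence "(\<Sum>k\<le>mdeg m. h (mps_coeff (F $ k) m) * y ^ k) = (\<Sum>k\<le>N. h (mps_coeff (F $ k) m) * y ^ k)"
    using m assms(2) by (intro sum.mono_neutral_left) (simp_all add: h)
  thus "mps_coeff (EV F) m = mps_coeff (\<Sum>k\<le>N. mps_const (y ^ k) * mmap (F $ k)) m"
    by (simp add: EV_def mult.commute)
qed

lemma EV_mult:
  assumes "regular F" "regular G" "regular (F * G)"
  shows "EV (F * G) = EV F * EV G"
proof (rule mps_eq_if_eq_upto)
  fix D
  let ?F = "Abs_fps (\<lambda>k. mmap (F $ k))" and ?G = "Abs_fps (\<lambda>k. mmap (G $ k))"
  let ?h = "\<lambda>M. if M \<le> D then mps_const (y ^ M) else 0"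
  have "eq_upto D (EV (F * G)) (\<Sum>M\<le>D. mps_const (y ^ M) * mmap ((F * G) $ M))"
    by (rule EV_eq_upto[OF assms(3) order.refl])
  also have "(\<Sum>M\<le>D. mps_const (y ^ M) * mmap ((F * G) $ M)) = (\<Sum>M\<le>D. (?F * ?G) $ M * ?h M)"
    by (simp add: fps_mult_nth mmap_sum mmap_mult mult.commute)
  also have "\<dots> = (\<Sum>n\<le>D. \<Sum>k\<le>D. ?F $ n * ?G $ k * ?h (n + k))"
    by (rule sum_fps_mult[symmetric]) simp
  also have "eq_upto D \<dots> (\<Sum>n\<le>D. \<Sum>k\<le>D. ?F $ n * ?G $ k * mps_const (y ^ (n + k)))"
  proof (intro eq_upto_sum)
    fix n k
    show "eq_upto D (?F $ n * ?G $ k * ?h (n + k)) (?F $ n * ?G $ k * mps_const (y ^ (n + k)))"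
    proof (cases "n + k \<le> D")
      case False
      have "ord (int n + int k) (?F $ n * ?G $ k)"
        using assms by (auto simp: regular_def intro!: ord_mult ord_mmap)
      hence "ord (int n + int k) (?F $ n * ?G $ k * mps_const (y ^ (n + k)))"
        by (subst mult.commute) (rule ord_scale)
      hence "eq_upto D (?F $ n * ?G $ k * mps_const (y ^ (n + k))) 0" by (rule ord_eq_upto_0) (use False in simp)
      thus ?thesis using False by (simp add: eq_upto_sym)
    qed simp
  qed
  also have "(\<Sum>n\<le>D. \<Sum>k\<le>D. ?F $ n * ?G $ k * mps_const (y ^ (n + k))) =
      (\<Sum>n\<le>D. mps_const (y ^ n) * mmap (F $ n)) * (\<Sum>k\<le>D. mps_const (y ^ k) * mmap (G $ k))"
    by (simp add: sum_product power_add mps_const_hom mult_ac)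
  also have "eq_upto D \<dots> (EV F * EV G)"
    by (intro eq_upto_mult eq_upto_sym[OF EV_eq_upto] assms order.refl)
  finally show "eq_upto D (EV (F * G)) (EV F * EV G)" .
qed

lemma EE_EV: "EE (EV F) = EV (EF F)"
  by (rule mps_eqI) (simp add: EE_coeff EV_def EF_nth h h_of_nat sum_distrib_left mult.assoc)

lemma regular_EF: "regular F \<Longrightarrow> regular (EF F)"
  by (auto simp: regular_def EF_nth ord_def EE_coeff)

lemma regular_qq: "regular qq"
  by (simp add: regular_def ord_qq)

lemma sum_linear_power:
  "(\<Sum>k\<le>N. h (coeff ([:c, d:] ^ N) k) * y ^ k) = (h c + h d * y) ^ N"
proof (induction N)
  case (Suc N)
  let ?p = "[:c, d:] ^ N"
  have deg: "coeff ?p (Suc N) = 0"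
    by (rule coeff_eq_0) (rule le_less_trans[OF degree_power_le], cases "d = 0", auto)
  have "coeff ([:c, d:] ^ Suc N) k = c * coeff ?p k + (case k of 0 \<Rightarrow> 0 | Suc l \<Rightarrow> d * coeff ?p l)" for k
    by (simp add: coeff_pCons split: nat.splits)
  hence "(\<Sum>k\<le>Suc N. h (coeff ([:c, d:] ^ Suc N) k) * y ^ k) =
      h c * (\<Sum>k\<le>Suc N. h (coeff ?p k) * y ^ k) + (\<Sum>k\<le>Suc N. h (case k of 0 \<Rightarrow> 0 | Suc l \<Rightarrow> d * coeff ?p l) * y ^ k)"
    by (simp only: h sum_distrib_left distrib_right sum.distrib mult.assoc)
  also have "(\<Sum>k\<le>Suc N. h (coeff ?p k) * y ^ k) = (\<Sum>k\<le>N. h (coeff ?p k) * y ^ k)"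
    by (simp add: deg h)
  also have "(\<Sum>k\<le>Suc N. h (case k of 0 \<Rightarrow> 0 | Suc l \<Rightarrow> d * coeff ?p l) * y ^ k) = 
      h d * y * (\<Sum>k\<le>N. h (coeff ?p k) * y ^ k)"
    by (simp add: sum.atMost_Suc_shift h sum_distrib_left mult_ac del: sum.atMost_Suc)
  finally show ?case unfolding Suc.IH by (simp only: power_Suc distrib_right)
qed (simp add: h)

lemma sum_cb: "(\<Sum>k\<le>N. h (2 * coeff (cb N) k) * y ^ k) = (y - h (bet / 2)) ^ N - (- y - h (bet / 2)) ^ N"
proof -
  have "2 * coeff (cb N) k = coeff ([:- bet / 2, 1:] ^ N) k - coeff ([:- bet / 2, -1:] ^ N) k" for k
    by (simp add: cb_def)
  hence "(\<Sum>k\<le>N. h (2 * coeff (cb N) k) * y ^ k) =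
      (h (- bet / 2) + h 1 * y) ^ N - (h (- bet / 2) + h (-1) * y) ^ N"
    by (simp only: h left_diff_distrib sum_subtractf sum_linear_power)
  moreover have "h (- x) = - h x" for x using h(4)[of 0 x] by (simp add: h)
  ultimately show ?thesis by (simp add: h algebra_simps)
qed

text \<open>The n-th coefficient is \<open>2 * cb n\<close> evaluated at y (\<open>sum_cb\<close>).
  The equation characterises \<open>EV qq\<close> as the product of (1 + (y + \<beta>/2) x_j) / (1 -
  (y - \<beta>/2) x_j) over all j.\<close>

lemma EE_EV_qq: "EE (EV qq) = psum (\<lambda>n. (y - h (bet / 2)) ^ n - (- y - h (bet / 2)) ^ n) * EV qq"
proof -
  have S: "(4 * sH) $ k = hh k" for k
    by (simp add: sH_nth fps_numeral_fps_const mps_const_hom(2) flip: mps_const_numeral mult.assoc mps_const_hom(5))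
  have reg: "regular (4 * sH)" by (simp only: regular_def S ord_hh simp_thms)
  have "EE (EV qq) = EV (EF (4 * sH) * qq)" by (simp add: EE_EV EF_qq)
  also have "\<dots> = EV (EF (4 * sH)) * EV qq"
    using regular_EF[OF regular_qq] by (intro EV_mult regular_EF reg regular_qq) (simp add: EF_qq)
  also have "EV (EF (4 * sH)) = psum (\<lambda>n. (y - h (bet / 2)) ^ n - (- y - h (bet / 2)) ^ n)"
  proof (rule mps_eqI)
    fix m
    have "EF (4 * sH) $ k = EE (hh k)" for k by (simp only: EF_nth S)
    hence "mps_coeff (EF (4 * sH) $ k) m = (if card (Poly_Mapping.keys m) = 1 then 2 * coeff (cb (mdeg m)) k else 0)" for k
      using card_keys_mdeg[of m] by (auto simp: hh_def EE_psum psum_coeff)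
    thus "mps_coeff (EV (EF (4 * sH))) m = mps_coeff (psum (\<lambda>n. (y - h (bet / 2)) ^ n - (- y - h (bet / 2)) ^ n)) m"
      by (simp add: EV_def psum_coeff h(1) flip: sum_cb)
  qed
  finally show ?thesis .
qed

lemma EV_qq_0: "mps_coeff (EV qq) 0 = 1"
  by (simp add: EV_def qq_def H.es_def mps_coeff_1 h mps_const_hom)

end

text \<open>At \<beta>/2 one of the two powers in \<open>cb n\<close> vanishes and the other is
  (-\<beta>)^n. This is the logarithmic derivative of the product of all 1 + \<beta> x_j, which is
  how that product is recognised.\<close>

lemma EE_kap: "EE kap = psum (\<lambda>n. - ((- bet) ^ n)) * kap"
proof -
  have cc: "EE cc = psum (\<lambda>n. - ((- bet) ^ n))"
  proof (rule mps_eqI)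
    fix m
    have "2 * poly (cb n) (bet / 2) = - ((- bet) ^ n)" if "n > 0" for n
      using that by (simp add: cb_def)
    thus "mps_coeff (EE cc) m = mps_coeff (psum (\<lambda>n. - ((- bet) ^ n))) m"
      using card_keys_mdeg[of m] by (auto simp: cc_def EE_psum psum_coeff)
  qed
  have "EE kap = EE cc * kap"
  proof (rule mps_eq_if_eq_upto)
    fix D
    have ord: "ord 1 cc" by (simp add: cc_def ord_psum)
    have iv: "mps_const (1 / fact (Suc k)) * (of_nat (Suc k) * x) = mps_const (1 / fact k :: qb) * x" for k and x :: "qb mps"
    proof -
      have "mps_const (1 / fact (Suc k)) * of_nat (Suc k) = mps_const (1 / fact k :: qb)"
        by (simp del: of_nat_Suc flip: mps_const_of_nat mps_const_hom(5))
      thus ?thesis by (simp only: mult.assoc[symmetric])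
    qed
    have "eq_upto D (EE kap) (EE (\<Sum>k\<le>Suc D. mps_const (1 / fact k) * cc ^ k))"
      unfolding kap_def by (intro EE_eq_upto eq_upto_sym[OF mexp_eq_upto] ord) simp
    also have "EE (\<Sum>k\<le>Suc D. mps_const (1 / fact k) * cc ^ k) = (\<Sum>k\<le>Suc D. mps_const (1 / fact k) * EE (cc ^ k))"
      by (simp add: EE_sum EE_simps EE_const_mult)
    also have "\<dots> = (\<Sum>k\<le>D. mps_const (1 / fact k) * (cc ^ k * EE cc))"
      unfolding sum.atMost_Suc_shift EE_power mult.assoc iv by (simp add: EE_simps)
    also have "\<dots> = EE cc * (\<Sum>k\<le>D. mps_const (1 / fact k) * cc ^ k)"
      by (simp add: sum_distrib_left mult_ac)
    also have "eq_upto D \<dots> (EE cc * kap)"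
      unfolding kap_def by (intro eq_upto_mult eq_upto_refl mexp_eq_upto ord) simp
    finally show "eq_upto D (EE kap) (EE cc * kap)" .
  qed
  thus ?thesis by (simp only: cc)
qed

lemma kap_0: "mps_coeff kap 0 = 1"
  by (simp add: kap_def mexp_def mps_coeff_1)

interpretation E0: evaluation "\<lambda>x. x" "- (bet / 2) :: qb"
  by standard auto

text \<open>At y = -\<beta>/2 the numerators of the product for \<open>EV qq\<close> become 1 and
  the denominators 1 + \<beta> x_j; correspondingly the two logarithmic derivatives cancel.\<close>

lemma kap_inverse: "kap * E0.EV qq = 1"
proof -
  have "EE (kap * E0.EV qq) = (psum (\<lambda>n. - ((- bet) ^ n)) +
      psum (\<lambda>n. (- (bet / 2) - bet / 2) ^ n - (- (- (bet / 2)) - bet / 2) ^ n)) * (kap * E0.EV qq)"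
    by (simp only: EE_mult EE_kap E0.EE_EV_qq) (simp add: algebra_simps)
  also have "psum (\<lambda>n. - ((- bet) ^ n)) + psum (\<lambda>n. (- (bet / 2) - bet / 2) ^ n - (- (- (bet / 2)) - bet / 2) ^ n) = 0"
    by (rule mps_eqI) (use card_keys_mdeg in \<open>auto simp: psum_coeff\<close>)
  finally have "EE (kap * E0.EV qq) = 0" by simp
  hence *: "of_nat (mdeg m) * mps_coeff (kap * E0.EV qq) m = 0" for m
    using EE_coeff[of "kap * E0.EV qq" m] by simp
  show ?thesis
  proof (rule mps_eqI)
    fix m
    show "mps_coeff (kap * E0.EV qq) m = mps_coeff 1 m"
      using *[of m] by (cases "m = 0") (simp_all add: mps_coeff_mult_0 kap_0 E0.EV_qq_0 mps_coeff_1 mdeg_eq_0_iff)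
  qed
qed


section \<open>Schur's Pfaffian\<close>

lemma unit_mult_cancel:
  assumes "u dvd 1" "x * u = y * (u :: 'a::comm_ring_1)"
  shows "x = y"
proof -
  from assms(1) obtain d where d: "1 = u * d" by (rule dvdE)
  have "x = x * (u * d)" by (simp flip: d)
  also have "\<dots> = y * (u * d)" by (simp only: mult.assoc[symmetric] assms(2))
  finally show ?thesis by (simp flip: d)
qed

text \<open>After a root is split off, the others remain roots of the quotient because differences
  of roots are units; this takes the place of the absence of zero divisors.\<close>

lemma poly_eq_0_many_roots:
  fixes p :: "'a::comm_ring_1 poly"
  assumes "finite J" "degree p < card J" "\<And>j. j \<in> J \<Longrightarrow> poly p (z j) = 0"
    and "\<And>i j. i \<in> J \<Longrightarrow> j \<in> J \<Longrightarrow> i \<noteq> j \<Longrightarrow> z i - z j dvd 1"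
  shows "p = 0"
  using assms
proof (induction J arbitrary: p rule: finite_induct)
  case (insert k J)
  have "poly p (z k) = 0" using insert.prems by simp
  then obtain q where q: "p = [:- z k, 1:] * q" unfolding poly_eq_0_iff_dvd by (elim dvdE)
  have "poly q (z j) = 0" if "j \<in> J" for j
  proof -
    have 0: "(z j - z k) * poly q (z j) = 0"
      using insert.prems(2)[of j] that by (simp add: q algebra_simps)
    have "z j - z k dvd 1" using insert.prems(3)[of j k] that insert.hyps by auto
    thus ?thesis using unit_mult_cancel[of "z j - z k" "poly q (z j)" 0] 0 by (simp add: mult.commute)
  qed
  moreover have "degree q < card J" if "q \<noteq> 0"
  proof -
    have "coeff p (Suc (degree q)) = lead_coeff q" by (simp add: q coeff_eq_0)
    hence "Suc (degree q) \<le> degree p" using that by (intro le_degree) simp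
    thus ?thesis using insert.prems(1) insert.hyps by simp
  qed
  ultimately have "q = 0" using insert.IH[of q] insert.prems(3) by blast
  thus ?case by (simp add: q)
qed simp

lemma prod_linear_monic:
  assumes "finite J"
  shows "degree (\<Prod>l\<in>J. [:f l, 1 :: 'a::comm_ring_1:]) \<le> card J \<and> coeff (\<Prod>l\<in>J. [:f l, 1:]) (card J) = 1"
  using assms
proof (induction J rule: finite_induct)
  case (insert k J)
  let ?p = "\<Prod>l\<in>J. [:f l, 1:]"
  have "degree ([:f k, 1:] * ?p) \<le> Suc (card J)"
    by (rule order.trans[OF degree_mult_le]) (use insert.IH in auto)
  moreover have "coeff ?p (Suc (card J)) = 0" using insert.IH by (intro coeff_eq_0) simp
  ultimately show ?case using insert by simp
qed simp

context
  fixes J :: "'i set" and z :: "'i \<Rightarrow> 'a::comm_ring_1" and T :: "'i \<Rightarrow> 'i \<Rightarrow> 'a"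
  assumes fin: "finite J"
    and unit: "\<And>i j. i \<in> J \<Longrightarrow> j \<in> J \<Longrightarrow> i \<noteq> j \<Longrightarrow> z i - z j dvd 1"
    and T: "\<And>i j. i \<in> J \<Longrightarrow> j \<in> J \<Longrightarrow> i \<noteq> j \<Longrightarrow> T i j * (z i - z j) = z i + z j"
begin

text \<open>
  Lagrange interpolation: both sides are polynomials in \<open>x\<close> of degree \<open>card I\<close> with the same leading
  coefficient that agree at all \<open>z i\<close>.
\<close>

lemma lagrange_schur:
  assumes "I \<subseteq> J"
  defines "c \<equiv> \<lambda>j. \<Prod>l\<in>I - {j}. T j l"
  shows "(\<Prod>l\<in>I. x + z l) - (\<Sum>j\<in>I. c j * ((x + z j) * (\<Prod>l\<in>I - {j}. x - z l))) =
    (1 - (\<Sum>j\<in>I. c j)) * (\<Prod>l\<in>I. x - z l)"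
proof -
  have finI: "finite I" using fin assms(1) finite_subset by blast
  define L where "L = (\<lambda>j. \<Prod>l\<in>I. [:if l = j then z l else - z l, 1:])"
  define p where "p = (\<Prod>l\<in>I. [:z l, 1:]) - (\<Sum>j\<in>I. smult (c j) (L j)) - smult (1 - (\<Sum>j\<in>I. c j)) (\<Prod>l\<in>I. [:- z l, 1:])"
  have L: "poly (L j) x = (x + z j) * (\<Prod>l\<in>I - {j}. x - z l)" if "j \<in> I" for j x
  proof -
    have "poly (L j) x = (z j + x) * (\<Prod>l\<in>I - {j}. (if l = j then z l else - z l) + x)"
      unfolding L_def poly_prod using finI that by (subst prod.remove[of _ j]) auto
    also have "(\<Prod>l\<in>I - {j}. (if l = j then z l else - z l) + x) = (\<Prod>l\<in>I - {j}. x - z l)"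
      by (intro prod.cong) auto
    finally show ?thesis by (simp add: add.commute)
  qed
  have p: "poly p x = (\<Prod>l\<in>I. x + z l) - (\<Sum>j\<in>I. c j * ((x + z j) * (\<Prod>l\<in>I - {j}. x - z l))) -
      (1 - (\<Sum>j\<in>I. c j)) * (\<Prod>l\<in>I. x - z l)" for x
    by (simp add: p_def poly_sum poly_prod L add.commute)
  have "p = 0"
  proof (cases "I = {}")
    case False
    have "degree p \<le> card I"
      unfolding p_def L_def using prod_linear_monic[OF finI]
      by (intro degree_diff_le degree_sum_le finI) (auto intro: order.trans[OF degree_smult_le])
    moreover have "coeff p (card I) = 0"
      unfolding p_def L_def by (simp add: coeff_sum prod_linear_monic[OF finI, THEN conjunct2])
    ultimately have "degree p < card I"
      using False finI by (metis card_0_eq degree_0 le_neq_implies_less leading_coeff_0_iff not_gr_zero)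
    moreover have "poly p (z i) = 0" if i: "i \<in> I" for i
    proof -
      have "(\<Sum>j\<in>I. c j * ((z i + z j) * (\<Prod>l\<in>I - {j}. z i - z l))) =
          (\<Sum>j\<in>{i}. c j * ((z i + z j) * (\<Prod>l\<in>I - {j}. z i - z l)))"
      proof (rule sum.mono_neutral_right)
        show "\<forall>j\<in>I - {i}. c j * ((z i + z j) * (\<Prod>l\<in>I - {j}. z i - z l)) = 0"
        proof
          fix j assume "j \<in> I - {i}"
          hence "(\<Prod>l\<in>I - {j}. z i - z l) = 0" using i finI by (intro prod_zero) auto
          thus "c j * ((z i + z j) * (\<Prod>l\<in>I - {j}. z i - z l)) = 0" by simp
        qed
      qed (use i finI in auto)
      also have "\<dots> = (z i + z i) * (\<Prod>l\<in>I - {i}. T i l * (z i - z l))"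
        by (simp add: c_def prod.distrib mult_ac)
      also have "(\<Prod>l\<in>I - {i}. T i l * (z i - z l)) = (\<Prod>l\<in>I - {i}. z i + z l)"
        using i assms(1) by (intro prod.cong T) auto
      also have "(z i + z i) * \<dots> = (\<Prod>l\<in>I. z i + z l)"
        using prod.remove[OF finI i, of "\<lambda>l. z i + z l"] by simp
      finally have "(\<Sum>j\<in>I. c j * ((z i + z j) * (\<Prod>l\<in>I - {j}. z i - z l))) = (\<Prod>l\<in>I. z i + z l)" .
      moreover have "(\<Prod>l\<in>I. z i - z l) = 0" using i finI by (intro prod_zero) auto
      ultimately show ?thesis by (simp add: p)
    qed
    ultimately show ?thesis
      using assms(1) by (intro poly_eq_0_many_roots[OF finI, of _ z] unit) auto
  qed (simp add: p_def)
  thus ?thesis using p[of x] by simp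
qed

text \<open>When an index k is added, \<open>lagrange_schur\<close> at x = z k shows that the new
  sum is 1 minus the old one, whence the parity.\<close>

lemma sum_schur_coeffs:
  assumes "I \<subseteq> J"
  shows "(\<Sum>j\<in>I. \<Prod>l\<in>I - {j}. T j l) = (if odd (card I) then 1 else 0)"
proof -
  have "finite I" using fin assms finite_subset by blast
  thus ?thesis using assms
  proof (induction I rule: finite_induct)
    case (insert k I)
    let ?c = "\<lambda>j. \<Prod>l\<in>I - {j}. T j l"
    let ?D = "\<Prod>l\<in>I. z k - z l"
    have kI: "j \<noteq> k" if "j \<in> I" for j using that insert.hyps by auto
    have sum: "(\<Sum>j\<in>insert k I. \<Prod>l\<in>insert k I - {j}. T j l) = (\<Prod>l\<in>I. T k l) + (\<Sum>j\<in>I. T j k * ?c j)"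
    proof -
      have "insert k I - {j} = insert k (I - {j})" if "j \<in> I" for j using kI[OF that] by auto
      thus ?thesis using insert.hyps by (simp add: Diff_insert_absorb)
    qed
    have "(\<Prod>l\<in>I. T k l) * ?D = (\<Prod>l\<in>I. z k + z l)"
      unfolding prod.distrib[symmetric] using insert.prems kI by (intro prod.cong T) auto
    moreover have "T j k * ?c j * ?D = - (?c j * ((z k + z j) * (\<Prod>l\<in>I - {j}. z k - z l)))" if j: "j \<in> I" for j
    proof -
      have D: "?D = (z k - z j) * (\<Prod>l\<in>I - {j}. z k - z l)" by (rule prod.remove[OF insert.hyps(1) j])
      have "T j k * (z j - z k) = z k + z j" using j insert.prems kI[OF j] by (subst T) (auto simp: add.commute)
      hence Tk: "T j k * (z k - z j) = - (z k + z j)" by (metis minus_diff_eq mult_minus_right)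
      have "T j k * ?c j * ?D = T j k * (z k - z j) * (?c j * (\<Prod>l\<in>I - {j}. z k - z l))"
        unfolding D by (simp only: mult_ac)
      thus ?thesis unfolding Tk by (simp only: mult_minus_left mult_ac)
    qed
    ultimately have "((\<Prod>l\<in>I. T k l) + (\<Sum>j\<in>I. T j k * ?c j)) * ?D =
        (\<Prod>l\<in>I. z k + z l) - (\<Sum>j\<in>I. ?c j * ((z k + z j) * (\<Prod>l\<in>I - {j}. z k - z l)))"
      by (simp add: distrib_right sum_distrib_right sum_negf)
    also have "\<dots> = (1 - (\<Sum>j\<in>I. ?c j)) * ?D"
      using insert.prems by (intro lagrange_schur) simp
    finally have eq: "((\<Prod>l\<in>I. T k l) + (\<Sum>j\<in>I. T j k * ?c j)) * ?D = (1 - (\<Sum>j\<in>I. ?c j)) * ?D" .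
    have "?D dvd (\<Prod>l\<in>I. 1)" using insert.prems kI by (intro prod_dvd_prod unit) auto
    hence "?D dvd 1" by simp
    from this eq have "(\<Prod>l\<in>I. T k l) + (\<Sum>j\<in>I. T j k * ?c j) = 1 - (\<Sum>j\<in>I. ?c j)"
      by (rule unit_mult_cancel)
    thus ?case using insert sum by simp
  qed simp
qed

text \<open>For odd cardinality the coefficients add up to 1 by \<open>sum_schur_coeffs\<close>, so
  the right-hand side of \<open>lagrange_schur\<close> disappears; then put x = -a.\<close>

lemma schur_expansion:
  assumes "odd (card J)" "\<And>j. j \<in> J \<Longrightarrow> s j * (a + z j) = a - z j" "\<And>j. j \<in> J \<Longrightarrow> a + z j dvd 1"
  shows "(\<Sum>j\<in>J. s j * (\<Prod>l\<in>J - {j}. T j l)) = (\<Prod>j\<in>J. s j)"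
proof -
  let ?c = "\<lambda>j. \<Prod>l\<in>J - {j}. T j l"
  let ?D = "\<Prod>l\<in>J. a + z l"
  have neg: "(\<Prod>l\<in>I. - a - z l) = (-1) ^ card I * (\<Prod>l\<in>I. a + z l)" for I
  proof -
    have "(\<Prod>l\<in>I. - a - z l) = (\<Prod>l\<in>I. (-1) * (a + z l))" by (intro prod.cong) auto
    thus ?thesis by (simp only: prod.distrib prod_constant)
  qed
  have "(\<Prod>l\<in>J. - a + z l) = (\<Sum>j\<in>J. ?c j * ((- a + z j) * (\<Prod>l\<in>J - {j}. - a - z l)))"
    using lagrange_schur[of J "- a"] sum_schur_coeffs[of J] assms(1) by simp
  also have "(\<Prod>l\<in>J. - a + z l) = (\<Prod>l\<in>J. (-1) * (s l * (a + z l)))"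
    using assms(2) by (intro prod.cong) auto
  also have "\<dots> = - ((\<Prod>j\<in>J. s j) * ?D)"
    unfolding prod.distrib prod_constant using assms(1) by simp
  also have "(\<Sum>j\<in>J. ?c j * ((- a + z j) * (\<Prod>l\<in>J - {j}. - a - z l))) = (\<Sum>j\<in>J. - (s j * ?c j * ?D))"
  proof (intro sum.cong refl)
    fix j assume j: "j \<in> J"
    have "even (card (J - {j}))" using j fin assms(1) by (simp add: card_Diff_singleton)
    hence "(\<Prod>l\<in>J - {j}. - a - z l) = (\<Prod>l\<in>J - {j}. a + z l)" by (simp add: neg)
    moreover have "- a + z j = - (s j * (a + z j))" using assms(2)[OF j] by simp
    moreover have "?D = (a + z j) * (\<Prod>l\<in>J - {j}. a + z l)" by (rule prod.remove[OF fin j])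
    ultimately show "?c j * ((- a + z j) * (\<Prod>l\<in>J - {j}. - a - z l)) = - (s j * ?c j * ?D)"
      by (simp add: mult_ac)
  qed
  finally have "(\<Sum>j\<in>J. s j * ?c j) * ?D = (\<Prod>j\<in>J. s j) * ?D"
    by (simp add: sum_negf sum_distrib_right)
  moreover have "?D dvd (\<Prod>l\<in>J. 1)" using assms(3) by (intro prod_dvd_prod)
  hence "?D dvd 1" by simp
  ultimately show ?thesis by (rule unit_mult_cancel[rotated])
qed

end

fun pairs_prod :: "('i \<Rightarrow> 'i \<Rightarrow> 'a::comm_ring_1) \<Rightarrow> 'i list \<Rightarrow> 'a" where
  "pairs_prod s [] = 1"
| "pairs_prod s (a # w) = prod_list (map (s a) w) * pairs_prod s w"

lemma pairs_prod_remove: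
  "pairs_prod s (u @ b # t) = prod_list (map (\<lambda>x. s x b) u) * prod_list (map (s b) t) * pairs_prod s (u @ t)"
  by (induction u) (auto simp: mult_ac)

lemma prod_list_distinct: "distinct w \<Longrightarrow> prod_list (map f w) = (\<Prod>x\<in>set w. f x :: 'a::comm_monoid_mult)"
  by (induction w) auto

lemma prod_list_mult: "prod_list (map (\<lambda>x. f x * g x) w) = prod_list (map f w) * prod_list (map g w :: 'a::comm_monoid_mult list)"
  by (induction w) (auto simp: mult_ac)

text \<open>By induction the minor without b is the product over all pairs of v divided by the
  factors containing b. Antisymmetry of \<open>s\<close> absorbs the sign (-1)^j and turns these
  quotients into the coefficients \<open>T b l\<close>, so that the expansion along the first row is
  \<open>schur_expansion\<close>.\<close>

lemma schur_pfaffian: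
  fixes z :: "'i \<Rightarrow> 'a::comm_ring_1"
  assumes "distinct w" "even (length w)"
    and s: "\<And>a b. a \<in> set w \<Longrightarrow> b \<in> set w \<Longrightarrow> a \<noteq> b \<Longrightarrow> s a b * (z a + z b) = z a - z b"
    and plus: "\<And>a b. a \<in> set w \<Longrightarrow> b \<in> set w \<Longrightarrow> a \<noteq> b \<Longrightarrow> z a + z b dvd 1"
    and minus: "\<And>a b. a \<in> set w \<Longrightarrow> b \<in> set w \<Longrightarrow> a \<noteq> b \<Longrightarrow> z a - z b dvd 1"
  shows "pf s w = pairs_prod s w"
  using assms
proof (induction "length w" arbitrary: w rule: less_induct)
  case less
  show ?case
  proof (cases w)
    case (Cons a v)
    have dv: "distinct v" "a \<notin> set v" "odd (length v)" using less.prems(1,2) Cons by auto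
    have "\<forall>i j. \<exists>d. i \<in> set v \<longrightarrow> j \<in> set v \<longrightarrow> i \<noteq> j \<longrightarrow> (z i - z j) * d = 1"
      using less.prems(5) Cons by (metis dvdE list.set_intros(2))
    then obtain d where d: "\<And>i j. i \<in> set v \<Longrightarrow> j \<in> set v \<Longrightarrow> i \<noteq> j \<Longrightarrow> (z i - z j) * d i j = 1" by metis
    define T where "T = (\<lambda>i j. (z i + z j) * d i j)"
    have T: "T i j * (z i - z j) = z i + z j" if "i \<in> set v" "j \<in> set v" "i \<noteq> j" for i j
      using d[OF that] by (simp add: T_def mult.assoc mult.commute[of "d i j"])
    have sT: "s i j * T i j = 1" "s j i * T i j = -1" if ij: "i \<in> set v" "j \<in> set v" "i \<noteq> j" for i j
    proof -
      have sij: "s i j * (z i + z j) = z i - z j" using less.prems(3)[of i j] ij Cons by simp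
      show "s i j * T i j = 1" unfolding T_def mult.assoc[symmetric] sij by (rule d[OF ij])
      have "s j i * (z i + z j) = - (z i - z j)" using less.prems(3)[of j i] ij Cons by (simp add: add.commute)
      thus "s j i * T i j = -1" by (simp only: T_def mult.assoc[symmetric] mult_minus_left d[OF ij])
    qed
    let ?c = "\<lambda>b. \<Prod>l\<in>set v - {b}. T b l"
    have trm: "(-1) ^ j * pf s (take j v @ drop (Suc j) v) = pairs_prod s v * ?c (v ! j)" if j: "j < length v" for j
    proof -
      let ?u = "take j v" and ?t = "drop (Suc j) v" and ?b = "v ! j"
      have v: "v = ?u @ ?b # ?t" by (rule id_take_nth_drop[OF j])
      have dist: "distinct (?u @ ?b # ?t)" using dv(1) by (subst v[symmetric])
      have sets: "set ?u \<subseteq> set v" "set ?t \<subseteq> set v" "?b \<in> set v" "?b \<notin> set ?u" "?b \<notin> set ?t"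
        using dist j by (auto dest: in_set_takeD in_set_dropD)
      have sub: "set (?u @ ?t) \<subseteq> set w" using sets Cons by auto
      have pf: "pf s (?u @ ?t) = pairs_prod s (?u @ ?t)"
      proof (rule less.hyps)
        show "distinct (?u @ ?t)" using dist by auto
        show "even (length (?u @ ?t))" using dv(3) j by simp
      qed (use sub less.prems(3-5) Cons j in \<open>auto 4 3 simp: subset_iff\<close>)
      have "set v - {?b} = set (?u @ ?t)" 
        using dist by (subst (1) v) auto
      hence "?c ?b = prod_list (map (T ?b) (?u @ ?t))"
        using dist by (subst prod_list_distinct) auto
      hence "pairs_prod s v * ?c ?b = pairs_prod s (?u @ ?t) *
          (prod_list (map (\<lambda>x. s x ?b * T ?b x) ?u) * prod_list (map (\<lambda>x. s ?b x * T ?b x) ?t))"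
        by (subst v) (simp add: pairs_prod_remove prod_list_mult mult_ac)
      also have "map (\<lambda>x. s x ?b * T ?b x) ?u = map (\<lambda>_. -1) ?u"
        using sets sT(2)[of ?b] by (intro map_cong refl) blast
      also have "map (\<lambda>x. s ?b x * T ?b x) ?t = map (\<lambda>_. 1) ?t"
        using sets sT(1)[of ?b] by (intro map_cong refl) blast
      also have "prod_list (map (\<lambda>_. -1) ?u) = (-1 :: 'a) ^ j"
        using j by (simp add: map_replicate_const prod_list_replicate)
      also have "prod_list (map (\<lambda>_. 1) ?t) = (1 :: 'a)" by (simp add: map_replicate_const prod_list_replicate)
      finally show ?thesis by (simp add: pf mult.commute)
    qed
    have "pf s w = (\<Sum>j<length v. pairs_prod s v * (s a (v ! j) * ?c (v ! j)))"
      unfolding Cons pf.simps(2)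
    proof (intro sum.cong refl)
      fix j assume "j \<in> {..<length v}"
      hence "(-1) ^ j * pf s (take j v @ drop (Suc j) v) = pairs_prod s v * ?c (v ! j)" by (intro trm) simp
      thus "(-1) ^ j * s a (v ! j) * pf s (take j v @ drop (Suc j) v) = pairs_prod s v * (s a (v ! j) * ?c (v ! j))"
      proof -
        assume *: "(-1) ^ j * pf s (take j v @ drop (Suc j) v) = pairs_prod s v * ?c (v ! j)"
        have "(-1) ^ j * s a (v ! j) * pf s (take j v @ drop (Suc j) v) =
            s a (v ! j) * ((-1) ^ j * pf s (take j v @ drop (Suc j) v))" by (simp only: mult_ac)
        thus ?thesis unfolding * by (simp only: mult_ac)
      qed
    qed
    also have "\<dots> = pairs_prod s v * (\<Sum>b\<in>set v. s a b * ?c b)"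
      unfolding sum_distrib_left[symmetric]
      by (intro arg_cong2[where f = times] refl sum.reindex_bij_betw bij_betw_nth dv)
    also have "(\<Sum>b\<in>set v. s a b * ?c b) = (\<Prod>b\<in>set v. s a b)"
    proof (rule schur_expansion[where z = z and T = T and a = "z a"])
      show "odd (card (set v))" using dv by (simp add: distinct_card)
    qed (use less.prems(3-5) dv Cons T in auto)
    also have "pairs_prod s v * \<dots> = pairs_prod s w"
      by (simp add: Cons prod_list_distinct[OF dv(1)] mult.commute)
    finally show ?thesis .
  qed simp
qed


section \<open>The generating function of the \<open>GP\<close>-functions\<close>

text \<open>
  \<open>Z r i\<close> is \<open>\<zeta>\<^sub>i = 1 / u\<^sub>i + \<beta> / 2\<close>, with \<open>\<zeta>\<^sub>r = - \<beta> / 2\<close> for the letter that is added when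
  \<open>r\<close> is odd, and \<open>Yi i\<close> is the inverse of \<open>\<zeta>\<^sub>i\<close>.
\<close>

definition Ui :: "nat \<Rightarrow> hs" where "Ui i = hahn_monom (Poly_Mapping.single i 1) 1"
definition Vi :: "nat \<Rightarrow> hs" where "Vi i = hahn_monom (Poly_Mapping.single i (-1)) 1"
definition Z :: "nat \<Rightarrow> nat \<Rightarrow> hs" where "Z r i = (if i < r then Vi i + hc (bet / 2) else hc (- bet / 2))"
definition Yi :: "nat \<Rightarrow> hs" where "Yi i = Ui i * hgeo i (hc (- bet / 2) * Ui i)"
definition Wi :: "nat \<Rightarrow> hs" where "Wi i = hgeo i (hc (- bet) * Ui i)"
definition W2 :: "nat \<Rightarrow> hs" where "W2 i = hc (1 / 2) * hgeo i (hc (- bet / 2) * Ui i)"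
text \<open>With t = -\<zeta>_j / \<zeta>_i, the quotient (1 + t) / (1 - t) of the next definition
  is (\<zeta>_i - \<zeta>_j) / (\<zeta>_i + \<zeta>_j), expanded in positive powers of u_i.\<close>

definition tt :: "nat \<Rightarrow> nat \<Rightarrow> nat \<Rightarrow> hs" where "tt r i j = - (Yi i * Z r j)"
definition SS :: "nat \<Rightarrow> nat \<Rightarrow> nat \<Rightarrow> hs" where "SS r i j = (1 + tt r i j) * hgeo i (tt r i j)"
definition Sa :: "nat \<Rightarrow> nat \<Rightarrow> nat \<Rightarrow> hs" where "Sa r i j = (if i < j then SS r i j else - SS r j i)"

lemma UV [simp]: "Ui i * Vi i = 1" "Vi i * Ui i = 1"
  by (simp_all add: Ui_def Vi_def hahn_monom_mult flip: single_add)

lemma hvars_monom: "hvars {i} (hahn_monom (Poly_Mapping.single i n) c)"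
  by (auto simp: hvars_def hahn_monom_coeff split: if_splits)

lemma hvars_UV [intro]: "hvars {i} (Ui i)" "hvars {i} (Vi i)"
  by (simp_all add: Ui_def Vi_def hvars_monom)

lemma hlow_UV: "hlow i 1 (Ui i)" "hlow i (-1) (Vi i)"
  by (auto simp: hlow_def Ui_def Vi_def hahn_monom_coeff split: if_splits)

lemma geo_ok:
  shows "hfirst i (hc c * Ui i)" "hlow i 1 (hc c * Ui i)" "hvars {i} (hc c * Ui i)"
proof -
  show v: "hvars {i} (hc c * Ui i)" by auto
  show "hfirst i (hc c * Ui i)" by (rule hfirst_hvars[OF v]) auto
  show "hlow i 1 (hc c * Ui i)" using hlow_mult[OF hlow_hc[of 0 i c] hlow_UV(1)[of i]] by simp
qed

lemma hvars_YW [intro]: "hvars {i} (Yi i)" "hvars {i} (Wi i)" "hvars {i} (W2 i)"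
  unfolding Yi_def Wi_def W2_def by (intro hvars_mult hvars_UV hvars_hc hvars_hgeo geo_ok)+

lemma hlow_YW: "hlow i 1 (Yi i)" "hlow i 0 (Wi i)" "hlow i 0 (W2 i)"
  using hlow_mult[OF hlow_UV(1)[of i] hlow_hgeo[OF geo_ok(1,2)[of i "- bet / 2"]]]
    hlow_hgeo[OF geo_ok(1,2)[of i "- bet"]]
    hlow_mult[OF hlow_hc[of 0 i "1/2"] hlow_hgeo[OF geo_ok(1,2)[of i "- bet / 2"]]]
  by (simp_all add: Yi_def Wi_def W2_def)

lemma hvars_Z: "hvars {i} (Z r i)"
  by (auto simp: Z_def)

lemma hlow_Z: "hlow i (-1) (Z r i)"
  by (auto simp: Z_def intro!: hlow_add hlow_UV hlow_hc)

lemma hc_minus: "hc (- a) = - hc a"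
  by (rule hc_hom)

lemma W_inverse: "(1 + hc bet * Ui i) * Wi i = 1"
  using hgeo_inverse[OF geo_ok(1,2)[of i "- bet"]] by (simp add: Wi_def hc_minus)

lemma W2_inverse: "(2 + hc bet * Ui i) * W2 i = 1"
proof -
  have "2 + hc bet * Ui i = hc 2 * (1 - hc (- bet / 2) * Ui i)"
    by (simp add: hc_minus hc_numeral algebra_simps) (simp flip: hc_numeral hc_hom mult.assoc)
  hence "(2 + hc bet * Ui i) * W2 i = (hc 2 * hc (1 / 2)) * ((1 - hc (- bet / 2) * Ui i) * hgeo i (hc (- bet / 2) * Ui i))"
    by (simp only: W2_def mult_ac)
  also have "\<dots> = 1" by (simp add: hgeo_inverse[OF geo_ok(1,2)] hc_hom(2) flip: hc_hom(5))
  finally show ?thesis .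
qed

lemma YZ: "i < r \<Longrightarrow> Yi i * Z r i = 1"
proof -
  assume "i < r"
  have "Z r i = Vi i * (1 - hc (- bet / 2) * Ui i)"
    using \<open>i < r\<close> by (simp add: Z_def hc_minus algebra_simps) (simp flip: mult.assoc)
  hence "Yi i * Z r i = (Ui i * Vi i) * ((1 - hc (- bet / 2) * Ui i) * hgeo i (hc (- bet / 2) * Ui i))"
    by (simp only: Yi_def mult_ac)
  thus ?thesis by (simp add: hgeo_inverse[OF geo_ok(1,2)])
qed

text \<open>1/\<zeta>_i has u_i-order 1 and \<zeta>_j does not involve u_i; for \<open>i < j\<close>
  no variable before u_i occurs. So the geometric series exists, in accordance with the order of
  expansion.\<close>

lemma tt_ok:
  assumes "i < j"
  shows "hfirst i (tt r i j)" "hlow i 1 (tt r i j)" "hvars {i, j} (tt r i j)"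
    "hfirst i (- tt r i j)" "hlow i 1 (- tt r i j)"
proof -
  show v: "hvars {i, j} (tt r i j)"
    unfolding tt_def using hvars_YW(1)[of i] hvars_Z[of j r] 
    by (intro hvars_uminus hvars_mult) (auto elim: hvars_mono)
  show f: "hfirst i (tt r i j)" by (rule hfirst_hvars[OF v]) (use assms in auto)
  have "hlow i 0 (Z r j)" by (rule hlow_not_var[OF hvars_Z]) (use assms in auto)
  from hlow_mult[OF hlow_YW(1)[of i] this] show l: "hlow i 1 (tt r i j)"
    unfolding tt_def by (intro hlow_uminus) simp
  show "hfirst i (- tt r i j)" using f by (simp add: hfirst_def)
  show "hlow i 1 (- tt r i j)" by (rule hlow_uminus[OF l])
qed

lemma Z_plus_minus:
  assumes "i < r"
  shows "Z r i + Z r j = Z r i * (1 - tt r i j)" "Z r i - Z r j = Z r i * (1 + tt r i j)"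
proof -
  have "Z r i * (Yi i * Z r j) = (Yi i * Z r i) * Z r j" by (simp only: mult_ac)
  hence "Z r i * (Yi i * Z r j) = Z r j" by (simp add: YZ[OF assms])
  thus "Z r i + Z r j = Z r i * (1 - tt r i j)" "Z r i - Z r j = Z r i * (1 + tt r i j)"
    by (simp_all add: tt_def distrib_left right_diff_distrib)
qed

lemma Z_units:
  assumes "i < j" "i < r"
  shows "Z r i dvd 1" "Z r i + Z r j dvd 1" "Z r i - Z r j dvd 1"
proof -
  show Z: "Z r i dvd 1" using YZ[OF assms(2)] by (metis dvd_triv_right)
  have "1 - tt r i j dvd 1" using hgeo_inverse[OF tt_ok(1,2)[OF assms(1)], of r] by (metis dvd_triv_left)
  with Z show "Z r i + Z r j dvd 1" unfolding Z_plus_minus[OF assms(2)] by (metis mult_dvd_mono mult_1)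
  have "1 + tt r i j dvd 1"
    using hgeo_inverse[OF tt_ok(4,5)[OF assms(1)], of r] by (metis diff_minus_eq_add dvd_triv_left)
  with Z show "Z r i - Z r j dvd 1" unfolding Z_plus_minus[OF assms(2)] by (metis mult_dvd_mono mult_1)
qed

lemma SS_mult:
  assumes "i < j" "i < r"
  shows "SS r i j * (Z r i + Z r j) = Z r i - Z r j"
proof -
  have "SS r i j * (Z r i + Z r j) = Z r i * (1 + tt r i j) * ((1 - tt r i j) * hgeo i (tt r i j))"
    unfolding Z_plus_minus[OF assms(2)] SS_def by (simp only: mult_ac)
  thus ?thesis by (simp add: hgeo_inverse[OF tt_ok(1,2)[OF assms(1)]] Z_plus_minus[OF assms(2)])
qed

lemma hvars_SS: "i < j \<Longrightarrow> hvars {i, j} (SS r i j)"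
  unfolding SS_def by (intro hvars_mult hvars_add hvars_1 hvars_hgeo tt_ok)

text \<open>With \<zeta>_r = -\<beta>/2 the quotient is (1/u_i + \<beta>) / (1/u_i).\<close>

lemma SS_last:
  assumes "i < r"
  shows "SS r i r = 1 + hc bet * Ui i"
proof -
  have "SS r i r * (Z r i + Z r r) = Z r i - Z r r" by (rule SS_mult[OF assms assms])
  moreover have "hc (- bet / 2) = - hc (bet / 2)" by (simp add: hc_minus)
  ultimately have "SS r i r * (Vi i + hc (bet / 2) + - hc (bet / 2)) = Vi i + hc (bet / 2) - - hc (bet / 2)"
    using assms by (simp only: Z_def less_irrefl if_True if_False)
  moreover have "hc (bet / 2) + hc (bet / 2) = hc bet" by (simp flip: hc_hom(3))
  ultimately have "SS r i r * Vi i = Vi i + hc bet" by (simp add: add.assoc)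
  hence "SS r i r * (Vi i * Ui i) = (Vi i + hc bet) * Ui i" by (simp only: mult.assoc[symmetric])
  thus ?thesis by (simp add: distrib_right)
qed

abbreviation uc :: "hs \<Rightarrow> ux_series" where "uc \<equiv> mps_const"

lemma evaluation_hc: "evaluation hc"
  by standard (simp_all add: hc_hom)

section \<open>The factors of the generating function\<close>

definition Xi :: "nat \<Rightarrow> nat \<Rightarrow> ux_series" where
  "Xi r i = evaluation.EV hc (Z r i) qq"

definition khat :: ux_series where
  "khat = evaluation.mmap hc kap"

text \<open>Each factor is (1 + (1/u_i + \<beta>) x_j) (1 + \<beta> x_j) / (1 - x_j/u_i). The middle
  term accounts for \<kappa>; the rest is the factor of \<open>qq\<close> at \<zeta>_i, because
  \<zeta>_i + \<beta>/2 = 1/u_i + \<beta> and \<zeta>_i - \<beta>/2 = 1/u_i.\<close>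

lemma prodinf_factor:
  assumes "i < r"
  shows "mps_prodinf (\<lambda>j. (uvar i \<oplus>\<^sub>\<beta> xvar j) / (uvar i \<ominus>\<^sub>\<beta> xvar j)) = khat * Xi r i"
proof -
  interpret E: evaluation hc "Z r i" by (rule evaluation_hc)
  let ?V = "Vi i" and ?U = "Ui i" and ?b = "hc bet"
  let ?f = "\<lambda>j. (uvar i \<oplus>\<^sub>\<beta> xvar j) / (uvar i \<ominus>\<^sub>\<beta> xvar j)"
  have bx: "(1 + uc ?b * xvar j) * mgeo (uc (- ?b) * xvar j) = 1" for j
    using mgeo_inverse[OF ord_const_xvar, of "- ?b" j] by (simp add: mps_const_hom)
  have Vx: "(1 - uc ?V * xvar j) * mgeo (uc ?V * xvar j) = 1" for j
    by (rule mgeo_inverse[OF ord_const_xvar])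
  have UVc: "uc ?U * uc ?V = 1" by (simp flip: mps_const_hom(5) add: mps_const_hom(2))
  have ominus: "uvar i \<ominus>\<^sub>\<beta> xvar j = (uc ?U - xvar j) * mgeo (uc (- ?b) * xvar j)" for j
    unfolding ominus_def ux_const_def uvar_def Ui_def[symmetric] hc_def[symmetric]
    by (rule mps_divide_unit) (use bx in \<open>simp add: mult.commute\<close>)
  have fac: "?f j = (uc ?U + xvar j + uc ?b * uc ?U * xvar j) * ((1 + uc ?b * xvar j) * (uc ?V * mgeo (uc ?V * xvar j)))" for j
  proof -
    have "((1 + uc ?b * xvar j) * (uc ?V * mgeo (uc ?V * xvar j))) * (uvar i \<ominus>\<^sub>\<beta> xvar j) =
        ((1 + uc ?b * xvar j) * mgeo (uc (- ?b) * xvar j)) * ((uc ?U * uc ?V - uc ?V * xvar j) * mgeo (uc ?V * xvar j))"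
      unfolding ominus by (simp add: algebra_simps)
    also have "\<dots> = 1" by (simp only: bx UVc Vx mult_1)
    finally have "?f j = (uvar i \<oplus>\<^sub>\<beta> xvar j) * ((1 + uc ?b * xvar j) * (uc ?V * mgeo (uc ?V * xvar j)))"
      by (rule mps_divide_unit)
    thus ?thesis by (simp add: oplus_def ux_const_def uvar_def Ui_def hc_def)
  qed
  have fac': "?f j * (1 - uc ?V * xvar j) = (1 - uc (- (?V + ?b)) * xvar j) * (1 - uc (- ?b) * xvar j)" for j
  proof -
    have "?f j * (1 - uc ?V * xvar j) = (uc ?U * uc ?V + uc ?V * xvar j + uc ?b * (uc ?U * uc ?V) * xvar j) *
        (1 + uc ?b * xvar j) * ((1 - uc ?V * xvar j) * mgeo (uc ?V * xvar j))"
      unfolding fac by (simp only: distrib_left distrib_right mult_ac add_ac mult_1_left mult_1_right)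
    also have "\<dots> = (1 + uc ?V * xvar j + uc ?b * xvar j) * (1 + uc ?b * xvar j)"
      by (simp only: UVc Vx mult_1_right)
    finally show ?thesis by (simp add: mps_const_hom algebra_simps)
  qed
  show ?thesis
  proof (rule mps_prodinf_eqI)
    let ?a = "\<lambda>n. ?V ^ n - (- (?V + ?b)) ^ n - (- ?b) ^ n"
    show "EE (?f j) = psum1 j ?a * ?f j" for j by (rule EE_factor[OF fac'])
    show "mps_coeff (?f j) 0 = 1" for j
    proof -
      have "Poly_Mapping.single j (Suc 0) \<noteq> 0"
        by (metis keys_single keys_zero nat.simps(3) insert_not_empty)
      hence "mps_coeff (xvar j :: ux_series) 0 = 0" by (auto simp: xvar.rep_eq)
      thus ?thesis
        using arg_cong[OF fac'[of j], of "\<lambda>f. mps_coeff f 0"] by (simp add: mps_coeff_mult_0 mps_coeff_1)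
    qed
    have Zb: "Z r i - hc (bet / 2) = ?V" "- Z r i - hc (bet / 2) = - (?V + ?b)"
    proof -
      have "hc (bet / 2) + hc (bet / 2) = ?b" by (simp flip: hc_hom(3))
      thus "Z r i - hc (bet / 2) = ?V" "- Z r i - hc (bet / 2) = - (?V + ?b)"
        using assms by (simp_all add: Z_def algebra_simps)
    qed
    have "EE khat = E.mmap (EE kap)" by (simp add: khat_def E.mmap_EE)
    also have "\<dots> = psum (\<lambda>n. hc (- ((- bet) ^ n))) * khat"
      by (simp add: EE_kap E.mmap_mult E.mmap_psum khat_def)
    finally have "EE (khat * Xi r i) = (psum (\<lambda>n. hc (- ((- bet) ^ n))) + psum (\<lambda>n. ?V ^ n - (- (?V + ?b)) ^ n)) * (khat * Xi r i)"
      by (simp only: EE_mult E.EE_EV_qq Xi_def Zb) (simp add: algebra_simps)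
    also have "psum (\<lambda>n. hc (- ((- bet) ^ n))) + psum (\<lambda>n. ?V ^ n - (- (?V + ?b)) ^ n) = psum ?a"
      by (rule mps_eqI) (simp add: psum_coeff hc_minus hc_power)
    finally show "EE (khat * Xi r i) = psum ?a * (khat * Xi r i)" .
    show "mps_coeff (khat * Xi r i) 0 = 1"
      by (simp add: mps_coeff_mult_0 khat_def kap_0 Xi_def E.EV_qq_0 hc_hom)
  qed (rule hahn_torsion_free)
qed

text \<open>u_j - u_i and u_i + u_j + \<beta> u_i u_j are u_i u_j times \<zeta>_i - \<zeta>_j and
  \<zeta>_i + \<zeta>_j; the denominator 1 + \<beta> u_i of the formal difference leaves
  \<open>Wi i\<close>.\<close>

lemma pair_factor:
  assumes "i < j" "j < r"
  shows "(uvar j \<ominus>\<^sub>\<beta> uvar i) / (uvar j \<oplus>\<^sub>\<beta> uvar i) = uc (SS r i j * Wi i)"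
proof -
  have i: "i < r" using assms by simp
  have Wi: "uc (Wi i) * (1 + uc (hc bet) * uc (Ui i)) = 1"
    using arg_cong[OF W_inverse[of i], of uc] by (simp add: mps_const_hom mult.commute)
  have num: "uvar j \<ominus>\<^sub>\<beta> uvar i = uc ((Ui j - Ui i) * Wi i)"
    unfolding ominus_def ux_const_def uvar_def Ui_def[symmetric] hc_def[symmetric] mps_const_hom(4,5)
    by (rule mps_divide_unit[OF Wi])
  have den: "uvar j \<oplus>\<^sub>\<beta> uvar i = uc (Ui i * Ui j * (Z r i + Z r j))"
  proof -
    have b: "hc (bet / 2) + hc (bet / 2) = hc bet" by (simp flip: hc_hom(3))
    have "Ui i * Ui j * (Z r i + Z r j) = (Ui i * Vi i) * Ui j + (Ui j * Vi j) * Ui i + (hc (bet / 2) + hc (bet / 2)) * Ui j * Ui i"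
      using assms i by (simp only: Z_def if_True) (simp only: distrib_left distrib_right mult_ac add_ac)
    also have "\<dots> = Ui j + Ui i + hc bet * Ui j * Ui i" by (simp add: b)
    finally show ?thesis
      by (simp add: oplus_def ux_const_def uvar_def Ui_def[symmetric] hc_def[symmetric] mps_const_hom)
  qed
  obtain d where d: "1 = (Z r i + Z r j) * d" using Z_units(2)[OF assms(1) i] by (rule dvdE)
  have "(uvar j \<ominus>\<^sub>\<beta> uvar i) / (uvar j \<oplus>\<^sub>\<beta> uvar i) = uc ((Ui j - Ui i) * Wi i) * uc (Vi i * Vi j * d)"
    unfolding num den
  proof (rule mps_divide_unit)
    have "Vi i * Vi j * d * (Ui i * Ui j * (Z r i + Z r j)) = (Ui i * Vi i) * (Ui j * Vi j) * ((Z r i + Z r j) * d)"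
      by (simp only: mult_ac)
    also have "\<dots> = 1" by (simp flip: d)
    finally show "uc (Vi i * Vi j * d) * uc (Ui i * Ui j * (Z r i + Z r j)) = 1"
      by (simp flip: mps_const_hom(5) add: mps_const_hom(2))
  qed
  also have "\<dots> = uc ((Ui j - Ui i) * Wi i * (Vi i * Vi j * d))"
    by (simp only: mps_const_hom(5))
  also have "(Ui j - Ui i) * Wi i * (Vi i * Vi j * d) = ((Ui j * Vi j) * Vi i - (Ui i * Vi i) * Vi j) * d * Wi i"
    by (simp only: left_diff_distrib right_diff_distrib mult_ac)
  also have "\<dots> = (Z r i - Z r j) * d * Wi i"
    using assms i by (simp add: Z_def)
  also have "\<dots> = SS r i j * ((Z r i + Z r j) * d) * Wi i"
    unfolding SS_mult[OF assms(1) i, symmetric] by (simp only: mult_ac)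
  also have "\<dots> = SS r i j * Wi i" by (simp flip: d)
  finally show ?thesis .
qed

lemma pre_factor: "1 / ((2 + ux_const bet * uvar i) * (1 + ux_const bet * uvar i)) = uc (W2 i * Wi i)"
proof -
  have "W2 i * Wi i * ((2 + hc bet * Ui i) * (1 + hc bet * Ui i)) =
      ((2 + hc bet * Ui i) * W2 i) * ((1 + hc bet * Ui i) * Wi i)" by (simp only: mult_ac)
  hence "W2 i * Wi i * ((2 + hc bet * Ui i) * (1 + hc bet * Ui i)) = 1"
    by (simp only: W_inverse W2_inverse mult_1)
  from arg_cong[OF this, of uc]
  have "uc (W2 i * Wi i) * ((2 + ux_const bet * uvar i) * (1 + ux_const bet * uvar i)) = 1"
    by (simp add: ux_const_def uvar_def Ui_def hc_def mps_const_hom mps_const_numeral)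
  from mps_divide_unit[OF this] show ?thesis by simp
qed

text \<open>The exponent N - i of 1 / (1 + \<beta> u_i) counts one from the prefactor and r - 1 - i
  from the pairs with larger index; for N = r + 1 one more is inserted to cancel the pair factor
  \<open>SS_last\<close> with the added letter.\<close>

definition Ai :: "nat \<Rightarrow> nat \<Rightarrow> nat \<Rightarrow> ux_series" where
  "Ai r N i = (if i < r then uc (W2 i * Wi i ^ (N - i)) * Xi r i else 1)"

lemma pairs_prod_upt: "pairs_prod s [0..<N] = (\<Prod>j<N. \<Prod>i<j. s i j)"
proof (induction N)
  case (Suc N)
  have "prod_list (map (\<lambda>x. s x N) [0..<N]) = (\<Prod>i<N. s i N)"
    by (subst prod_list_distinct) (simp_all add: atLeast0LessThan)
  thus ?case using pairs_prod_remove[of s "[0..<N]" N "[]"] Suc by (simp add: mult.commute)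
qed simp

lemma prod_lower_triangle:
  "(\<Prod>j<r. \<Prod>i<j. w i) = (\<Prod>i<r. w i ^ (r - 1 - i) :: 'a::comm_monoid_mult)"
proof (induction r)
  case (Suc r)
  have "(\<Prod>i<r. w i ^ (r - 1 - i)) * (\<Prod>i<r. w i) = (\<Prod>i<r. w i ^ (r - i))"
    unfolding prod.distrib[symmetric]
  proof (intro prod.cong refl)
    fix i assume "i \<in> {..<r}"
    hence "r - i = Suc (r - 1 - i)" by auto
    thus "w i ^ (r - 1 - i) * w i = w i ^ (r - i)" by (simp add: mult.commute)
  qed
  thus ?case using Suc by simp
qed simp

lemma GP_generating_eq:
  assumes "N = r \<or> N = Suc r"
  shows "GP_generating r = khat ^ r * (prod_list (map (Ai r N) [0..<N]) * pairs_prod (\<lambda>i j. uc (Sa r i j)) [0..<N])"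
proof -
  define P where "P = (\<Prod>j<r. \<Prod>i<j. uc (SS r i j))"
  have "GP_generating r = (\<Prod>i<r. uc (W2 i * Wi i)) * (\<Prod>i<r. khat * Xi r i) * (\<Prod>j<r. \<Prod>i<j. uc (SS r i j * Wi i))"
    unfolding GP_generating_def by (simp add: pre_factor prodinf_factor pair_factor)
  also have "(\<Prod>j<r. \<Prod>i<j. uc (SS r i j * Wi i)) = P * (\<Prod>i<r. uc (Wi i) ^ (r - 1 - i))"
    by (simp add: mps_const_hom prod.distrib P_def prod_lower_triangle)
  also have "(\<Prod>i<r. khat * Xi r i) = khat ^ r * (\<Prod>i<r. Xi r i)"
    by (simp add: prod.distrib)
  also have "(\<Prod>i<r. uc (W2 i * Wi i)) * (khat ^ r * (\<Prod>i<r. Xi r i)) * (P * (\<Prod>i<r. uc (Wi i) ^ (r - 1 - i))) =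
      khat ^ r * ((\<Prod>i<r. uc (W2 i * Wi i) * Xi r i * uc (Wi i) ^ (r - 1 - i)) * P)"
    by (simp add: prod.distrib mult_ac)
  also have "(\<Prod>i<r. uc (W2 i * Wi i) * Xi r i * uc (Wi i) ^ (r - 1 - i)) = (\<Prod>i<r. Ai r r i)"
  proof (intro prod.cong refl)
    fix i assume "i \<in> {..<r}"
    hence "i < r" "r - i = Suc (r - 1 - i)" by auto
    thus "uc (W2 i * Wi i) * Xi r i * uc (Wi i) ^ (r - 1 - i) = Ai r r i"
      by (simp add: Ai_def mps_const_hom mps_const_power mult_ac)
  qed
  finally have eq: "GP_generating r = khat ^ r * ((\<Prod>i<r. Ai r r i) * P)" .
  have pl: "prod_list (map (Ai r N) [0..<N]) = (\<Prod>i<N. Ai r N i)"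
    by (subst prod_list_distinct) (simp_all add: atLeast0LessThan)
  have PS: "(\<Prod>j<r. \<Prod>i<j. uc (Sa r i j)) = P"
    by (simp add: P_def Sa_def)
  from assms show ?thesis
  proof
    assume N: "N = r"
    show ?thesis unfolding pl pairs_prod_upt eq unfolding N PS ..
  next
    assume N: "N = Suc r"
    have "(\<Prod>i<N. Ai r N i) * (\<Prod>j<N. \<Prod>i<j. uc (Sa r i j)) =
        (\<Prod>i<r. Ai r N i * uc (Sa r i r)) * P"
      by (simp add: N PS prod.distrib Ai_def mult_ac)
    also have "(\<Prod>i<r. Ai r N i * uc (Sa r i r)) = (\<Prod>i<r. Ai r r i)"
    proof (intro prod.cong refl)
      fix i assume "i \<in> {..<r}"
      hence i: "i < r" "N - i = Suc (r - i)" by (auto simp: N)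
      have "Wi i ^ (N - i) * (1 + hc bet * Ui i) = Wi i ^ (r - i) * ((1 + hc bet * Ui i) * Wi i)"
        unfolding i(2) power_Suc by (simp only: mult_ac)
      hence "Wi i ^ (N - i) * (1 + hc bet * Ui i) = Wi i ^ (r - i)"
        by (simp only: W_inverse mult_1_right)
      hence "uc (Wi i ^ (N - i)) * uc (1 + hc bet * Ui i) = uc (Wi i ^ (r - i))"
        by (simp only: mps_const_hom(5)[symmetric])
      moreover have "Ai r N i * uc (Sa r i r) = uc (W2 i) * Xi r i * (uc (Wi i ^ (N - i)) * uc (1 + hc bet * Ui i))"
        using i by (simp add: Ai_def Sa_def SS_last mps_const_hom(5) mult_ac)
      ultimately show "Ai r N i * uc (Sa r i r) = Ai r r i"
        using i by (simp add: Ai_def mps_const_hom(5) mult_ac)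
    qed
    finally show ?thesis unfolding pl pairs_prod_upt eq by (rule arg_cong[OF sym])
  qed
qed

lemma GP_generating_pf:
  assumes "N = r \<or> N = Suc r" "even N"
  shows "GP_generating r = khat ^ r * pf (\<lambda>i j. Ai r N i * Ai r N j * uc (Sa r i j)) [0..<N]"
proof -
  have lt: "i < r" if "i < j" "j < N" for i j using that assms(1) by auto
  have unit: "uc x dvd 1" if x: "x dvd 1" for x
  proof -
    obtain d where "1 = x * d" using x by (rule dvdE)
    hence "1 = uc x * uc d" by (simp flip: mps_const_hom(5) add: mps_const_hom(2))
    thus ?thesis by (rule dvdI)
  qed
  have "pf (\<lambda>i j. uc (Sa r i j)) [0..<N] = pairs_prod (\<lambda>i j. uc (Sa r i j)) [0..<N]"
  proof (rule schur_pfaffian[where z = "\<lambda>i. uc (Z r i)"])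
    fix i j assume "i \<in> set [0..<N]" "j \<in> set [0..<N]" and ne: "i \<noteq> j"
    hence ij: "i < N" "j < N" by auto
    have *: "Sa r i j * (Z r i + Z r j) = Z r i - Z r j \<and> Z r i + Z r j dvd 1 \<and> Z r i - Z r j dvd 1"
    proof (cases "i < j")
      case True
      thus ?thesis using SS_mult[OF True lt[OF True ij(2)]] Z_units[OF True lt[OF True ij(2)]] by (simp add: Sa_def)
    next
      case False
      hence ji: "j < i" using ne by simp
      have "Sa r i j * (Z r i + Z r j) = - (SS r j i * (Z r j + Z r i))" using ji by (simp add: Sa_def add.commute)
      also have "\<dots> = Z r i - Z r j" unfolding SS_mult[OF ji lt[OF ji ij(1)]] by simp
      finally show ?thesis using Z_units[OF ji lt[OF ji ij(1)]]
        by (metis add.commute dvd_minus_iff minus_diff_eq minus_dvd_iff)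
    qed
    show "uc (Sa r i j) * (uc (Z r i) + uc (Z r j)) = uc (Z r i) - uc (Z r j)"
      using * by (simp flip: mps_const_hom)
    show "uc (Z r i) + uc (Z r j) dvd 1" "uc (Z r i) - uc (Z r j) dvd 1"
      using * unit by (auto simp flip: mps_const_hom(3,4))
  qed (use assms(2) in auto)
  thus ?thesis unfolding GP_generating_eq[OF assms(1)] by (simp add: pf_scale)
qed


section \<open>Coefficient extraction\<close>

definition Cx :: "(nat \<Rightarrow>\<^sub>0 int) \<Rightarrow> ux_series \<Rightarrow> qb mps" where
  "Cx e f = Abs_mps (\<lambda>m. hahn_coeff (mps_coeff f m) e)"

lemma Cx_coeff [simp]: "mps_coeff (Cx e f) m = hahn_coeff (mps_coeff f m) e"
  by (simp add: Cx_def)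

lemma Cx_add: "Cx e (f + g) = Cx e f + Cx e g"
  by (rule mps_eqI) simp

lemma Cx_sum: "Cx e (\<Sum>i\<in>I. f i) = (\<Sum>i\<in>I. Cx e (f i))"
  by (rule mps_eqI) simp

lemma Cx_eq_upto: "eq_upto D f g \<Longrightarrow> eq_upto D (Cx e f) (Cx e g)"
  by (simp add: eq_upto_def)

lemma Cx_const_mmap: "Cx e (uc x * evaluation.mmap hc k) = mps_const (hahn_coeff x e) * k"
proof -
  interpret E: evaluation hc 0 by (rule evaluation_hc)
  show ?thesis by (rule mps_eqI) (simp add: mult.commute[of x] mult.commute[of _ "hahn_coeff x e"])
qed

lemma Cx_mmap: "Cx e (evaluation.mmap hc k * f) = k * Cx e f"
proof -
  interpret E: evaluation hc 0 by (rule evaluation_hc)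
  show ?thesis by (rule mps_eqI) (simp add: mps_coeff_mult case_prod_unfold)
qed

lemma Cx_khat: "Cx e (khat ^ n * f) = kap ^ n * Cx e f"
  by (induction n) (simp_all add: khat_def Cx_mmap mult.assoc)

lemma Cx_sign: "Cx e ((- 1) ^ n * f) = (- 1) ^ n * Cx e f"
  by (rule mps_eqI) (cases "even n", simp_all)

lemma Cx_hc: "Cx e (uc (hc c) * f) = mps_const c * Cx e f"
  by (rule mps_eqI) simp

definition uvars :: "nat set \<Rightarrow> ux_series \<Rightarrow> bool" where
  "uvars I f \<longleftrightarrow> (\<forall>m. hvars I (mps_coeff f m))"

lemma hvars_sum: "(\<And>i. i \<in> S \<Longrightarrow> hvars I (f i)) \<Longrightarrow> hvars I (\<Sum>i\<in>S. f i)"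
  by (induction S rule: infinite_finite_induct) auto

lemma uvars_sum: "(\<And>i. i \<in> S \<Longrightarrow> uvars I (f i)) \<Longrightarrow> uvars I (\<Sum>i\<in>S. f i)"
  by (auto simp: uvars_def intro!: hvars_sum)

lemma uvars_mult: "uvars I f \<Longrightarrow> uvars I g \<Longrightarrow> uvars I (f * g)"
  by (auto simp: uvars_def mps_coeff_mult intro!: hvars_sum)

lemma uvars_const: "hvars I x \<Longrightarrow> uvars I (uc x)"
  by (auto simp: uvars_def mps_const_coeff)

lemma uvars_1: "uvars I 1"
  using uvars_const[OF hvars_1] by (simp add: mps_const_hom)

lemma uvars_mono: "uvars I f \<Longrightarrow> I \<subseteq> J \<Longrightarrow> uvars J f"
  by (auto simp: uvars_def intro: hvars_mono)

lemma uvars_sign: "uvars I ((- 1) ^ n)"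
  using uvars_const[OF hvars_power[OF hvars_uminus[OF hvars_1]]] by (simp add: mps_const_hom mps_const_power)

lemma Xi_coeff: "mps_coeff (Xi r i) m = (\<Sum>k\<le>mdeg m. hc (mps_coeff (qq $ k) m) * Z r i ^ k)"
proof -
  interpret E: evaluation hc "Z r i" by (rule evaluation_hc)
  show ?thesis by (simp add: Xi_def E.EV_def)
qed

lemma uvars_Ai: "uvars {i} (Ai r N i)"
proof -
  have "uvars {i} (Xi r i)"
    by (auto simp: uvars_def Xi_coeff intro!: hvars_sum hvars_mult hvars_power hvars_Z)
  thus ?thesis by (auto simp: Ai_def uvars_1 intro!: uvars_mult uvars_const)
qed

text \<open>Since the factors share no variable, the exponent splits in exactly one way.\<close>

lemma hahn_coeff_mult_disjoint:
  assumes "hvars I f" "hvars J g" "I \<inter> J = {}" "Poly_Mapping.keys e \<subseteq> I" "Poly_Mapping.keys e' \<subseteq> J"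
  shows "hahn_coeff (f * g) (e + e') = hahn_coeff f e * hahn_coeff g e'"
proof -
  have "hahn_coeff (f * g) (e + e') = (\<Sum>(a, b)\<in>{(e, e')}. hahn_coeff f a * hahn_coeff g b)"
  proof (rule hahn_coeff_mult_superset)
    show "conv_set (+) (hahn_coeff f) (hahn_coeff g) (e + e') \<subseteq> {(e, e')}"
    proof clarify
      fix a b assume "(a, b) \<in> conv_set (+) (hahn_coeff f) (hahn_coeff g) (e + e')"
      hence *: "a + b = e + e'" "hahn_coeff f a \<noteq> 0" "hahn_coeff g b \<noteq> 0" by (auto simp: conv_set_def)
      have "Poly_Mapping.lookup a i = Poly_Mapping.lookup e i" for i
      proof (cases "i \<in> I")
        case True
        hence "i \<notin> J" using assms(3) by auto
        hence "Poly_Mapping.lookup b i = 0" "Poly_Mapping.lookup e' i = 0"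
          using hvars_lookup[OF assms(2) *(3)] assms(5) by (auto simp: in_keys_iff)
        thus ?thesis using arg_cong[OF *(1), of "\<lambda>f. Poly_Mapping.lookup f i"] by (simp add: lookup_add)
      next
        case False
        thus ?thesis using hvars_lookup[OF assms(1) *(2)] assms(4) by (auto simp: in_keys_iff)
      qed
      hence "a = e" by (intro poly_mapping_eqI)
      thus "a = e \<and> b = e'" using *(1) by simp
    qed
  qed auto
  thus ?thesis by simp
qed

lemma Cx_mult_disjoint:
  assumes "uvars I f" "uvars J g" "I \<inter> J = {}" "Poly_Mapping.keys e \<subseteq> I" "Poly_Mapping.keys e' \<subseteq> J"
  shows "Cx (e + e') (f * g) = Cx e f * Cx e' g"
  using assms(1,2) by (intro mps_eqI)
    (simp add: mps_coeff_mult case_prod_unfold uvars_def hahn_coeff_mult_disjoint[OF _ _ assms(3-5)])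

lemma keys_sum_list:
  "(\<And>i. i \<in> set w \<Longrightarrow> Poly_Mapping.keys (e i) \<subseteq> {i}) \<Longrightarrow> Poly_Mapping.keys (sum_list (map e w) :: 'b \<Rightarrow>\<^sub>0 int) \<subseteq> set w"
proof (induction w)
  case (Cons a w)
  have "Poly_Mapping.keys (sum_list (map e w)) \<subseteq> set w" by (rule Cons.IH) (use Cons.prems in auto)
  thus ?case using Cons.prems[of a] keys_add[of "e a" "sum_list (map e w)"] by auto
qed simp

lemma sum_list_remove:
  "j < length v \<Longrightarrow> sum_list (map e v) = e (v ! j) + (sum_list (map e (take j v @ drop (Suc j) v)) :: 'a::comm_monoid_add)"
  by (subst id_take_nth_drop[of j v]) (simp_all add: add_ac)

lemma sorted_remove:
  "sorted_wrt R v \<Longrightarrow> sorted_wrt R (take j v @ drop (Suc j) v)"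
proof (induction v arbitrary: j)
  case (Cons a v)
  thus ?case by (cases j) (auto dest: in_set_takeD in_set_dropD)
qed simp

lemma uvars_pf:
  assumes "sorted_wrt (<) w" "\<And>i j. i < j \<Longrightarrow> i \<in> set w \<Longrightarrow> j \<in> set w \<Longrightarrow> uvars {i, j} (G i j)"
  shows "uvars (set w) (pf G w)"
  using assms
proof (induction "length w" arbitrary: w rule: less_induct)
  case less
  show ?case
  proof (cases w)
    case Nil
    thus ?thesis by (simp add: uvars_1)
  next
    case (Cons a v)
    show ?thesis
      unfolding Cons pf.simps(2)
    proof (intro uvars_sum uvars_mult uvars_sign)
      fix j assume "j \<in> {..<length v}"
      hence j: "j < length v" by simp
      let ?w = "take j v @ drop (Suc j) v"
      have sub: "set ?w \<subseteq> set v" by (auto dest: in_set_takeD in_set_dropD)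
      have "uvars {a, v ! j} (G a (v ! j))"
        using less.prems j by (auto simp: Cons)
      thus "uvars (set (a # v)) (G a (v ! j))" by (rule uvars_mono) (use j in auto)
      have "uvars (set ?w) (pf G ?w)"
      proof (rule less.hyps)
        show "sorted_wrt (<) ?w" using less.prems(1) by (intro sorted_remove) (simp add: Cons)
        show "length ?w < length w" using j by (simp add: Cons)
        fix i k assume "i < k" "i \<in> set ?w" "k \<in> set ?w"
        thus "uvars {i, k} (G i k)" using sub less.prems(2)[of i k] by (auto simp: Cons)
      qed
      thus "uvars (set (a # v)) (pf G ?w)" by (rule uvars_mono) (use sub in auto)
    qed
  qed
qed

lemma Cx_pf:
  assumes "sorted_wrt (<) w"
    "\<And>i j. i < j \<Longrightarrow> i \<in> set w \<Longrightarrow> j \<in> set w \<Longrightarrow> uvars {i, j} (G i j)"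
    "\<And>i j. i < j \<Longrightarrow> i \<in> set w \<Longrightarrow> j \<in> set w \<Longrightarrow> Cx (e i + e j) (G i j) = H i j"
    "\<And>i. i \<in> set w \<Longrightarrow> Poly_Mapping.keys (e i) \<subseteq> {i}"
  shows "Cx (sum_list (map e w)) (pf G w) = pf H w"
  using assms
proof (induction "length w" arbitrary: w rule: less_induct)
  case less
  show ?case
  proof (cases w)
    case Nil
    have "Cx 0 1 = 1" using Cx_khat[of 0 0 1] Cx_const_mmap
      by (intro mps_eqI) (simp add: mps_coeff_1 hahn_coeff_1)
    thus ?thesis by (simp add: Nil)
  next
    case (Cons a v)
    have "Cx (sum_list (map e w)) ((- 1) ^ j * G a (v ! j) * pf G (take j v @ drop (Suc j) v)) =
        (- 1) ^ j * H a (v ! j) * pf H (take j v @ drop (Suc j) v)" if j: "j < length v" for j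
    proof -
      let ?w = "take j v @ drop (Suc j) v"
      have sub: "set ?w \<subseteq> set v" by (auto dest: in_set_takeD in_set_dropD)
      hence subw: "i \<in> set w" if "i \<in> set ?w" for i using that by (auto simp: Cons)
      have srt: "sorted_wrt (<) ?w" using less.prems(1) by (intro sorted_remove) (simp add: Cons)
      have a: "a < v ! j" "a \<in> set w" "v ! j \<in> set w" using less.prems(1) j by (auto simp: Cons)
      have IH: "Cx (sum_list (map e ?w)) (pf G ?w) = pf H ?w"
      proof (rule less.hyps[OF _ srt])
        show "length ?w < length w" using j by (simp add: Cons)
      qed (use less.prems(2-4) subw in blast)+
      have d: "distinct (a # v)" using less.prems(1) unfolding Cons by (rule strict_sorted_iff[THEN iffD1, THEN conjunct2])
      have "v ! j \<notin> set ?w"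
      proof -
        have "distinct (take j v @ v ! j # drop (Suc j) v)"
          using d by (subst id_take_nth_drop[OF j, symmetric]) simp
        thus ?thesis by auto
      qed
      hence disj: "{a, v ! j} \<inter> set ?w = {}" using d sub by auto
      have "Cx (e a + e (v ! j) + sum_list (map e ?w)) (G a (v ! j) * pf G ?w) =
          Cx (e a + e (v ! j)) (G a (v ! j)) * Cx (sum_list (map e ?w)) (pf G ?w)"
      proof (rule Cx_mult_disjoint[OF _ _ disj])
        show "uvars {a, v ! j} (G a (v ! j))" using less.prems(2) a by auto
        show "uvars (set ?w) (pf G ?w)"
          by (rule uvars_pf[OF srt]) (use subw less.prems(2) in blast)
        show "Poly_Mapping.keys (sum_list (map e ?w)) \<subseteq> set ?w"
          by (rule keys_sum_list) (use subw less.prems(4) in blast)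
        show "Poly_Mapping.keys (e a + e (v ! j)) \<subseteq> {a, v ! j}"
          using less.prems(4)[of a] less.prems(4)[of "v ! j"] a keys_add[of "e a" "e (v ! j)"] by auto
      qed
      moreover have "e a + e (v ! j) + sum_list (map e ?w) = sum_list (map e w)"
        unfolding Cons by (simp add: sum_list_remove[OF j, of e] add.assoc)
      ultimately have "Cx (sum_list (map e w)) (G a (v ! j) * pf G ?w) = H a (v ! j) * pf H ?w"
        by (simp only: IH less.prems(3)[OF a])
      thus ?thesis by (simp only: mult.assoc Cx_sign)
    qed
    thus ?thesis unfolding Cons pf.simps(2) Cx_sum by (simp add: Cons)
  qed
qed


section \<open>Coefficients of the pair factors\<close>

lemma coeff_W2: "hahn_coeff (W2 i) (Poly_Mapping.single i d) = (if d \<ge> 0 then 1 / 2 * (- bet / 2) ^ nat d else 0)"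
proof (cases "d \<ge> 0")
  case True
  have mon: "(hc (- bet / 2) * Ui i) ^ k = hahn_monom (Poly_Mapping.single i (int k)) ((- bet / 2) ^ k)" for k
  proof (induction k)
    case (Suc k)
    show ?case unfolding power_Suc Suc
      by (simp add: hc_def Ui_def hahn_monom_mult algebra_simps flip: single_add)
  qed simp
  have "hahn_coeff (hgeo i (hc (- bet / 2) * Ui i)) (Poly_Mapping.single i d) =
      hahn_coeff (\<Sum>k\<le>nat d. (hc (- bet / 2) * Ui i) ^ k) (Poly_Mapping.single i d)"
    by (rule hgeo_coeff_sum[OF geo_ok(1,2)]) simp
  also have "\<dots> = (\<Sum>k\<le>nat d. if k = nat d then (- bet / 2) ^ nat d else 0)"
    unfolding mon hahn_coeff_sum
  proof (intro sum.cong refl)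
    fix k
    have "Poly_Mapping.single i d = Poly_Mapping.single i (int k) \<longleftrightarrow> k = nat d"
      using True by (metis lookup_single_eq nat_int int_nat_eq)
    thus "hahn_coeff (hahn_monom (Poly_Mapping.single i (int k)) ((- bet / 2) ^ k)) (Poly_Mapping.single i d) =
        (if k = nat d then (- bet / 2) ^ nat d else 0)"
      by (simp add: hahn_monom_coeff)
  qed
  finally show ?thesis using True by (simp add: W2_def)
next
  case False
  thus ?thesis using hlowD[OF hlow_YW(3)[of i], of "Poly_Mapping.single i d"] by simp
qed

text \<open>
  The substitution of \<open>\<zeta>\<^sub>i\<close> turns multiplication by \<open>Tq\<close> into multiplication by
  \<open>(\<zeta>\<^sub>i - \<beta>/2) / (\<zeta>\<^sub>i + \<beta>/2) = 1 / (1 + \<beta> u\<^sub>i)\<close>.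
\<close>

lemma coeff_letter:
  assumes "i < r" "l > 0"
  shows "hahn_coeff (W2 i * Wi i ^ s * Z r i ^ n) (Poly_Mapping.single i (- int l)) = (Phi_fps l * Tq ^ s) $ n"
proof (induction s arbitrary: n)
  case 0
  interpret E: evaluation hc "Vi i" by (rule evaluation_hc)
  have Vk: "Vi i ^ k = hahn_monom (Poly_Mapping.single i (- int k)) 1" for k
    by (induction k) (simp_all add: Vi_def hahn_monom_mult flip: single_add)
  have sub: "Poly_Mapping.single i (- int l) - Poly_Mapping.single i (- int k) = Poly_Mapping.single i (int k - int l)" for k
    by (simp flip: single_diff)
  have "Z r i ^ n = (\<Sum>k\<le>n. hc (coeff ([:bet / 2, 1:] ^ n) k) * Vi i ^ k)"
    using assms(1) E.sum_linear_power[of "bet / 2" 1 n] by (simp add: Z_def hc_hom add.commute)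
  hence "W2 i * Z r i ^ n = (\<Sum>k\<le>n. hc (coeff ([:bet / 2, 1:] ^ n) k) * (Vi i ^ k * W2 i))"
    by (simp add: sum_distrib_left mult_ac)
  hence "hahn_coeff (W2 i * Z r i ^ n) (Poly_Mapping.single i (- int l)) =
      (\<Sum>k\<le>n. coeff ([:bet / 2, 1:] ^ n) k * (if k \<ge> l then 1 / 2 * (- bet / 2) ^ (k - l) else 0))"
    by (simp add: Vk hahn_monom_mult_coeff sub coeff_W2 nat_diff_distrib cong: sum.cong if_cong)
  also have "\<dots> = (\<Sum>k\<in>{l..l + n}. coeff ([:bet / 2, 1:] ^ n) k * (1 / 2 * (- bet / 2) ^ (k - l)))"
    by (rule sum.mono_neutral_cong) (auto simp: degree_linear_power)
  also have "\<dots> = (\<Sum>k\<le>n. coeff ([:bet / 2, 1:] ^ n) (l + k) * (1 / 2 * (- bet / 2) ^ k))"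
    by (rule sum.reindex_bij_witness[of _ "\<lambda>k. l + k" "\<lambda>k. k - l"]) auto
  also have "\<dots> = Phi_fps l $ n" by (simp add: Phi_fps_def mult.commute)
  finally show ?case by simp
next
  case (Suc s)
  let ?e = "Poly_Mapping.single i (- int l)"
  let ?b = "hc (bet / 2)"
  define F where "F = Phi_fps l * Tq ^ s"
  define G where "G = Abs_fps (\<lambda>n. hahn_coeff (W2 i * Wi i ^ Suc s * Z r i ^ n) ?e)"
  have F: "F $ n = hahn_coeff (W2 i * Wi i ^ s * Z r i ^ n) ?e" for n by (simp add: F_def Suc)
  \<comment> \<open>Only non-negative powers of u_i occur here and l > 0. This is the initial value
    of the recursion in n that multiplication by \<open>Tq\<close> amounts to.\<close>
  have zero: "hahn_coeff (W2 i * Wi i ^ t * Z r i ^ 0) ?e = 0" for t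
  proof -
    have "hlow i (0 + int t * 0) (W2 i * Wi i ^ t)" by (intro hlow_mult hlow_power hlow_YW)
    thus ?thesis using assms(2) by (intro hlowD[of i 0]) simp_all
  qed
  have WZ: "Wi i * (Z r i + ?b) = Z r i - ?b"
  proof -
    have bb: "?b + ?b = hc bet" by (simp flip: hc_hom(3))
    have "Z r i + ?b = Vi i * (1 + hc bet * Ui i)"
    proof -
      have "Vi i * (1 + hc bet * Ui i) = Vi i + hc bet * (Vi i * Ui i)" by (simp only: distrib_left mult_1_right mult_1_left mult_ac)
      thus ?thesis using assms(1) bb by (simp add: Z_def add.assoc)
    qed
    hence "Wi i * (Z r i + ?b) = Vi i * ((1 + hc bet * Ui i) * Wi i)" by (simp only: mult_ac)
    thus ?thesis using assms(1) by (simp add: W_inverse Z_def)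
  qed
  have "G * (1 + fps_const (bet / 2) * fps_X) = F * (1 - fps_const (bet / 2) * fps_X)"
  proof (rule fps_ext)
    fix n
    show "(G * (1 + fps_const (bet / 2) * fps_X)) $ n = (F * (1 - fps_const (bet / 2) * fps_X)) $ n"
    proof (cases n)
      case 0
      thus ?thesis using zero[of "Suc s"] zero[of s] by (simp add: fps_mult_nth G_def F)
    next
      case (Suc k)
      let ?w = "W2 i * Wi i ^ s * Z r i ^ k"
      have "W2 i * Wi i ^ Suc s * Z r i ^ Suc k + ?b * (W2 i * Wi i ^ Suc s * Z r i ^ k) = ?w * (Wi i * (Z r i + ?b))"
        by (simp only: power_Suc distrib_left mult_ac)
      also have "\<dots> = W2 i * Wi i ^ s * Z r i ^ Suc k - ?b * ?w"
        unfolding WZ by (simp only: power_Suc right_diff_distrib mult_ac)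
      finally have "hahn_coeff (W2 i * Wi i ^ Suc s * Z r i ^ Suc k + ?b * (W2 i * Wi i ^ Suc s * Z r i ^ k)) ?e =
          hahn_coeff (W2 i * Wi i ^ s * Z r i ^ Suc k - ?b * ?w) ?e" by (rule arg_cong)
      hence eq: "G $ Suc k + bet / 2 * G $ k = F $ Suc k - bet / 2 * F $ k"
        unfolding G_def F fps_nth_Abs_fps hahn_coeff_simps hc_mult_coeff .
      have X: "(H * (1 + fps_const c * fps_X)) $ Suc k = H $ Suc k + c * H $ k" for H :: "qb fps" and c
        by (simp add: distrib_left mult.left_commute[of H])
      have Y: "(H * (1 - fps_const c * fps_X)) $ Suc k = H $ Suc k - c * H $ k" for H :: "qb fps" and c
        by (simp add: right_diff_distrib mult.left_commute[of H])
      show ?thesis unfolding Suc X Y by (rule eq)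
    qed
  qed
  also have "\<dots> = F * Tq * (1 + fps_const (bet / 2) * fps_X)" by (simp only: mult.assoc Tq_mult)
  finally have "G = F * Tq"
  proof (rule mult_right_cancel[THEN iffD1, rotated])
    have "(1 + fps_const (bet / 2) * fps_X) $ 0 \<noteq> 0" by simp
    thus "1 + fps_const (bet / 2) * fps_X \<noteq> 0" by force
  qed
  from arg_cong[OF this, of "\<lambda>f. f $ n"] show ?case by (simp add: G_def F_def mult.assoc mult.commute[of Tq])
qed

text \<open>The added letter 1 / (1 - \<beta>X/2) becomes 1 / (1 + \<beta>X/2) after passing its
  exponential; with powers of -\<beta>/2 as coefficients it acts on \<open>qq\<close> as evaluation
  at -\<beta>/2.\<close>

lemma phi_0_Tq: "phi_fps 0 * Tq = Abs_fps (\<lambda>n. (- bet / 2) ^ n)"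
proof -
  let ?d = "1 + fps_const (bet / 2) * fps_X"
  have geo: "Abs_fps (\<lambda>n. c ^ n) * (1 - fps_const c * fps_X) = 1" for c :: qb
    by (rule fps_ext) (simp add: right_diff_distrib mult.left_commute[of "Abs_fps _"] fps_X_mult_nth flip: power_Suc)
  have "coeff ([:bet / 2, 1:] ^ n) 0 = (bet / 2) ^ n" for n
    by (induction n) simp_all
  hence phi: "phi_fps 0 = Abs_fps (\<lambda>n. (bet / 2) ^ n)" by (simp add: phi_fps_def)
  have "phi_fps 0 * Tq * ?d = phi_fps 0 * (1 - fps_const (bet / 2) * fps_X)"
    by (simp only: mult.assoc Tq_mult)
  also have "\<dots> = 1" unfolding phi by (rule geo)
  also have "\<dots> = Abs_fps (\<lambda>n. (- bet / 2) ^ n) * ?d"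
  proof -
    have "?d = 1 - fps_const (- bet / 2) * fps_X" by (rule fps_ext) simp
    thus ?thesis by (simp only: geo)
  qed
  finally show ?thesis
  proof (rule mult_right_cancel[THEN iffD1, rotated])
    have "?d $ 0 \<noteq> 0" by simp
    thus "?d \<noteq> 0" by force
  qed
qed

lemma twist_nth: "i < length fs \<Longrightarrow> twist fs ! i = fs ! i * Tq ^ (length fs - i)"
proof (induction fs arbitrary: i)
  case (Cons f fs)
  thus ?case by (cases i) auto
qed simp


section \<open>Matching the entries of the two Pfaffians\<close>

definition aneg :: "nat \<Rightarrow> qb fps \<Rightarrow> nat \<Rightarrow> qb mps" where
  "aneg D f p = (\<Sum>k\<le>D. mps_const (if p \<le> k then f $ (k - p) else 0) * qq $ k)"

definition apos :: "nat \<Rightarrow> qb fps \<Rightarrow> nat \<Rightarrow> qb mps" where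
  "apos D f p = (\<Sum>k\<le>D. mps_const (f $ (k + p)) * qq $ k)"

lemma eq_upto_sum_qq:
  assumes "D \<le> N"
  shows "eq_upto D (\<Sum>k\<le>N. mps_const (c k) * qq $ k) (\<Sum>k\<le>D. mps_const (c k) * qq $ k)"
  unfolding eq_upto_def mps_coeff_sum
proof (intro allI impI)
  fix m assume m: "mdeg m \<le> D"
  show "(\<Sum>k\<le>N. mps_coeff (mps_const (c k) * qq $ k) m) = (\<Sum>k\<le>D. mps_coeff (mps_const (c k) * qq $ k) m)"
    using assms m by (intro sum.mono_neutral_right) (auto intro!: ord_eq_0[OF ord_qq])
qed

text \<open>Exchanging the sums separates the two letters. The opposite index shifts by p in
  \<open>aneg\<close> and \<open>apos\<close> are the counterparts of multiplication by
  \<zeta>_i^{-p} and \<zeta>_j^p on the side of the generating function.\<close>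

lemma gfull_eq_upto: "eq_upto D (gfull f f') (\<Sum>p\<le>D. ep p * (aneg D f p * apos D f' p))"
proof -
  \<comment> \<open>Twice D, so that after a shift by p <= D all coefficients of \<open>qq\<close>
    up to index D are still included.\<close>
  define M where "M = 2 * D"
  define c where "c = (\<lambda>f n. mps_const (f $ n) :: qb mps)"
  define A where "A = (\<lambda>p. \<Sum>n\<le>M. c f n * qq $ (n + p))"
  define B where "B = (\<lambda>p. \<Sum>k\<le>M. if p \<le> k then c f' k * qq $ (k - p) else 0)"
  have cI: "mps_const (f $ n) = c f n" for f n by (simp add: c_def)
  have inner: "(\<Sum>p\<le>k. X p) = (\<Sum>p\<le>M. if p \<le> k then X p else 0)" if "k \<le> M" for X :: "nat \<Rightarrow> qb mps" and k
    using that by (intro sum.mono_neutral_cong_left) auto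
  have "gpart M f f' = (\<Sum>n\<le>M. \<Sum>k\<le>M. \<Sum>p\<le>M. ep p * ((c f n * qq $ (n + p)) * (if p \<le> k then c f' k * qq $ (k - p) else 0)))"
    unfolding gpart_def ghat_def cI
  proof (intro sum.cong refl)
    fix n k assume "k \<in> {..M}"
    hence "c f n * c f' k * (\<Sum>p\<le>k. ep p * (qq $ (n + p) * qq $ (k - p))) =
        (\<Sum>p\<le>M. if p \<le> k then c f n * c f' k * (ep p * (qq $ (n + p) * qq $ (k - p))) else 0)"
      unfolding sum_distrib_left by (intro inner) simp
    also have "\<dots> = (\<Sum>p\<le>M. ep p * ((c f n * qq $ (n + p)) * (if p \<le> k then c f' k * qq $ (k - p) else 0)))"
    proof (intro sum.cong refl)
      fix p
      have "c f n * c f' k * (ep p * (qq $ (n + p) * qq $ (k - p))) = ep p * ((c f n * qq $ (n + p)) * (c f' k * qq $ (k - p)))"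
        by (simp only: mult_ac)
      thus "(if p \<le> k then c f n * c f' k * (ep p * (qq $ (n + p) * qq $ (k - p))) else 0) =
          ep p * ((c f n * qq $ (n + p)) * (if p \<le> k then c f' k * qq $ (k - p) else 0))"
        by (cases "p \<le> k") (simp_all only: if_True if_False mult_zero_right)
    qed
    finally show "c f n * c f' k * (\<Sum>p\<le>k. ep p * (qq $ (n + p) * qq $ (k - p))) =
        (\<Sum>p\<le>M. ep p * ((c f n * qq $ (n + p)) * (if p \<le> k then c f' k * qq $ (k - p) else 0)))" .
  qed
  also have "\<dots> = (\<Sum>n\<le>M. \<Sum>p\<le>M. \<Sum>k\<le>M. ep p * ((c f n * qq $ (n + p)) * (if p \<le> k then c f' k * qq $ (k - p) else 0)))"
    by (intro sum.cong refl sum.swap)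
  also have "\<dots> = (\<Sum>p\<le>M. \<Sum>n\<le>M. \<Sum>k\<le>M. ep p * ((c f n * qq $ (n + p)) * (if p \<le> k then c f' k * qq $ (k - p) else 0)))"
    by (rule sum.swap)
  also have "\<dots> = (\<Sum>p\<le>M. ep p * (A p * B p))"
    unfolding A_def B_def sum_product unfolding sum_distrib_left ..
  finally have gp: "gpart M f f' = (\<Sum>p\<le>M. ep p * (A p * B p))" .
  have A: "eq_upto D (A p) (aneg D f p)" for p
  proof -
    have "A p = (\<Sum>k\<in>{p..M + p}. c f (k - p) * qq $ k)"
      unfolding A_def by (rule sum.reindex_bij_witness[of _ "\<lambda>k. k - p" "\<lambda>k. k + p"]) auto
    also have "\<dots> = (\<Sum>k\<le>M + p. mps_const (if p \<le> k then f $ (k - p) else 0) * qq $ k)"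
      by (rule sum.mono_neutral_cong_left) (auto simp: c_def mps_const_hom)
    finally show ?thesis unfolding aneg_def by (simp only: eq_upto_sum_qq M_def)
  qed
  have B: "eq_upto D (B p) (apos D f' p)" if "p \<le> D" for p
  proof -
    have "B p = (\<Sum>k\<in>{p..M}. c f' k * qq $ (k - p))"
      unfolding B_def by (rule sum.mono_neutral_cong_right) auto
    also have "\<dots> = (\<Sum>k\<le>M - p. mps_const (f' $ (k + p)) * qq $ k)"
      unfolding c_def by (rule sum.reindex_bij_witness[of _ "\<lambda>k. k + p" "\<lambda>k. k - p"]) (use that in \<open>auto simp: M_def\<close>)
    finally show ?thesis unfolding apos_def using that by (simp only:) (rule eq_upto_sum_qq, simp add: M_def)
  qed
  have "eq_upto D (gpart M f f') (gfull f f')"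
    using gpart_gfull[of M f f'] by (auto simp: eq_upto_def M_def)
  hence "eq_upto D (gfull f f') (\<Sum>p\<le>M. ep p * (A p * B p))" unfolding gp by (rule eq_upto_sym)
  also have "eq_upto D \<dots> (\<Sum>p\<le>M. ep p * (aneg D f p * B p))"
    by (intro eq_upto_sum eq_upto_mult eq_upto_refl A)
  also have "(\<Sum>p\<le>M. ep p * (aneg D f p * B p)) = (\<Sum>p\<le>D. ep p * (aneg D f p * B p))"
    by (intro sum.mono_neutral_right) (auto simp: M_def aneg_def mps_const_hom)
  also have "eq_upto D \<dots> (\<Sum>p\<le>D. ep p * (aneg D f p * apos D f' p))"
    by (intro eq_upto_sum eq_upto_mult eq_upto_refl B) simp
  finally show ?thesis .
qed

lemma Cx_Xi: "eq_upto D (Cx e (uc w * Xi r i)) (\<Sum>k\<le>D. mps_const (hahn_coeff (w * Z r i ^ k) e) * qq $ k)"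
proof -
  interpret E: evaluation hc "Z r i" by (rule evaluation_hc)
  have "eq_upto D (uc w * Xi r i) (uc w * (\<Sum>k\<le>D. uc (Z r i ^ k) * E.mmap (qq $ k)))"
    unfolding Xi_def by (intro eq_upto_mult eq_upto_refl E.EV_eq_upto E.regular_qq order.refl)
  also have "uc w * (\<Sum>k\<le>D. uc (Z r i ^ k) * E.mmap (qq $ k)) = (\<Sum>k\<le>D. uc (w * Z r i ^ k) * E.mmap (qq $ k))"
    by (simp add: sum_distrib_left mps_const_hom mult.assoc)
  finally show ?thesis using Cx_eq_upto by (fastforce simp: Cx_sum Cx_const_mmap)
qed

lemma Cx_Ai_Z:
  assumes "i < r" "l > 0" "f = Phi_fps l * Tq ^ (N - i)"
  shows "eq_upto D (Cx (Poly_Mapping.single i (- int l)) (Ai r N i * uc (Z r i ^ p))) (apos D f p)"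
proof -
  let ?w = "W2 i * Wi i ^ (N - i) * Z r i ^ p"
  have "Ai r N i * uc (Z r i ^ p) = uc ?w * Xi r i"
    using assms(1) by (simp add: Ai_def mps_const_hom mult_ac)
  moreover have "hahn_coeff (?w * Z r i ^ k) (Poly_Mapping.single i (- int l)) = f $ (k + p)" for k
  proof -
    have "?w * Z r i ^ k = W2 i * Wi i ^ (N - i) * Z r i ^ (k + p)" by (simp only: power_add mult_ac)
    thus ?thesis by (simp only: assms(3) coeff_letter[OF assms(1,2)])
  qed
  ultimately show ?thesis using Cx_Xi[of D "Poly_Mapping.single i (- int l)" ?w r i]
    by (simp add: apos_def)
qed

text \<open>Multiplication by 1/\<zeta>_i^p lowers the index by p. For k < p only non-negative
  powers of u_i remain, which do not contribute to the exponent -l; this is the zero in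
  \<open>aneg\<close>.\<close>

lemma Cx_Ai_Y:
  assumes "i < r" "l > 0" "f = Phi_fps l * Tq ^ (N - i)"
  shows "eq_upto D (Cx (Poly_Mapping.single i (- int l)) (Ai r N i * uc (Yi i ^ p))) (aneg D f p)"
proof -
  let ?w = "W2 i * Wi i ^ (N - i)" and ?e = "Poly_Mapping.single i (- int l)"
  have YZp: "Yi i ^ n * Z r i ^ n = 1" for n
    using YZ[OF assms(1)] by (simp flip: power_mult_distrib)
  have "Ai r N i * uc (Yi i ^ p) = uc (?w * Yi i ^ p) * Xi r i"
    using assms(1) by (simp add: Ai_def mps_const_hom mult_ac)
  moreover have "hahn_coeff (?w * Yi i ^ p * Z r i ^ k) ?e = (if p \<le> k then f $ (k - p) else 0)" for k
  proof (cases "p \<le> k")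
    case True
    have "Z r i ^ k = Z r i ^ p * Z r i ^ (k - p)" using True by (simp flip: power_add)
    hence "?w * Yi i ^ p * Z r i ^ k = ?w * (Yi i ^ p * Z r i ^ p) * Z r i ^ (k - p)"
      by (simp only: mult_ac)
    thus ?thesis using True coeff_letter[OF assms(1,2)] by (simp add: YZp assms(3))
  next
    case False
    have "Yi i ^ p = Yi i ^ (p - k) * Yi i ^ k" using False by (simp flip: power_add)
    hence "?w * Yi i ^ p * Z r i ^ k = ?w * Yi i ^ (p - k) * (Yi i ^ k * Z r i ^ k)"
      by (simp only: mult_ac)
    moreover have "hlow i (0 + int (N - i) * 0 + int (p - k) * 1) (?w * Yi i ^ (p - k))"
      by (intro hlow_mult hlow_power hlow_YW)
    ultimately have "hlow i 0 (?w * Yi i ^ p * Z r i ^ k)" by (simp add: YZp hlow_mono)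
    thus ?thesis using False assms(2) by (simp add: hlowD)
  qed
  ultimately show ?thesis using Cx_Xi[of D ?e "?w * Yi i ^ p" r i]
    by (simp add: aneg_def)
qed

text \<open>The left-hand side is free of x, whereas \<open>apos\<close> evaluates \<open>qq\<close>
  at -\<beta>/2; the factor \<kappa> compensates by \<open>kap_inverse\<close>.\<close>

lemma Cx_last: "eq_upto D (Cx 0 (Ai r N r * uc (Z r r ^ p))) (kap * apos D (phi_fps 0 * Tq) p)"
proof -
  have "hc (- bet / 2) ^ p = hc ((- bet / 2) ^ p)" by (rule hc_power[symmetric])
  hence eq: "Cx 0 (Ai r N r * uc (Z r r ^ p)) = mps_const ((- bet / 2) ^ p)"
    by (intro mps_eqI) (simp add: Ai_def Z_def mps_const_coeff hc_coeff)
  have "apos D (phi_fps 0 * Tq) p = mps_const ((- bet / 2) ^ p) * (\<Sum>k\<le>D. mps_const ((- bet / 2) ^ k) * qq $ k)"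
    unfolding apos_def phi_0_Tq sum_distrib_left
    by (intro sum.cong refl) (simp add: power_add mps_const_hom mult_ac)
  also have "(\<Sum>k\<le>D. mps_const ((- bet / 2) ^ k) * qq $ k) = (\<Sum>k\<le>D. mps_const ((- (bet / 2)) ^ k) * E0.mmap (qq $ k))"
    by (intro sum.cong refl arg_cong2[where f = times] mps_eqI) simp_all
  also have "eq_upto D (mps_const ((- bet / 2) ^ p) * \<dots>) (mps_const ((- bet / 2) ^ p) * E0.EV qq)"
    by (intro eq_upto_mult eq_upto_refl eq_upto_sym[OF E0.EV_eq_upto] E0.regular_qq order.refl)
  finally have "eq_upto D (kap * apos D (phi_fps 0 * Tq) p) (kap * (mps_const ((- bet / 2) ^ p) * E0.EV qq))"
    by (intro eq_upto_mult eq_upto_refl)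
  also have "kap * (mps_const ((- bet / 2) ^ p) * E0.EV qq) = mps_const ((- bet / 2) ^ p)"
    unfolding mult.left_commute[of kap] kap_inverse by simp
  finally show ?thesis unfolding eq by (rule eq_upto_sym)
qed

text \<open>Bounds the pole in u_i by the x-degree. This holds for \<open>Xi\<close> because
  \<zeta>_i^k is multiplied by a series of x-degree at least k.\<close>

definition ulow :: "nat \<Rightarrow> ux_series \<Rightarrow> bool" where
  "ulow i f \<longleftrightarrow> (\<forall>m. hlow i (- int (mdeg m)) (mps_coeff f m))"

lemma hlow_0: "hlow i k 0"
  by (simp add: hlow_def)

lemma hlow_sum: "(\<And>j. j \<in> S \<Longrightarrow> hlow i k (f j)) \<Longrightarrow> hlow i k (\<Sum>j\<in>S. f j)"
  by (induction S rule: infinite_finite_induct) (auto intro: hlow_add hlow_0)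

lemma ulow_mult: "ulow i f \<Longrightarrow> ulow i g \<Longrightarrow> ulow i (f * g)"
  unfolding ulow_def mps_coeff_mult
proof (intro allI hlow_sum, clarify)
  fix m a b assume *: "\<forall>m. hlow i (- int (mdeg m)) (mps_coeff f m)" "\<forall>m. hlow i (- int (mdeg m)) (mps_coeff g m)"
    and ab: "(a, b) \<in> splits m"
  have "hlow i (- int (mdeg a) + - int (mdeg b)) (mps_coeff f a * mps_coeff g b)"
    using * by (intro hlow_mult) auto
  thus "hlow i (- int (mdeg m)) (mps_coeff f a * mps_coeff g b)" by (simp add: splits_mdeg[OF ab])
qed

lemma ulow_const: "hlow i 0 w \<Longrightarrow> ulow i (uc w)"
  by (auto simp: ulow_def mps_const_coeff hlow_0 intro: hlow_mono)

lemma ulow_Ai: "ulow i (Ai r N i)"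
proof -
  have "ulow i (Xi r i)"
    unfolding ulow_def Xi_coeff
  proof (intro allI hlow_sum)
    fix m :: "nat \<Rightarrow>\<^sub>0 nat" and k assume k: "k \<in> {..mdeg m}"
    have "hlow i (0 + int k * -1) (hc (mps_coeff (qq $ k) m) * Z r i ^ k)"
      by (intro hlow_mult hlow_hc hlow_power hlow_Z) simp
    thus "hlow i (- int (mdeg m)) (hc (mps_coeff (qq $ k) m) * Z r i ^ k)" by (rule hlow_mono) (use k in simp)
  qed
  moreover have "hlow i (0 + int (N - i) * 0) (W2 i * Wi i ^ (N - i))"
    by (intro hlow_mult hlow_power hlow_YW)
  ultimately show ?thesis
    using ulow_const[OF hlow_1[of 0 i]] by (auto simp: Ai_def mps_const_hom(2) intro!: ulow_mult ulow_const)
qed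

lemma ulow_Ai': "i \<noteq> j \<Longrightarrow> ulow i (Ai r N j)"
  using uvars_Ai[of j r N] by (auto simp: ulow_def uvars_def intro!: hlow_not_var)

text \<open>(1 + t) / (1 - t) = 2 (1 + t + ... + t^D) - 1 + 2 t^(D+1) / (1 - t); for t = -\<zeta>_j
  / \<zeta>_i the coefficients of the finite part are \<open>ep\<close>, the same as in the
  two-point function.\<close>

lemma SS_expand:
  assumes "i < j"
  obtains R where "SS r i j = (\<Sum>p\<le>D. hc (ep p) * (Yi i ^ p * Z r j ^ p)) + R" "hlow i (int (Suc D)) R"
proof
  let ?t = "tt r i j"
  let ?g = "hgeo i ?t"
  note ok = tt_ok(1,2)[OF assms, of r]
  have tg: "(1 - ?t) * ?g = 1" by (rule hgeo_inverse[OF ok])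
  have ept: "hc (ep p) * (Yi i ^ p * Z r j ^ p) = (if p = 0 then 1 else 2) * ?t ^ p" for p
  proof -
    have "?t ^ p = (- 1) ^ p * (Yi i ^ p * Z r j ^ p)"
      unfolding tt_def power_minus[of "Yi i * Z r j"] power_mult_distrib ..
    moreover have "hc (ep p) = (if p = 0 then 1 else 2) * (- 1) ^ p"
      by (simp add: ep_def hc_hom hc_power hc_numeral)
    moreover have "(- 1) ^ p * ((- 1) ^ p * x) = x" for x :: hs
      by (simp flip: mult.assoc power_mult_distrib)
    ultimately show ?thesis by (simp add: mult.assoc)
  qed
  have "(\<Sum>p\<le>D. hc (ep p) * (Yi i ^ p * Z r j ^ p)) = 2 * (\<Sum>p\<le>D. ?t ^ p) - 1"
    unfolding ept by (induction D) (simp_all add: algebra_simps)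
  also have "(\<Sum>p\<le>D. ?t ^ p) = (\<Sum>p\<le>D. ?t ^ p) * ((1 - ?t) * ?g)" by (simp only: tg mult_1_right)
  also have "\<dots> = ((1 - ?t) * (\<Sum>p\<le>D. ?t ^ p)) * ?g" by (simp only: mult_ac)
  also have "(1 - ?t) * (\<Sum>p\<le>D. ?t ^ p) = 1 - ?t ^ Suc D" by (rule sum_gp_basic)
  finally have "(\<Sum>p\<le>D. hc (ep p) * (Yi i ^ p * Z r j ^ p)) + 2 * (?t ^ Suc D * ?g) = 2 * ?g - 1"
    by (simp add: left_diff_distrib right_diff_distrib del: power_Suc)
  also have "\<dots> = 2 * ?g - (1 - ?t) * ?g" by (simp only: tg)
  also have "\<dots> = SS r i j" by (simp add: SS_def left_diff_distrib distrib_right)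
  finally show "SS r i j = (\<Sum>p\<le>D. hc (ep p) * (Yi i ^ p * Z r j ^ p)) + 2 * (?t ^ Suc D * ?g)" by (rule sym)
  have "hlow i (0 + (int (Suc D) * 1 + 0)) (hc 2 * (?t ^ Suc D * ?g))"
    by (intro hlow_mult hlow_power hlow_hc hlow_hgeo ok) simp
  thus "hlow i (int (Suc D)) (2 * (?t ^ Suc D * ?g))" by (simp add: hc_numeral del: power_Suc)
qed

text \<open>In the finite part of \<open>SS_expand\<close> the variables u_i and u_j separate. The
  remainder has u_i-order above D, the other factors have poles in u_i of order at most the
  x-degree, and a non-positive power of u_i is extracted, so up to degree D the remainder is
  invisible.\<close>

lemma Cx_pair:
  assumes "i < j" "i < r" "l > 0" "f = Phi_fps l * Tq ^ (N - i)" "Poly_Mapping.keys e \<subseteq> {j}"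
    and g: "\<And>D p. eq_upto D (Cx e (Ai r N j * uc (Z r j ^ p))) (d * apos D g p)"
  shows "Cx (Poly_Mapping.single i (- int l) + e) (Ai r N i * Ai r N j * uc (SS r i j)) = d * gfull f g"
proof (rule mps_eq_if_eq_upto)
  fix D
  let ?e = "Poly_Mapping.single i (- int l)"
  obtain R where S: "SS r i j = (\<Sum>p\<le>D. hc (ep p) * (Yi i ^ p * Z r j ^ p)) + R"
    and R: "hlow i (int (Suc D)) R"
    using SS_expand[OF assms(1)] .
  have uc_sum: "uc (\<Sum>p\<le>D. hc (ep p) * (Yi i ^ p * Z r j ^ p)) = (\<Sum>p\<le>D. uc (hc (ep p)) * (uc (Yi i ^ p) * uc (Z r j ^ p)))"
    by (simp add: mps_const_sum mps_const_hom)
  have "Ai r N i * Ai r N j * uc (SS r i j) =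
      (\<Sum>p\<le>D. uc (hc (ep p)) * ((Ai r N i * uc (Yi i ^ p)) * (Ai r N j * uc (Z r j ^ p)))) + Ai r N i * Ai r N j * uc R"
    unfolding S mps_const_hom(3) uc_sum distrib_left sum_distrib_left by (simp only: mult_ac)
  hence "Cx (?e + e) (Ai r N i * Ai r N j * uc (SS r i j)) =
      (\<Sum>p\<le>D. mps_const (ep p) * Cx (?e + e) ((Ai r N i * uc (Yi i ^ p)) * (Ai r N j * uc (Z r j ^ p)))) +
      Cx (?e + e) (Ai r N i * Ai r N j * uc R)"
    by (simp only: Cx_add Cx_sum Cx_hc)
  also have "eq_upto D \<dots> ((\<Sum>p\<le>D. mps_const (ep p) * (aneg D f p * (d * apos D g p))) + 0)"
    unfolding eq_upto_def mps_coeff_simps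
  proof (intro allI impI arg_cong2[where f = "(+)"])
    fix m assume m: "mdeg m \<le> D"
    have "eq_upto D (\<Sum>p\<le>D. mps_const (ep p) * Cx (?e + e) ((Ai r N i * uc (Yi i ^ p)) * (Ai r N j * uc (Z r j ^ p))))
        (\<Sum>p\<le>D. mps_const (ep p) * (aneg D f p * (d * apos D g p)))"
    proof (intro eq_upto_sum eq_upto_mult eq_upto_refl)
      fix p
      have "Cx (?e + e) ((Ai r N i * uc (Yi i ^ p)) * (Ai r N j * uc (Z r j ^ p))) =
          Cx ?e (Ai r N i * uc (Yi i ^ p)) * Cx e (Ai r N j * uc (Z r j ^ p))"
      proof (rule Cx_mult_disjoint)
        show "uvars {i} (Ai r N i * uc (Yi i ^ p))" "uvars {j} (Ai r N j * uc (Z r j ^ p))"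
          by (intro uvars_mult uvars_Ai uvars_const hvars_power hvars_YW hvars_Z)+
      qed (use assms in auto)
      moreover have "eq_upto D \<dots> (aneg D f p * (d * apos D g p))"
        by (intro eq_upto_mult Cx_Ai_Y assms)
      ultimately show "eq_upto D (Cx (?e + e) ((Ai r N i * uc (Yi i ^ p)) * (Ai r N j * uc (Z r j ^ p))))
          (aneg D f p * (d * apos D g p))" by simp
    qed
    from eq_uptoD[OF this m] show "mps_coeff (\<Sum>p\<le>D. mps_const (ep p) * Cx (?e + e) ((Ai r N i * uc (Yi i ^ p)) * (Ai r N j * uc (Z r j ^ p)))) m =
        mps_coeff (\<Sum>p\<le>D. mps_const (ep p) * (aneg D f p * (d * apos D g p))) m" .
    have "ulow i (Ai r N i * Ai r N j)"
      by (intro ulow_mult ulow_Ai ulow_Ai') (use assms(1) in simp)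
    hence "hlow i (int (Suc D) + - int (mdeg m)) (R * mps_coeff (Ai r N i * Ai r N j) m)"
      by (intro hlow_mult R) (simp add: ulow_def)
    moreover have "i \<notin> Poly_Mapping.keys e" using assms(1,5) by auto
    hence "Poly_Mapping.lookup (?e + e) i \<le> 0" by (simp add: lookup_add in_keys_iff)
    ultimately have "hahn_coeff (R * mps_coeff (Ai r N i * Ai r N j) m) (?e + e) = 0"
      by (intro hlowD) (use m in auto)
    thus "mps_coeff (Cx (?e + e) (Ai r N i * Ai r N j * uc R)) m = 0"
      by (simp add: mult.commute[of _ "uc R"])
  qed
  also have "(\<Sum>p\<le>D. mps_const (ep p) * (aneg D f p * (d * apos D g p))) + 0 = d * (\<Sum>p\<le>D. ep p * (aneg D f p * apos D g p))"
  proof -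
    have "mps_const (ep p) = (ep p :: qb mps)" for p
      by (simp add: ep_def mps_const_hom mps_const_power mps_const_numeral)
    thus ?thesis by (simp add: sum_distrib_left mult_ac)
  qed
  also have "eq_upto D \<dots> (d * gfull f g)"
    by (intro eq_upto_mult eq_upto_refl eq_upto_sym[OF gfull_eq_upto])
  finally show "eq_upto D (Cx (?e + e) (Ai r N i * Ai r N j * uc (SS r i j))) (d * gfull f g)" .
qed

theorem theorem5p2:
  fixes lam :: "nat list"
  assumes "strict_partition lam"
  shows "GP lam = vev (fexp hamiltonian) (ket_P lam)"
proof -
  define r N where "r = length lam" and "N = length (ket_fps lam)"
  define t where "t = (\<lambda>i. twist (ket_fps lam) ! i)"
  define e where "e = (\<lambda>i. if i < r then Poly_Mapping.single i (- int (lam ! i)) else 0)"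
  \<comment> \<open>The added letter supplies the factor by which \<kappa>^r from the infinite
    products falls short of \<kappa>^N.\<close>
  define d where "d = (\<lambda>i. if i < r then 1 else kap)"
  have N: "N = r \<or> N = Suc r" "even N"
    using even_length_ket_fps[of lam] by (auto simp: N_def r_def ket_fps_def)
  have pos: "lam ! i > 0" if "i < r" for i
    using assms that by (auto simp: strict_partition_def r_def)
  have t: "t i = Phi_fps (lam ! i) * Tq ^ (N - i)" if "i < r" for i
    using that twist_nth[of i "ket_fps lam"] by (simp add: t_def r_def N_def ket_fps_def nth_append)
  have tr: "t r = phi_fps 0 * Tq" if "N = Suc r"
    using that twist_nth[of r "ket_fps lam"] by (auto simp: t_def r_def N_def ket_fps_def nth_append split: if_splits)
  have keys: "Poly_Mapping.keys (e i) \<subseteq> {i}" for i by (simp add: e_def)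
  have letter: "eq_upto D (Cx (e j) (Ai r N j * uc (Z r j ^ p))) (d j * apos D (t j) p)" if "j < N" for j p D
  proof (cases "j < r")
    case True
    thus ?thesis using Cx_Ai_Z[OF True pos[OF True] t[OF True]] by (simp add: e_def d_def)
  next
    case False
    hence "j = r" "N = Suc r" using that N(1) by auto
    thus ?thesis using Cx_last by (simp add: e_def d_def tr)
  qed
  have "sum_list (map e [0..<N]) = (\<Sum>i<N. e i)"
    by (simp add: sum_list_distinct_conv_sum_set atLeast0LessThan)
  also have "\<dots> = (\<Sum>i<r. Poly_Mapping.single i (- int (lam ! i)))"
    using N(1) by (auto simp: e_def)
  finally have ee: "sum_list (map e [0..<N]) = (\<Sum>i<length lam. Poly_Mapping.single i (- int (lam ! i)))"
    by (simp add: r_def)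
  have "GP lam = Cx (sum_list (map e [0..<N])) (GP_generating r)"
    by (simp add: GP_def Cx_def ee r_def)
  also have "\<dots> = kap ^ r * Cx (sum_list (map e [0..<N])) (pf (\<lambda>i j. Ai r N i * Ai r N j * uc (Sa r i j)) [0..<N])"
    unfolding GP_generating_pf[OF N] by (rule Cx_khat)
  also have "Cx (sum_list (map e [0..<N])) (pf (\<lambda>i j. Ai r N i * Ai r N j * uc (Sa r i j)) [0..<N]) =
      pf (\<lambda>i j. d i * d j * gfull (t i) (t j)) [0..<N]"
  proof (rule Cx_pf)
    fix i j assume "i < j" "j \<in> set [0..<N]"
    hence ij: "i < j" "j < N" "i < r" using N(1) by auto
    have "hvars {i, j} (SS r i j)" by (rule hvars_SS[OF ij(1)])
    thus "uvars {i, j} (Ai r N i * Ai r N j * uc (Sa r i j))"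
      using ij uvars_mono[OF uvars_Ai, of i "{i, j}"] uvars_mono[OF uvars_Ai, of j "{i, j}"]
      by (auto simp: Sa_def intro!: uvars_mult uvars_const)
    show "Cx (e i + e j) (Ai r N i * Ai r N j * uc (Sa r i j)) = d i * d j * gfull (t i) (t j)"
      using Cx_pair[OF ij(1,3) pos[OF ij(3)] t[OF ij(3)] keys letter[OF ij(2)]] ij
      by (simp add: Sa_def e_def d_def)
  qed (use keys in auto)
  also have "\<dots> = prod_list (map d [0..<N]) * pf (\<lambda>i j. gfull (t i) (t j)) [0..<N]"
    by (rule pf_scale)
  also have "pf (\<lambda>i j. gfull (t i) (t j)) [0..<N] = pf gfull (map t [0..<N])"
    by (simp add: pf_map)
  also have "map t [0..<N] = twist (ket_fps lam)"
    unfolding t_def by (rule nth_equalityI) (simp_all add: N_def)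
  also have "prod_list (map d [0..<N]) = kap ^ (N - r)"
  proof -
    have "prod_list (map d [0..<N]) = (\<Prod>i<N. d i)"
      by (simp add: prod_list_distinct atLeast0LessThan)
    also have "\<dots> = kap ^ (N - r)" using N(1) by (auto simp: d_def)
    finally show ?thesis .
  qed
  also have "kap ^ r * (kap ^ (N - r) * pf gfull (twist (ket_fps lam))) = kap ^ N * pf gfull (twist (ket_fps lam))"
    using N(1) by (auto simp: mult_ac)
  also have "\<dots> = vev (fexp hamiltonian) (ket_P lam)"
    by (simp add: vev_ket_P N_def)
  finally show ?thesis .
qed

end
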